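(* Let $n\ge k\ge 1$, $K=k(n-k+1)$, $N\ge 0$, and let $\pi:Y_{n,k,N}\to\widetilde{\mathrm{Gr}}$ be the projection sending a flag of lattices $\Lambda_\bullet$ to $\Lambda_0$. Each fiber of $\pi$ is either empty or isomorphic to a $\Delta$-Springer fiber $Z_{n,\mu,k}$ for some partition $\mu$.
   Context: **Affine flags.** $\mathbb O=\mathbb C[[\epsilon]]$, $\mathbb K=\mathbb C((\epsilon))$; $e_1,\dots,e_K$ is the standard basis of $\mathbb K^K$, extended by $e_{i+K}=\epsilon e_i$ ($i\in\mathbb Z$). $I^-\subset\mathrm{GL}_K(\mathbb O)$ is the subgroup of matrices that become lower triangular at $\epsilon=0$. $\widetilde{\mathrm{Gr}}=\mathrm{GL}_K(\mathbb K)/\mathrm{GL}_K(\mathbb O)$ is the space of $\mathbb O$-lattices in $\mathbb K^K$; $\widetilde{\mathrm{Fl}}=\mathrm{GL}_K(\mathbb K)/I^-$ is the space of full flags of lattices $\Lambda_0\supset\Lambda_1\supset\cdots\supset\Lambda_K=\epsilon\Lambda_0$ with one-dimensional successive quotients ($gI^-$ corresponds to $\Lambda_i=g\,\mathbb O\{\epsilon e_1,\dots,\epsilon e_i,e_{i+1},\dots,e_K\}$); $\widetilde{\mathrm{Fl}}_{(K-n,1^n)}$ is the space of partial flags $\Lambda_0\supset\Lambda_{K-n}\supset\Lambda_{K-n+1}\supset\cdots\supset\Lambda_K=\epsilon\Lambda_0$, with forgetful map $\mathrm{pr}$ from $\widetilde{\mathrm{Fl}}$. An affine permutation is a bijection $w:\mathbb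 Z\to\mathbb Z$ with $w(i+K)=w(i)+K$, viewed in $\mathrm{GL}_K(\mathbb K)$ via $e_i\mapsto e_{w(i)}$; positive means $w(i)>0$ for $1\le i\le K$; normalized means $1\le w^{-1}(1)\le K$. $C=\bigcup_w I^-wI^-/I^-$ over positive normalized $w$, $C'=\mathrm{pr}(C)$. **$Y_{n,k,N}$.** $\gamma=\gamma_{n,k,N}$ is the $\mathbb O$-linear operator with $\gamma e_i=e_{i+k}$ for $1\le i\le (n-k)k$, $\gamma e_i=e_{i+k+1}$ for $(n-k)k<i<K$, $\gamma e_K=\epsilon^{N+1}e_1$, and $$Y_{n,k,N}=C'\cap\{\Lambda_\bullet\in\widetilde{\mathrm{Fl}}_{(K-n,1^n)}:\gamma\Lambda_i\subseteq\Lambda_i\ \forall i,\ JT(\gamma|_{\Lambda_0/\Lambda_{K-n}})\le (n-k)^{k-1}\},$$ with $JT$ the Jordan type and $\le$ dominance order (equivalently $\gamma^{n-k}\Lambda_0\subseteq\Lambda_{K-n}$). All spaces carry the reduced structure. **$\Delta$-Springer fibers.** Let $\mu$ be a partition of size $m\le n$, $s\ge\ell(\mu)$ an integer, $\nu=(n-m)^s+\mu$ (add $n-m$ to each of the $s$ parts of $\mu$, padded by zeros). Fix a nilpotent operator $\overline\gamma$ on $\mathbb C^{|\nu|}$ of Jordan type $\nu$. Then $Z_{n,\mu,s}$ is the variety of partial flags $\mathbb C^{|\nu|}=F_0\supset F_{|\nu|-n}\supset F_{|\nu|-n+1}\supset\cdots\supset F_{|\nu|}=0$ with $\dim F_i=|\nu|-i$,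 $\overline\gamma F_i\subset F_i$ for all $i$, and $JT(\overline\gamma|_{F_0/F_{|\nu|-n}})\le(n-m)^{s-1}$ (equivalently $\overline\gamma^{\,n-m}F_0\subseteq F_{|\nu|-n}$). *)

theory Defs
  imports
    "Jordan_Normal_Form.Jordan_Normal_Form"
    "Jordan_Normal_Form.VS_Connect"
    "HOL-Computational_Algebra.Formal_Laurent_Series"
    "HOL-Library.FuncSet"
begin

section \<open>Partitions\<close>

definition is_partition :: "nat list \<Rightarrow> bool" where
  "is_partition la \<longleftrightarrow> sorted_wrt (\<ge>) la \<and> 0 \<notin> set la"

text \<open>Dominance order. Trailing zeros in either list are immaterial, so
  \<^term>\<open>replicate b a\<close> stands for the rectangular partition $(a^b)$ even when
  \<^prop>\<open>a = 0\<close>.\<close>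

definition dominated :: "nat list \<Rightarrow> nat list \<Rightarrow> bool" where
  "dominated la mu \<longleftrightarrow> sum_list la = sum_list mu \<and>
     (\<forall>i. sum_list (take i la) \<le> sum_list (take i mu))"

text \<open>The partition $\nu = (n-m)^s + \mu$ with $m = |\mu|$ (meant for $s \ge \ell(\mu)$,
  $m \le n$). Zero parts, which occur only if $m = n$, are dropped.\<close>

definition nu_part :: "nat \<Rightarrow> nat list \<Rightarrow> nat \<Rightarrow> nat list" where
  "nu_part n mu s = filter (\<lambda>l. 0 < l)
     (map (\<lambda>i. (n - sum_list mu) + (if i < length mu then mu ! i else 0)) [0..<s])"


section \<open>Subquotients of complex vector spaces of column vectors\<close>

text \<open>Both $\mathbb{C}^D$ and $\mathbb{C}((\epsilon))^D$ are used as complex vector spaces. The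
  argument \<open>sc\<close> is the embedding of the complex scalars into the ring of entries: the identity,
  respectively \<^const>\<open>fls_const\<close>. For subspaces $W \subseteq U$, the list \<open>vs\<close> represents an
  ordered basis of $U/W$: every class has exactly one coordinate vector.\<close>

definition quotient_basis ::
  "(complex \<Rightarrow> 'a::comm_ring_1) \<Rightarrow> nat \<Rightarrow> 'a vec set \<Rightarrow> 'a vec set \<Rightarrow> 'a vec list \<Rightarrow> bool" where
  "quotient_basis sc D U W vs \<longleftrightarrow> set vs \<subseteq> U \<and>
     (\<forall>u\<in>U. \<exists>!c. c \<in> carrier_vec (length vs) \<and>
        u - mat_of_cols D vs *\<^sub>v map_vec sc c \<in> W)"

definition has_quotient_dim ::
  "(complex \<Rightarrow> 'a::comm_ring_1) \<Rightarrow> nat \<Rightarrow> 'a vec set \<Rightarrow> 'a vec set \<Rightarrow> nat \<Rightarrow> bool" where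
  "has_quotient_dim sc D U W d \<longleftrightarrow> (\<exists>vs. quotient_basis sc D U W vs \<and> length vs = d)"

text \<open>The operator induced by \<open>T\<close> on $U/W$ is nilpotent of Jordan type \<open>la\<close>: its matrix \<open>A\<close> in
  some basis of $U/W$ has Jordan normal form with eigenvalue $0$ and block sizes \<open>la\<close>.\<close>

definition has_jordan_type ::
  "(complex \<Rightarrow> 'a::comm_ring_1) \<Rightarrow> nat \<Rightarrow> ('a vec \<Rightarrow> 'a vec) \<Rightarrow>
     'a vec set \<Rightarrow> 'a vec set \<Rightarrow> nat list \<Rightarrow> bool" where
  "has_jordan_type sc D T U W la \<longleftrightarrow> is_partition la \<and>
     (\<exists>vs A. quotient_basis sc D U W vs \<and> A \<in> carrier_mat (length vs) (length vs) \<and>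
        (\<forall>j<length vs. T (vs ! j) - mat_of_cols D vs *\<^sub>v map_vec sc (col A j) \<in> W) \<and>
        jordan_nf A (map (\<lambda>l. (l, 0)) la))"

definition jordan_type_le ::
  "(complex \<Rightarrow> 'a::comm_ring_1) \<Rightarrow> nat \<Rightarrow> ('a vec \<Rightarrow> 'a vec) \<Rightarrow>
     'a vec set \<Rightarrow> 'a vec set \<Rightarrow> nat list \<Rightarrow> bool" where
  "jordan_type_le sc D T U W mu \<longleftrightarrow> (\<exists>la. has_jordan_type sc D T U W la \<and> dominated la mu)"


section \<open>Varieties as spaces with functions\<close>

text \<open>A (reduced) variety is represented by its points, its Zariski open sets, and, for each open
  set, its regular complex-valued functions.\<close>

record 'p space_with_functions =
  points :: "'p set"
  is_open :: "'p set \<Rightarrow> bool"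
  is_regular :: "'p set \<Rightarrow> ('p \<Rightarrow> complex) \<Rightarrow> bool"

text \<open>An isomorphism is a homeomorphism under which regular functions correspond.\<close>

definition isomorphic_spaces ::
  "'p space_with_functions \<Rightarrow> 'q space_with_functions \<Rightarrow> bool" where
  "isomorphic_spaces X Y \<longleftrightarrow> (\<exists>\<phi>. bij_betw \<phi> (points X) (points Y) \<and>
     (\<forall>U\<subseteq>points X. is_open X U \<longleftrightarrow> is_open Y (\<phi> ` U)) \<and>
     (\<forall>V f. is_open Y V \<longrightarrow>
        (is_regular Y V f \<longleftrightarrow> is_regular X {x \<in> points X. \<phi> x \<in> V} (f \<circ> \<phi>))))"

text \<open>Polynomials (each in finitely many variables) in a family of coordinate functions.\<close>

inductive_set polynomials_in :: "('g \<Rightarrow> complex) set \<Rightarrow> ('g \<Rightarrow> complex) set"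
  for \<Phi> :: "('g \<Rightarrow> complex) set" where
  const: "(\<lambda>_. c) \<in> polynomials_in \<Phi>"
| coord: "x \<in> \<Phi> \<Longrightarrow> x \<in> polynomials_in \<Phi>"
| add: "p \<in> polynomials_in \<Phi> \<Longrightarrow> q \<in> polynomials_in \<Phi> \<Longrightarrow> (\<lambda>g. p g + q g) \<in> polynomials_in \<Phi>"
| mult: "p \<in> polynomials_in \<Phi> \<Longrightarrow> q \<in> polynomials_in \<Phi> \<Longrightarrow> (\<lambda>g. p g * q g) \<in> polynomials_in \<Phi>"

definition zariski_open_in :: "('g \<Rightarrow> complex) set \<Rightarrow> 'g set \<Rightarrow> 'g set \<Rightarrow> bool" where
  "zariski_open_in \<Phi> S U \<longleftrightarrow> U \<subseteq> S \<and>
     (\<forall>x\<in>U. \<exists>h\<in>polynomials_in \<Phi>. h x \<noteq> 0 \<and> {y \<in> S. h y \<noteq> 0} \<subseteq> U)"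

definition regular_on :: "('g \<Rightarrow> complex) set \<Rightarrow> 'g set \<Rightarrow> ('g \<Rightarrow> complex) \<Rightarrow> bool" where
  "regular_on \<Phi> S f \<longleftrightarrow>
     (\<forall>x\<in>S. \<exists>p\<in>polynomials_in \<Phi>. \<exists>h\<in>polynomials_in \<Phi>.
        h x \<noteq> 0 \<and> (\<forall>y\<in>S. h y \<noteq> 0 \<longrightarrow> f y = p y / h y))"

text \<open>The reduced structure on a subset \<open>X\<close> of a homogeneous space $G/P$, where \<open>q\<close> is the
  quotient map on \<open>G\<close> and \<open>\<Phi>\<close> are the coordinates of \<open>G\<close>. Since $G \to G/P$ is open and has
  sections locally in the Zariski topology, a subset of \<open>X\<close> is open, and a function on it is
  regular, if and only if this holds for the pullback to \<open>G\<close>.\<close>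

definition homogeneous_subspace ::
  "('g \<Rightarrow> complex) set \<Rightarrow> 'g set \<Rightarrow> ('g \<Rightarrow> 'p) \<Rightarrow> 'p set \<Rightarrow> 'p space_with_functions" where
  "homogeneous_subspace \<Phi> G q X = \<lparr>
     points = X,
     is_open = (\<lambda>U. U \<subseteq> X \<and> zariski_open_in \<Phi> {g \<in> G. q g \<in> X} {g \<in> G. q g \<in> U}),
     is_regular = (\<lambda>U f. regular_on \<Phi> {g \<in> G. q g \<in> U} (f \<circ> q)) \<rparr>"


section \<open>Affine flags\<close>

text \<open>Matrices and vectors are indexed from $0$ in the library, whereas the basis vectors
  $e_1,\dots,e_K$ are indexed from $1$. Flags are functions of the index $i$ of $\Lambda_i$ that are
  extensional, that is, undefined off the index set.\<close>

definition GL :: "nat \<Rightarrow> 'a::comm_ring_1 mat set" where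
  "GL d = {g \<in> carrier_mat d d. invertible_mat g}"

text \<open>$e_i \in \mathbb{K}^K$ for all integers $i$, with $e_{i+K} = \epsilon e_i$.\<close>

definition ebasis :: "nat \<Rightarrow> int \<Rightarrow> complex fls vec" where
  "ebasis K i = fls_X_intpow ((i - 1) div int K) \<cdot>\<^sub>v unit_vec K (nat ((i - 1) mod int K))"

definition O_span :: "nat \<Rightarrow> complex fls vec list \<Rightarrow> complex fls vec set" where
  "O_span K vs = {mat_of_cols K vs *\<^sub>v map_vec fps_to_fls c | c. c \<in> carrier_vec (length vs)}"

definition eps_times :: "complex fls vec set \<Rightarrow> complex fls vec set" where
  "eps_times L = (\<lambda>v. fls_X \<cdot>\<^sub>v v) ` L"

definition is_lattice :: "nat \<Rightarrow> complex fls vec set \<Rightarrow> bool" where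
  "is_lattice K L \<longleftrightarrow>
     (\<exists>g\<in>GL K. L = (\<lambda>v. g *\<^sub>v v) ` O_span K (map (ebasis K) [1..int K]))"

definition iwahori_minus :: "nat \<Rightarrow> complex fls mat set" where
  "iwahori_minus K = {map_mat fps_to_fls h | h.
     h \<in> GL K \<and> (\<forall>i j. i < j \<and> j < K \<longrightarrow> fps_nth (h $$ (i, j)) 0 = 0)}"

text \<open>The flag of the coset $g I^-$: $\Lambda_i = g\,\mathbb{O}\{\epsilon e_1,\dots,\epsilon e_i,
  e_{i+1},\dots,e_K\}$.\<close>

definition full_flag :: "nat \<Rightarrow> complex fls mat \<Rightarrow> nat \<Rightarrow> complex fls vec set" where
  "full_flag K g = (\<lambda>i\<in>{0..K}. (\<lambda>v. g *\<^sub>v v) ` O_span K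
     (map (\<lambda>j. if j \<le> int i then fls_X \<cdot>\<^sub>v ebasis K j else ebasis K j) [1..int K]))"

definition flag_index :: "nat \<Rightarrow> nat \<Rightarrow> nat set" where
  "flag_index K n = insert 0 {K - n..K}"

definition forget_flag :: "nat \<Rightarrow> nat \<Rightarrow> (nat \<Rightarrow> 'a set) \<Rightarrow> nat \<Rightarrow> 'a set" where
  "forget_flag K n F = restrict F (flag_index K n)"

definition partial_affine_flags :: "nat \<Rightarrow> nat \<Rightarrow> (nat \<Rightarrow> complex fls vec set) set" where
  "partial_affine_flags K n = {F \<in> extensional (flag_index K n).
     (\<forall>i\<in>flag_index K n. is_lattice K (F i)) \<and>
     F K = eps_times (F 0) \<and>
     (\<forall>i\<in>flag_index K n. \<forall>j\<in>flag_index K n. i \<le> j \<longrightarrow>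
        F j \<subseteq> F i \<and> has_quotient_dim fls_const K (F i) (F j) (j - i))}"

definition affine_perm :: "nat \<Rightarrow> (int \<Rightarrow> int) \<Rightarrow> bool" where
  "affine_perm K w \<longleftrightarrow> bij w \<and> (\<forall>i. w (i + int K) = w i + int K)"

definition positive_perm :: "nat \<Rightarrow> (int \<Rightarrow> int) \<Rightarrow> bool" where
  "positive_perm K w \<longleftrightarrow> (\<forall>i\<in>{1..int K}. 0 < w i)"

definition normalized_perm :: "nat \<Rightarrow> (int \<Rightarrow> int) \<Rightarrow> bool" where
  "normalized_perm K w \<longleftrightarrow> inv_into UNIV w 1 \<in> {1..int K}"

definition perm_matrix :: "nat \<Rightarrow> (int \<Rightarrow> int) \<Rightarrow> complex fls mat" where
  "perm_matrix K w = mat_of_cols K (map (\<lambda>i. ebasis K (w i)) [1..int K])"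

definition C_flags :: "nat \<Rightarrow> (nat \<Rightarrow> complex fls vec set) set" where
  "C_flags K = {full_flag K (b * perm_matrix K w * b') | b w b'.
     b \<in> iwahori_minus K \<and> b' \<in> iwahori_minus K \<and>
     affine_perm K w \<and> positive_perm K w \<and> normalized_perm K w}"

definition C'_flags :: "nat \<Rightarrow> nat \<Rightarrow> (nat \<Rightarrow> complex fls vec set) set" where
  "C'_flags K n = forget_flag K n ` C_flags K"


section \<open>The variety $Y_{n,k,N}$ and the fibers of its projection\<close>

definition K_of :: "nat \<Rightarrow> nat \<Rightarrow> nat" where
  "K_of n k = k * (n - k + 1)"

definition gamma :: "nat \<Rightarrow> nat \<Rightarrow> nat \<Rightarrow> complex fls mat" where
  "gamma n k N = (let K = K_of n k in mat_of_cols K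
     (map (\<lambda>i. if i \<le> int ((n - k) * k) then ebasis K (i + int k)
               else if i < int K then ebasis K (i + int k + 1)
               else fls_X ^ (N + 1) \<cdot>\<^sub>v ebasis K 1) [1..int K]))"

definition Y_flags :: "nat \<Rightarrow> nat \<Rightarrow> nat \<Rightarrow> (nat \<Rightarrow> complex fls vec set) set" where
  "Y_flags n k N = (let K = K_of n k; T = (\<lambda>v. gamma n k N *\<^sub>v v) in
     C'_flags K n \<inter>
     {F \<in> partial_affine_flags K n.
        (\<forall>i\<in>flag_index K n. T ` F i \<subseteq> F i) \<and>
        jordan_type_le fls_const K T (F 0) (F (K - n)) (replicate (k - 1) (n - k))})"

definition Y_proj :: "(nat \<Rightarrow> complex fls vec set) \<Rightarrow> complex fls vec set" where
  "Y_proj F = F 0"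

definition laurent_coordinates :: "nat \<Rightarrow> (complex fls mat \<Rightarrow> complex) set" where
  "laurent_coordinates K = {(\<lambda>g. fls_nth (g $$ (i, j)) r) | i j r. i < K \<and> j < K}"

text \<open>The fiber over the lattice \<open>L\<close> with its reduced structure as a subset of the partial affine
  flag variety, presented as a homogeneous space of $GL_K(\mathbb{K})$ with the Laurent coefficients
  of matrix entries as coordinates. On flags with fixed $\Lambda_0$ = \<open>L\<close> = $g_0 \mathbb{O}^K$ the
  matrices representing them are the products of $g_0$ and an element of $GL_K(\mathbb{O})$; hence
  their entries have poles of bounded order, and the structure obtained is that of a subset of the
  flag variety of $\Lambda_0/\epsilon\Lambda_0$.\<close>

definition Y_fiber ::
  "nat \<Rightarrow> nat \<Rightarrow> nat \<Rightarrow> complex fls vec set \<Rightarrow> (nat \<Rightarrow> complex fls vec set) space_with_functions"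
where
  "Y_fiber n k N L = homogeneous_subspace
     (laurent_coordinates (K_of n k)) (GL (K_of n k))
     (\<lambda>g. forget_flag (K_of n k) n (full_flag (K_of n k) g))
     {F \<in> Y_flags n k N. Y_proj F = L}"


section \<open>$\Delta$-Springer fibers\<close>

text \<open>The operator \<open>G\<close> is meant to be nilpotent on $\mathbb{C}^d$, $d = |\nu|$, of Jordan type
  $\nu$, with $s \ge 1$.\<close>

definition delta_springer_flags ::
  "nat \<Rightarrow> nat list \<Rightarrow> nat \<Rightarrow> complex mat \<Rightarrow> (nat \<Rightarrow> complex vec set) set" where
  "delta_springer_flags n mu s G =
    (let d = sum_list (nu_part n mu s); m = sum_list mu; T = (\<lambda>v. G *\<^sub>v v) in
     {F \<in> extensional (flag_index d n).
        F 0 = carrier_vec d \<and> F d = {0\<^sub>v d} \<and>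
        (\<forall>i\<in>flag_index d n.
           subspace class_ring (F i) (module_vec TYPE(complex) d) \<and>
           has_quotient_dim (\<lambda>c. c) d (F i) {0\<^sub>v d} (d - i) \<and>
           T ` F i \<subseteq> F i) \<and>
        (\<forall>i\<in>flag_index d n. \<forall>j\<in>flag_index d n. i \<le> j \<longrightarrow> F j \<subseteq> F i) \<and>
        jordan_type_le (\<lambda>c. c) d T (F 0) (F (d - n)) (replicate (s - 1) (n - m))})"

text \<open>The flag of subspaces spanned by the last $d - i$ columns of \<open>g\<close>.\<close>

definition column_flag :: "nat \<Rightarrow> complex mat \<Rightarrow> nat \<Rightarrow> complex vec set" where
  "column_flag d g = (\<lambda>i\<in>{0..d}. (\<lambda>v. g *\<^sub>v v) ` {v \<in> carrier_vec d. \<forall>j<i. v $ j = 0})"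

definition entry_coordinates :: "nat \<Rightarrow> (complex mat \<Rightarrow> complex) set" where
  "entry_coordinates d = {(\<lambda>g. g $$ (i, j)) | i j. i < d \<and> j < d}"

definition delta_springer_fiber ::
  "nat \<Rightarrow> nat list \<Rightarrow> nat \<Rightarrow> complex mat \<Rightarrow> (nat \<Rightarrow> complex vec set) space_with_functions" where
  "delta_springer_fiber n mu s G =
    (let d = sum_list (nu_part n mu s) in
     homogeneous_subspace (entry_coordinates d) (GL d)
       (\<lambda>g. forget_flag d n (column_flag d g))
       (delta_springer_flags n mu s G))"

end

theory Submission
  imports
    Defs
    "Jordan_Normal_Form.Jordan_Normal_Form_Existence"
begin

text \<open>Fix a lattice $\Lambda_0 = L$ stable under $\gamma$ and let \<open>A\<close> be the nilpotent operator induced by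
  $\gamma$ on $L/\epsilon L \cong \mathbb{C}^K$. A flag in the fiber over \<open>L\<close> is a flag of \<open>A\<close>-stable subspaces
  of dimensions $n, \dots, 0$ containing $\mathrm{im}\, A^{n-k}$; membership in \<open>C'\<close> depends only on \<open>L\<close>, because
  a full flag belongs to \<open>C\<close> if and only if $\Lambda_0 \subseteq \mathbb{O}^K$ and $\Lambda_0$ is not contained in
  the span of $\epsilon e_1, e_2, \dots, e_K$. The latter condition and the shape of $\gamma$ force \<open>A\<close> to have at
  most \<open>k\<close> Jordan blocks, say of sizes $\lambda_i$. With $\mu_i = \max(\lambda_i - (n-k), 0)$ and $q = n - |\mu|$,
  every subspace in the flag lies in $W = \{x : A^q x \in \mathrm{im}\, A^{n-k}\}$, since $A^q$ vanishes on the
  \<open>q\<close>-dimensional quotient of the largest one by $\mathrm{im}\, A^{n-k}$, and \<open>A\<close> restricted to \<open>W\<close> has Jordan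
  type $(q^k) + \mu$. There the conditions are those of a $\Delta$-Springer fiber.\<close>

section \<open>Matrices\<close>

no_notation fps_nth (infixl "$" 75)

text \<open>That every part of the Jordan type of the restriction to W is at least q rests on K =
  (k-1)(n-k) + n: it gives q \<le> min(l, n-k) for each of the k block sizes l of A, padded by
  zeros. If A has fewer than k blocks, this forces q = 0. That |mu| is at most n follows from the
  existence of a point in the fiber.

  The restriction to W is encoded by matrix identities with an explicit left inverse. Such
  identities pass to direct sums and to conjugates, so only a single Jordan block has to be
  inspected.

  Beyond the bijection of flags, the obstacle is the variety structure, which on both sides is
  defined through a group of matrices, one of them infinite-dimensional. The bijection is lifted
  locally to the groups: only the last n columns of a matrix determine the flag, so the other
  columns are frozen, and invertibility becomes the nonvanishing of a determinant. Over a fixed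
  lattice the poles are bounded, which makes the constant terms of the products involved polynomial
  in finitely many Laurent coefficients.\<close>

lemma mult_mat_vec_nth:
  assumes "A \<in> carrier_mat nr nc" "v \<in> carrier_vec nc" "i < nr"
  shows "(A *\<^sub>v v) $ i = (\<Sum>j<nc. A $$ (i, j) * v $ j)"
  using assms by (auto simp: scalar_prod_def atLeast0LessThan intro!: sum.cong)

lemma mult_mat_nth:
  assumes "A \<in> carrier_mat nr n" "B \<in> carrier_mat n nc" "i < nr" "j < nc"
  shows "(A * B) $$ (i, j) = (\<Sum>l<n. A $$ (i, l) * B $$ (l, j))"
  using assms by (auto simp: scalar_prod_def atLeast0LessThan intro!: sum.cong)

lemma mult_mat_vec_unit:
  fixes A :: "'a :: comm_ring_1 mat"
  assumes A: "A \<in> carrier_mat nr nc" and "j < nc"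
  shows "A *\<^sub>v unit_vec nc j = col A j"
proof -
  have "A *\<^sub>v unit_vec nc j = A *\<^sub>v col (1\<^sub>m nc) j" using assms by simp
  also have "\<dots> = col (A * 1\<^sub>m nc) j" using assms by (subst col_mult2) auto
  finally show ?thesis using A by simp
qed

lemma eq_mat_of_mult_vec:
  fixes A :: "'a :: comm_ring_1 mat"
  assumes A: "A \<in> carrier_mat nr nc" and B: "B \<in> carrier_mat nr nc"
    and eq: "\<And>v. v \<in> carrier_vec nc \<Longrightarrow> A *\<^sub>v v = B *\<^sub>v v"
  shows "A = B"
proof (rule mat_col_eqI)
  fix j assume "j < dim_col B"
  then have j: "j < nc" using B by simp
  show "col A j = col B j"
    using eq[of "unit_vec nc j"] mult_mat_vec_unit[OF A j] mult_mat_vec_unit[OF B j] by simp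
qed (use A B in auto)

lemma GL_carrier: "g \<in> GL d \<Longrightarrow> g \<in> carrier_mat d d"
  by (simp add: GL_def)

lemma GL_I:
  assumes "g \<in> carrier_mat d d" "g' \<in> carrier_mat d d" "g * g' = 1\<^sub>m d" "g' * g = 1\<^sub>m d"
  shows "g \<in> GL d"
  unfolding GL_def invertible_mat_def inverts_mat_def using assms by auto

lemma GL_E:
  assumes "g \<in> GL d"
  obtains g' where "g' \<in> carrier_mat d d" "g * g' = 1\<^sub>m d" "g' * g = 1\<^sub>m d"
proof -
  have g: "g \<in> carrier_mat d d" using assms by (rule GL_carrier)
  from assms obtain B where B: "g * B = 1\<^sub>m d" "B * g = 1\<^sub>m (dim_row B)"
    unfolding GL_def invertible_mat_def inverts_mat_def by auto
  have "dim_col (g * B) = d" "dim_col (B * g) = dim_row B" using B by simp_all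
  then have "B \<in> carrier_mat d d" using g by auto
  with B show thesis using that by auto
qed

lemma GL_mult:
  fixes g h :: "'a :: comm_ring_1 mat"
  assumes g: "g \<in> GL d" and h: "h \<in> GL d"
  shows "g * h \<in> GL d"
proof -
  obtain g' where g': "g' \<in> carrier_mat d d" "g * g' = 1\<^sub>m d" "g' * g = 1\<^sub>m d"
    using GL_E[OF g] .
  obtain h' where h': "h' \<in> carrier_mat d d" "h * h' = 1\<^sub>m d" "h' * h = 1\<^sub>m d"
    using GL_E[OF h] .
  note c = GL_carrier[OF g] GL_carrier[OF h] g'(1) h'(1)
  have "g * h * (h' * g') = g * (h * h') * g'" "h' * g' * (g * h) = h' * (g' * g) * h"
    using c by (simp_all add: assoc_mult_mat[of _ d d _ d _ d])
  then show ?thesis using c g' h' by (intro GL_I[of _ _ "h' * g'"]) auto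
qed

lemma GL_iff_det:
  fixes g :: "'a :: field mat"
  assumes g: "g \<in> carrier_mat d d"
  shows "g \<in> GL d \<longleftrightarrow> det g \<noteq> 0"
proof
  assume "g \<in> GL d"
  then obtain g' where g': "g' \<in> carrier_mat d d" "g * g' = 1\<^sub>m d" by (rule GL_E)
  then have "det g * det g' = 1" using det_mult[OF g g'(1)] by simp
  then show "det g \<noteq> 0" by auto
next
  assume "det g \<noteq> 0"
  then have u: "g \<in> Units (ring_mat TYPE('a) d (0 :: nat))" by (rule det_non_zero_imp_unit[OF g])
  then show "g \<in> GL d"
    unfolding Units_def by (auto simp: ring_mat_simps intro: GL_I)
qed

lemma GL_mult_vec_cancel:
  fixes g :: "'a :: comm_ring_1 mat"
  assumes "g \<in> GL d" "v \<in> carrier_vec d" "w \<in> carrier_vec d" "g *\<^sub>v v = g *\<^sub>v w"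
  shows "v = w"
proof -
  obtain g' where g': "g' \<in> carrier_mat d d" "g' * g = 1\<^sub>m d" using GL_E[OF assms(1)] .
  have "g' *\<^sub>v (g *\<^sub>v u) = u" if "u \<in> carrier_vec d" for u
    using that g' by (subst assoc_mult_mat_vec[OF g'(1) GL_carrier[OF assms(1)] that, symmetric]) simp
  with assms show ?thesis by metis
qed

section \<open>Matrices with trivial kernel and their completion to invertible matrices\<close>

definition injective_mat :: "'a :: comm_ring_1 mat \<Rightarrow> bool" where
  "injective_mat M \<longleftrightarrow> (\<forall>v\<in>carrier_vec (dim_col M). M *\<^sub>v v = 0\<^sub>v (dim_row M) \<longrightarrow> v = 0\<^sub>v (dim_col M))"

lemma injective_matD:
  assumes "injective_mat M" "M \<in> carrier_mat r c" "v \<in> carrier_vec c" "M *\<^sub>v v = 0\<^sub>v r"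
  shows "v = 0\<^sub>v c"
  using assms unfolding injective_mat_def by auto

lemma injective_mat_cancel:
  assumes M: "injective_mat M" "M \<in> carrier_mat r c"
    and v: "v \<in> carrier_vec c" and w: "w \<in> carrier_vec c" and eq: "M *\<^sub>v v = M *\<^sub>v w"
  shows "v = w"
proof -
  have "M *\<^sub>v (v - w) = 0\<^sub>v r"
    using M v w eq by (simp add: mult_minus_distrib_mat_vec[of _ r c])
  then have "v - w = 0\<^sub>v c" using injective_matD[OF M, of "v - w"] v w by auto
  show ?thesis
  proof (rule eq_vecI)
    fix i assume "i < dim_vec w"
    then have i: "i < c" using w by auto
    have "(v - w) $ i = 0" using \<open>v - w = 0\<^sub>v c\<close> i by simp
    then show "v $ i = w $ i" using v w i by simp
  qed (use v w in auto)
qed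

lemma injective_mat_of_left_inverse:
  assumes M: "M \<in> carrier_mat r c" and R: "R \<in> carrier_mat c r" and RM: "R * M = 1\<^sub>m c"
  shows "injective_mat M"
  unfolding injective_mat_def
proof (intro ballI impI)
  fix v assume v: "v \<in> carrier_vec (dim_col M)" "M *\<^sub>v v = 0\<^sub>v (dim_row M)"
  have "R * M *\<^sub>v v = R *\<^sub>v (M *\<^sub>v v)" using v M R by (intro assoc_mult_mat_vec) auto
  then show "v = 0\<^sub>v (dim_col M)" using v M R RM by auto
qed

lemma injective_mat_mult:
  assumes "injective_mat M" "injective_mat M'" and M: "M \<in> carrier_mat r c"
    and M': "M' \<in> carrier_mat c c'"
  shows "injective_mat (M * M')"
  unfolding injective_mat_def
proof (intro ballI impI)
  fix v assume v: "v \<in> carrier_vec (dim_col (M * M'))" "(M * M') *\<^sub>v v = 0\<^sub>v (dim_row (M * M'))"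
  then have v': "v \<in> carrier_vec c'" using M' by simp
  have "M *\<^sub>v (M' *\<^sub>v v) = 0\<^sub>v r" using v M M' by (simp add: assoc_mult_mat_vec[OF M M' v'])
  then have "M' *\<^sub>v v = 0\<^sub>v c" using injective_matD[OF assms(1) M, of "M' *\<^sub>v v"] M' v' by auto
  then show "v = 0\<^sub>v (dim_col (M * M'))" using injective_matD[OF assms(2) M' v'] M' by simp
qed

lemma injective_mat_GL: "g \<in> GL d \<Longrightarrow> injective_mat g"
  by (metis GL_E GL_carrier injective_mat_of_left_inverse)

lemma GL_of_injective_mat:
  fixes g :: "'a :: field mat"
  assumes "injective_mat g" "g \<in> carrier_mat d d"
  shows "g \<in> GL d"
  unfolding GL_iff_det[OF assms(2)] det_0_iff_vec_prod_zero_field[OF assms(2)]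
  using injective_matD[OF assms] by auto

text \<open>Makes a wide matrix square, so that the determinant criterion for a nontrivial kernel
  applies to it.\<close>

definition pad_mat :: "nat \<Rightarrow> nat \<Rightarrow> 'a :: zero mat \<Rightarrow> 'a mat" where
  "pad_mat r c M = mat r c (\<lambda>(i, j). if i < dim_row M \<and> j < dim_col M then M $$ (i, j) else 0)"

text \<open>Padding a matrix with more columns than rows by zero rows gives a square matrix of
  determinant zero; a kernel vector of it is killed by \<open>M\<close> as well.\<close>

lemma injective_mat_cols_le_rows:
  fixes M :: "'a :: field mat"
  assumes inj: "injective_mat M" and M: "M \<in> carrier_mat r c"
  shows "c \<le> r"
proof (rule ccontr)
  assume "\<not> c \<le> r"
  then have rc: "r < c" by simp
  let ?P = "pad_mat c c M"
  have P: "?P \<in> carrier_mat c c" by (simp add: pad_mat_def)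
  have "row ?P r = 0\<^sub>v c" using M rc by (auto simp: pad_mat_def)
  then have tv: "transpose_mat ?P *\<^sub>v unit_vec c r = 0\<^sub>v c"
    using rc P by (subst mult_mat_vec_unit[of _ c c]) auto
  have "unit_vec c r \<noteq> (0\<^sub>v c :: 'a vec)"
  proof
    assume "unit_vec c r = (0\<^sub>v c :: 'a vec)"
    then have "unit_vec c r $ r = (0\<^sub>v c :: 'a vec) $ r" by simp
    then show False using rc by simp
  qed
  then have "det (transpose_mat ?P) = 0"
    using tv P by (intro iffD2[OF det_0_iff_vec_prod_zero_field[of _ c]] exI[of _ "unit_vec c r"]) auto
  then have "det ?P = 0" using det_transpose[OF P] by simp
  then obtain v where v: "v \<in> carrier_vec c" "v \<noteq> 0\<^sub>v c" "?P *\<^sub>v v = 0\<^sub>v c"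
    using det_0_iff_vec_prod_zero_field[OF P] by auto
  have "M *\<^sub>v v = 0\<^sub>v r"
  proof (rule eq_vecI)
    fix i assume "i < dim_vec (0\<^sub>v r :: 'a vec)"
    then have i: "i < r" by simp
    have "(M *\<^sub>v v) $ i = (?P *\<^sub>v v) $ i"
      using i rc M v(1) P
      by (subst mult_mat_vec_nth[OF M v(1)], simp, subst mult_mat_vec_nth[OF P v(1)], simp)
        (auto simp: pad_mat_def intro!: sum.cong)
    then show "(M *\<^sub>v v) $ i = 0\<^sub>v r $ i" using v(3) i rc by simp
  qed (use M in auto)
  then show False using injective_matD[OF inj M v(1)] v(2) by simp
qed

text \<open>The transpose has more columns than rows, so it kills some nonzero \<open>y\<close>.
  Every vector in the range of \<open>M\<close> pairs to zero with \<open>y\<close>, whereas a unit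
  vector at a nonzero coordinate of \<open>y\<close> does not.\<close>

lemma not_in_mat_range:
  fixes M :: "'a :: field mat"
  assumes M: "M \<in> carrier_mat r c" and cr: "c < r"
  obtains x where "x \<in> carrier_vec r" "\<And>v. v \<in> carrier_vec c \<Longrightarrow> M *\<^sub>v v \<noteq> x"
proof -
  let ?T = "transpose_mat M"
  have T: "?T \<in> carrier_mat c r" using M by simp
  obtain y where y: "y \<in> carrier_vec r" "y \<noteq> 0\<^sub>v r" "?T *\<^sub>v y = 0\<^sub>v c"
    using injective_mat_cols_le_rows[OF _ T] cr T unfolding injective_mat_def by fastforce
  have "\<exists>i<r. y $ i \<noteq> 0"
  proof (rule ccontr)
    assume "\<not> ?thesis"
    then have "y = 0\<^sub>v r" using y(1) by (intro eq_vecI) auto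
    with y(2) show False by simp
  qed
  then obtain i where i: "i < r" "y $ i \<noteq> 0" by auto
  have "M *\<^sub>v v \<noteq> unit_vec r i" if v: "v \<in> carrier_vec c" for v
  proof
    assume "M *\<^sub>v v = unit_vec r i"
    then have "y $ i = y \<bullet> (M *\<^sub>v v)" using i y by simp
    also have "\<dots> = (?T *\<^sub>v y) \<bullet> v"
      using transpose_vec_mult_scalar[OF M v y(1)] y(1) M v 
      by (metis)
    also have "\<dots> = 0" using y(3) v by simp
    finally show False using i by simp
  qed
  then show thesis using that[of "unit_vec r i"] by auto
qed

text \<open>The members of dimension at most \<open>m\<close> of a column flag depend only on these
  columns. Partial flags are therefore handled through tails of invertible matrices.\<close>

definition tail_cols :: "nat \<Rightarrow> 'a mat \<Rightarrow> 'a mat" where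
  "tail_cols m h = mat (dim_row h) m (\<lambda>(i, j). h $$ (i, dim_col h - m + j))"

lemma tail_cols_carrier: "h \<in> carrier_mat r c \<Longrightarrow> tail_cols m h \<in> carrier_mat r m"
  by (simp add: tail_cols_def)

lemma tail_cols_mult_vec:
  fixes h :: "'a :: comm_ring_1 mat"
  assumes h: "h \<in> carrier_mat r c" and m: "m \<le> c" and v: "v \<in> carrier_vec m"
  shows "tail_cols m h *\<^sub>v v = h *\<^sub>v (0\<^sub>v (c - m) @\<^sub>v v)"
proof (rule eq_vecI)
  fix i assume "i < dim_vec (h *\<^sub>v (0\<^sub>v (c - m) @\<^sub>v v))"
  then have i: "i < r" using h by simp
  have w: "0\<^sub>v (c - m) @\<^sub>v v \<in> carrier_vec c"
    using append_carrier_vec[OF zero_carrier_vec v, of "c - m"] m by simp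
  have "(h *\<^sub>v (0\<^sub>v (c - m) @\<^sub>v v)) $ i = (\<Sum>j<c. h $$ (i, j) * (0\<^sub>v (c - m) @\<^sub>v v) $ j)"
    by (rule mult_mat_vec_nth[OF h w i])
  also have "\<dots> = (\<Sum>j\<in>{c-m..<c}. h $$ (i, j) * (0\<^sub>v (c - m) @\<^sub>v v) $ j)"
    using v by (intro sum.mono_neutral_right) auto
  also have "\<dots> = (\<Sum>j<m. h $$ (i, c - m + j) * v $ j)"
    using v m by (intro sum.reindex_bij_witness[of _ "\<lambda>j. c - m + j" "\<lambda>j. j - (c - m)"]) auto
  also have "\<dots> = (tail_cols m h *\<^sub>v v) $ i"
    using v h m i mult_mat_vec_nth[OF tail_cols_carrier[OF h] v i]
    by (simp add: tail_cols_def)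
  finally show "(tail_cols m h *\<^sub>v v) $ i = (h *\<^sub>v (0\<^sub>v (c - m) @\<^sub>v v)) $ i" by simp
qed (use h in \<open>auto simp: tail_cols_def\<close>)

lemma injective_tail_cols:
  fixes h :: "'a :: comm_ring_1 mat"
  assumes "injective_mat h" and h: "h \<in> carrier_mat r c" and m: "m \<le> c"
  shows "injective_mat (tail_cols m h)"
  unfolding injective_mat_def
proof (intro ballI impI)
  fix v assume "v \<in> carrier_vec (dim_col (tail_cols m h))"
    and 0: "tail_cols m h *\<^sub>v v = 0\<^sub>v (dim_row (tail_cols m h))"
  then have v: "v \<in> carrier_vec m" by (simp add: tail_cols_def)
  have w: "0\<^sub>v (c - m) @\<^sub>v v \<in> carrier_vec c"
    using append_carrier_vec[OF zero_carrier_vec v, of "c - m"] m by simp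
  have "h *\<^sub>v (0\<^sub>v (c - m) @\<^sub>v v) = 0\<^sub>v r"
    using 0 h unfolding tail_cols_mult_vec[OF h m v] by (simp add: tail_cols_def)
  then have "0\<^sub>v (c - m) @\<^sub>v v = 0\<^sub>v c" by (rule injective_matD[OF assms(1) h w])
  then have "(0\<^sub>v (c - m) @\<^sub>v v) $ (c - m + j) = 0" if "j < m" for j
    using that m by simp
  then have "v $ j = 0" if "j < m" for j using that v by simp
  then show "v = 0\<^sub>v (dim_col (tail_cols m h))" using v by (intro eq_vecI) (auto simp: tail_cols_def)
qed

lemma tail_cols_tail_cols:
  "m \<le> m' \<Longrightarrow> m' \<le> dim_col h \<Longrightarrow> tail_cols m (tail_cols m' h) = tail_cols m h"
  by (intro eq_matI) (auto simp: tail_cols_def)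

text \<open>Vectors outside the range are added in front, one at a time, so that the given columns
  remain the tail.\<close>

lemma complete_to_GL:
  fixes Z :: "'a :: field mat"
  assumes "injective_mat Z" "Z \<in> carrier_mat r m"
  obtains h where "h \<in> GL r" "tail_cols m h = Z"
proof -
  have "\<exists>h\<in>GL r. tail_cols m h = Z"
    using assms
  proof (induction "r - m" arbitrary: m Z)
    case 0
    then have "m = r" using injective_mat_cols_le_rows[OF 0(2,3)] by simp
    then have "Z \<in> GL r" using GL_of_injective_mat 0 by auto
    moreover have "tail_cols m Z = Z" using 0 \<open>m = r\<close> by (intro eq_matI) (auto simp: tail_cols_def)
    ultimately show ?case by blast
  next
    case (Suc k)
    then have mr: "m < r" by simp
    note Z = Suc.prems
    obtain x where x: "x \<in> carrier_vec r" "\<And>v. v \<in> carrier_vec m \<Longrightarrow> Z *\<^sub>v v \<noteq> x"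
      by (rule not_in_mat_range[OF Z(2) mr]) blast
    define Z' where "Z' = mat r (Suc m) (\<lambda>(i, j). case j of 0 \<Rightarrow> x $ i | Suc j' \<Rightarrow> Z $$ (i, j'))"
    have Z': "Z' \<in> carrier_mat r (Suc m)" by (simp add: Z'_def)
    have ZZ: "tail_cols m Z' = Z" using Z by (intro eq_matI) (auto simp: tail_cols_def Z'_def)
    have dec: "Z' *\<^sub>v v = v $ 0 \<cdot>\<^sub>v x + Z *\<^sub>v vec m (\<lambda>j. v $ Suc j)" (is "_ = ?rhs")
      if v: "v \<in> carrier_vec (Suc m)" for v
    proof (rule eq_vecI)
      fix i assume "i < dim_vec ?rhs"
      then have i: "i < r" using Z by simp
      have "(Z' *\<^sub>v v) $ i = (\<Sum>j<Suc m. Z' $$ (i, j) * v $ j)"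
        by (rule mult_mat_vec_nth[OF Z' v i])
      also have "\<dots> = x $ i * v $ 0 + (\<Sum>j<m. Z $$ (i, j) * v $ Suc j)"
        using i by (subst sum.lessThan_Suc_shift) (simp add: Z'_def)
      also have "\<dots> = ?rhs $ i"
        using i x(1) Z mult_mat_vec_nth[OF Z(2), of "vec m (\<lambda>j. v $ Suc j)" i] by simp
      finally show "(Z' *\<^sub>v v) $ i = ?rhs $ i" .
    qed (use Z Z' in auto)
    have "injective_mat Z'"
      unfolding injective_mat_def
    proof (intro ballI impI)
      fix v assume v0: "v \<in> carrier_vec (dim_col Z')" and eq: "Z' *\<^sub>v v = 0\<^sub>v (dim_row Z')"
      then have v: "v \<in> carrier_vec (Suc m)" by (simp add: Z'_def)
      let ?u = "vec m (\<lambda>j. v $ Suc j)"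
      have eq': "v $ 0 \<cdot>\<^sub>v x + Z *\<^sub>v ?u = 0\<^sub>v r" using eq dec[OF v] Z' by simp
      \<comment> \<open>A nonzero coefficient of the new column would express \<open>x\<close>
        through the columns of \<open>Z\<close>.\<close>
      have c0: "v $ 0 = 0"
      proof (rule ccontr)
        assume nz: "v $ 0 \<noteq> 0"
        have "Z *\<^sub>v ((- inverse (v $ 0)) \<cdot>\<^sub>v ?u) = x"
        proof (rule eq_vecI)
          fix i assume "i < dim_vec x"
          then have i: "i < r" using x by simp
          have "(v $ 0 \<cdot>\<^sub>v x + Z *\<^sub>v ?u) $ i = 0" using eq' i by simp
          then have "v $ 0 * x $ i + (Z *\<^sub>v ?u) $ i = 0" using i x Z by simp
          then have zu: "(Z *\<^sub>v ?u) $ i = - (v $ 0 * x $ i)" by (simp add: eq_neg_iff_add_eq_0 add.commute)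
          have "Z *\<^sub>v ((- inverse (v $ 0)) \<cdot>\<^sub>v ?u) = (- inverse (v $ 0)) \<cdot>\<^sub>v (Z *\<^sub>v ?u)"
            using Z by (intro mult_mat_vec) auto
          moreover have "((- inverse (v $ 0)) \<cdot>\<^sub>v (Z *\<^sub>v ?u)) $ i = - inverse (v $ 0) * (Z *\<^sub>v ?u) $ i"
            using i Z by simp
          ultimately show "(Z *\<^sub>v ((- inverse (v $ 0)) \<cdot>\<^sub>v ?u)) $ i = x $ i"
            using zu nz by simp
        qed (use x Z in auto)
        then show False using x(2)[of "(- inverse (v $ 0)) \<cdot>\<^sub>v ?u"] by simp
      qed
      then have "Z *\<^sub>v ?u = 0\<^sub>v r" using eq' x Z by (auto simp: smult_vec_def vec_eq_iff)
      then have "?u = 0\<^sub>v m" using injective_matD[OF Z] by simp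
      then have "v $ Suc j = 0" if "j < m" for j using that by (metis index_vec index_zero_vec(1))
      with c0 have "v $ j = 0" if "j < Suc m" for j using that by (cases j) auto
      then show "v = 0\<^sub>v (dim_col Z')" using v Z' by (intro eq_vecI) auto
    qed
    then obtain h where h: "h \<in> GL r" "tail_cols (Suc m) h = Z'"
      using Suc.hyps(1)[of "Suc m" Z'] Suc.hyps(2) Z' by (metis Suc_diff_Suc diff_Suc_1 mr)
    have "tail_cols m h = Z"
      using tail_cols_tail_cols[of m "Suc m" h] h ZZ GL_carrier[OF h(1)] mr by auto
    then show ?case using h by blast
  qed
  then show thesis using that by blast
qed

section \<open>Nilpotent Jordan forms\<close>

lemma similar_mat_four_block_swap:
  fixes A :: "'a :: comm_ring_1 mat"
  assumes A: "A \<in> carrier_mat n n" and B: "B \<in> carrier_mat m m"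
  shows "similar_mat (four_block_mat A (0\<^sub>m n m) (0\<^sub>m m n) B) (four_block_mat B (0\<^sub>m m n) (0\<^sub>m n m) A)"
proof -
  let ?P = "four_block_mat (0\<^sub>m n m) (1\<^sub>m n) (1\<^sub>m m) (0\<^sub>m m n) :: 'a mat"
  let ?Q = "four_block_mat (0\<^sub>m m n) (1\<^sub>m m) (1\<^sub>m n) (0\<^sub>m n m) :: 'a mat"
  let ?A = "four_block_mat A (0\<^sub>m n m) (0\<^sub>m m n) B"
  let ?B = "four_block_mat B (0\<^sub>m m n) (0\<^sub>m n m) A"
  have PQ: "?P * ?Q = 1\<^sub>m (n + m)"
    by (subst mult_four_block_mat[of _ n m _ n _ m _ _ n _ m]) (auto intro!: eq_matI)
  have QP: "?Q * ?P = 1\<^sub>m (n + m)"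
    by (subst mult_four_block_mat[of _ m n _ m _ n _ _ m _ n]) (auto intro!: eq_matI)
  have PB: "?P * ?B = four_block_mat (0\<^sub>m n m) A B (0\<^sub>m m n)"
    using A B by (subst mult_four_block_mat[of _ n m _ n _ m _ _ m _ n]) auto
  have "?P * ?B * ?Q = ?A"
    unfolding PB using A B by (subst mult_four_block_mat[of _ n m _ n _ m _ _ n _ m]) auto
  moreover have "?P \<in> carrier_mat (n + m) (n + m)" "?Q \<in> carrier_mat (n + m) (n + m)"
    "?A \<in> carrier_mat (n + m) (n + m)" "?B \<in> carrier_mat (n + m) (n + m)"
    using A B by (auto simp: add.commute)
  ultimately have "similar_mat_wit ?A ?B ?P ?Q"
    using PQ QP by (intro similar_mat_witI) auto
  then show ?thesis unfolding similar_mat_def by blast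
qed

lemma similar_jordan_matrix_append_Cons:
  fixes x :: "nat \<times> 'a :: comm_ring_1"
  shows "similar_mat (jordan_matrix (x # xs @ ys)) (jordan_matrix (xs @ x # ys))"
proof (induction xs)
  case Nil
  show ?case by (auto intro: similar_mat_refl jordan_matrix_carrier)
next
  case (Cons z xs)
  obtain nx ax nz az where xz: "x = (nx, ax)" "z = (nz, az)" by fastforce
  let ?s = "\<lambda>l. sum_list (map fst l)"
  let ?fb = "\<lambda>A B. four_block_mat A (0\<^sub>m (dim_row A) (dim_row B)) (0\<^sub>m (dim_row B) (dim_row A)) B"
  let ?X = "jordan_block nx ax" and ?Z = "jordan_block nz az" and ?R = "jordan_matrix (xs @ ys)"
  have fb: "jordan_matrix ((n, a) # l) = ?fb (jordan_block n a) (jordan_matrix l)" for n a and l :: "(nat \<times> 'a) list"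
    by (simp add: jordan_matrix_Cons)
  have "?fb ?X (?fb ?Z ?R) = ?fb (?fb ?X ?Z) ?R"
    using assoc_four_block_mat[of ?X ?Z ?R] by (simp add: Let_def)
  moreover have "?fb ?Z (?fb ?X ?R) = ?fb (?fb ?Z ?X) ?R"
    using assoc_four_block_mat[of ?Z ?X ?R] by (simp add: Let_def)
  moreover have "similar_mat (?fb (?fb ?X ?Z) ?R) (?fb (?fb ?Z ?X) ?R)"
  proof -
    have "similar_mat (?fb ?X ?Z) (?fb ?Z ?X)"
      using similar_mat_four_block_swap[of ?X nx ?Z nz] by simp
    moreover have "similar_mat ?R ?R" by (rule similar_mat_refl[OF jordan_matrix_carrier])
    moreover have "?fb ?X ?Z \<in> carrier_mat (nx + nz) (nx + nz)"
      using four_block_carrier_mat[of ?X nx nx ?Z nz nz] by simp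
    ultimately have "similar_mat
        (four_block_mat (?fb ?X ?Z) (0\<^sub>m (nx + nz) (?s (xs @ ys))) (0\<^sub>m (?s (xs @ ys)) (nx + nz)) ?R)
        (four_block_mat (?fb ?Z ?X) (0\<^sub>m (nx + nz) (?s (xs @ ys))) (0\<^sub>m (?s (xs @ ys)) (nx + nz)) ?R)"
      using jordan_matrix_carrier by (rule similar_mat_four_block_0_0)
    then show ?thesis by (simp only: index_mat_four_block(2) jordan_matrix_dim jordan_block_index(2) add.commute)
  qed
  ultimately have 1: "similar_mat (jordan_matrix (x # z # xs @ ys)) (jordan_matrix (z # x # xs @ ys))"
    unfolding xz fb by (simp only: append_Cons fb)
  have 2: "similar_mat (jordan_matrix (z # x # xs @ ys)) (jordan_matrix (z # xs @ x # ys))"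
  proof -
    have "similar_mat ?Z ?Z" by (intro similar_mat_refl[of _ nz]) simp
    from similar_mat_four_block_0_0[OF this Cons.IH jordan_block_carrier jordan_matrix_carrier]
    show ?thesis unfolding xz fb[of nz az] by (simp add: ac_simps)
  qed
  show ?case using similar_mat_trans[OF 1 2] by simp
qed

text \<open>Serves two purposes: moving a chosen block to the front of a Jordan matrix, and sorting
  the block sizes into a partition.\<close>

lemma similar_jordan_matrix_mset:
  fixes xs ys :: "(nat \<times> 'a :: comm_ring_1) list"
  assumes "mset xs = mset ys"
  shows "similar_mat (jordan_matrix xs) (jordan_matrix ys)"
  using assms
proof (induction xs arbitrary: ys)
  case Nil
  then show ?case by (auto intro: similar_mat_refl jordan_matrix_carrier)
next
  case (Cons x xs)
  then have "x \<in> set ys" by (metis list.set_intros(1) mset_eq_setD)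
  then obtain us vs where ys: "ys = us @ x # vs" by (meson split_list)
  obtain nx ax where x: "x = (nx, ax)" by fastforce
  have "mset xs = mset (us @ vs)" using Cons.prems ys by simp
  from Cons.IH[OF this] have IH: "similar_mat (jordan_matrix xs) (jordan_matrix (us @ vs))" .
  have len: "sum_list (map fst xs) = sum_list (map fst (us @ vs))"
    using \<open>mset xs = mset (us @ vs)\<close> by (metis mset_map sum_mset_sum_list)
  have "similar_mat (jordan_matrix (x # xs)) (jordan_matrix (x # us @ vs))"
    unfolding x jordan_matrix_Cons len
    by (rule similar_mat_four_block_0_0[OF _ IH])
      (use jordan_matrix_carrier[of xs] in \<open>simp_all only: len jordan_block_carrier similar_mat_refl[OF jordan_block_carrier]\<close>)
  then show ?case
    unfolding ys by (rule similar_mat_trans) (rule similar_jordan_matrix_append_Cons)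
qed

lemma jordan_nf_nilpotent_exists:
  fixes A :: "complex mat"
  assumes A: "A \<in> carrier_mat d d" and nil: "A ^\<^sub>m r = 0\<^sub>m d d"
  obtains la where "is_partition la" "sum_list la = d" "jordan_nf A (map (\<lambda>l. (l, 0)) la)"
proof -
  obtain as where "char_poly A = (\<Prod>a\<leftarrow>as. [:- a, 1:])"
    using char_poly_factorized[OF A] by blast
  from jordan_nf_exists[OF A this] obtain n_as where jnf: "jordan_nf A n_as" by blast
  obtain P Q where PQ: "similar_mat_wit A (jordan_matrix n_as) P Q"
    using jnf unfolding jordan_nf_def similar_mat_def by blast
  note w = similar_mat_witD2[OF A PQ]
  have d: "sum_list (map fst n_as) = d" using w(5) by (metis carrier_matD(1) jordan_matrix_dim(1))
  have pw: "similar_mat_wit (jordan_matrix n_as ^\<^sub>m r) (A ^\<^sub>m r) Q P"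
    by (rule similar_mat_wit_sym[OF similar_mat_wit_pow[OF PQ]])
  have J0: "jordan_matrix n_as ^\<^sub>m r = 0\<^sub>m d d"
    using similar_mat_witD2[OF _ pw, of d d] w nil by auto
  \<comment> \<open>With the block of eigenvalue \<open>a\<close> in front, the corner entry of the
    \<open>r\<close>-th power is \<open>a ^ r\<close>, and this power is the zero matrix.\<close>
  have ev: "a = 0" if mem: "(n, a) \<in> set n_as" for n a
  proof -
    have n: "n \<noteq> 0" using jnf mem unfolding jordan_nf_def by force
    obtain us vs where sp: "n_as = us @ (n, a) # vs" using split_list[OF mem] by blast
    have "similar_mat (jordan_matrix n_as) (jordan_matrix ((n, a) # us @ vs))"
      by (rule similar_jordan_matrix_mset) (simp add: sp)
    then obtain P' Q' where "similar_mat_wit (jordan_matrix n_as) (jordan_matrix ((n, a) # us @ vs)) P' Q'"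
      unfolding similar_mat_def by blast
    from similar_mat_wit_sym[OF similar_mat_wit_pow[OF this, of r]] J0
    have sw: "similar_mat_wit (jordan_matrix ((n, a) # us @ vs) ^\<^sub>m r) (0\<^sub>m d d) Q' P'" by simp
    have len: "sum_list (map fst ((n, a) # us @ vs)) = d" using d by (simp add: sp)
    have "jordan_matrix ((n, a) # us @ vs) ^\<^sub>m r \<in> carrier_mat d d"
      using pow_carrier_mat[OF jordan_matrix_carrier[of "(n, a) # us @ vs"], of r] by (simp only: len)
    from similar_mat_witD2[OF this sw] have "jordan_matrix ((n, a) # us @ vs) ^\<^sub>m r = 0\<^sub>m d d" by auto
    then have "four_block_mat (jordan_block n a ^\<^sub>m r) (0\<^sub>m n (sum_list (map fst (us @ vs))))
       (0\<^sub>m (sum_list (map fst (us @ vs))) n) (jordan_matrix (us @ vs) ^\<^sub>m r) = 0\<^sub>m d d"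
      unfolding jordan_matrix_Cons pow_four_block_mat[OF jordan_block_carrier jordan_matrix_carrier] .
    then have "four_block_mat (jordan_block n a ^\<^sub>m r) (0\<^sub>m n (sum_list (map fst (us @ vs))))
       (0\<^sub>m (sum_list (map fst (us @ vs))) n) (jordan_matrix (us @ vs) ^\<^sub>m r) $$ (0, 0) = 0\<^sub>m d d $$ (0, 0)"
      by (rule arg_cong)
    moreover have "0 < d" using n len by simp
    ultimately have "(jordan_block n a ^\<^sub>m r) $$ (0, 0) = 0"
      using n by (simp add: index_mat_four_block(1) split: if_splits)
    then show "a = 0" using n by (simp add: jordan_block_pow)
  qed
  define la where "la = rev (sort (map fst n_as))"
  have n_as: "n_as = map (\<lambda>l. (l, 0)) (map fst n_as)"
    using map_idI[of n_as "\<lambda>p. (fst p, 0)"] ev by (force simp: o_def)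
  have "mset (map (\<lambda>l. (l, 0 :: complex)) la) = mset n_as"
    using arg_cong[OF n_as, of mset] by (simp add: la_def multiset.map_comp)
  then have "similar_mat (jordan_matrix n_as) (jordan_matrix (map (\<lambda>l. (l, 0)) la))"
    by (intro similar_jordan_matrix_mset) simp
  moreover have "similar_mat A (jordan_matrix n_as)" using jnf by (simp add: jordan_nf_def)
  ultimately have "similar_mat A (jordan_matrix (map (\<lambda>l. (l, 0)) la))" by (metis similar_mat_trans)
  moreover have "0 \<notin> set la" using jnf by (auto simp: la_def jordan_nf_def)
  ultimately have "jordan_nf A (map (\<lambda>l. (l, 0)) la)" by (auto simp: jordan_nf_def)
  moreover have "sorted_wrt (\<ge>) la" unfolding la_def by (simp add: sorted_wrt_rev)
  moreover have "sum_list la = d"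
  proof -
    have "mset la = mset (map fst n_as)" by (simp add: la_def)
    then show ?thesis using d by (metis sum_mset_sum_list)
  qed
  ultimately show thesis using that \<open>0 \<notin> set la\<close> by (simp add: is_partition_def)
qed

lemma four_block_diag_eq_zero_iff:
  assumes "A \<in> carrier_mat n n'" "B \<in> carrier_mat m m'"
  shows "four_block_mat A (0\<^sub>m n m') (0\<^sub>m m n') B = 0\<^sub>m (n + m) (n' + m') \<longleftrightarrow> A = 0\<^sub>m n n' \<and> B = 0\<^sub>m m m'"
  (is "?F = _ \<longleftrightarrow> _")
proof
  assume F: "?F = 0\<^sub>m (n + m) (n' + m')"
  have "A $$ (i, j) = 0" if "i < n" "j < n'" for i j
    using arg_cong[OF F, of "\<lambda>M. M $$ (i, j)"] that assms by simp
  moreover have "B $$ (i, j) = 0" if "i < m" "j < m'" for i j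
    using arg_cong[OF F, of "\<lambda>M. M $$ (n + i, n' + j)"] that assms by simp
  ultimately show "A = 0\<^sub>m n n' \<and> B = 0\<^sub>m m m'" using assms by (auto intro!: eq_matI)
qed auto

lemma jordan_block_zero_pow_eq_zero_iff:
  "jordan_block l (0 :: 'a :: field) ^\<^sub>m e = 0\<^sub>m l l \<longleftrightarrow> l \<le> e"
proof
  assume eq: "jordan_block l (0 :: 'a) ^\<^sub>m e = 0\<^sub>m l l"
  show "l \<le> e"
  proof (rule ccontr)
    assume "\<not> l \<le> e"
    then show False using arg_cong[OF eq, of "\<lambda>M. M $$ (0, e)"] by (simp add: jordan_block_zero_pow)
  qed
qed (auto simp: jordan_block_zero_pow intro!: eq_matI)

abbreviation nilpotent_jordan_matrix :: "nat list \<Rightarrow> 'a :: {zero, one} mat" where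
  "nilpotent_jordan_matrix la \<equiv> jordan_matrix (map (\<lambda>l. (l, 0)) la)"

lemma nilpotent_jordan_matrix_carrier:
  "nilpotent_jordan_matrix la \<in> carrier_mat (sum_list la) (sum_list la)"
  using jordan_matrix_carrier[of "map (\<lambda>l. (l, 0)) la"] by (simp add: o_def)

lemma nilpotent_jordan_matrix_Cons:
  "nilpotent_jordan_matrix (l # la) = four_block_mat (jordan_block l 0) (0\<^sub>m l (sum_list la))
     (0\<^sub>m (sum_list la) l) (nilpotent_jordan_matrix la)"
  by (simp add: jordan_matrix_Cons o_def)

lemma nilpotent_jordan_matrix_pow_Cons:
  "nilpotent_jordan_matrix (l # la) ^\<^sub>m e = four_block_mat (jordan_block l (0 :: 'a :: field) ^\<^sub>m e)
     (0\<^sub>m l (sum_list la)) (0\<^sub>m (sum_list la) l) (nilpotent_jordan_matrix la ^\<^sub>m e)"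
  unfolding nilpotent_jordan_matrix_Cons
  by (rule pow_four_block_mat[OF jordan_block_carrier nilpotent_jordan_matrix_carrier])

lemma nilpotent_jordan_matrix_pow_eq_zero_iff:
  "nilpotent_jordan_matrix la ^\<^sub>m e = (0\<^sub>m (sum_list la) (sum_list la) :: 'a :: field mat)
     \<longleftrightarrow> (\<forall>l\<in>set la. l \<le> e)"
proof (induction la)
  case Nil
  show ?case using pow_carrier_mat[OF nilpotent_jordan_matrix_carrier[of "[]"], of e] by (auto intro!: eq_matI)
next
  case (Cons l la)
  have "nilpotent_jordan_matrix (l # la) ^\<^sub>m e =
      (0\<^sub>m (sum_list (l # la)) (sum_list (l # la)) :: 'a mat) \<longleftrightarrow>
    jordan_block l (0 :: 'a) ^\<^sub>m e = 0\<^sub>m l l \<and> nilpotent_jordan_matrix la ^\<^sub>m e = (0\<^sub>m (sum_list la) (sum_list la) :: 'a mat)"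
    unfolding nilpotent_jordan_matrix_pow_Cons sum_list.Cons
    by (rule four_block_diag_eq_zero_iff)
      (simp_all only: jordan_block_pow_carrier pow_carrier_mat[OF nilpotent_jordan_matrix_carrier])
  then show ?case unfolding Cons.IH jordan_block_zero_pow_eq_zero_iff by simp
qed

lemma jordan_nf_pow_eq_zero_iff:
  fixes A :: "'a :: field mat"
  assumes A: "A \<in> carrier_mat d d" and jnf: "jordan_nf A (map (\<lambda>l. (l, 0)) la)"
  shows "sum_list la = d" and "A ^\<^sub>m e = 0\<^sub>m d d \<longleftrightarrow> (\<forall>l\<in>set la. l \<le> e)"
proof -
  obtain P Q where PQ: "similar_mat_wit A (nilpotent_jordan_matrix la) P Q"
    using jnf unfolding jordan_nf_def similar_mat_def by blast
  note w = similar_mat_witD2[OF A PQ]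
  have "sum_list la = dim_row (nilpotent_jordan_matrix la :: 'a mat)"
    using nilpotent_jordan_matrix_carrier by (metis carrier_matD(1))
  then show d: "sum_list la = d" using w(5) by (metis carrier_matD(1))
  have pw: "similar_mat_wit (A ^\<^sub>m e) (nilpotent_jordan_matrix la ^\<^sub>m e) P Q"
    by (rule similar_mat_wit_pow[OF PQ])
  have "A ^\<^sub>m e = 0\<^sub>m d d \<longleftrightarrow> nilpotent_jordan_matrix la ^\<^sub>m e = (0\<^sub>m d d :: 'a mat)"
    using similar_mat_witD2[OF pow_carrier_mat[OF A] pw]
      similar_mat_witD2[OF pow_carrier_mat[OF w(5)] similar_mat_wit_sym[OF pw]]
    by auto
  then show "A ^\<^sub>m e = 0\<^sub>m d d \<longleftrightarrow> (\<forall>l\<in>set la. l \<le> e)"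
    unfolding d[symmetric] nilpotent_jordan_matrix_pow_eq_zero_iff .
qed

section \<open>Truncation of nilpotent operators\<close>

text \<open>Stated through dimensions rather than carrier sets, so that it can serve as a rewrite
  rule on long products.\<close>

lemma mult_mat_assoc_dims:
  fixes A B C :: "'a :: semiring_0 mat"
  shows "dim_col A = dim_row B \<Longrightarrow> dim_col B = dim_row C \<Longrightarrow> A * B * C = A * (B * C)"
  by (rule assoc_mult_mat[of _ "dim_row A" "dim_col A" _ "dim_col B" _ "dim_col C"]) auto

text \<open>The matrix identities express that \<open>Q\<close> identifies \<open>G\<close> with the restriction of \<open>A\<close> to the subspace
  $\{x : A^q x \in \mathrm{im}\, A^e\}$ and that $\mathrm{im}\, Q G^q = \mathrm{im}\, A^e$.\<close>

definition truncation :: "nat \<Rightarrow> nat \<Rightarrow> 'a :: field mat \<Rightarrow> 'a mat \<Rightarrow> 'a mat \<Rightarrow> bool" where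
  "truncation q e A G Q \<longleftrightarrow> (\<exists>a g R M M' N.
     A \<in> carrier_mat a a \<and> G \<in> carrier_mat g g \<and> Q \<in> carrier_mat a g \<and> R \<in> carrier_mat g a \<and>
     M \<in> carrier_mat g a \<and> M' \<in> carrier_mat a g \<and> N \<in> carrier_mat a a \<and>
     A * Q = Q * G \<and> R * Q = 1\<^sub>m g \<and> A ^\<^sub>m e = Q * G ^\<^sub>m q * M \<and> Q * G ^\<^sub>m q = A ^\<^sub>m e * M' \<and>
     Q * R + N * A ^\<^sub>m q = 1\<^sub>m a \<and> N * A ^\<^sub>m e = 0\<^sub>m a a)"

lemma sum_indicator_eq:
  fixes f :: "nat \<Rightarrow> 'a :: semiring_1"
  shows "(\<Sum>j<n. (if P \<and> j = i then 1 else 0) * f j) = (if P \<and> i < n then f i else 0)"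
proof -
  have "(\<Sum>j<n. (if P \<and> j = i then 1 else 0) * f j) = (\<Sum>j<n. if j = i then (if P then f j else 0) else 0)"
    by (intro sum.cong) auto
  then show ?thesis by (simp add: sum.delta)
qed

text \<open>The left factor is a partial permutation matrix, which selects rows of the right factor;
  the matrices occurring for a single Jordan block have this form. \<open>P'\<close> is a simplified
  form of the row condition \<open>P i \<and> t i < n\<close>.\<close>

lemma indicator_mat_mult:
  assumes "\<And>i. i < r \<Longrightarrow> P i \<Longrightarrow> t i < n \<Longrightarrow> P' i" "\<And>i. i < r \<Longrightarrow> P' i \<Longrightarrow> P i \<and> t i < n"
  shows "mat r n (\<lambda>(i, j). if P i \<and> j = t i then 1 else 0) * mat n c F =
    mat r c (\<lambda>(i, j). if P' i then F (t i, j) else (0 :: 'a :: comm_ring_1))"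
proof (rule eq_matI)
  fix i j assume "i < dim_row (mat r c (\<lambda>(i, j). if P' i then F (t i, j) else (0 :: 'a)))"
    "j < dim_col (mat r c (\<lambda>(i, j). if P' i then F (t i, j) else (0 :: 'a)))"
  then have ij: "i < r" "j < c" by auto
  have "(mat r n (\<lambda>(i, j). if P i \<and> j = t i then 1 else 0) * mat n c F) $$ (i, j) =
     (\<Sum>l<n. (if P i \<and> l = t i then 1 else 0) * F (l, j))"
    using ij by (subst mult_mat_nth[of _ r n _ c]) auto
  also have "\<dots> = (if P i \<and> t i < n then F (t i, j) else 0)" by (rule sum_indicator_eq)
  finally show "(mat r n (\<lambda>(i, j). if P i \<and> j = t i then 1 else 0) * mat n c F) $$ (i, j) =
     mat r c (\<lambda>(i, j). if P' i then F (t i, j) else 0) $$ (i, j)"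
    using ij assms[of i] by auto
qed auto

text \<open>The block shifts the basis vectors down by one. The image of its \<open>e\<close>-th
  power is spanned by the first \<open>l - e\<close> of them, so the vectors whose
  \<open>q\<close>-fold shift lies there are spanned by the first \<open>q + (l - e)\<close>. The
  hypotheses keep this number at most \<open>l\<close>.\<close>

lemma truncation_jordan_block:
  assumes "q \<le> e" "q \<le> l"
  shows "truncation q e (jordan_block l (0 :: 'a :: field)) (jordan_block (q + (l - e)) 0)
     (mat l (q + (l - e)) (\<lambda>(i, j). if i = j then 1 else 0))"
proof -
  define n where "n = q + (l - e)"
  have n: "n \<le> l" "q \<le> n" using assms by (auto simp: n_def)
  let ?Q = "mat l n (\<lambda>(i, j). if i = j then 1 else 0 :: 'a)"
  let ?R = "mat n l (\<lambda>(i, j). if i = j then 1 else 0 :: 'a)"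
  \<comment> \<open>\<open>?M\<close> and \<open>?M'\<close> compensate the difference between the
    shifts by \<open>q\<close> and by \<open>e\<close>. \<open>?N\<close> undoes the shift by
    \<open>q\<close> on the coordinates from \<open>n\<close> on; it kills the image of the
    \<open>e\<close>-th power, which lies in the first \<open>l - e\<close> coordinates.\<close>
  let ?M = "mat n l (\<lambda>(j, t). if t + q = j + e then 1 else 0 :: 'a)"
  let ?M' = "mat l n (\<lambda>(j, t). if j + q = t + e then 1 else 0 :: 'a)"
  let ?N = "mat l l (\<lambda>(i, s). if i = s + q \<and> n \<le> i then 1 else 0 :: 'a)"
  let ?A = "jordan_block l (0 :: 'a)" and ?G = "jordan_block n (0 :: 'a)"
  have P: "jordan_block m (0 :: 'a) ^\<^sub>m r = mat m m (\<lambda>(i, j). if i + r < m \<and> j = i + r then 1 else 0)" for m r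
    unfolding jordan_block_zero_pow by (intro eq_matI) auto
  have A1: "jordan_block m (0 :: 'a) = mat m m (\<lambda>(i, j). if i + 1 < m \<and> j = i + 1 then 1 else 0)" for m
    by (intro eq_matI) (auto simp: jordan_block_def)
  have Q: "?Q = mat l n (\<lambda>(i, j). if i < n \<and> j = i then 1 else 0)" by (intro eq_matI) auto
  have R: "?R = mat n l (\<lambda>(i, j). if i < n \<and> j = i then 1 else 0)" by (intro eq_matI) auto
  have N: "?N = mat l l (\<lambda>(i, j). if n \<le> i \<and> j = i - q then 1 else 0)"
    using n by (intro eq_matI) auto
  have QG: "?Q * ?G ^\<^sub>m r = mat l n (\<lambda>(i, j). if i < n \<and> j = i + r then 1 else 0)" for r
    unfolding P by (subst Q, subst indicator_mat_mult[where P' = "\<lambda>i. i < n"]) (auto intro!: eq_matI)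
  have 1: "?A * ?Q = ?Q * ?G"
  proof -
    have "?A * ?Q = mat l n (\<lambda>(i, j). if i < n \<and> j = i + 1 then 1 else 0)"
      unfolding A1 using n by (subst indicator_mat_mult[where P' = "\<lambda>i. i + 1 < l"]) (auto intro!: eq_matI)
    moreover have "?G = ?G ^\<^sub>m 1" by (simp add: pow_mat.simps(2)[of _ 0, unfolded One_nat_def[symmetric]])
    ultimately show ?thesis using QG[of 1] by simp
  qed
  have 2: "?R * ?Q = 1\<^sub>m n"
    using n by (subst R, subst indicator_mat_mult[where P' = "\<lambda>i. i < n"]) (auto intro!: eq_matI)
  have 3: "?A ^\<^sub>m e = ?Q * ?G ^\<^sub>m q * ?M"
    unfolding QG unfolding P by (subst indicator_mat_mult[where P' = "\<lambda>i. i + e < l"])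
      (use assms in \<open>auto simp: n_def intro!: eq_matI\<close>)
  have 4: "?Q * ?G ^\<^sub>m q = ?A ^\<^sub>m e * ?M'"
    unfolding QG unfolding P by (subst indicator_mat_mult[where P' = "\<lambda>i. i + e < l"])
      (use assms in \<open>auto simp: n_def intro!: eq_matI\<close>)
  have QR: "?Q * ?R = mat l l (\<lambda>(i, j). if i < n then (if i = j then 1 else 0) else 0)"
    by (subst Q, subst indicator_mat_mult[where P' = "\<lambda>i. i < n"]) (auto intro!: eq_matI)
  have NP: "?N * ?A ^\<^sub>m r = mat l l (\<lambda>(i, j). if n \<le> i then (if i - q + r < l \<and> j = i - q + r then 1 else 0) else 0)" for r
    unfolding P by (subst N, subst indicator_mat_mult[where P' = "\<lambda>i. n \<le> i"]) (auto intro!: eq_matI)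
  have 5: "?Q * ?R + ?N * ?A ^\<^sub>m q = 1\<^sub>m l"
    unfolding QR NP using n by (intro eq_matI) auto
  have 6: "?N * ?A ^\<^sub>m e = 0\<^sub>m l l"
    unfolding NP using assms by (intro eq_matI) (auto simp: n_def)
  show ?thesis unfolding truncation_def n_def[symmetric]
    by (rule exI[of _ l], rule exI[of _ n], rule exI[of _ ?R], rule exI[of _ ?M],
        rule exI[of _ ?M'], rule exI[of _ ?N])
      (use 1 2 3 4 5 6 in \<open>simp only: jordan_block_carrier mat_carrier simp_thms\<close>)
qed

lemma mult_four_block_diag:
  fixes A1 :: "'a :: comm_ring_1 mat"
  assumes "A1 \<in> carrier_mat r1 n1" "A2 \<in> carrier_mat r2 n2" "B1 \<in> carrier_mat n1 c1" "B2 \<in> carrier_mat n2 c2"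
  shows "four_block_mat A1 (0\<^sub>m r1 n2) (0\<^sub>m r2 n1) A2 * four_block_mat B1 (0\<^sub>m n1 c2) (0\<^sub>m n2 c1) B2 =
    four_block_mat (A1 * B1) (0\<^sub>m r1 c2) (0\<^sub>m r2 c1) (A2 * B2)"
  using assms by (subst mult_four_block_mat[of _ r1 n1 _ n2 _ r2 _ _ c1 _ c2]) auto

text \<open>The identities involve only sums and products of matrices, so they hold blockwise for
  direct sums.\<close>

lemma truncation_four_block_diag:
  assumes t1: "truncation q e A1 G1 Q1" and t2: "truncation q e A2 G2 Q2"
  shows "truncation q e (four_block_mat A1 (0\<^sub>m (dim_row A1) (dim_col A2)) (0\<^sub>m (dim_row A2) (dim_col A1)) A2)
    (four_block_mat G1 (0\<^sub>m (dim_row G1) (dim_col G2)) (0\<^sub>m (dim_row G2) (dim_col G1)) G2)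
    (four_block_mat Q1 (0\<^sub>m (dim_row Q1) (dim_col Q2)) (0\<^sub>m (dim_row Q2) (dim_col Q1)) Q2)"
proof -
  from t1 obtain a1 g1 R1 M1 M1' N1 where
    c1: "A1 \<in> carrier_mat a1 a1" "G1 \<in> carrier_mat g1 g1" "Q1 \<in> carrier_mat a1 g1" "R1 \<in> carrier_mat g1 a1"
     "M1 \<in> carrier_mat g1 a1" "M1' \<in> carrier_mat a1 g1" "N1 \<in> carrier_mat a1 a1" and
    e1: "A1 * Q1 = Q1 * G1" "R1 * Q1 = 1\<^sub>m g1" "A1 ^\<^sub>m e = Q1 * G1 ^\<^sub>m q * M1" "Q1 * G1 ^\<^sub>m q = A1 ^\<^sub>m e * M1'"
     "Q1 * R1 + N1 * A1 ^\<^sub>m q = 1\<^sub>m a1" "N1 * A1 ^\<^sub>m e = 0\<^sub>m a1 a1"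
    unfolding truncation_def by blast
  from t2 obtain a2 g2 R2 M2 M2' N2 where
    c2: "A2 \<in> carrier_mat a2 a2" "G2 \<in> carrier_mat g2 g2" "Q2 \<in> carrier_mat a2 g2" "R2 \<in> carrier_mat g2 a2"
     "M2 \<in> carrier_mat g2 a2" "M2' \<in> carrier_mat a2 g2" "N2 \<in> carrier_mat a2 a2" and
    e2: "A2 * Q2 = Q2 * G2" "R2 * Q2 = 1\<^sub>m g2" "A2 ^\<^sub>m e = Q2 * G2 ^\<^sub>m q * M2" "Q2 * G2 ^\<^sub>m q = A2 ^\<^sub>m e * M2'"
     "Q2 * R2 + N2 * A2 ^\<^sub>m q = 1\<^sub>m a2" "N2 * A2 ^\<^sub>m e = 0\<^sub>m a2 a2"
    unfolding truncation_def by blast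
  let ?fb = "\<lambda>r1 r2 s1 s2 X Y. four_block_mat X (0\<^sub>m r1 s2) (0\<^sub>m r2 s1) Y :: 'a mat"
  note pw = pow_carrier_mat[OF c1(1)] pow_carrier_mat[OF c2(1)] pow_carrier_mat[OF c1(2)] pow_carrier_mat[OF c2(2)]
  have QGc: "Q1 * G1 ^\<^sub>m q \<in> carrier_mat a1 g1" "Q2 * G2 ^\<^sub>m q \<in> carrier_mat a2 g2"
    using c1 c2 pw by auto
  note mm = mult_four_block_diag
  have fc: "?fb r1 r2 s1 s2 X Y \<in> carrier_mat (r1 + r2) (s1 + s2)"
    if "X \<in> carrier_mat r1 s1" "Y \<in> carrier_mat r2 s2" for r1 r2 s1 s2 X Y using that by auto
  have d: "dim_row A1 = a1" "dim_col A1 = a1" "dim_row A2 = a2" "dim_col A2 = a2"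
    "dim_row G1 = g1" "dim_col G1 = g1" "dim_row G2 = g2" "dim_col G2 = g2"
    "dim_row Q1 = a1" "dim_col Q1 = g1" "dim_row Q2 = a2" "dim_col Q2 = g2" using c1 c2 by auto
  note pf = pow_four_block_mat[OF c1(1) c2(1)] pow_four_block_mat[OF c1(2) c2(2)]
  have E1: "?fb a1 a2 a1 a2 A1 A2 * ?fb a1 a2 g1 g2 Q1 Q2 = ?fb a1 a2 g1 g2 Q1 Q2 * ?fb g1 g2 g1 g2 G1 G2"
    by (simp only: mm[OF c1(1) c2(1) c1(3) c2(3)] mm[OF c1(3) c2(3) c1(2) c2(2)] e1(1) e2(1))
  have E2: "?fb g1 g2 a1 a2 R1 R2 * ?fb a1 a2 g1 g2 Q1 Q2 = 1\<^sub>m (g1 + g2)"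
    by (simp only: mm[OF c1(4) c2(4) c1(3) c2(3)] e1(2) e2(2) four_block_one_mat)
  have E3: "?fb a1 a2 a1 a2 A1 A2 ^\<^sub>m e =
      ?fb a1 a2 g1 g2 Q1 Q2 * ?fb g1 g2 g1 g2 G1 G2 ^\<^sub>m q * ?fb g1 g2 a1 a2 M1 M2"
    unfolding pf mm[OF c1(3) c2(3) pw(3,4)] mm[OF QGc c1(5) c2(5)] e1(3) e2(3) ..
  have E4: "?fb a1 a2 g1 g2 Q1 Q2 * ?fb g1 g2 g1 g2 G1 G2 ^\<^sub>m q =
      ?fb a1 a2 a1 a2 A1 A2 ^\<^sub>m e * ?fb a1 a2 g1 g2 M1' M2'"
    unfolding pf mm[OF c1(3) c2(3) pw(3,4)] mm[OF pw(1,2) c1(6) c2(6)] e1(4) e2(4) ..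
  have E5: "?fb a1 a2 g1 g2 Q1 Q2 * ?fb g1 g2 a1 a2 R1 R2 + ?fb a1 a2 a1 a2 N1 N2 * ?fb a1 a2 a1 a2 A1 A2 ^\<^sub>m q
      = 1\<^sub>m (a1 + a2)"
  proof -
    have "Q1 * R1 \<in> carrier_mat a1 a1" "Q2 * R2 \<in> carrier_mat a2 a2"
      "N1 * A1 ^\<^sub>m q \<in> carrier_mat a1 a1" "N2 * A2 ^\<^sub>m q \<in> carrier_mat a2 a2" using c1 c2 pw by auto
    then show ?thesis
      unfolding pf mm[OF c1(3) c2(3) c1(4) c2(4)] mm[OF c1(7) c2(7) pw(1,2)]
      by (subst add_four_block_mat[of _ a1 a1 _ a2 _ a2]) (auto simp: e1(5) e2(5))
  qed
  have E6: "?fb a1 a2 a1 a2 N1 N2 * ?fb a1 a2 a1 a2 A1 A2 ^\<^sub>m e = 0\<^sub>m (a1 + a2) (a1 + a2)"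
    unfolding pf mm[OF c1(7) c2(7) pw(1,2)] e1(6) e2(6) by (rule four_block_zero_mat)
  show ?thesis
    unfolding truncation_def d
    by (rule exI[of _ "a1 + a2"], rule exI[of _ "g1 + g2"], rule exI[of _ "?fb g1 g2 a1 a2 R1 R2"],
        rule exI[of _ "?fb g1 g2 a1 a2 M1 M2"], rule exI[of _ "?fb a1 a2 g1 g2 M1' M2'"],
        rule exI[of _ "?fb a1 a2 a1 a2 N1 N2"], intro conjI fc c1 c2; fact)
qed

lemma truncation_nilpotent_jordan_matrix:
  assumes "q \<le> e" "\<And>l. l \<in> set ls \<Longrightarrow> q \<le> l"
  obtains Q where "truncation q e (nilpotent_jordan_matrix ls :: 'a :: field mat)
     (nilpotent_jordan_matrix (map (\<lambda>l. q + (l - e)) ls)) Q"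
proof -
  have "\<exists>Q. truncation q e (nilpotent_jordan_matrix ls :: 'a :: field mat)
     (nilpotent_jordan_matrix (map (\<lambda>l. q + (l - e)) ls)) Q"
    using assms(2)
  proof (induction ls)
    case Nil
    have z: "nilpotent_jordan_matrix [] = (0\<^sub>m 0 0 :: 'a mat)" by (auto simp: jordan_matrix_def)
    have "truncation q e (0\<^sub>m 0 0) (0\<^sub>m 0 0) (0\<^sub>m 0 0 :: 'a mat)"
      unfolding truncation_def
      by (rule exI[of _ 0], rule exI[of _ 0], (rule exI[of _ "0\<^sub>m 0 0"])+) (auto intro!: eq_matI)
    then show ?case using z by auto
  next
    case (Cons l ls)
    then obtain Q where Q: "truncation q e (nilpotent_jordan_matrix ls :: 'a mat)
       (nilpotent_jordan_matrix (map (\<lambda>l. q + (l - e)) ls)) Q" by auto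
    have "q \<le> l" using Cons by simp
    from truncation_four_block_diag[OF truncation_jordan_block[OF assms(1) this] Q]
    obtain Q' where "truncation q e (nilpotent_jordan_matrix (l # ls) :: 'a mat)
       (nilpotent_jordan_matrix ((q + (l - e)) # map (\<lambda>l. q + (l - e)) ls)) Q'"
      unfolding nilpotent_jordan_matrix_Cons by (simp add: o_def)
    then show ?case unfolding list.map by blast
  qed
  then show thesis using that by blast
qed

lemma truncation_similar:
  assumes t: "truncation q e A G Q" and A: "similar_mat_wit A' A P P'" and G: "similar_mat_wit G' G S S'"
  shows "truncation q e A' G' (P * Q * S')"
proof -
  from t obtain a g R M M' N where
    c: "A \<in> carrier_mat a a" "G \<in> carrier_mat g g" "Q \<in> carrier_mat a g" "R \<in> carrier_mat g a"
     "M \<in> carrier_mat g a" "M' \<in> carrier_mat a g" "N \<in> carrier_mat a a" and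
    e: "A * Q = Q * G" "R * Q = 1\<^sub>m g" "A ^\<^sub>m e = Q * G ^\<^sub>m q * M" "Q * G ^\<^sub>m q = A ^\<^sub>m e * M'"
     "Q * R + N * A ^\<^sub>m q = 1\<^sub>m a" "N * A ^\<^sub>m e = 0\<^sub>m a a"
    unfolding truncation_def by blast
  note wA = similar_mat_witD2[OF c(1) similar_mat_wit_sym[OF A]]
  note wG = similar_mat_witD2[OF c(2) similar_mat_wit_sym[OF G]]
  have A'e: "A' = P * A * P'" "G' = S * G * S'"
    using similar_mat_witD(3)[OF refl A] similar_mat_witD(3)[OF refl G] .
  note pA = similar_mat_wit_pow_id[OF A] and pG = similar_mat_wit_pow_id[OF G]
  note pc = pow_carrier_mat[OF c(1)] pow_carrier_mat[OF c(2)]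
  have PP: "P' * P = 1\<^sub>m a" "P * P' = 1\<^sub>m a" "S' * S = 1\<^sub>m g" "S * S' = 1\<^sub>m g"
    and Pc: "P \<in> carrier_mat a a" "P' \<in> carrier_mat a a" "S \<in> carrier_mat g g" "S' \<in> carrier_mat g g"
    and c': "A' \<in> carrier_mat a a" "G' \<in> carrier_mat g g"
    using wA(1,2,5-7) wG(1,2,5-7) by (simp_all only: simp_thms)
  have dims: "dim_row A = a" "dim_col A = a" "dim_row G = g" "dim_col G = g" "dim_row Q = a" "dim_col Q = g"
    "dim_row R = g" "dim_col R = a" "dim_row M = g" "dim_col M = a" "dim_row M' = a" "dim_col M' = g"
    "dim_row N = a" "dim_col N = a" "dim_row P = a" "dim_col P = a" "dim_row P' = a" "dim_col P' = a"
    "dim_row S = g" "dim_col S = g" "dim_row S' = g" "dim_col S' = g"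
    "dim_row (A ^\<^sub>m r) = a" "dim_col (A ^\<^sub>m r) = a" "dim_row (G ^\<^sub>m r) = g" "dim_col (G ^\<^sub>m r) = g" for r
    using c Pc pc[of r] by (simp_all only: carrier_mat_def mem_Collect_eq simp_thms)
  note as = mult_mat_assoc_dims
  have ext: "X * (Y * Z) = W * Z" if "X * Y = W" "dim_col X = dim_row Y" "dim_col Y = dim_row Z"
    for X Y Z W :: "'a mat" using that by (simp flip: as)
  \<comment> \<open>Products are kept associated to the right, and these rules cancel an inverse
    pair in front of any remaining factor.\<close>
  have cl1: "P' * (P * X) = X" if "dim_row X = a" for X
    by (subst ext[OF PP(1)]) (use that dims(15-18) in \<open>auto intro: left_mult_one_mat[OF carrier_matI]\<close>)
  have cl2: "S' * (S * X) = X" if "dim_row X = g" for X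
    by (subst ext[OF PP(3)]) (use that dims(19-22) in \<open>auto intro: left_mult_one_mat[OF carrier_matI]\<close>)
  note cl = cl1 cl2
  have 1: "A' * (P * Q * S') = P * Q * S' * G'"
  proof -
    have "A * (Q * S') = Q * (G * S')" using ext[OF e(1), of S'] dims by (simp add: as)
    then show ?thesis by (simp add: A'e as dims cl)
  qed
  have 2: "S * R * P' * (P * Q * S') = 1\<^sub>m g"
    using ext[OF e(2), of S'] dims Pc PP by (simp add: as cl)
  have 3: "A' ^\<^sub>m e = P * Q * S' * G' ^\<^sub>m q * (S * M * P')"
    using e(3) dims by (simp add: pA pG as cl)
  have 4: "P * Q * S' * G' ^\<^sub>m q = A' ^\<^sub>m e * (P * M' * S')"
  proof -
    have "Q * (G ^\<^sub>m q * S') = A ^\<^sub>m e * (M' * S')" using ext[OF e(4), of S'] dims by (simp add: as)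
    then show ?thesis by (simp add: pA pG as cl dims)
  qed
  have 5: "P * Q * S' * (S * R * P') + P * N * P' * A' ^\<^sub>m q = 1\<^sub>m a"
  proof -
    have QR: "Q * R \<in> carrier_mat a a" "N * A ^\<^sub>m q \<in> carrier_mat a a" using c pc by auto
    have "P * (Q * R + N * A ^\<^sub>m q) * P' = P * (Q * R) * P' + P * (N * A ^\<^sub>m q) * P'"
      using QR Pc by (simp add: mult_add_distrib_mat[of _ a a] add_mult_distrib_mat[of _ a a])
    then have "P * (Q * R) * P' + P * (N * A ^\<^sub>m q) * P' = 1\<^sub>m a" using e(5) Pc PP by simp
    then show ?thesis by (simp add: pA as cl dims)
  qed
  have 6: "P * N * P' * A' ^\<^sub>m e = 0\<^sub>m a a"
    using ext[OF e(6), of P'] dims Pc by (simp add: pA as cl)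
  have "P * Q * S' \<in> carrier_mat a g" "S * R * P' \<in> carrier_mat g a" "S * M * P' \<in> carrier_mat g a"
    "P * M' * S' \<in> carrier_mat a g" "P * N * P' \<in> carrier_mat a a" using c Pc by auto
  then show ?thesis unfolding truncation_def using 1 2 3 4 5 6 c' by blast
qed

section \<open>Jordan types on quotient spaces\<close>

lemma zero_mat_mult_vec:
  "v \<in> carrier_vec m \<Longrightarrow> 0\<^sub>m n m *\<^sub>v v = (0\<^sub>v n :: 'a :: semiring_0 vec)"
  by (intro eq_vecI) (auto simp: scalar_prod_def)

text \<open>Closure is required only under the complex scalars embedded by \<open>sc\<close>. This
  covers O-lattices, seen as complex vector spaces, as well as subspaces of C^D.\<close>

definition scalar_subspace :: "(complex \<Rightarrow> 'a :: comm_ring_1) \<Rightarrow> nat \<Rightarrow> 'a vec set \<Rightarrow> bool" where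
  "scalar_subspace sc D W \<longleftrightarrow> W \<subseteq> carrier_vec D \<and> 0\<^sub>v D \<in> W \<and> (\<forall>v\<in>W. \<forall>w\<in>W. v + w \<in> W) \<and>
     (\<forall>c. \<forall>v\<in>W. sc c \<cdot>\<^sub>v v \<in> W)"

lemma scalar_subspaceD:
  assumes "scalar_subspace sc D W"
  shows "W \<subseteq> carrier_vec D" "v \<in> W \<Longrightarrow> v \<in> carrier_vec D" "0\<^sub>v D \<in> W"
    "v \<in> W \<Longrightarrow> w \<in> W \<Longrightarrow> v + w \<in> W" "v \<in> W \<Longrightarrow> sc c \<cdot>\<^sub>v v \<in> W"
  using assms unfolding scalar_subspace_def by auto

lemma scalar_subspace_diff:
  assumes W: "scalar_subspace sc D W" and "comm_ring_hom sc" and v: "v \<in> W" and w: "w \<in> W"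
  shows "v - w \<in> W"
proof -
  interpret comm_ring_hom sc by fact
  have "sc (- 1) \<cdot>\<^sub>v w \<in> W" using scalar_subspaceD(5)[OF W w] .
  then have "v + sc (- 1) \<cdot>\<^sub>v w \<in> W" using scalar_subspaceD(4)[OF W v] by blast
  moreover have "v + sc (- 1) \<cdot>\<^sub>v w = v - w"
    using scalar_subspaceD(2)[OF W v] scalar_subspaceD(2)[OF W w] by (intro eq_vecI) (auto simp: hom_uminus)
  ultimately show ?thesis by simp
qed

lemma scalar_subspace_mult_mat_vec:
  assumes W: "scalar_subspace sc D W" and M: "M \<in> carrier_mat D l" and c: "c \<in> carrier_vec l"
    and cols: "\<And>j. j < l \<Longrightarrow> col M j \<in> W"
  shows "M *\<^sub>v map_vec sc c \<in> W"
proof -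
  have "vec D (\<lambda>i. \<Sum>j<n. M $$ (i, j) * sc (c $ j)) \<in> W" if "n \<le> l" for n
    using that
  proof (induction n)
    case 0
    have "vec D (\<lambda>i. 0 :: 'a) = 0\<^sub>v D" by auto
    then show ?case using scalar_subspaceD(3)[OF W] by simp
  next
    case (Suc n)
    have "vec D (\<lambda>i. \<Sum>j<n. M $$ (i, j) * sc (c $ j)) + sc (c $ n) \<cdot>\<^sub>v col M n \<in> W"
      using Suc cols[of n] by (intro scalar_subspaceD(4,5)[OF W]) auto
    also have "vec D (\<lambda>i. \<Sum>j<n. M $$ (i, j) * sc (c $ j)) + sc (c $ n) \<cdot>\<^sub>v col M n =
        vec D (\<lambda>i. \<Sum>j<Suc n. M $$ (i, j) * sc (c $ j))"
      using M Suc by (intro eq_vecI) (auto simp: mult.commute)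
    finally show ?case .
  qed
  from this[of l] have "vec D (\<lambda>i. \<Sum>j<l. M $$ (i, j) * sc (c $ j)) \<in> W" by simp
  also have "vec D (\<lambda>i. \<Sum>j<l. M $$ (i, j) * sc (c $ j)) = M *\<^sub>v map_vec sc c"
  proof (rule eq_vecI)
    fix i assume "i < dim_vec (M *\<^sub>v map_vec sc c)"
    then have "i < D" using M by simp
    then show "vec D (\<lambda>i. \<Sum>j<l. M $$ (i, j) * sc (c $ j)) $ i = (M *\<^sub>v map_vec sc c) $ i"
      using c mult_mat_vec_nth[OF M, of "map_vec sc c" i] by (auto intro!: sum.cong)
  qed (use M in simp)
  finally show ?thesis .
qed

lemma sum_list_le_length_mult:
  fixes xs :: "nat list"
  shows "\<forall>x\<in>set xs. x \<le> e \<Longrightarrow> sum_list xs \<le> length xs * e"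
  by (induction xs) auto

text \<open>Used for the quotient of the zeroth member of a flag by the next one, over Laurent
  series and over the complex numbers, and for the quotient of the largest proper member by the
  image of a power of the operator.\<close>

locale quotient_operator =
  fixes sc :: "complex \<Rightarrow> 'a :: comm_ring_1" and D :: nat and g :: "'a mat" and U W :: "'a vec set"
  assumes hom: "comm_ring_hom sc" and g: "g \<in> carrier_mat D D"
    and U: "scalar_subspace sc D U" and W: "scalar_subspace sc D W" and WU: "W \<subseteq> U"
    and gU: "\<And>u. u \<in> U \<Longrightarrow> g *\<^sub>v u \<in> U" and gW: "\<And>w. w \<in> W \<Longrightarrow> g *\<^sub>v w \<in> W"
begin

interpretation comm_ring_hom sc by (rule hom)

definition matrix_mod :: "'a vec list \<Rightarrow> complex mat \<Rightarrow> bool" where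
  "matrix_mod vs A \<longleftrightarrow> A \<in> carrier_mat (length vs) (length vs) \<and>
     (\<forall>j<length vs. g *\<^sub>v (vs ! j) - mat_of_cols D vs *\<^sub>v map_vec sc (col A j) \<in> W)"

lemma pow_W: "w \<in> W \<Longrightarrow> (g ^\<^sub>m r) *\<^sub>v w \<in> W"
proof (induction r arbitrary: w)
  case 0
  then show ?case using scalar_subspaceD(2)[OF W 0] g by simp
next
  case (Suc r)
  then have "(g ^\<^sub>m Suc r) *\<^sub>v w = (g ^\<^sub>m r) *\<^sub>v (g *\<^sub>v w)"
    using g scalar_subspaceD(2)[OF W Suc.prems] by (simp add: assoc_mult_mat_vec[of _ D D _ D])
  then show ?case using Suc.IH[OF gW[OF Suc.prems]] by simp
qed

lemma quotient_basis_cols: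
  assumes "quotient_basis sc D U W vs" "j < length vs"
  shows "vs ! j \<in> U" "vs ! j \<in> carrier_vec D" "col (mat_of_cols D vs) j = vs ! j"
proof -
  show "vs ! j \<in> U" using assms unfolding quotient_basis_def by auto
  then show "vs ! j \<in> carrier_vec D" by (rule scalar_subspaceD(2)[OF U])
  then show "col (mat_of_cols D vs) j = vs ! j" using assms(2) by simp
qed

lemma quotient_basis_lincomb_in:
  assumes "quotient_basis sc D U W vs" "c \<in> carrier_vec (length vs)"
  shows "mat_of_cols D vs *\<^sub>v map_vec sc c \<in> U"
  using quotient_basis_cols[OF assms(1)] assms(2) 
  by (intro scalar_subspace_mult_mat_vec[OF U, of _ "length vs"]) auto

lemma matrix_mod_exists:
  assumes qb: "quotient_basis sc D U W vs"
  obtains A where "matrix_mod vs A"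
proof -
  have "\<forall>j. \<exists>c. j < length vs \<longrightarrow> c \<in> carrier_vec (length vs) \<and> g *\<^sub>v (vs ! j) - mat_of_cols D vs *\<^sub>v map_vec sc c \<in> W"
    using qb gU[OF quotient_basis_cols(1)[OF qb]] unfolding quotient_basis_def by blast
  then obtain c where c: "\<And>j. j < length vs \<Longrightarrow> c j \<in> carrier_vec (length vs)"
    "\<And>j. j < length vs \<Longrightarrow> g *\<^sub>v (vs ! j) - mat_of_cols D vs *\<^sub>v map_vec sc (c j) \<in> W"
    by metis
  let ?A = "mat_of_cols (length vs) (map c [0..<length vs])"
  have "col ?A j = c j" if "j < length vs" for j using c(1)[OF that] that by simp
  then have "matrix_mod vs ?A" unfolding matrix_mod_def using c by auto
  then show thesis by (rule that)
qed

lemma matrix_mod_pow: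
  assumes qb: "quotient_basis sc D U W vs" and A: "matrix_mod vs A" and c: "c \<in> carrier_vec (length vs)"
  shows "(g ^\<^sub>m r) *\<^sub>v (mat_of_cols D vs *\<^sub>v map_vec sc c) -
    mat_of_cols D vs *\<^sub>v map_vec sc ((A ^\<^sub>m r) *\<^sub>v c) \<in> W"
proof -
  let ?l = "length vs" and ?V = "mat_of_cols D vs"
  have Ac: "A \<in> carrier_mat ?l ?l" using A by (simp add: matrix_mod_def)
  have Vc: "?V \<in> carrier_mat D ?l" by simp
  have V: "?V *\<^sub>v map_vec sc c \<in> carrier_vec D" for c using mult_mat_vec_carrier[OF Vc, of "map_vec sc c"] by (metis Vc carrier_matD(1) carrier_vec_dim_vec dim_mult_mat_vec)
  have one: "g *\<^sub>v (?V *\<^sub>v map_vec sc c) - ?V *\<^sub>v map_vec sc (A *\<^sub>v c) \<in> W"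
    if c: "c \<in> carrier_vec ?l" for c
  proof -
    \<comment> \<open>The columns of the error matrix lie in \<open>W\<close>. As \<open>c\<close>
      has complex entries, their combination stays in \<open>W\<close>, for which only closure under
      complex scalars is assumed.\<close>
    let ?E = "g * ?V - ?V * map_mat sc A"
    have E: "?E \<in> carrier_mat D ?l" using g Ac by auto
    have "?E *\<^sub>v map_vec sc c \<in> W"
    proof (rule scalar_subspace_mult_mat_vec[OF W E c])
      fix j assume j: "j < ?l"
      have "col ?E j = g *\<^sub>v col ?V j - ?V *\<^sub>v map_vec sc (col A j)"
        using g Ac j Vc by (intro eq_vecI) (auto simp: scalar_prod_def)
      then show "col ?E j \<in> W"
        using A j quotient_basis_cols(3)[OF qb j] by (simp add: matrix_mod_def)
    qed
    moreover have "?E *\<^sub>v map_vec sc c = g *\<^sub>v (?V *\<^sub>v map_vec sc c) - ?V *\<^sub>v map_vec sc (A *\<^sub>v c)"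
    proof -
      have "?E *\<^sub>v map_vec sc c = g * ?V *\<^sub>v map_vec sc c - ?V * map_mat sc A *\<^sub>v map_vec sc c"
        using g Ac c by (intro minus_mult_distrib_mat_vec[of _ D ?l]) auto
      moreover have "map_mat sc A *\<^sub>v map_vec sc c = map_vec sc (A *\<^sub>v c)"
        using mult_mat_vec_hom[OF Ac c] by simp
      ultimately show ?thesis
        using g Ac c by (simp add: assoc_mult_mat_vec[of _ D D _ ?l] assoc_mult_mat_vec[of _ D ?l _ ?l])
    qed
    ultimately show ?thesis by simp
  qed
  show ?thesis using c
  proof (induction r arbitrary: c)
    case 0
    have "?V *\<^sub>v map_vec sc c - ?V *\<^sub>v map_vec sc c = 0\<^sub>v D" using V[of c] by simp
    then show ?case using 0 g V[of c] scalar_subspaceD(3)[OF W] Ac by simp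
  next
    case (Suc r)
    let ?x = "g *\<^sub>v (?V *\<^sub>v map_vec sc c) - ?V *\<^sub>v map_vec sc (A *\<^sub>v c)"
    have Acc: "A *\<^sub>v c \<in> carrier_vec ?l" using Ac Suc.prems by simp
    have gr: "g ^\<^sub>m r \<in> carrier_mat D D" using g by simp
    have xW: "?x \<in> W" by (rule one[OF Suc.prems])
    have "(g ^\<^sub>m Suc r) *\<^sub>v (?V *\<^sub>v map_vec sc c) = (g ^\<^sub>m r) *\<^sub>v (g *\<^sub>v (?V *\<^sub>v map_vec sc c))"
      using assoc_mult_mat_vec[OF gr g V[of c]] by simp
    also have "g *\<^sub>v (?V *\<^sub>v map_vec sc c) = ?x + ?V *\<^sub>v map_vec sc (A *\<^sub>v c)"
      using g V[of c] V[of "A *\<^sub>v c"] by (intro eq_vecI) auto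
    also have "(g ^\<^sub>m r) *\<^sub>v \<dots> = (g ^\<^sub>m r) *\<^sub>v ?x + (g ^\<^sub>m r) *\<^sub>v (?V *\<^sub>v map_vec sc (A *\<^sub>v c))"
      using scalar_subspaceD(2)[OF W xW] V by (intro mult_add_distrib_mat_vec[OF gr]) auto
    finally have e1: "(g ^\<^sub>m Suc r) *\<^sub>v (?V *\<^sub>v map_vec sc c) =
      (g ^\<^sub>m r) *\<^sub>v ?x + (g ^\<^sub>m r) *\<^sub>v (?V *\<^sub>v map_vec sc (A *\<^sub>v c))" .
    have e2: "(A ^\<^sub>m Suc r) *\<^sub>v c = (A ^\<^sub>m r) *\<^sub>v (A *\<^sub>v c)"
      using assoc_mult_mat_vec[OF pow_carrier_mat[OF Ac] Ac Suc.prems] by simp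
    have "(g ^\<^sub>m r) *\<^sub>v ?x + ((g ^\<^sub>m r) *\<^sub>v (?V *\<^sub>v map_vec sc (A *\<^sub>v c)) -
       ?V *\<^sub>v map_vec sc ((A ^\<^sub>m r) *\<^sub>v (A *\<^sub>v c))) \<in> W"
      using Suc.IH[OF Acc] pow_W[OF xW] by (rule scalar_subspaceD(4)[OF W, rotated])
    moreover have "x + (y - z) = x + y - z" if "x \<in> carrier_vec D" "y \<in> carrier_vec D" "z \<in> carrier_vec D"
      for x y z :: "'a vec" using that by (intro eq_vecI) auto
    ultimately show ?case
      unfolding e1 e2 using gr scalar_subspaceD(2)[OF W pow_W[OF xW, of r]] V
      by (simp add: mult_mat_vec_carrier[OF gr])
  qed
qed

lemma matrix_mod_pow_eq_zero_iff:
  assumes qb: "quotient_basis sc D U W vs" and A: "matrix_mod vs A"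
  shows "A ^\<^sub>m r = 0\<^sub>m (length vs) (length vs) \<longleftrightarrow> (\<forall>u\<in>U. (g ^\<^sub>m r) *\<^sub>v u \<in> W)"
proof
  let ?l = "length vs" and ?V = "mat_of_cols D vs"
  have Vc: "?V \<in> carrier_mat D ?l" by simp
  have Ac: "A \<in> carrier_mat ?l ?l" using A by (simp add: matrix_mod_def)
  have gr: "g ^\<^sub>m r \<in> carrier_mat D D" using g by simp
  have V0: "?V *\<^sub>v map_vec sc (0\<^sub>v ?l) = 0\<^sub>v D"
  proof -
    have "map_vec sc (0\<^sub>v ?l) = 0\<^sub>v ?l" by (intro eq_vecI) auto
    then show ?thesis by (simp add: mult_mat_vec_def scalar_prod_def zero_vec_def)
  qed
  {
    assume A0: "A ^\<^sub>m r = 0\<^sub>m ?l ?l"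
    show "\<forall>u\<in>U. (g ^\<^sub>m r) *\<^sub>v u \<in> W"
    proof
      fix u assume u: "u \<in> U"
      then obtain c where c: "c \<in> carrier_vec ?l" "u - ?V *\<^sub>v map_vec sc c \<in> W"
        using qb unfolding quotient_basis_def by blast
      have uc: "u \<in> carrier_vec D" "?V *\<^sub>v map_vec sc c \<in> carrier_vec D"
        using scalar_subspaceD(2)[OF U] u quotient_basis_lincomb_in[OF qb c(1)] by auto
      have "u = (u - ?V *\<^sub>v map_vec sc c) + ?V *\<^sub>v map_vec sc c" using uc by (intro eq_vecI) auto
      then have "(g ^\<^sub>m r) *\<^sub>v u = (g ^\<^sub>m r) *\<^sub>v (u - ?V *\<^sub>v map_vec sc c) + (g ^\<^sub>m r) *\<^sub>v (?V *\<^sub>v map_vec sc c)"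
        using mult_add_distrib_mat_vec[OF gr _ uc(2), of "u - ?V *\<^sub>v map_vec sc c"] uc by auto
      moreover have "(g ^\<^sub>m r) *\<^sub>v (?V *\<^sub>v map_vec sc c) \<in> W"
      proof -
        have "0\<^sub>m ?l ?l *\<^sub>v c = 0\<^sub>v ?l" using c(1) by (rule zero_mat_mult_vec)
        then show ?thesis
          using matrix_mod_pow[OF qb A c(1), of r] V0 mult_mat_vec_carrier[OF gr uc(2)] by (simp add: A0)
      qed
      ultimately show "(g ^\<^sub>m r) *\<^sub>v u \<in> W" using pow_W[OF c(2)] scalar_subspaceD(4)[OF W] by simp
    qed
  next
    assume gW': "\<forall>u\<in>U. (g ^\<^sub>m r) *\<^sub>v u \<in> W"
    show "A ^\<^sub>m r = 0\<^sub>m ?l ?l"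
    proof (rule eq_mat_of_mult_vec[OF pow_carrier_mat[OF Ac]])
      fix c :: "complex vec" assume c: "c \<in> carrier_vec ?l"
      let ?c = "(A ^\<^sub>m r) *\<^sub>v c"
      have cc: "?c \<in> carrier_vec ?l" using mult_mat_vec_carrier[OF pow_carrier_mat[OF Ac] c] .
      have VcU: "?V *\<^sub>v map_vec sc c \<in> U" by (rule quotient_basis_lincomb_in[OF qb c])
      have y: "?V *\<^sub>v map_vec sc ?c \<in> carrier_vec D"
        using scalar_subspaceD(2)[OF U quotient_basis_lincomb_in[OF qb cc]] .
      have x: "(g ^\<^sub>m r) *\<^sub>v (?V *\<^sub>v map_vec sc c) \<in> W" using gW' VcU by blast
      have d: "(g ^\<^sub>m r) *\<^sub>v (?V *\<^sub>v map_vec sc c) - ?V *\<^sub>v map_vec sc ?c \<in> W"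
        by (rule matrix_mod_pow[OF qb A c])
      have "0\<^sub>v D - ?V *\<^sub>v map_vec sc ?c =
        ((g ^\<^sub>m r) *\<^sub>v (?V *\<^sub>v map_vec sc c) - ?V *\<^sub>v map_vec sc ?c) - (g ^\<^sub>m r) *\<^sub>v (?V *\<^sub>v map_vec sc c)"
      proof -
        have "0\<^sub>v D - b = a - b - a" if "a \<in> carrier_vec D" "b \<in> carrier_vec D" for a b :: "'a vec"
          using that by (intro eq_vecI) auto
        then show ?thesis using y scalar_subspaceD(2)[OF W x] by blast
      qed
      \<comment> \<open>Both \<open>?c\<close> and the zero vector are coordinate vectors of the
        zero class, so the uniqueness of coordinates identifies them.\<close>
      then have 1: "0\<^sub>v D - ?V *\<^sub>v map_vec sc ?c \<in> W"
        using scalar_subspace_diff[OF W hom d x] by simp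
      have 2: "0\<^sub>v D - ?V *\<^sub>v map_vec sc (0\<^sub>v ?l) \<in> W"
        unfolding V0 using scalar_subspaceD(3)[OF W] by simp
      have "\<exists>!c. c \<in> carrier_vec ?l \<and> 0\<^sub>v D - ?V *\<^sub>v map_vec sc c \<in> W"
        using qb scalar_subspaceD(3)[OF U] unfolding quotient_basis_def by blast
      then have "?c = 0\<^sub>v ?l" using 1 2 cc by (metis zero_carrier_vec)
      then show "?c = 0\<^sub>m ?l ?l *\<^sub>v c" unfolding zero_mat_mult_vec[OF c] .
    qed simp
  }
qed

text \<open>Jordan blocks of a nilpotent operator on a space of dimension \<open>q\<close> have size
  at most \<open>q\<close>, so its \<open>q\<close>-th power vanishes.\<close>

lemma pow_quotient_dim:
  assumes "has_quotient_dim sc D U W q" and nil: "\<And>u. u \<in> U \<Longrightarrow> (g ^\<^sub>m r) *\<^sub>v u \<in> W" and "u \<in> U"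
  shows "(g ^\<^sub>m q) *\<^sub>v u \<in> W"
proof -
  obtain vs where qb: "quotient_basis sc D U W vs" and l: "length vs = q"
    using assms(1) unfolding has_quotient_dim_def by blast
  obtain A where A: "matrix_mod vs A" using matrix_mod_exists[OF qb] .
  have Ac: "A \<in> carrier_mat q q" using A l by (simp add: matrix_mod_def)
  have "A ^\<^sub>m r = 0\<^sub>m q q" using matrix_mod_pow_eq_zero_iff[OF qb A, of r] nil l by simp
  from jordan_nf_nilpotent_exists[OF Ac this] obtain la where
    la: "sum_list la = q" "jordan_nf A (map (\<lambda>l. (l, 0)) la)" by metis
  have "\<forall>x\<in>set la. x \<le> q" using la(1) member_le_sum_list by blast
  then have "A ^\<^sub>m q = 0\<^sub>m q q" using jordan_nf_pow_eq_zero_iff(2)[OF Ac la(2)] by simp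
  then show ?thesis using matrix_mod_pow_eq_zero_iff[OF qb A, of q] assms(3) l by simp
qed

text \<open>The largest part of a partition dominated by the rectangle is at most \<open>e\<close>,
  and the largest part is the nilpotency order. Conversely, parts of size at most \<open>e\<close>
  have partial sums at most \<open>i * e\<close>; once the rectangle is exhausted, its partial sum
  is the total \<open>s * e\<close>, which is the dimension of the quotient.\<close>

lemma jordan_type_le_replicate_iff:
  assumes "has_quotient_dim sc D U W (s * e)"
  shows "jordan_type_le sc D (\<lambda>v. g *\<^sub>v v) U W (replicate s e) \<longleftrightarrow> (\<forall>u\<in>U. (g ^\<^sub>m e) *\<^sub>v u \<in> W)"
proof
  assume "jordan_type_le sc D (\<lambda>v. g *\<^sub>v v) U W (replicate s e)"
  then obtain la vs A where p: "is_partition la" and dom: "dominated la (replicate s e)"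
    and qb: "quotient_basis sc D U W vs" and A: "matrix_mod vs A" and jnf: "jordan_nf A (map (\<lambda>l. (l, 0)) la)"
    unfolding jordan_type_le_def has_jordan_type_def matrix_mod_def by blast
  have Ac: "A \<in> carrier_mat (length vs) (length vs)" using A by (simp add: matrix_mod_def)
  have "\<forall>x\<in>set la. x \<le> e"
  proof (cases la)
    case (Cons x xs)
    have "sum_list (take 1 la) \<le> sum_list (take 1 (replicate s e))" using dom unfolding dominated_def by blast
    then have "x \<le> e" using Cons by (cases s) auto
    then show ?thesis using Cons p unfolding is_partition_def by auto
  qed simp
  then have "A ^\<^sub>m e = 0\<^sub>m (length vs) (length vs)" using jordan_nf_pow_eq_zero_iff(2)[OF Ac jnf] by simp
  then show "\<forall>u\<in>U. (g ^\<^sub>m e) *\<^sub>v u \<in> W" using matrix_mod_pow_eq_zero_iff[OF qb A] by simp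
next
  assume nil: "\<forall>u\<in>U. (g ^\<^sub>m e) *\<^sub>v u \<in> W"
  obtain vs where qb: "quotient_basis sc D U W vs" and l: "length vs = s * e"
    using assms unfolding has_quotient_dim_def by blast
  obtain A where A: "matrix_mod vs A" using matrix_mod_exists[OF qb] .
  have Ac: "A \<in> carrier_mat (length vs) (length vs)" using A by (simp add: matrix_mod_def)
  have A0: "A ^\<^sub>m e = 0\<^sub>m (length vs) (length vs)" using matrix_mod_pow_eq_zero_iff[OF qb A] nil by simp
  from jordan_nf_nilpotent_exists[OF Ac A0] obtain la where
    la: "is_partition la" "sum_list la = s * e" "jordan_nf A (map (\<lambda>l. (l, 0)) la)" using l by metis
  have le: "\<forall>x\<in>set la. x \<le> e" using jordan_nf_pow_eq_zero_iff(2)[OF Ac la(3)] A0 by simp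
  have "sum_list (take i la) \<le> sum_list (take i (replicate s e))" for i
  proof (cases "i \<le> s")
    case True
    have "sum_list (take i la) \<le> length (take i la) * e"
      using le by (intro sum_list_le_length_mult) (blast dest: in_set_takeD)
    also have "\<dots> \<le> i * e" by simp
    finally show ?thesis using True by (simp add: min_def sum_list_replicate)
  next
    case False
    have "sum_list la = sum_list (take i la) + sum_list (drop i la)"
      by (metis append_take_drop_id sum_list_append)
    then show ?thesis using la(2) False by (simp add: sum_list_replicate)
  qed
  then have "dominated la (replicate s e)" using la(2) by (simp add: dominated_def sum_list_replicate)
  then show "jordan_type_le sc D (\<lambda>v. g *\<^sub>v v) U W (replicate s e)"
    unfolding jordan_type_le_def has_jordan_type_def using la qb A unfolding matrix_mod_def by blast
qed

end

section \<open>Lattices and flags\<close>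

lemma mult_mat_smult_vec:
  fixes A :: "'a :: comm_ring_1 mat"
  assumes "A \<in> carrier_mat nr nc" "v \<in> carrier_vec nc"
  shows "A *\<^sub>v (k \<cdot>\<^sub>v v) = k \<cdot>\<^sub>v (A *\<^sub>v v)"
  using assms by (intro eq_vecI) (auto simp: scalar_prod_def sum_distrib_left ac_simps)

text \<open>\<open>integral\<close> stands for membership in O and \<open>ct\<close> for the
  reduction modulo epsilon. The second instance takes the complex numbers with the identity, so that
  flags of lattices and flags of subspaces share their lemmas.\<close>

locale residue_map =
  fixes sc :: "complex \<Rightarrow> 'a :: comm_ring_1" and integral :: "'a \<Rightarrow> bool" and ct :: "'a \<Rightarrow> complex"
  assumes sc_hom: "comm_ring_hom sc"
    and integral_sc: "integral (sc c)" and ct_sc: "ct (sc c) = c"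
    and integral_add: "integral x \<Longrightarrow> integral y \<Longrightarrow> integral (x + y)"
    and integral_mult: "integral x \<Longrightarrow> integral y \<Longrightarrow> integral (x * y)"
    and ct_add: "integral x \<Longrightarrow> integral y \<Longrightarrow> ct (x + y) = ct x + ct y"
    and ct_mult: "integral x \<Longrightarrow> integral y \<Longrightarrow> ct (x * y) = ct x * ct y"
begin

interpretation sc: comm_ring_hom sc by (rule sc_hom)

lemma integral_0: "integral 0" and ct_0: "ct 0 = 0" and integral_1: "integral 1" and ct_1: "ct 1 = 1"
  using integral_sc[of 0] ct_sc[of 0] integral_sc[of 1] ct_sc[of 1] by simp_all

lemma minus_residue:
  assumes "integral x"
  shows "integral (- x)" "ct (- x) = - ct x"
  using integral_mult[OF integral_sc[of "- 1"] assms] ct_mult[OF integral_sc[of "- 1"] assms] ct_sc[of "- 1"]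
  by (simp_all add: sc.hom_uminus)

lemma diff_residue:
  assumes "integral x" "integral y"
  shows "integral (x - y)" "ct (x - y) = ct x - ct y"
  using integral_add[OF assms(1) minus_residue(1)[OF assms(2)]]
    ct_add[OF assms(1) minus_residue(1)[OF assms(2)]] minus_residue(2)[OF assms(2)]
  by simp_all

lemma integral_ct_sum:
  "(\<And>i. i \<in> A \<Longrightarrow> integral (f i)) \<Longrightarrow> integral (sum f A) \<and> ct (sum f A) = (\<Sum>i\<in>A. ct (f i))"
  by (induction A rule: infinite_finite_induct) (auto simp: integral_0 ct_0 integral_add ct_add)

definition integral_vec :: "'a vec \<Rightarrow> bool" where
  "integral_vec v \<longleftrightarrow> (\<forall>i<dim_vec v. integral (v $ i))"

definition integral_mat :: "'a mat \<Rightarrow> bool" where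
  "integral_mat M \<longleftrightarrow> (\<forall>i<dim_row M. \<forall>j<dim_col M. integral (M $$ (i, j)))"

lemma integral_vecD: "integral_vec v \<Longrightarrow> v \<in> carrier_vec n \<Longrightarrow> i < n \<Longrightarrow> integral (v $ i)"
  by (auto simp: integral_vec_def)

lemma integral_matD: "integral_mat M \<Longrightarrow> M \<in> carrier_mat r c \<Longrightarrow> i < r \<Longrightarrow> j < c \<Longrightarrow> integral (M $$ (i, j))"
  by (auto simp: integral_mat_def)

lemma mult_mat_vec_residue:
  assumes M: "integral_mat M" "M \<in> carrier_mat r c" and v: "integral_vec v" "v \<in> carrier_vec c"
  shows "integral_vec (M *\<^sub>v v)" "map_vec ct (M *\<^sub>v v) = map_mat ct M *\<^sub>v map_vec ct v"
proof -
  have *: "integral ((M *\<^sub>v v) $ i) \<and> ct ((M *\<^sub>v v) $ i) = (\<Sum>j<c. ct (M $$ (i, j)) * ct (v $ j))"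
    if i: "i < r" for i
  proof -
    have t: "integral (M $$ (i, j) * v $ j) \<and> ct (M $$ (i, j) * v $ j) = ct (M $$ (i, j)) * ct (v $ j)"
      if "j < c" for j
      using integral_matD[OF M i that] integral_vecD[OF v that] integral_mult ct_mult by simp
    show ?thesis
      unfolding mult_mat_vec_nth[OF M(2) v(2) i]
      using integral_ct_sum[of "{..<c}" "\<lambda>j. M $$ (i, j) * v $ j"] t by simp
  qed
  show "integral_vec (M *\<^sub>v v)" using * M(2) by (auto simp: integral_vec_def)
  show "map_vec ct (M *\<^sub>v v) = map_mat ct M *\<^sub>v map_vec ct v"
  proof (rule eq_vecI)
    fix i assume "i < dim_vec (map_mat ct M *\<^sub>v map_vec ct v)"
    then have i: "i < r" using M(2) by simp
    have "(map_mat ct M *\<^sub>v map_vec ct v) $ i = (\<Sum>j<c. map_mat ct M $$ (i, j) * map_vec ct v $ j)"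
      using M(2) v(2) i by (intro mult_mat_vec_nth) auto
    also have "\<dots> = (\<Sum>j<c. ct (M $$ (i, j)) * ct (v $ j))" using M(2) v(2) i by simp
    finally show "map_vec ct (M *\<^sub>v v) $ i = (map_mat ct M *\<^sub>v map_vec ct v) $ i"
      using *[OF i] i M(2) by simp
  qed (use M in simp)
qed

lemma mult_mat_residue:
  assumes M: "integral_mat M" "M \<in> carrier_mat r n" and N: "integral_mat N" "N \<in> carrier_mat n c"
  shows "integral_mat (M * N)" "map_mat ct (M * N) = map_mat ct M * map_mat ct N"
proof -
  have cN: "integral_vec (col N j)" "col N j \<in> carrier_vec n" if "j < c" for j
    using N that by (auto simp: integral_vec_def integral_mat_def)
  note r = mult_mat_vec_residue[OF M cN]
  show "integral_mat (M * N)"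
    unfolding integral_mat_def
  proof (intro allI impI)
    fix i j assume "i < dim_row (M * N)" "j < dim_col (M * N)"
    then have ij: "i < r" "j < c" using M N by auto
    have "(M * N) $$ (i, j) = (M *\<^sub>v col N j) $ i" using ij M N by simp
    moreover have "integral ((M *\<^sub>v col N j) $ i)"
      using r(1)[OF ij(2) ij(2)] mult_mat_vec_carrier[OF M(2) cN(2)[OF ij(2)]] ij(1) by (rule integral_vecD)
    ultimately show "integral ((M * N) $$ (i, j))" by simp
  qed
  show "map_mat ct (M * N) = map_mat ct M * map_mat ct N"
  proof (rule mat_col_eqI)
    fix j assume "j < dim_col (map_mat ct M * map_mat ct N)"
    then have j: "j < c" using N by simp
    have "col (map_mat ct (M * N)) j = map_vec ct (col (M * N) j)" using M N j by simp
    also have "col (M * N) j = M *\<^sub>v col N j" by (rule col_mult2[OF M(2) N(2) j])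
    also have "map_vec ct \<dots> = map_mat ct M *\<^sub>v map_vec ct (col N j)" by (rule r(2)[OF j j])
    also have "map_vec ct (col N j) = col (map_mat ct N) j" using N j by simp
    also have "map_mat ct M *\<^sub>v \<dots> = col (map_mat ct M * map_mat ct N) j"
      using M N j by (subst col_mult2[of _ r n _ c]) auto
    finally show "col (map_mat ct (M * N)) j = col (map_mat ct M * map_mat ct N) j" .
  qed (use M N in auto)
qed

lemma integral_mat_one: "integral_mat (1\<^sub>m n)" "map_mat ct (1\<^sub>m n) = 1\<^sub>m n"
  by (auto simp: integral_mat_def integral_0 integral_1 ct_0 ct_1 intro!: eq_matI)

lemma integral_mat_sc: "integral_mat (map_mat sc M)" "map_mat ct (map_mat sc M) = M"
  by (auto simp: integral_mat_def integral_sc ct_sc intro!: eq_matI)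

lemma integral_mat_pow:
  assumes M: "integral_mat M" "M \<in> carrier_mat n n"
  shows "integral_mat (M ^\<^sub>m r)" "map_mat ct (M ^\<^sub>m r) = map_mat ct M ^\<^sub>m r"
proof -
  have "integral_mat (M ^\<^sub>m r) \<and> map_mat ct (M ^\<^sub>m r) = map_mat ct M ^\<^sub>m r"
  proof (induction r)
    case 0
    then show ?case using integral_mat_one[of n] M(2) by simp
  next
    case (Suc r)
    then show ?case using mult_mat_residue[of "M ^\<^sub>m r" n n M n] M by simp
  qed
  then show "integral_mat (M ^\<^sub>m r)" "map_mat ct (M ^\<^sub>m r) = map_mat ct M ^\<^sub>m r" by auto
qed

text \<open>Over Laurent series this is the O-span of epsilon e_1, ..., epsilon e_i, e_(i+1), ...,
  e_D; over the complex numbers it is the span of the last \<open>D - i\<close> unit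
  vectors.\<close>

definition std_flag :: "nat \<Rightarrow> nat \<Rightarrow> 'a vec set" where
  "std_flag D i = {v \<in> carrier_vec D. integral_vec v \<and> (\<forall>l<D. l < i \<longrightarrow> ct (v $ l) = 0)}"

definition matrix_flag :: "nat \<Rightarrow> 'a mat \<Rightarrow> nat \<Rightarrow> 'a vec set" where
  "matrix_flag D g i = (\<lambda>v. g *\<^sub>v v) ` std_flag D i"

text \<open>The inverse image of \<open>S\<close> under the reduction of the lattice g O^D modulo
  epsilon, with coordinates given by \<open>g\<close>. Flags between a lattice and its multiple by
  epsilon arise in this way from flags in C^D.\<close>

definition lift :: "nat \<Rightarrow> 'a mat \<Rightarrow> complex vec set \<Rightarrow> 'a vec set" where
  "lift D g S = (\<lambda>v. g *\<^sub>v v) ` {v \<in> carrier_vec D. integral_vec v \<and> map_vec ct v \<in> S}"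

lemma scalar_subspace_std_flag: "scalar_subspace sc D (std_flag D i)"
  unfolding scalar_subspace_def std_flag_def
  by (auto simp: integral_vec_def integral_0 ct_0 integral_add ct_add integral_mult integral_sc ct_mult ct_sc)

lemma matrix_flag_mem_iff:
  assumes "g \<in> GL D" "v \<in> carrier_vec D"
  shows "g *\<^sub>v v \<in> matrix_flag D g i \<longleftrightarrow> v \<in> std_flag D i"
proof
  assume "g *\<^sub>v v \<in> matrix_flag D g i"
  then obtain v' where v': "v' \<in> std_flag D i" "g *\<^sub>v v = g *\<^sub>v v'" by (auto simp: matrix_flag_def)
  then have "v = v'" using GL_mult_vec_cancel[OF assms] by (simp add: std_flag_def)
  then show "v \<in> std_flag D i" using v' by simp
qed (simp add: matrix_flag_def)

lemma scalar_subspace_matrix_flag: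
  assumes g: "g \<in> carrier_mat D D"
  shows "scalar_subspace sc D (matrix_flag D g i)"
proof -
  note S = scalar_subspaceD[OF scalar_subspace_std_flag[of D i]]
  show ?thesis
    unfolding scalar_subspace_def
  proof (intro conjI ballI allI)
    show "matrix_flag D g i \<subseteq> carrier_vec D" using g S(2) by (auto simp: matrix_flag_def)
    have "g *\<^sub>v 0\<^sub>v D = 0\<^sub>v D" using g by (intro eq_vecI) auto
    then show "0\<^sub>v D \<in> matrix_flag D g i" using S(3) unfolding matrix_flag_def by (metis imageI)
  next
    fix v w assume "v \<in> matrix_flag D g i" "w \<in> matrix_flag D g i"
    then obtain v' w' where vw: "v' \<in> std_flag D i" "v = g *\<^sub>v v'" "w' \<in> std_flag D i" "w = g *\<^sub>v w'"
      unfolding matrix_flag_def by blast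
    then have "v + w = g *\<^sub>v (v' + w')" using S(2) g by (simp add: mult_add_distrib_mat_vec[of _ D D])
    then show "v + w \<in> matrix_flag D g i" using S(4) vw unfolding matrix_flag_def by blast
  next
    fix c v assume "v \<in> matrix_flag D g i"
    then obtain v' where v: "v' \<in> std_flag D i" "v = g *\<^sub>v v'" unfolding matrix_flag_def by blast
    then have "sc c \<cdot>\<^sub>v v = g *\<^sub>v (sc c \<cdot>\<^sub>v v')" using mult_mat_smult_vec[OF g S(2)[OF v(1)]] by simp
    then show "sc c \<cdot>\<^sub>v v \<in> matrix_flag D g i" using S(5) v unfolding matrix_flag_def by blast
  qed
qed

lemma matrix_flag_antimono: "i \<le> j \<Longrightarrow> matrix_flag D g j \<subseteq> matrix_flag D g i"
  unfolding matrix_flag_def by (intro image_mono) (auto simp: std_flag_def)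

text \<open>The columns \<open>i\<close>, ..., \<open>j - 1\<close> of \<open>g\<close> represent a
  basis of the quotient, and the coordinates of \<open>g *\<^sub>v v\<close> are the constant terms
  of \<open>v\<close> at these positions.\<close>

lemma matrix_flag_quotient_dim:
  assumes g: "g \<in> GL D" and ij: "i \<le> j" "j \<le> D"
  shows "has_quotient_dim sc D (matrix_flag D g i) (matrix_flag D g j) (j - i)"
proof -
  have gc: "g \<in> carrier_mat D D" by (rule GL_carrier[OF g])
  define vs where "vs = map (col g) [i..<j]"
  \<comment> \<open>Puts the coordinates \<open>c\<close> at the positions \<open>i\<close>, ...,
    \<open>j - 1\<close>, so that \<open>g\<close> maps \<open>w c\<close> to the combination of
    basis vectors with coefficients \<open>c\<close>.\<close>
  define w where "w c = vec D (\<lambda>l. if i \<le> l \<and> l < j then sc (c $ (l - i)) else 0)" for c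
  have len: "length vs = j - i" by (simp add: vs_def)
  have V: "mat_of_cols D vs *\<^sub>v map_vec sc c = g *\<^sub>v w c" if c: "c \<in> carrier_vec (j - i)" for c
  proof (rule eq_vecI)
    fix r assume "r < dim_vec (g *\<^sub>v w c)"
    then have r: "r < D" using gc by simp
    have Vc: "mat_of_cols D vs \<in> carrier_mat D (j - i)" by (simp add: len[symmetric])
    have "(mat_of_cols D vs *\<^sub>v map_vec sc c) $ r = (\<Sum>l<j - i. mat_of_cols D vs $$ (r, l) * map_vec sc c $ l)"
      using c r by (intro mult_mat_vec_nth[OF Vc]) auto
    also have "\<dots> = (\<Sum>l<j - i. g $$ (r, i + l) * sc (c $ l))"
      using c r gc ij by (intro sum.cong) (auto simp: mat_of_cols_def vs_def)
    also have "\<dots> = (\<Sum>l\<in>{i..<j}. g $$ (r, l) * sc (c $ (l - i)))"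
      by (rule sum.reindex_bij_witness[of _ "\<lambda>l. l - i" "\<lambda>l. i + l"]) auto
    also have "\<dots> = (\<Sum>l<D. g $$ (r, l) * w c $ l)"
      using ij by (intro sum.mono_neutral_cong_left) (auto simp: w_def)
    also have "\<dots> = (g *\<^sub>v w c) $ r"
      using r by (intro mult_mat_vec_nth[OF gc, symmetric]) (auto simp: w_def)
    finally show "(mat_of_cols D vs *\<^sub>v map_vec sc c) $ r = (g *\<^sub>v w c) $ r" .
  qed (use gc in simp)
  have wc: "w c \<in> carrier_vec D" for c by (simp add: w_def)
  have "quotient_basis sc D (matrix_flag D g i) (matrix_flag D g j) vs"
    unfolding quotient_basis_def
  proof (intro conjI ballI)
    show "set vs \<subseteq> matrix_flag D g i"
    proof
      fix x assume "x \<in> set vs"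
      then obtain l where l: "i \<le> l" "l < j" "x = col g l" by (auto simp: vs_def)
      then have "x = g *\<^sub>v unit_vec D l" using mult_mat_vec_unit[OF gc] ij by simp
      moreover have "unit_vec D l \<in> std_flag D i"
        using l ij by (auto simp: std_flag_def integral_vec_def integral_0 integral_1 ct_0 index_unit_vec)
      ultimately show "x \<in> matrix_flag D g i" by (auto simp: matrix_flag_def)
    qed
  next
    fix u assume "u \<in> matrix_flag D g i"
    then obtain v where v: "v \<in> std_flag D i" "u = g *\<^sub>v v" by (auto simp: matrix_flag_def)
    have vc: "v \<in> carrier_vec D" "\<And>l. l < D \<Longrightarrow> integral (v $ l)" "\<And>l. l < D \<Longrightarrow> l < i \<Longrightarrow> ct (v $ l) = 0"
      using v(1) by (auto simp: std_flag_def integral_vec_def)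
    have iff: "u - mat_of_cols D vs *\<^sub>v map_vec sc c \<in> matrix_flag D g j \<longleftrightarrow> c = vec (j - i) (\<lambda>l. ct (v $ (i + l)))"
      if c: "c \<in> carrier_vec (j - i)" for c
    proof -
      have "u - mat_of_cols D vs *\<^sub>v map_vec sc c = g *\<^sub>v (v - w c)"
        unfolding V[OF c] v(2) using mult_minus_distrib_mat_vec[OF gc vc(1) wc] by simp
      then have "u - mat_of_cols D vs *\<^sub>v map_vec sc c \<in> matrix_flag D g j \<longleftrightarrow> v - w c \<in> std_flag D j"
        using matrix_flag_mem_iff[OF g] vc(1) wc by simp
      also have "\<dots> \<longleftrightarrow> (\<forall>l<D. l < j \<longrightarrow> ct (v $ l - w c $ l) = 0)"
        using vc wc by (auto simp: std_flag_def integral_vec_def w_def intro!: diff_residue(1) integral_sc integral_0)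
      also have "\<dots> \<longleftrightarrow> (\<forall>l<D. i \<le> l \<and> l < j \<longrightarrow> ct (v $ l) = c $ (l - i))"
      proof -
        have "ct (v $ l - w c $ l) = (if i \<le> l then ct (v $ l) - c $ (l - i) else 0)" if "l < D" "l < j" for l
          using that vc(2)[OF that(1)] vc(3)[OF that(1)]
          by (auto simp: w_def diff_residue(2) integral_sc ct_sc integral_0 ct_0)
        then show ?thesis by auto
      qed
      also have "\<dots> \<longleftrightarrow> (\<forall>l<j - i. ct (v $ (i + l)) = c $ l)"
      proof (intro iffI allI impI)
        fix l assume "\<forall>l<D. i \<le> l \<and> l < j \<longrightarrow> ct (v $ l) = c $ (l - i)" "l < j - i"
        then show "ct (v $ (i + l)) = c $ l" using ij by (auto dest!: spec[of _ "i + l"])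
      next
        fix l assume "\<forall>l<j - i. ct (v $ (i + l)) = c $ l" "l < D" "i \<le> l \<and> l < j"
        then show "ct (v $ l) = c $ (l - i)" by (metis diff_less_mono le_add_diff_inverse)
      qed
      also have "\<dots> \<longleftrightarrow> c = vec (j - i) (\<lambda>l. ct (v $ (i + l)))"
        using c by (auto intro!: eq_vecI)
      finally show ?thesis .
    qed
    show "\<exists>!c. c \<in> carrier_vec (length vs) \<and> u - mat_of_cols D vs *\<^sub>v map_vec sc c \<in> matrix_flag D g j"
      unfolding len
      by (rule ex1I[of _ "vec (j - i) (\<lambda>l. ct (v $ (i + l)))"]) (use iff in auto)
  qed
  then show ?thesis unfolding has_quotient_dim_def using len by blast
qed

end

interpretation cres: residue_map "\<lambda>c. c" "\<lambda>_. True" "\<lambda>c. c"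
  by standard auto

lemma column_flag_eq:
  assumes "i \<le> d"
  shows "column_flag d g i = cres.matrix_flag d g i"
proof -
  have "{v \<in> carrier_vec d. \<forall>j<i. v $ j = 0} = cres.std_flag d i"
    using assms unfolding cres.std_flag_def cres.integral_vec_def by auto
  then show ?thesis using assms by (simp add: column_flag_def cres.matrix_flag_def)
qed

context residue_map
begin

text \<open>Since \<open>u\<close> and its inverse are integral, \<open>g * u\<close> and
  \<open>g\<close> span the same lattice, and the position of the flag between this lattice and its
  multiple by epsilon is seen by the reduction of \<open>u\<close>.\<close>

lemma matrix_flag_mult_eq_lift:
  assumes g: "g \<in> carrier_mat D D" and u: "u \<in> carrier_mat D D" "integral_mat u"
    and u': "u' \<in> carrier_mat D D" "integral_mat u'" "u * u' = 1\<^sub>m D" "u' * u = 1\<^sub>m D" and i: "i \<le> D"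
  shows "matrix_flag D (g * u) i = lift D g (column_flag D (map_mat ct u) i)"
proof -
  have cf: "column_flag D (map_mat ct u) i =
    (\<lambda>v. map_mat ct u *\<^sub>v v) ` {v \<in> carrier_vec D. \<forall>j<i. v $ j = 0}"
    using i by (simp add: column_flag_def)
  have std: "std_flag D i = {v \<in> carrier_vec D. integral_vec v \<and> map_vec ct v \<in> {v \<in> carrier_vec D. \<forall>j<i. v $ j = 0}}"
    using i by (auto simp: std_flag_def)
  show ?thesis
  proof (intro equalityI subsetI)
    fix x assume "x \<in> matrix_flag D (g * u) i"
    then obtain v where v: "v \<in> std_flag D i" "x = g * u *\<^sub>v v" by (auto simp: matrix_flag_def)
    then have vc: "v \<in> carrier_vec D" "integral_vec v" by (auto simp: std_flag_def)
    have "x = g *\<^sub>v (u *\<^sub>v v)" using v(2) vc g u by (simp add: assoc_mult_mat_vec[of _ D D _ D])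
    moreover have "integral_vec (u *\<^sub>v v)" "map_vec ct (u *\<^sub>v v) \<in> column_flag D (map_mat ct u) i"
      using mult_mat_vec_residue[OF u(2,1) vc(2,1)] v(1) unfolding cf std by auto
    moreover have "u *\<^sub>v v \<in> carrier_vec D" using u vc by simp
    ultimately show "x \<in> lift D g (column_flag D (map_mat ct u) i)" unfolding lift_def by blast
  next
    fix x assume "x \<in> lift D g (column_flag D (map_mat ct u) i)"
    then obtain w where w: "w \<in> carrier_vec D" "integral_vec w" "x = g *\<^sub>v w"
      "map_vec ct w \<in> column_flag D (map_mat ct u) i" unfolding lift_def by blast
    from w(4) obtain s where s: "s \<in> carrier_vec D" "\<forall>j<i. s $ j = 0" "map_vec ct w = map_mat ct u *\<^sub>v s"
      unfolding cf by auto
    let ?v = "u' *\<^sub>v w"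
    have v: "?v \<in> carrier_vec D" "integral_vec ?v" using u' w mult_mat_vec_residue(1) by auto
    have "map_vec ct ?v = map_mat ct u' *\<^sub>v (map_mat ct u *\<^sub>v s)"
      using mult_mat_vec_residue(2)[OF u'(2,1) w(2,1)] s by simp
    also have "\<dots> = (map_mat ct u' * map_mat ct u) *\<^sub>v s"
      using u u' s by (simp add: assoc_mult_mat_vec[of _ D D _ D])
    also have "map_mat ct u' * map_mat ct u = 1\<^sub>m D"
      using mult_mat_residue(2)[OF u'(2,1) u(2,1)] u'(4) integral_mat_one(2) by simp
    also have "1\<^sub>m D *\<^sub>v s = s" using s by simp
    finally have "?v \<in> std_flag D i" unfolding std using v s by simp
    moreover have "g * u *\<^sub>v ?v = x"
    proof -
      have "g * u *\<^sub>v ?v = g *\<^sub>v (u *\<^sub>v (u' *\<^sub>v w))"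
        using g u u' w v by (simp add: assoc_mult_mat_vec[of _ D D _ D])
      also have "u *\<^sub>v (u' *\<^sub>v w) = u * u' *\<^sub>v w"
        by (rule assoc_mult_mat_vec[OF u(1) u'(1) w(1), symmetric])
      finally show ?thesis using u' w by simp
    qed
    ultimately show "x \<in> matrix_flag D (g * u) i" unfolding matrix_flag_def by blast
  qed
qed

end

section \<open>Laurent series: products, integrality and constant terms\<close>

lemma fls_nth_X_intpow_mult: "fls_nth (fls_X_intpow i * f) n = fls_nth (f :: complex fls) (n - i)"
  by (simp add: fls_X_intpow_times_conv_shift)

lemma fls_nth_X_mult: "fls_nth (fls_X * f) n = fls_nth (f :: complex fls) (n - 1)"
  by (simp add: fls_X_times_conv_shift)

lemma fls_bounded_below:
  fixes f :: "complex fls"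
  assumes "\<And>i. i < a \<Longrightarrow> fls_nth f i = 0"
  obtains p where "f = fls_X_intpow a * fps_to_fls p"
proof -
  let ?g = "fls_X_intpow (- a) * f"
  have "fls_subdegree ?g \<ge> 0"
    by (rule fls_subdegree_ge0I) (simp only: fls_nth_X_intpow_mult, simp add: assms)
  then have "fps_to_fls (fls_regpart ?g) = ?g" by (rule fls_regpart_to_fls_trivial)
  then have "fls_X_intpow a * fps_to_fls (fls_regpart ?g) = fls_X_intpow a * fls_X_intpow (- a) * f"
    by (simp only: mult.assoc)
  also have "\<dots> = f" unfolding fls_X_intpow_times_fls_X_intpow by simp
  finally show thesis using that[of "fls_regpart ?g"] by simp
qed

text \<open>The range of the convolution depends on the bounds \<open>a\<close> and \<open>b\<close>
  alone and not on the factors. Coefficients of products are therefore given by one polynomial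
  formula wherever the poles are uniformly bounded.\<close>

lemma fls_nth_mult_bounded_below:
  fixes f g :: "complex fls"
  assumes f: "\<And>i. i < a \<Longrightarrow> fls_nth f i = 0" and g: "\<And>i. i < b \<Longrightarrow> fls_nth g i = 0"
  shows "fls_nth (f * g) n = (\<Sum>i=a..n - b. fls_nth f i * fls_nth g (n - i))"
proof -
  obtain p where p: "f = fls_X_intpow a * fps_to_fls p" using fls_bounded_below[OF f] .
  obtain q where q: "g = fls_X_intpow b * fps_to_fls q" using fls_bounded_below[OF g] .
  have "f * g = fls_X_intpow a * (fls_X_intpow b * (fps_to_fls p * fps_to_fls q))"
    unfolding p q by (simp only: ac_simps)
  then have "fls_nth (f * g) n = fls_nth (fps_to_fls (p * q)) (n - a - b)"
    by (simp only: fls_nth_X_intpow_mult fls_times_fps_to_fls)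
  also have "\<dots> = (if n - a - b < 0 then 0 else \<Sum>i\<le>nat (n - a - b). fps_nth p i * fps_nth q (nat (n - a - b) - i))"
    by (simp add: fps_mult_nth atMost_atLeast0)
  also have "\<dots> = (\<Sum>i=a..n - b. fls_nth f i * fls_nth g (n - i))"
  proof (cases "n - a - b < 0")
    case False
    have "(\<Sum>i\<le>nat (n - a - b). fps_nth p i * fps_nth q (nat (n - a - b) - i)) =
      (\<Sum>i=a..n - b. fls_nth f i * fls_nth g (n - i))"
    proof (rule sum.reindex_bij_witness[of _ "\<lambda>i. nat (i - a)" "\<lambda>i. a + int i"])
      fix i assume i: "i \<in> {..nat (n - a - b)}"
      then have "nat (n - (a + int i) - b) = nat (n - a - b) - i" by auto
      then show "fls_nth f (a + int i) * fls_nth g (n - (a + int i)) = fps_nth p i * fps_nth q (nat (n - a - b) - i)"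
        using i False unfolding p q fls_nth_X_intpow_mult by (simp add: of_nat_diff algebra_simps)
    qed (use False in auto)
    then show ?thesis using False by simp
  qed simp
  finally show ?thesis .
qed

definition fls_is_integral :: "complex fls \<Rightarrow> bool" where
  "fls_is_integral x \<longleftrightarrow> (\<forall>n<0. fls_nth x n = 0)"

lemma fls_is_integral_iff: "fls_is_integral x \<longleftrightarrow> (\<exists>a. x = fps_to_fls a)"
proof
  assume "fls_is_integral x"
  then obtain p where "x = fls_X_intpow 0 * fps_to_fls p"
    using fls_bounded_below[of 0 x] unfolding fls_is_integral_def by blast
  then show "\<exists>a. x = fps_to_fls a" by auto
qed (auto simp: fls_is_integral_def)

lemma comm_ring_hom_fls_const: "comm_ring_hom (fls_const :: complex \<Rightarrow> complex fls)"
  by unfold_locales (simp_all add: fls_plus_const)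

interpretation fres: residue_map fls_const fls_is_integral "\<lambda>x. fls_nth x 0"
proof
  fix x y :: "complex fls" and c d
  show "fls_is_integral (fls_const c)" "fls_nth (fls_const c) 0 = c" by (auto simp: fls_is_integral_def)
  assume "fls_is_integral x" "fls_is_integral y"
  then obtain a b where ab: "x = fps_to_fls a" "y = fps_to_fls b" by (auto simp: fls_is_integral_iff)
  show "fls_is_integral (x + y)" unfolding fls_is_integral_iff ab by (metis fps_to_fls_plus)
  show "fls_is_integral (x * y)" unfolding fls_is_integral_iff ab by (metis fls_times_fps_to_fls)
  show "fls_nth (x + y) 0 = fls_nth x 0 + fls_nth y 0" by simp
  show "fls_nth (x * y) 0 = fls_nth x 0 * fls_nth y 0"
    unfolding ab by (simp flip: fls_times_fps_to_fls)
qed (auto simp: fls_plus_const comm_ring_hom_fls_const intro: comm_ring_hom.axioms)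

lemma fls_is_integral_zero_ct_iff: "fls_is_integral x \<and> fls_nth x 0 = 0 \<longleftrightarrow> (\<exists>a. x = fls_X * fps_to_fls a)"
proof
  assume x: "fls_is_integral x \<and> fls_nth x 0 = 0"
  have "fls_nth x i = 0" if "i < 1" for i
    using x that by (cases "i = 0") (auto simp: fls_is_integral_def)
  then obtain p where "x = fls_X_intpow 1 * fps_to_fls p" using fls_bounded_below[of 1 x] by blast
  moreover have "fls_X_intpow 1 = (fls_X :: complex fls)" by (simp add: fls_X_conv_shift_1)
  ultimately show "\<exists>a. x = fls_X * fps_to_fls a" by auto
next
  assume "\<exists>a. x = fls_X * fps_to_fls a"
  then obtain a where "x = fls_X * fps_to_fls a" by blast
  then show "fls_is_integral x \<and> fls_nth x 0 = 0" by (simp add: fls_is_integral_def fls_nth_X_mult)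
qed

section \<open>Lattices as members of matrix flags\<close>

abbreviation "red_mat \<equiv> map_mat (\<lambda>x :: complex fls. fls_nth x 0)"

lemma ebasis_unit: "l < K \<Longrightarrow> ebasis K (1 + int l) = unit_vec K l"
proof -
  assume l: "l < K"
  have "(1 + int l - 1) div int K = 0" "nat ((1 + int l - 1) mod int K) = l" using l by auto
  then show ?thesis unfolding ebasis_def by (intro eq_vecI) auto
qed

text \<open>Multiplication by it turns the \<open>i\<close>-th member of a flag into the zeroth
  member of another one, so that statements about lattices g O^K cover all members.\<close>

definition eps_diag :: "nat \<Rightarrow> nat \<Rightarrow> complex fls mat" where
  "eps_diag K i = mat K K (\<lambda>(r, l). if r = l then (if l < i then fls_X else 1) else 0)"

lemma eps_diag_carrier: "eps_diag K i \<in> carrier_mat K K"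
  by (simp add: eps_diag_def)

lemma eps_diag_cols:
  "mat_of_cols K (map (\<lambda>j. if j \<le> int i then fls_X \<cdot>\<^sub>v ebasis K j else ebasis K j) [1..int K]) = eps_diag K i"
  (is "mat_of_cols K ?vs = _")
proof (rule eq_matI)
  fix r l assume "r < dim_row (eps_diag K i)" "l < dim_col (eps_diag K i)"
  then have rl: "r < K" "l < K" by (auto simp: eps_diag_def)
  have "[1..int K] ! l = 1 + int l" using rl by (subst nth_upto) auto
  then have "?vs ! l = (if l < i then fls_X \<cdot>\<^sub>v unit_vec K l else unit_vec K l)"
    using rl ebasis_unit[of l K] by (auto simp: nth_map)
  then show "mat_of_cols K ?vs $$ (r, l) = eps_diag K i $$ (r, l)"
    using rl by (simp add: mat_of_cols_def eps_diag_def)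
qed (auto simp: eps_diag_def)

lemma eps_diag_mult_vec:
  assumes "c \<in> carrier_vec K"
  shows "eps_diag K i *\<^sub>v c = vec K (\<lambda>l. (if l < i then fls_X else 1) * c $ l)"
proof (rule eq_vecI)
  fix r assume "r < dim_vec (vec K (\<lambda>l. (if l < i then fls_X else 1) * c $ l))"
  then have r: "r < K" by simp
  have "(eps_diag K i *\<^sub>v c) $ r = (\<Sum>l<K. eps_diag K i $$ (r, l) * c $ l)"
    by (rule mult_mat_vec_nth[OF eps_diag_carrier assms r])
  also have "\<dots> = (\<Sum>l<K. if l = r then (if l < i then fls_X else 1) * c $ l else 0)"
    using r by (intro sum.cong) (auto simp: eps_diag_def)
  also have "\<dots> = (if r < i then fls_X else 1) * c $ r" using r by simp
  finally show "(eps_diag K i *\<^sub>v c) $ r = vec K (\<lambda>l. (if l < i then fls_X else 1) * c $ l) $ r"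
    using r by simp
qed (simp add: eps_diag_def)

lemma eps_diag_GL: "eps_diag K i \<in> GL K"
proof -
  have "det (eps_diag K i) = prod_list (diag_mat (eps_diag K i))"
    by (rule det_lower_triangular[OF _ eps_diag_carrier]) (auto simp: eps_diag_def)
  moreover have "0 \<notin> set (diag_mat (eps_diag K i))" by (auto simp: diag_mat_def eps_diag_def)
  ultimately show ?thesis unfolding GL_iff_det[OF eps_diag_carrier] by (simp add: prod_list_zero_iff)
qed

lemma O_vecs: "{map_vec fps_to_fls c | c :: complex fps vec. c \<in> carrier_vec K} = fres.std_flag K 0"
proof (intro equalityI subsetI)
  fix v assume "v \<in> {map_vec fps_to_fls c | c :: complex fps vec. c \<in> carrier_vec K}"
  then obtain c where c: "v = map_vec fps_to_fls c" "c \<in> carrier_vec K" by blast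
  have "fls_is_integral (fps_to_fls a)" for a by (auto simp: fls_is_integral_iff)
  then show "v \<in> fres.std_flag K 0" unfolding c(1) using c(2)
    by (auto simp: fres.std_flag_def fres.integral_vec_def)
next
  fix v assume v: "v \<in> fres.std_flag K 0"
  then have "\<forall>i. \<exists>a. i < K \<longrightarrow> v $ i = fps_to_fls a"
    by (auto simp: fres.std_flag_def fres.integral_vec_def fls_is_integral_iff)
  then obtain a where a: "\<And>i. i < K \<Longrightarrow> v $ i = fps_to_fls (a i)" by metis
  have "v = map_vec fps_to_fls (vec K a)" using v a by (intro eq_vecI) (auto simp: fres.std_flag_def)
  then show "v \<in> {map_vec fps_to_fls c | c :: complex fps vec. c \<in> carrier_vec K}" by auto
qed

lemma std_flag_eps_diag:
  assumes "i \<le> K"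
  shows "fres.std_flag K i = (\<lambda>v. eps_diag K i *\<^sub>v v) ` fres.std_flag K 0"
proof (intro equalityI subsetI)
  fix v assume v: "v \<in> fres.std_flag K i"
  then have vc: "v \<in> carrier_vec K" "\<And>l. l < K \<Longrightarrow> fls_is_integral (v $ l)"
    "\<And>l. l < K \<Longrightarrow> l < i \<Longrightarrow> fls_nth (v $ l) 0 = 0"
    by (auto simp: fres.std_flag_def fres.integral_vec_def)
  have "\<forall>l. \<exists>y. l < K \<longrightarrow> fls_is_integral y \<and> v $ l = (if l < i then fls_X else 1) * y"
  proof
    fix l
    show "\<exists>y. l < K \<longrightarrow> fls_is_integral y \<and> v $ l = (if l < i then fls_X else 1) * y"
    proof (cases "l < i \<and> l < K")
      case True
      then show ?thesis using vc(2)[of l] vc(3)[of l] fls_is_integral_zero_ct_iff[of "v $ l"] fls_is_integral_iff by auto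
    next
      case False
      then show ?thesis using vc(2)[of l] by (intro exI[of _ "v $ l"]) auto
    qed
  qed
  then obtain y where y: "\<And>l. l < K \<Longrightarrow> fls_is_integral (y l)"
    "\<And>l. l < K \<Longrightarrow> v $ l = (if l < i then fls_X else 1) * y l" by metis
  have "v = eps_diag K i *\<^sub>v vec K y"
    using vc(1) y(2) by (subst eps_diag_mult_vec) (auto intro!: eq_vecI)
  moreover have "vec K y \<in> fres.std_flag K 0"
    using y(1) by (auto simp: fres.std_flag_def fres.integral_vec_def)
  ultimately show "v \<in> (\<lambda>v. eps_diag K i *\<^sub>v v) ` fres.std_flag K 0" by blast
next
  fix v assume "v \<in> (\<lambda>v. eps_diag K i *\<^sub>v v) ` fres.std_flag K 0"
  then obtain c where c: "c \<in> carrier_vec K" "\<And>l. l < K \<Longrightarrow> fls_is_integral (c $ l)" "v = eps_diag K i *\<^sub>v c"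
    by (auto simp: fres.std_flag_def fres.integral_vec_def)
  have "fls_is_integral (fls_X * c $ l) \<and> fls_nth (fls_X * c $ l) 0 = 0" if "l < K" for l
    using c(2)[OF that] fls_is_integral_zero_ct_iff[of "fls_X * c $ l"] by (auto simp: fls_is_integral_iff)
  then show "v \<in> fres.std_flag K i"
    unfolding c(3) eps_diag_mult_vec[OF c(1)] using c(2)
    by (auto simp: fres.std_flag_def fres.integral_vec_def)
qed

lemma full_flag_eq:
  assumes "i \<le> K"
  shows "full_flag K g i = fres.matrix_flag K g i"
proof -
  have len: "length (map (\<lambda>j. if j \<le> int i then fls_X \<cdot>\<^sub>v ebasis K j else ebasis K j) [1..int K]) = K"
    by simp
  have "O_span K (map (\<lambda>j. if j \<le> int i then fls_X \<cdot>\<^sub>v ebasis K j else ebasis K j) [1..int K]) =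
      (\<lambda>v. eps_diag K i *\<^sub>v v) ` {map_vec fps_to_fls c | c :: complex fps vec. c \<in> carrier_vec K}"
    unfolding O_span_def eps_diag_cols len by auto
  then show ?thesis
    using assms by (simp add: full_flag_def fres.matrix_flag_def std_flag_eps_diag[OF assms] O_vecs)
qed

lemma is_lattice_iff: "is_lattice K L \<longleftrightarrow> (\<exists>g\<in>GL K. L = fres.matrix_flag K g 0)"
proof -
  have len: "length (map (ebasis K) [1..int K]) = K" by simp
  have "map (ebasis K) [1..int K] = map (\<lambda>j. if j \<le> int 0 then fls_X \<cdot>\<^sub>v ebasis K j else ebasis K j) [1..int K]"
    by (intro map_cong) auto
  then have "mat_of_cols K (map (ebasis K) [1..int K]) = eps_diag K 0" using eps_diag_cols[of K 0] by (simp only:)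
  then have "O_span K (map (ebasis K) [1..int K]) =
      (\<lambda>v. eps_diag K 0 *\<^sub>v v) ` {map_vec fps_to_fls c | c :: complex fps vec. c \<in> carrier_vec K}"
    unfolding O_span_def len by auto
  then have "O_span K (map (ebasis K) [1..int K]) = fres.std_flag K 0"
    using std_flag_eps_diag[of 0 K] by (simp add: O_vecs)
  then show ?thesis unfolding is_lattice_def fres.matrix_flag_def by auto
qed

lemma matrix_flag_eps_diag:
  assumes "i \<le> K" "g \<in> carrier_mat K K"
  shows "fres.matrix_flag K g i = fres.matrix_flag K (g * eps_diag K i) 0"
proof -
  have "g *\<^sub>v (eps_diag K i *\<^sub>v v) = g * eps_diag K i *\<^sub>v v" if "v \<in> fres.std_flag K 0" for v
    using that assms(2) eps_diag_carrier by (simp add: assoc_mult_mat_vec[of _ K K _ K] fres.std_flag_def)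
  then show ?thesis
    unfolding fres.matrix_flag_def std_flag_eps_diag[OF assms(1)] image_image by (intro image_cong) auto
qed

lemma is_lattice_matrix_flag:
  assumes "g \<in> GL K" "i \<le> K"
  shows "is_lattice K (fres.matrix_flag K g i)"
  unfolding is_lattice_iff matrix_flag_eps_diag[OF assms(2) GL_carrier[OF assms(1)]]
  using GL_mult[OF assms(1) eps_diag_GL] by blast

lemma matrix_flag_eps_times:
  assumes g: "g \<in> carrier_mat K K"
  shows "fres.matrix_flag K g K = eps_times (fres.matrix_flag K g 0)"
proof -
  have "g *\<^sub>v (eps_diag K K *\<^sub>v v) = fls_X \<cdot>\<^sub>v (g *\<^sub>v v)" if "v \<in> fres.std_flag K 0" for v
  proof -
    have v: "v \<in> carrier_vec K" using that by (simp add: fres.std_flag_def)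
    have "eps_diag K K *\<^sub>v v = fls_X \<cdot>\<^sub>v v" using v by (subst eps_diag_mult_vec) (auto intro!: eq_vecI)
    then show ?thesis using mult_mat_smult_vec[OF g v] by simp
  qed
  then show ?thesis
    unfolding fres.matrix_flag_def std_flag_eps_diag[OF order_refl] eps_times_def image_image
    by (intro image_cong) auto
qed

text \<open>Two O-bases of the same lattice differ by an element of GL_K(O), because each has
  integral coordinates in the other.\<close>

lemma matrix_flag_eq_base_change:
  assumes g: "g \<in> carrier_mat K K" and g0: "g0 \<in> GL K" "g0' \<in> carrier_mat K K" "g0' * g0 = 1\<^sub>m K" "g0 * g0' = 1\<^sub>m K"
    and eq: "fres.matrix_flag K g 0 = fres.matrix_flag K g0 0"
  obtains u' where "g0' * g \<in> carrier_mat K K" "fres.integral_mat (g0' * g)" "u' \<in> carrier_mat K K"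
    "fres.integral_mat u'" "g0' * g * u' = 1\<^sub>m K" "u' * (g0' * g) = 1\<^sub>m K" "g = g0 * (g0' * g)"
proof -
  note g0c = GL_carrier[OF g0(1)]
  define u where "u = g0' * g"
  have u: "u \<in> carrier_mat K K" using g0 g by (simp add: u_def)
  have gu: "g = g0 * u"
    using g g0 g0c by (simp add: u_def flip: assoc_mult_mat[of _ K K _ K _ K])
  have e: "unit_vec K j \<in> fres.std_flag K 0" if "j < K" for j
    using that by (auto simp: fres.std_flag_def fres.integral_vec_def fres.integral_0 fres.integral_1 index_unit_vec)
  have "fres.integral_vec (col u j)" if j: "j < K" for j
  proof -
    have "g *\<^sub>v unit_vec K j \<in> fres.matrix_flag K g0 0" using e[OF j] eq unfolding fres.matrix_flag_def by blast
    also have "g *\<^sub>v unit_vec K j = g0 *\<^sub>v (u *\<^sub>v unit_vec K j)"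
      unfolding gu using g0c u by (intro assoc_mult_mat_vec) auto
    finally have "u *\<^sub>v unit_vec K j \<in> fres.std_flag K 0"
      using fres.matrix_flag_mem_iff[OF g0(1)] u by simp
    then show ?thesis using mult_mat_vec_unit[OF u j] by (simp add: fres.std_flag_def)
  qed
  then have ui: "fres.integral_mat u" using u by (auto simp: fres.integral_mat_def fres.integral_vec_def)
  \<comment> \<open>The vectors \<open>w\<close> will be the columns of the inverse of
    \<open>u\<close>; they can be taken integral because the columns of \<open>g0\<close> lie in the
    lattice spanned by \<open>g\<close>.\<close>
  have "\<forall>j. \<exists>w. j < K \<longrightarrow> w \<in> carrier_vec K \<and> fres.integral_vec w \<and> u *\<^sub>v w = unit_vec K j"
  proof (intro allI)
    fix j
    show "\<exists>w. j < K \<longrightarrow> w \<in> carrier_vec K \<and> fres.integral_vec w \<and> u *\<^sub>v w = unit_vec K j"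
    proof (cases "j < K")
      case True
      then have "g0 *\<^sub>v unit_vec K j \<in> fres.matrix_flag K g 0" using e eq unfolding fres.matrix_flag_def by blast
      then obtain w where w: "w \<in> fres.std_flag K 0" "g0 *\<^sub>v unit_vec K j = g *\<^sub>v w"
        unfolding fres.matrix_flag_def by blast
      have wc: "w \<in> carrier_vec K" "fres.integral_vec w" using w(1) by (auto simp: fres.std_flag_def)
      have "g *\<^sub>v w = g0 *\<^sub>v (u *\<^sub>v w)" unfolding gu using g0c u wc by (intro assoc_mult_mat_vec) auto
      with w(2) have "g0 *\<^sub>v unit_vec K j = g0 *\<^sub>v (u *\<^sub>v w)" by (rule trans)
      then have "unit_vec K j = u *\<^sub>v w"
        by (rule GL_mult_vec_cancel[OF g0(1) unit_vec_carrier mult_mat_vec_carrier[OF u wc(1)]])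
      then show ?thesis using wc by auto
    qed simp
  qed
  then obtain w where w: "\<And>j. j < K \<Longrightarrow> w j \<in> carrier_vec K" "\<And>j. j < K \<Longrightarrow> fres.integral_vec (w j)"
    "\<And>j. j < K \<Longrightarrow> u *\<^sub>v w j = unit_vec K j" by metis
  define u' where "u' = mat_of_cols K (map w [0..<K])"
  have u': "u' \<in> carrier_mat K K" by (rule carrier_matI) (simp_all add: u'_def)
  have colu': "col u' j = w j" if "j < K" for j using w(1)[OF that] that by (simp add: u'_def)
  have "u * u' = 1\<^sub>m K"
  proof (rule mat_col_eqI)
    fix j assume "j < dim_col (1\<^sub>m K :: complex fls mat)"
    then have j: "j < K" by simp
    then show "col (u * u') j = col (1\<^sub>m K) j"
      using col_mult2[OF u u' j] colu'[OF j] w(3)[OF j] by simp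
  qed (use u u' in auto)
  moreover then have "u' * u = 1\<^sub>m K" using mat_mult_left_right_inverse[OF u u'] by simp
  moreover have "fres.integral_mat u'"
    unfolding fres.integral_mat_def
  proof (intro allI impI)
    fix i j assume "i < dim_row u'" "j < dim_col u'"
    then have ij: "i < K" "j < K" using u' by auto
    have "u' $$ (i, j) = col u' j $ i" using ij u' by simp
    then show "fls_is_integral (u' $$ (i, j))"
      using colu'[OF ij(2)] fres.integral_vecD[OF w(2)[OF ij(2)] w(1)[OF ij(2)] ij(1)] by simp
  qed
  ultimately show thesis using that[of u'] u ui u' gu unfolding u_def by blast
qed

section \<open>The flags in $C$\<close>

text \<open>For r = s K + l with 0 \<le> l < K, the vector epsilon^s e_(l+1) is e_(r+1) in the
  numbering by all integers. The filtration consists of the series in e_(r+1), e_(r+2), ..., and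
  these lattices are preserved by I^-.\<close>

definition order_filtration :: "nat \<Rightarrow> int \<Rightarrow> complex fls vec set" where
  "order_filtration K r = {v \<in> carrier_vec K. \<forall>l<K. \<forall>s. s * int K + int l < r \<longrightarrow> fls_nth (v $ l) s = 0}"

text \<open>The coefficient of e_(r+1), which is the leading term allowed in
  \<open>order_filtration K r\<close>.\<close>

definition order_coeff :: "nat \<Rightarrow> int \<Rightarrow> complex fls vec \<Rightarrow> complex" where
  "order_coeff K r v = fls_nth (v $ nat (r mod int K)) (r div int K)"

lemma order_filtrationD:
  "v \<in> order_filtration K r \<Longrightarrow> v \<in> carrier_vec K"
  "v \<in> order_filtration K r \<Longrightarrow> l < K \<Longrightarrow> s * int K + int l < r \<Longrightarrow> fls_nth (v $ l) s = 0"
  by (auto simp: order_filtration_def)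

lemma order_filtration_step:
  assumes K: "0 < K" and v: "v \<in> order_filtration K r" and z: "order_coeff K r v = 0"
  shows "v \<in> order_filtration K (r + 1)"
  unfolding order_filtration_def
proof (intro CollectI conjI allI impI)
  show "v \<in> carrier_vec K" by (rule order_filtrationD(1)[OF v])
  fix l s assume l: "l < K" and s: "s * int K + int l < r + 1"
  show "fls_nth (v $ l) s = 0"
  proof (cases "s * int K + int l = r")
    case True
    then have "r div int K = s" "r mod int K = int l" using l by auto
    then show ?thesis using z by (simp add: order_coeff_def)
  next
    case False
    then show ?thesis using s by (intro order_filtrationD(2)[OF v l]) simp
  qed
qed

lemma order_coeff_zero:
  assumes K: "0 < K" and v: "v \<in> order_filtration K r" and "r' < r"
  shows "order_coeff K r' v = 0"
  unfolding order_coeff_def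
  by (rule order_filtrationD(2)[OF v]) (use K assms(3) in \<open>auto simp: nat_less_iff\<close>)

lemma order_filtration_antimono: "r \<le> r' \<Longrightarrow> order_filtration K r' \<subseteq> order_filtration K r"
  unfolding order_filtration_def by auto

lemma std_flag_order_filtration:
  assumes "i \<le> K" "0 < K"
  shows "fres.std_flag K i = order_filtration K (int i)"
proof -
  have "(fls_is_integral x \<and> (l < i \<longrightarrow> fls_nth x 0 = 0)) \<longleftrightarrow> (\<forall>s. s * int K + int l < int i \<longrightarrow> fls_nth x s = 0)"
    if l: "l < K" for x l
  proof -
    have *: "s * int K + int l < int i \<longleftrightarrow> s < 0 \<or> s = 0 \<and> l < i" for s
    proof (cases "s < 0")
      case True
      then have "s * int K \<le> (-1) * int K" by (intro mult_right_mono) auto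
      then show ?thesis using True l by linarith
    next
      case False
      show ?thesis
      proof (cases "s = 0")
        case False
        with \<open>\<not> s < 0\<close> have "1 * int K \<le> s * int K" by (intro mult_right_mono) auto
        then show ?thesis using \<open>\<not> s < 0\<close> False assms by linarith
      qed simp
    qed
    show ?thesis unfolding * fls_is_integral_def by auto
  qed
  moreover have "fres.std_flag K i =
      {v \<in> carrier_vec K. \<forall>l<K. fls_is_integral (v $ l) \<and> (l < i \<longrightarrow> fls_nth (v $ l) 0 = 0)}"
    unfolding fres.std_flag_def fres.integral_vec_def by auto
  ultimately show ?thesis unfolding order_filtration_def by simp
qed

text \<open>One elimination step: multiplication by epsilon^s shifts orders by s K, so for suitable
  \<open>a\<close> the difference loses its term of order \<open>r\<close>.\<close>

lemma order_filtration_diff_smult: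
  assumes K: "0 < K" and v: "v \<in> order_filtration K r" and w: "w \<in> order_filtration K (r - s * int K)"
  shows "v - (fls_const a * fls_X_intpow s) \<cdot>\<^sub>v w \<in> order_filtration K r"
    and "order_coeff K r (v - (fls_const a * fls_X_intpow s) \<cdot>\<^sub>v w) = order_coeff K r v - a * order_coeff K (r - s * int K) w"
proof -
  have vw: "v \<in> carrier_vec K" "w \<in> carrier_vec K" using v w by (auto dest: order_filtrationD(1))
  have n: "fls_nth ((v - (fls_const a * fls_X_intpow s) \<cdot>\<^sub>v w) $ l) t = fls_nth (v $ l) t - a * fls_nth (w $ l) (t - s)"
    if "l < K" for l t
  proof -
    have "(v - (fls_const a * fls_X_intpow s) \<cdot>\<^sub>v w) $ l = v $ l - fls_const a * (fls_X_intpow s * w $ l)"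
      using that vw by (simp add: mult.assoc)
    then show ?thesis by (simp only: fls_minus_nth fls_mult_const_nth fls_nth_X_intpow_mult)
  qed
  show "v - (fls_const a * fls_X_intpow s) \<cdot>\<^sub>v w \<in> order_filtration K r"
    unfolding order_filtration_def
  proof (intro CollectI conjI allI impI)
    fix l t assume l: "l < K" and t: "t * int K + int l < r"
    have "fls_nth (v $ l) t = 0" by (rule order_filtrationD(2)[OF v l t])
    moreover have "fls_nth (w $ l) (t - s) = 0"
      by (rule order_filtrationD(2)[OF w l]) (use t in \<open>simp add: algebra_simps\<close>)
    ultimately show "fls_nth ((v - (fls_const a * fls_X_intpow s) \<cdot>\<^sub>v w) $ l) t = 0" unfolding n[OF l] by simp
  qed (use vw in auto)
  have rs: "r - s * int K = r + (- s) * int K" by simp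
  have "(r + (- s) * int K) div int K = - s + r div int K" by (rule div_mult_self1) (use K in simp)
  moreover have "(r + (- s) * int K) mod int K = r mod int K" by (rule mod_mult_self1)
  ultimately have m: "(r - s * int K) mod int K = r mod int K" "(r - s * int K) div int K = r div int K - s"
    unfolding rs by (simp_all only:)
  have "nat (r mod int K) < K" using K by (simp add: nat_less_iff)
  from n[OF this, of "r div int K"]
  show "order_coeff K r (v - (fls_const a * fls_X_intpow s) \<cdot>\<^sub>v w) = order_coeff K r v - a * order_coeff K (r - s * int K) w"
    unfolding order_coeff_def m .
qed

section \<open>Bounds on the poles of matrix entries\<close>

definition coeffs_above :: "int \<Rightarrow> complex fls \<Rightarrow> bool" where
  "coeffs_above b x \<longleftrightarrow> (\<forall>s<b. fls_nth x s = 0)"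

lemma coeffs_above_mult: "coeffs_above a x \<Longrightarrow> coeffs_above b y \<Longrightarrow> coeffs_above (a + b) (x * y)"
  unfolding coeffs_above_def using fls_nth_mult_bounded_below[of a x b y] by simp

lemma coeffs_above_sum: "(\<And>i. i \<in> A \<Longrightarrow> coeffs_above b (f i)) \<Longrightarrow> coeffs_above b (sum f A)"
  unfolding coeffs_above_def by (simp add: fls_nth_sum)

lemma coeffs_above_mult_mat_vec:
  assumes A: "A \<in> carrier_mat r c" and v: "v \<in> carrier_vec c"
    and "\<And>i j. i < r \<Longrightarrow> j < c \<Longrightarrow> coeffs_above a (A $$ (i, j))" "\<And>j. j < c \<Longrightarrow> coeffs_above b (v $ j)" "i < r"
  shows "coeffs_above (a + b) ((A *\<^sub>v v) $ i)"
  unfolding mult_mat_vec_nth[OF A v assms(5)] using assms by (intro coeffs_above_sum coeffs_above_mult) auto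

lemma mat_coeffs_above:
  obtains M :: int where "0 \<le> M" "\<And>i j. i < dim_row A \<Longrightarrow> j < dim_col A \<Longrightarrow> coeffs_above (- M) (A $$ (i, j))"
proof -
  let ?S = "{fls_subdegree (A $$ (i, j)) | i j. i < dim_row A \<and> j < dim_col A}"
  have fin: "finite ?S" by (rule finite_subset[of _ "(\<lambda>(i, j). fls_subdegree (A $$ (i, j))) ` ({..<dim_row A} \<times> {..<dim_col A})"]) auto
  \<comment> \<open>The sum of the absolute values of all subdegrees is a nonnegative bound for each
    of them.\<close>
  define M where "M = (\<Sum>x\<in>?S. \<bar>x\<bar>)"
  have "0 \<le> M" by (simp add: M_def sum_nonneg)
  moreover have "coeffs_above (- M) (A $$ (i, j))" if "i < dim_row A" "j < dim_col A" for i j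
  proof -
    have "fls_subdegree (A $$ (i, j)) \<in> ?S" using that by blast
    then have "\<bar>fls_subdegree (A $$ (i, j))\<bar> \<le> M" unfolding M_def using fin by (intro member_le_sum) auto
    then show ?thesis unfolding coeffs_above_def by (auto intro!: fls_eq0_below_subdegree)
  qed
  ultimately show thesis using that by blast
qed

lemma order_filtration_coeffs_above:
  assumes "0 < K"
  shows "v \<in> order_filtration K (b * int K) \<longleftrightarrow> v \<in> carrier_vec K \<and> (\<forall>l<K. coeffs_above b (v $ l))"
proof -
  have *: "s * int K + int l < b * int K \<longleftrightarrow> s < b" if "l < K" for s l
  proof
    assume "s < b"
    then have "(s + 1) * int K \<le> b * int K" by (intro mult_right_mono) auto
    then show "s * int K + int l < b * int K" using that by (simp add: algebra_simps)
  next
    assume lt: "s * int K + int l < b * int K"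
    show "s < b"
    proof (rule ccontr)
      assume "\<not> s < b"
      then have "b * int K \<le> s * int K" by (intro mult_right_mono) auto
      then show False using lt by linarith
    qed
  qed
  show ?thesis unfolding order_filtration_def coeffs_above_def using * by auto
qed

section \<open>The group I^- and the lattices Lambda_0 of the flags in C\<close>

lemma iwahori_minusI:
  assumes b: "b \<in> carrier_mat K K" "fres.integral_mat b"
    and low: "\<And>i j. i < j \<Longrightarrow> j < K \<Longrightarrow> fls_nth (b $$ (i, j)) 0 = 0"
    and diag: "\<And>i. i < K \<Longrightarrow> fls_nth (b $$ (i, i)) 0 \<noteq> 0"
  shows "b \<in> iwahori_minus K"
proof -
  let ?h = "map_mat fls_regpart b"
  have h: "?h \<in> carrier_mat K K" using b by simp
  have bh: "b = map_mat fps_to_fls ?h"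
  proof (rule eq_matI)
    fix i j assume "i < dim_row (map_mat fps_to_fls ?h)" "j < dim_col (map_mat fps_to_fls ?h)"
    then have ij: "i < K" "j < K" using b by auto
    have "fls_is_integral (b $$ (i, j))" by (rule fres.integral_matD[OF b(2,1) ij])
    then obtain a where "b $$ (i, j) = fps_to_fls a" by (auto simp: fls_is_integral_iff)
    then show "b $$ (i, j) = map_mat fps_to_fls ?h $$ (i, j)" using ij b by simp
  qed auto
  have hom: "comm_ring_hom (\<lambda>x :: complex fps. fps_nth x 0)" by unfold_locales (auto simp: fps_mult_nth)
  have "fps_nth (det ?h) 0 = det (map_mat (\<lambda>x. fps_nth x 0) ?h)"
    using comm_ring_hom.hom_det[OF hom, of ?h] by simp
  also have "map_mat (\<lambda>x. fps_nth x 0) ?h = red_mat b" using b by (intro eq_matI) auto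
  \<comment> \<open>The reduction is lower triangular with nonzero diagonal. The determinant is
    therefore a unit of O, and the adjugate divided by it is the inverse over O.\<close>
  also have "det (red_mat b) = prod_list (diag_mat (red_mat b))"
    by (rule det_lower_triangular[of K]) (use b low in auto)
  also have "\<dots> \<noteq> 0" using b diag by (auto simp: prod_list_zero_iff diag_mat_def)
  finally have d: "fps_nth (det ?h) 0 \<noteq> 0" .
  have inv: "inverse (det ?h) * det ?h = 1" by (rule inverse_mult_eq_1[OF d])
  note adj = adj_mat[OF h]
  let ?g = "inverse (det ?h) \<cdot>\<^sub>m adj_mat ?h"
  have "?g * ?h = inverse (det ?h) \<cdot>\<^sub>m (adj_mat ?h * ?h)" using adj h by (simp add: mult_smult_assoc_mat)
  also have "\<dots> = (inverse (det ?h) * det ?h) \<cdot>\<^sub>m 1\<^sub>m K" unfolding adj(3) by (intro eq_matI) auto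
  also have "\<dots> = 1\<^sub>m K" unfolding inv by (intro eq_matI) auto
  finally have gh: "?g * ?h = 1\<^sub>m K" .
  have "?h * ?g = inverse (det ?h) \<cdot>\<^sub>m (?h * adj_mat ?h)" using adj h by (simp add: mult_smult_distrib)
  also have "\<dots> = (inverse (det ?h) * det ?h) \<cdot>\<^sub>m 1\<^sub>m K" unfolding adj(2) by (intro eq_matI) auto
  also have "\<dots> = 1\<^sub>m K" unfolding inv by (intro eq_matI) auto
  finally have "?h \<in> GL K" using gh h adj(1) by (intro GL_I[of _ _ ?g]) auto
  moreover have "fps_nth (?h $$ (i, j)) 0 = 0" if "i < j" "j < K" for i j
    using low[OF that] that b by auto
  ultimately show ?thesis unfolding iwahori_minus_def using bh by blast
qed

lemma iwahori_minusE:
  assumes "b \<in> iwahori_minus K"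
  obtains b' where "b \<in> carrier_mat K K" "fres.integral_mat b" "b' \<in> carrier_mat K K" "fres.integral_mat b'"
    "b * b' = 1\<^sub>m K" "b' * b = 1\<^sub>m K" "\<And>i j. i < j \<Longrightarrow> j < K \<Longrightarrow> fls_nth (b $$ (i, j)) 0 = 0"
proof -
  from assms obtain h where h: "b = map_mat fps_to_fls h" "h \<in> GL K"
    "\<And>i j. i < j \<Longrightarrow> j < K \<Longrightarrow> fps_nth (h $$ (i, j)) 0 = 0" unfolding iwahori_minus_def by blast
  obtain h' where h': "h' \<in> carrier_mat K K" "h * h' = 1\<^sub>m K" "h' * h = 1\<^sub>m K" using GL_E[OF h(2)] .
  have hom: "comm_ring_hom (fps_to_fls :: complex fps \<Rightarrow> complex fls)"
    by unfold_locales (auto simp: fls_times_fps_to_fls)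
  note hc = GL_carrier[OF h(2)]
  have int: "fres.integral_mat (map_mat fps_to_fls x)" for x :: "complex fps mat"
    by (auto simp: fres.integral_mat_def fls_is_integral_iff)
  interpret comm_ring_hom "fps_to_fls :: complex fps \<Rightarrow> complex fls" by (rule hom)
  have "map_mat fps_to_fls h * map_mat fps_to_fls h' = map_mat fps_to_fls (h * h')"
    "map_mat fps_to_fls h' * map_mat fps_to_fls h = map_mat fps_to_fls (h' * h)"
    using mat_hom_mult[OF hc h'(1)] mat_hom_mult[OF h'(1) hc] by simp_all
  moreover have "map_mat fps_to_fls (1\<^sub>m K) = (1\<^sub>m K :: complex fls mat)" by (intro eq_matI) auto
  ultimately have "b * map_mat fps_to_fls h' = 1\<^sub>m K" "map_mat fps_to_fls h' * b = 1\<^sub>m K"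
    unfolding h(1) h'(2,3) by simp_all
  moreover have "fls_nth (b $$ (i, j)) 0 = 0" if "i < j" "j < K" for i j
    using h(3)[OF that] that hc unfolding h(1) by auto
  ultimately show thesis using that[of "map_mat fps_to_fls h'"] int hc h'(1) unfolding h(1) by auto
qed

text \<open>Positivity of \<open>w\<close> makes its matrix integral, which puts Lambda_0 inside
  O^K. Normalization makes e_1 a column of that matrix, and the translate of e_1 by \<open>b\<close>
  is a vector of Lambda_0 whose first coordinate has nonzero constant term.\<close>

lemma C_flagsE:
  assumes F: "F \<in> C_flags K" and K: "0 < K"
  obtains g v where "g \<in> carrier_mat K K" "F = full_flag K g" "fres.matrix_flag K g 0 \<subseteq> fres.std_flag K 0"
    "v \<in> fres.matrix_flag K g 0" "fls_nth (v $ 0) 0 \<noteq> 0"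
proof -
  obtain b w c where bc: "b \<in> iwahori_minus K" "c \<in> iwahori_minus K" and w: "positive_perm K w" "normalized_perm K w"
    "affine_perm K w" and F: "F = full_flag K (b * perm_matrix K w * c)"
    using F unfolding C_flags_def by blast
  let ?P = "perm_matrix K w"
  obtain b' where b: "b \<in> carrier_mat K K" "fres.integral_mat b" "b' \<in> carrier_mat K K" "fres.integral_mat b'"
    "b * b' = 1\<^sub>m K" "\<And>i j. i < j \<Longrightarrow> j < K \<Longrightarrow> fls_nth (b $$ (i, j)) 0 = 0"
    using iwahori_minusE[OF bc(1)] by metis
  obtain c' where c: "c \<in> carrier_mat K K" "fres.integral_mat c" "c' \<in> carrier_mat K K" "fres.integral_mat c'"
    "c * c' = 1\<^sub>m K"
    using iwahori_minusE[OF bc(2)] by metis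
  have len: "length (map (\<lambda>i. ebasis K (w i)) [1..int K]) = K" by simp
  have P: "?P \<in> carrier_mat K K" unfolding perm_matrix_def by (rule carrier_matI) (simp_all add: len)
  have Pcol: "col ?P j = ebasis K (w (1 + int j))" if j: "j < K" for j
  proof -
    have "ebasis K x \<in> carrier_vec K" for x by (simp add: ebasis_def)
    moreover have "[1..int K] ! j = 1 + int j" using j by (subst nth_upto) auto
    ultimately show ?thesis unfolding perm_matrix_def using j len by (subst col_mat_of_cols) simp_all
  qed
  have "fls_is_integral (?P $$ (i, j))" if ij: "i < K" "j < K" for i j
  proof -
    have "0 < w (1 + int j)" using w(1) ij unfolding positive_perm_def by auto
    then have "0 \<le> (w (1 + int j) - 1) div int K" using K by (simp add: pos_imp_zdiv_nonneg_iff)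
    moreover have "?P $$ (i, j) = fls_X_intpow ((w (1 + int j) - 1) div int K) * unit_vec K (nat ((w (1 + int j) - 1) mod int K)) $ i"
      using Pcol[OF ij(2)] ij P by (metis col_def ebasis_def index_col carrier_matD index_smult_vec(1) index_unit_vec(3))
    ultimately show ?thesis
      unfolding fls_is_integral_def by (simp only: fls_nth_X_intpow_mult) (auto simp: unit_vec_def ij)
  qed
  then have Pi: "fres.integral_mat ?P" using P by (auto simp: fres.integral_mat_def)
  let ?g = "b * ?P * c"
  have g: "?g \<in> carrier_mat K K" "fres.integral_mat ?g"
    using b c P Pi by (auto intro!: fres.mult_mat_residue(1)[of _ K K _ K])
  have sub: "fres.matrix_flag K ?g 0 \<subseteq> fres.std_flag K 0"
    using g fres.mult_mat_vec_residue(1)[OF g(2,1)]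
    by (auto simp: fres.matrix_flag_def fres.std_flag_def)
  define j where "j = nat (inv_into UNIV w 1 - 1)"
  have j: "j < K" "1 + int j = inv_into UNIV w 1"
    using w(2) unfolding normalized_perm_def j_def by auto
  have "w (1 + int j) = 1" unfolding j(2) using w(3) unfolding affine_perm_def by (simp add: bij_is_surj surj_f_inv_f)
  then have Pj: "?P *\<^sub>v unit_vec K j = unit_vec K 0"
    using Pcol[OF j(1)] mult_mat_vec_unit[OF P j(1)] ebasis_unit[of 0 K] K by simp
  \<comment> \<open>Chosen so that \<open>c\<close> maps it to the unit vector \<open>j\<close>; the
    permutation matrix maps that to e_1, and \<open>b\<close> maps e_1 to its first column.\<close>
  let ?x = "c' *\<^sub>v unit_vec K j"
  have u: "unit_vec K j \<in> carrier_vec K" "fres.integral_vec (unit_vec K j)"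
    by (auto simp: fres.integral_vec_def fres.integral_0 fres.integral_1 unit_vec_def)
  have x: "?x \<in> carrier_vec K" "fres.integral_vec ?x" using c(3) fres.mult_mat_vec_residue(1)[OF c(4,3) u(2,1)] by auto
  have "?g *\<^sub>v ?x = b * ?P *\<^sub>v (c *\<^sub>v ?x)" using b P c(1) x(1) by (intro assoc_mult_mat_vec) auto
  also have "c *\<^sub>v ?x = unit_vec K j" using c u by (simp flip: assoc_mult_mat_vec)
  also have "b * ?P *\<^sub>v unit_vec K j = b *\<^sub>v (?P *\<^sub>v unit_vec K j)" using b P by (intro assoc_mult_mat_vec) auto
  finally have gx: "?g *\<^sub>v ?x = col b 0" using Pj mult_mat_vec_unit[OF b(1) K] by simp
  have "?g *\<^sub>v ?x \<in> fres.matrix_flag K ?g 0"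
    using x unfolding fres.matrix_flag_def fres.std_flag_def by auto
  moreover have "fls_nth ((?g *\<^sub>v ?x) $ 0) 0 \<noteq> 0"
  proof
    assume "fls_nth ((?g *\<^sub>v ?x) $ 0) 0 = 0"
    then have z: "fls_nth (b $$ (0, 0)) 0 = 0" using gx K b(1) by simp
    \<comment> \<open>If the corner entry vanished, the whole first row of the triangular matrix
      \<open>red_mat b\<close> would vanish, contrary to its invertibility.\<close>
    have "red_mat b * red_mat b' = 1\<^sub>m K"
      using fres.mult_mat_residue(2)[OF b(2,1,4,3)] b(5) fres.integral_mat_one(2) by simp
    then have "(\<Sum>l<K. red_mat b $$ (0, l) * red_mat b' $$ (l, 0)) = 1"
      using mult_mat_nth[of "red_mat b" K K "red_mat b'" K 0 0] b K by simp
    moreover have "red_mat b $$ (0, l) = 0" if "l < K" for l using z b(6)[of 0 l] b(1) that K by (cases "l = 0") auto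
    ultimately show False by simp
  qed
  ultimately show thesis using that[OF g(1) F sub] by blast
qed

lemma nonempty_bounded_int_max:
  fixes P :: "int \<Rightarrow> bool"
  assumes "P a" "\<And>r. P r \<Longrightarrow> r < B"
  obtains w where "P w" "\<not> P (w + 1)"
proof -
  have ex: "P (B - int (nat (B - a)))" using assms(1) assms(2)[OF assms(1)] by simp
  define n where "n = (LEAST n. P (B - int n))"
  have n: "P (B - int n)" unfolding n_def by (rule LeastI[of "\<lambda>n. P (B - int n)", OF ex])
  then have "0 < n" using assms(2)[OF n] by simp
  have "\<not> P (B - int n + 1)"
  proof
    assume "P (B - int n + 1)"
    then have "P (B - int (n - 1))" using \<open>0 < n\<close> by (simp add: of_nat_diff algebra_simps)
    then have "n \<le> n - 1" unfolding n_def by (rule Least_le)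
    then show False using \<open>0 < n\<close> by simp
  qed
  then show thesis using that n by blast
qed

text \<open>Column \<open>j\<close> of \<open>g\<close> is modified by later columns and by multiples of $\epsilon$ so that the
  order of its leading term becomes maximal; then no two leading terms are congruent modulo \<open>K\<close>.\<close>

definition column_multipliers :: "nat \<Rightarrow> nat \<Rightarrow> complex fls vec set" where
  "column_multipliers K j = {c \<in> fres.std_flag K j. fls_nth (c $ j) 0 = 1}"

text \<open>The orders are bounded: if \<open>g *\<^sub>v c\<close> were divisible by a high power
  of epsilon, then \<open>c\<close> would be divisible by epsilon, but its coordinate
  \<open>j\<close> has constant term 1.\<close>

lemma column_multiplier_max:
  assumes g: "g \<in> GL K" and j: "j < K"
  obtains w c where "c \<in> column_multipliers K j" "g *\<^sub>v c \<in> order_filtration K w"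
    "order_coeff K w (g *\<^sub>v c) \<noteq> 0"
    "\<And>c'. c' \<in> column_multipliers K j \<Longrightarrow> g *\<^sub>v c' \<notin> order_filtration K (w + 1)"
proof -
  have K: "0 < K" using j by simp
  obtain g' where g': "g' \<in> carrier_mat K K" "g' * g = 1\<^sub>m K" using GL_E[OF g] by metis
  note gc = GL_carrier[OF g]
  obtain M where M: "0 \<le> M" "\<And>i j. i < K \<Longrightarrow> j < K \<Longrightarrow> coeffs_above (- M) (g $$ (i, j))"
    using mat_coeffs_above[of g] gc by auto
  obtain M' where M': "0 \<le> M'" "\<And>i j. i < K \<Longrightarrow> j < K \<Longrightarrow> coeffs_above (- M') (g' $$ (i, j))"
    using mat_coeffs_above[of g'] g' by auto
  define P where "P r = (\<exists>c\<in>column_multipliers K j. g *\<^sub>v c \<in> order_filtration K r)" for r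
  have "unit_vec K j \<in> column_multipliers K j"
    using j by (auto simp: column_multipliers_def fres.std_flag_def fres.integral_vec_def fres.integral_0 fres.integral_1 index_unit_vec)
  moreover have "g *\<^sub>v unit_vec K j \<in> order_filtration K (- M * int K)"
    unfolding order_filtration_coeffs_above[OF K] mult_mat_vec_unit[OF gc j]
    using M j gc by auto
  ultimately have Pa: "P (- M * int K)" unfolding P_def by blast
  have Pb: "r < (M' + 1) * int K" if "P r" for r
  proof (rule ccontr)
    assume "\<not> r < (M' + 1) * int K"
    then obtain c where c: "c \<in> column_multipliers K j" "g *\<^sub>v c \<in> order_filtration K ((M' + 1) * int K)"
      using \<open>P r\<close> order_filtration_antimono[of "(M' + 1) * int K" r K] unfolding P_def by auto
    have cc: "c \<in> carrier_vec K" using c(1) by (simp add: column_multipliers_def fres.std_flag_def)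
    \<comment> \<open>\<open>g'\<close> has poles of order at most \<open>M'\<close>, so vanishing
      to order \<open>M' + 1\<close> leaves one factor of epsilon.\<close>
    have "coeffs_above (- M' + (M' + 1)) ((g' *\<^sub>v (g *\<^sub>v c)) $ j)"
      using c(2) M' j unfolding order_filtration_coeffs_above[OF K]
      by (intro coeffs_above_mult_mat_vec[OF g'(1)]) auto
    moreover have "g' *\<^sub>v (g *\<^sub>v c) = c" using g' gc cc by (simp flip: assoc_mult_mat_vec)
    ultimately have "fls_nth (c $ j) 0 = 0" by (simp add: coeffs_above_def)
    then show False using c(1) by (simp add: column_multipliers_def)
  qed
  obtain w where w: "P w" "\<not> P (w + 1)" using nonempty_bounded_int_max[of P, OF Pa Pb] by blast
  then obtain c where c: "c \<in> column_multipliers K j" "g *\<^sub>v c \<in> order_filtration K w" unfolding P_def by blast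
  have "order_coeff K w (g *\<^sub>v c) \<noteq> 0"
    using order_filtration_step[OF K c(2)] w(2) c(1) unfolding P_def by blast
  then show thesis using that c w(2) unfolding P_def by blast
qed

text \<open>By triangularity, the first coordinate with nonzero residue is at the same place in
  \<open>v\<close> and in \<open>b *\<^sub>v v\<close>.\<close>

lemma std_flag_residue_iff:
  assumes v: "v \<in> carrier_vec K" "fres.integral_vec v" and b: "b \<in> carrier_mat K K" "fres.integral_mat b"
    and low: "\<And>i j. i < j \<Longrightarrow> j < K \<Longrightarrow> fls_nth (b $$ (i, j)) 0 = 0"
    and diag: "\<And>i. i < K \<Longrightarrow> fls_nth (b $$ (i, i)) 0 \<noteq> 0"
  shows "b *\<^sub>v v \<in> fres.std_flag K i \<longleftrightarrow> v \<in> fres.std_flag K i"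
proof -
  have ct: "fls_nth ((b *\<^sub>v v) $ l) 0 = (\<Sum>m<K. fls_nth (b $$ (l, m)) 0 * fls_nth (v $ m) 0)" if l: "l < K" for l
  proof -
    have "fls_nth ((b *\<^sub>v v) $ l) 0 = map_vec (\<lambda>x. fls_nth x 0) (b *\<^sub>v v) $ l" using l b by simp
    also have "\<dots> = (red_mat b *\<^sub>v map_vec (\<lambda>x. fls_nth x 0) v) $ l"
      unfolding fres.mult_mat_vec_residue(2)[OF b(2,1) v(2,1)] ..
    also have "\<dots> = (\<Sum>m<K. red_mat b $$ (l, m) * map_vec (\<lambda>x. fls_nth x 0) v $ m)"
      using b v l by (intro mult_mat_vec_nth[of _ K]) auto
    finally show ?thesis using b v l by simp
  qed
  have ct': "fls_nth ((b *\<^sub>v v) $ l) 0 = fls_nth (b $$ (l, l)) 0 * fls_nth (v $ l) 0"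
    if l: "l < K" and z: "\<And>m. m < l \<Longrightarrow> fls_nth (v $ m) 0 = 0" for l
  proof -
    have "(\<Sum>m<K. fls_nth (b $$ (l, m)) 0 * fls_nth (v $ m) 0) = (\<Sum>m\<in>{l}. fls_nth (b $$ (l, m)) 0 * fls_nth (v $ m) 0)"
    proof (rule sum.mono_neutral_right)
      show "\<forall>m\<in>{..<K} - {l}. fls_nth (b $$ (l, m)) 0 * fls_nth (v $ m) 0 = 0"
      proof
        fix m assume "m \<in> {..<K} - {l}"
        then show "fls_nth (b $$ (l, m)) 0 * fls_nth (v $ m) 0 = 0"
          using low[of l m] z[of m] by (cases "m < l") auto
      qed
    qed (use l in auto)
    then show ?thesis using ct[OF l] by simp
  qed
  have bv: "b *\<^sub>v v \<in> carrier_vec K" "fres.integral_vec (b *\<^sub>v v)"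
    using fres.mult_mat_vec_residue(1)[OF b(2,1) v(2,1)] b(1) v(1) by auto
  show ?thesis
  proof
    assume bs: "b *\<^sub>v v \<in> fres.std_flag K i"
    have "l < i \<longrightarrow> fls_nth (v $ l) 0 = 0" if "l < K" for l
      using that
    proof (induction l rule: less_induct)
      case (less l)
      show ?case
      proof
        assume li: "l < i"
        then have "fls_nth (v $ m) 0 = 0" if "m < l" for m using less that by auto
        then have "fls_nth ((b *\<^sub>v v) $ l) 0 = fls_nth (b $$ (l, l)) 0 * fls_nth (v $ l) 0"
          by (intro ct'[OF less.prems])
        moreover have "fls_nth ((b *\<^sub>v v) $ l) 0 = 0" using bs li less.prems by (simp add: fres.std_flag_def)
        ultimately show "fls_nth (v $ l) 0 = 0" using diag[OF less.prems] by simp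
      qed
    qed
    then show "v \<in> fres.std_flag K i" using v by (simp add: fres.std_flag_def)
  next
    assume vs: "v \<in> fres.std_flag K i"
    have "fls_nth ((b *\<^sub>v v) $ l) 0 = 0" if "l < K" "l < i" for l
      using ct'[OF that(1)] vs that by (simp add: fres.std_flag_def)
    then show "b *\<^sub>v v \<in> fres.std_flag K i" using bv by (simp add: fres.std_flag_def)
  qed
qed

lemma iwahori_minus_preserves_flag:
  assumes g: "g \<in> carrier_mat K K" and b: "b \<in> carrier_mat K K" "fres.integral_mat b"
    and low: "\<And>i j. i < j \<Longrightarrow> j < K \<Longrightarrow> fls_nth (b $$ (i, j)) 0 = 0"
    and diag: "\<And>i. i < K \<Longrightarrow> fls_nth (b $$ (i, i)) 0 \<noteq> 0"
  shows "fres.matrix_flag K (g * b) i = fres.matrix_flag K g i"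
proof -
  have "b \<in> iwahori_minus K" by (rule iwahori_minusI[OF b low diag])
  then obtain b' where b': "b' \<in> carrier_mat K K" "fres.integral_mat b'" "b * b' = 1\<^sub>m K"
    by (rule iwahori_minusE) blast
  have iff: "b *\<^sub>v v \<in> fres.std_flag K i \<longleftrightarrow> v \<in> fres.std_flag K i"
    if "v \<in> carrier_vec K" "fres.integral_vec v" for v
    by (rule std_flag_residue_iff[OF that b low diag])
  have "(\<lambda>v. b *\<^sub>v v) ` fres.std_flag K i = fres.std_flag K i"
  proof (intro equalityI subsetI)
    fix v assume v: "v \<in> fres.std_flag K i"
    then have vc: "v \<in> carrier_vec K" "fres.integral_vec v" by (auto simp: fres.std_flag_def)
    have "b *\<^sub>v (b' *\<^sub>v v) = v" using b b' vc by (simp flip: assoc_mult_mat_vec)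
    moreover have "b' *\<^sub>v v \<in> carrier_vec K" "fres.integral_vec (b' *\<^sub>v v)"
      using b' vc fres.mult_mat_vec_residue(1)[OF b'(2,1) vc(2,1)] by auto
    ultimately have "b' *\<^sub>v v \<in> fres.std_flag K i" using iff[of "b' *\<^sub>v v"] v by simp
    with \<open>b *\<^sub>v (b' *\<^sub>v v) = v\<close> show "v \<in> (\<lambda>v. b *\<^sub>v v) ` fres.std_flag K i" by (metis imageI)
  next
    fix v assume "v \<in> (\<lambda>v. b *\<^sub>v v) ` fres.std_flag K i"
    then obtain x where x: "x \<in> fres.std_flag K i" "v = b *\<^sub>v x" by blast
    then show "v \<in> fres.std_flag K i" using iff[of x] by (simp add: fres.std_flag_def)
  qed
  moreover have "fres.matrix_flag K (g * b) i = (\<lambda>v. g *\<^sub>v v) ` (\<lambda>v. b *\<^sub>v v) ` fres.std_flag K i"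
    unfolding fres.matrix_flag_def image_image
    using g b by (intro image_cong) (auto simp: fres.std_flag_def assoc_mult_mat_vec[of _ K K _ K])
  ultimately show ?thesis unfolding fres.matrix_flag_def by simp
qed


text \<open>The converse of \<open>C_flagsE\<close>, through a Bruhat decomposition
  \<open>b1 * perm_matrix K W = g * b2\<close>. \<open>W\<close> records the maximal leading orders
  of the columns. The inclusion of Lambda_0 in O^K makes them nonnegative, hence \<open>W\<close>
  positive; the vector \<open>v\<close> forces one of them to be 0, hence \<open>W\<close>
  normalized.\<close>

lemma C_flagsI:
  assumes K: "0 < K" and g: "g \<in> GL K" and sub: "fres.matrix_flag K g 0 \<subseteq> fres.std_flag K 0"
    and v: "v \<in> fres.matrix_flag K g 0" "fls_nth (v $ 0) 0 \<noteq> 0"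
  shows "full_flag K g \<in> C_flags K"
proof -
  note gc = GL_carrier[OF g]
  have "\<forall>j. \<exists>w c. j < K \<longrightarrow> c \<in> column_multipliers K j \<and> g *\<^sub>v c \<in> order_filtration K w \<and>
      order_coeff K w (g *\<^sub>v c) \<noteq> 0 \<and> (\<forall>c'\<in>column_multipliers K j. g *\<^sub>v c' \<notin> order_filtration K (w + 1))"
    using column_multiplier_max[OF g] by metis
  then obtain w c where wc: "\<And>j. j < K \<Longrightarrow> c j \<in> column_multipliers K j"
    "\<And>j. j < K \<Longrightarrow> g *\<^sub>v c j \<in> order_filtration K (w j)" "\<And>j. j < K \<Longrightarrow> order_coeff K (w j) (g *\<^sub>v c j) \<noteq> 0"
    "\<And>j c'. j < K \<Longrightarrow> c' \<in> column_multipliers K j \<Longrightarrow> g *\<^sub>v c' \<notin> order_filtration K (w j + 1)"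
    by metis
  have cc: "c j \<in> carrier_vec K" "\<And>l. l < K \<Longrightarrow> fls_is_integral (c j $ l)" "\<And>l. l < j \<Longrightarrow> l < K \<Longrightarrow> fls_nth (c j $ l) 0 = 0"
    "fls_nth (c j $ j) 0 = 1" if "j < K" for j
    using wc(1)[OF that] by (auto simp: column_multipliers_def fres.std_flag_def fres.integral_vec_def)
  \<comment> \<open>If two leading positions were congruent modulo \<open>K\<close>, subtracting a
    multiple of \<open>c j\<close> from \<open>c i\<close> would raise the order of column
    \<open>i\<close>. The condition on \<open>s\<close> says that the multiple comes from a later
    column or carries a positive power of epsilon, so the difference is still a multiplier for
    column \<open>i\<close>.\<close>
  have no: False if ij: "i < K" "j < K" and s: "w i = w j + s * int K" "0 < s \<or> s = 0 \<and> i < j" for i j s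
  proof -
    define a where "a = order_coeff K (w i) (g *\<^sub>v c i) / order_coeff K (w j) (g *\<^sub>v c j)"
    let ?f = "fls_const a * fls_X_intpow s"
    let ?c = "c i - ?f \<cdot>\<^sub>v c j"
    have wj: "w i - s * int K = w j" using s by simp
    have nth: "fls_nth (?c $ l) t = fls_nth (c i $ l) t - a * fls_nth (c j $ l) (t - s)" if "l < K" for l t
    proof -
      have "?c $ l = c i $ l - fls_const a * (fls_X_intpow s * c j $ l)"
        using that cc(1)[OF ij(1)] cc(1)[OF ij(2)] by (simp add: mult.assoc)
      then show ?thesis by (simp only: fls_minus_nth fls_mult_const_nth fls_nth_X_intpow_mult)
    qed
    have "?c \<in> column_multipliers K i"
    proof -
      have neg: "fls_nth (c j $ l) t = 0" if "l < K" "t < 0" for l t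
        using cc(2)[OF ij(2) that(1)] that(2) by (simp add: fls_is_integral_def)
      have jz: "fls_nth (c j $ l) (0 - s) = 0" if "l < K" "l \<le> i" for l
        using s(2) that neg[OF that(1), of "- s"] cc(3)[OF ij(2) _ that(1)] by auto
      have 1: "fls_is_integral (?c $ l)" if "l < K" for l
        unfolding fls_is_integral_def
        using nth[OF that] neg[OF that] cc(2)[OF ij(1) that] s(2) by (auto simp: fls_is_integral_def)
      have 2: "fls_nth (?c $ l) 0 = 0" if "l < K" "l < i" for l
        using nth[OF that(1), of 0] cc(3)[OF ij(1) that(2,1)] jz[OF that(1)] that by simp
      have 3: "fls_nth (?c $ i) 0 = 1"
        using nth[OF ij(1), of 0] cc(4)[OF ij(1)] jz[OF ij(1)] by simp
      have "?c \<in> carrier_vec K" using cc(1)[OF ij(1)] cc(1)[OF ij(2)] by simp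
      moreover have "x \<in> column_multipliers K i"
        if "x \<in> carrier_vec K" "\<And>l. l < K \<Longrightarrow> fls_is_integral (x $ l)"
          "\<And>l. l < K \<Longrightarrow> l < i \<Longrightarrow> fls_nth (x $ l) 0 = 0" "fls_nth (x $ i) 0 = 1" for x
        using that by (auto simp: column_multipliers_def fres.std_flag_def fres.integral_vec_def)
      ultimately show ?thesis using 1 2 3 by blast
    qed
    moreover have "g *\<^sub>v ?c \<in> order_filtration K (w i + 1)"
    proof -
      have eq: "g *\<^sub>v ?c = g *\<^sub>v c i - ?f \<cdot>\<^sub>v (g *\<^sub>v c j)"
        using gc cc(1)[OF ij(1)] cc(1)[OF ij(2)]
        by (simp add: mult_minus_distrib_mat_vec[of _ K K] mult_mat_smult_vec[of _ K K])
      note of = order_filtration_diff_smult[OF K wc(2)[OF ij(1)], of "g *\<^sub>v c j" s a, unfolded wj, OF wc(2)[OF ij(2)]]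
      have "order_coeff K (w i) (g *\<^sub>v ?c) = 0"
        unfolding eq of(2) using wc(3)[OF ij(2)] by (simp add: a_def)
      then show ?thesis using order_filtration_step[OF K] of(1) unfolding eq by blast
    qed
    ultimately show False using wc(4)[OF ij(1)] by blast
  qed
  have inj: "i = j" if ij: "i < K" "j < K" and m: "w i mod int K = w j mod int K" for i j
  proof (rule ccontr)
    assume ne: "i \<noteq> j"
    define s where "s = w i div int K - w j div int K"
    have wi: "w i = w j + s * int K" "w j = w i + (- s) * int K"
    proof -
      have "w i div int K * int K + w i mod int K = w i" "w j div int K * int K + w j mod int K = w j"
        by (rule div_mult_mod_eq)+
      with m show "w i = w j + s * int K" unfolding s_def left_diff_distrib by linarith
      then show "w j = w i + (- s) * int K" by simp
    qed
    consider "s > 0" | "s < 0" | "s = 0" "i < j" | "s = 0" "j < i" using ne by linarith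
    then show False
    proof cases
      case 1 then show False using no[OF ij wi(1)] by simp
    next
      case 2 then show False using no[OF ij(2,1) wi(2)] by simp
    next
      case 3 then show False using no[OF ij wi(1)] by simp
    next
      case 4 then show False using no[OF ij(2,1) wi(2)] by simp
    qed
  qed
  define rho where "rho j = nat (w j mod int K)" for j
  have rho: "rho j < K" "int (rho j) = w j mod int K" for j using K by (auto simp: rho_def nat_less_iff)
  have injr: "inj_on rho {..<K}" by (rule inj_onI) (use inj rho(2) in \<open>metis lessThan_iff\<close>)
  have "rho ` {..<K} = {..<K}" by (rule endo_inj_surj[OF _ _ injr]) (use rho in auto)
  then have bij: "bij_betw rho {..<K} {..<K}" using injr by (simp add: bij_betw_def)
  define rinv where "rinv = inv_into {..<K} rho"
  have rinv: "rinv i < K" "rho (rinv i) = i" if "i < K" for i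
    using that bij unfolding rinv_def bij_betw_def by (metis inv_into_into lessThan_iff, metis f_inv_into_f lessThan_iff)
  have rinv': "rinv (rho j) = j" if "j < K" for j
    unfolding rinv_def using that injr by (simp add: inv_into_f_f)
  \<comment> \<open>The periodic extension of \<open>w\<close>; the summand 1 turns orders, where
    e_1 has order 0, into indices of the e_i.\<close>
  define W where "W i = w (nat ((i - 1) mod int K)) + 1 + ((i - 1) div int K) * int K" for i
  have W_idx: "W (1 + int j) = w j + 1" if "j < K" for j using that by (simp add: W_def)
  have Wshift: "W (i + int K) = W i + int K" for i
  proof -
    have e: "i + int K - 1 = (i - 1) + int K" by simp
    have "(i + int K - 1) mod int K = (i - 1) mod int K" unfolding e by simp
    moreover have "(i + int K - 1) div int K = (i - 1) div int K + 1" unfolding e using K by simp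
    ultimately show ?thesis by (simp add: W_def algebra_simps)
  qed
  have lt: "nat ((i - 1) mod int K) < K" for i using K by (simp add: nat_less_iff)
  have "inj W"
  proof (rule injI)
    fix x y assume eq: "W x = W y"
    let ?x = "nat ((x - 1) mod int K)" and ?y = "nat ((y - 1) mod int K)"
    have "(W x - 1) mod int K = w ?x mod int K" "(W y - 1) mod int K = w ?y mod int K" by (simp_all add: W_def)
    then have xy: "?x = ?y" using inj[OF lt[of x] lt[of y]] eq by simp
    then have m: "(x - 1) mod int K = (y - 1) mod int K" using K by (metis nat_int_comparison(1) eq_nat_nat_iff pos_mod_sign of_nat_0_less_iff)
    have "(x - 1) div int K * int K = (y - 1) div int K * int K" using eq xy by (simp add: W_def)
    then have "x - 1 = y - 1" using m by (metis div_mult_mod_eq)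
    then show "x = y" by simp
  qed
  moreover have "surj W"
  proof (rule surjI)
    fix y :: int
    let ?j = "rinv (nat ((y - 1) mod int K))"
    let ?i = "1 + int ?j + (y - 1 - w ?j) div int K * int K"
    have j: "?j < K" "rho ?j = nat ((y - 1) mod int K)" using rinv[OF lt[of y]] by auto
    have "w ?j mod int K = (y - 1) mod int K" using rho(2)[of ?j] j(2) K by simp
    then have d: "int K dvd y - 1 - w ?j" by (metis mod_eq_dvd_iff)
    have "(?i - 1) mod int K = int ?j" using j(1) by simp
    moreover have "(?i - 1) div int K = (y - 1 - w ?j) div int K" using j(1) K by simp
    ultimately have "W ?i = w ?j + 1 + (y - 1 - w ?j) div int K * int K" by (simp add: W_def)
    then show "W ((\<lambda>y. 1 + int (rinv (nat ((y - 1) mod int K))) +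
       (y - 1 - w (rinv (nat ((y - 1) mod int K)))) div int K * int K) y) = y" using d by simp
  qed
  ultimately have "bij W" by (simp add: bij_def)
  then have aff: "affine_perm K W" using Wshift by (simp add: affine_perm_def)
  have gcj: "g *\<^sub>v c j \<in> order_filtration K 0" if "j < K" for j
  proof -
    have "c j \<in> fres.std_flag K 0" using wc(1)[OF that] by (auto simp: column_multipliers_def fres.std_flag_def)
    then have "g *\<^sub>v c j \<in> fres.matrix_flag K g 0" by (auto simp: fres.matrix_flag_def)
    then show ?thesis using sub std_flag_order_filtration[of 0 K] K by auto
  qed
  have wpos: "0 \<le> w j" if "j < K" for j
    using order_coeff_zero[OF K gcj[OF that], of "w j"] wc(3)[OF that] by (meson not_le)
  have pos: "positive_perm K W"
    unfolding positive_perm_def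
  proof
    fix i assume i: "i \<in> {1..int K}"
    then have "i = 1 + int (nat (i - 1))" "nat (i - 1) < K" by auto
    then show "0 < W i" using W_idx[of "nat (i - 1)"] wpos[of "nat (i - 1)"] by simp
  qed
  \<comment> \<open>Collects the column modifications. Modulo epsilon it is lower triangular with
    ones on the diagonal, so it lies in I^- and leaves the flag unchanged.\<close>
  define b2 where "b2 = mat_of_cols K (map c [0..<K])"
  have b2: "b2 \<in> carrier_mat K K" by (rule carrier_matI) (simp_all add: b2_def)
  have b2col: "col b2 j = c j" if "j < K" for j using cc(1)[OF that] that by (simp add: b2_def)
  have b2e: "b2 $$ (i, j) = c j $ i" if "i < K" "j < K" for i j
    using that b2col[OF that(2)] b2 by (metis carrier_matD index_col)
  have b2i: "fres.integral_mat b2" using b2 cc(2) b2e by (auto simp: fres.integral_mat_def)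
  have b2flag: "fres.matrix_flag K (g * b2) i = fres.matrix_flag K g i" for i
    by (rule iwahori_minus_preserves_flag[OF gc b2 b2i]) (use cc b2e in auto)
  have gb2: "col (g * b2) j = g *\<^sub>v c j" if "j < K" for j using col_mult2[OF gc b2 that] b2col[OF that] by simp
  \<comment> \<open>Otherwise every column of \<open>g * b2\<close> has a first coordinate divisible
    by epsilon, hence so has every vector of Lambda_0, contrary to the choice of
    \<open>v\<close>.\<close>
  have "\<exists>j<K. w j = 0"
  proof (rule ccontr)
    assume "\<not> ?thesis"
    then have w1: "1 \<le> w j" if "j < K" for j using wpos[OF that] that by force
    have c1: "g *\<^sub>v c j \<in> fres.std_flag K 1" if "j < K" for j
      using wc(2)[OF that] order_filtration_antimono[OF w1[OF that], of K] std_flag_order_filtration[of 1 K] K by auto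
    have gb: "g * b2 \<in> carrier_mat K K" using gc b2 by simp
    have ent: "(g * b2) $$ (i, j) = (g *\<^sub>v c j) $ i" if "i < K" "j < K" for i j
      using gb2[OF that(2)] gb that by (metis carrier_matD index_col)
    have gbi: "fres.integral_mat (g * b2)"
      unfolding fres.integral_mat_def
    proof (intro allI impI)
      fix i j assume "i < dim_row (g * b2)" "j < dim_col (g * b2)"
      then have ij: "i < K" "j < K" using gb by auto
      have "fres.integral_vec (g *\<^sub>v c j)" "g *\<^sub>v c j \<in> carrier_vec K"
        using c1[OF ij(2)] by (auto simp: fres.std_flag_def)
      then show "fls_is_integral ((g * b2) $$ (i, j))"
        unfolding ent[OF ij] using ij(1) by (rule fres.integral_vecD)
    qed
    have gb0: "fls_nth ((g * b2) $$ (0, j)) 0 = 0" if "j < K" for j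
      using ent[OF K that] c1[OF that] K by (simp add: fres.std_flag_def)
    obtain x where x: "x \<in> fres.std_flag K 0" "v = g * b2 *\<^sub>v x" using v(1) b2flag[of 0] by (auto simp: fres.matrix_flag_def)
    then have xc: "x \<in> carrier_vec K" "fres.integral_vec x" by (auto simp: fres.std_flag_def)
    have "v \<in> carrier_vec K" unfolding x(2) by (rule mult_mat_vec_carrier[OF gb xc(1)])
    then have "fls_nth (v $ 0) 0 = map_vec (\<lambda>x. fls_nth x 0) v $ 0" using K by simp
    also have "\<dots> = (red_mat (g * b2) *\<^sub>v map_vec (\<lambda>x. fls_nth x 0) x) $ 0"
      unfolding x(2) fres.mult_mat_vec_residue(2)[OF gbi gb xc(2,1)] ..
    also have "\<dots> = (\<Sum>m<K. red_mat (g * b2) $$ (0, m) * map_vec (\<lambda>x. fls_nth x 0) x $ m)"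
      using gb xc K by (intro mult_mat_vec_nth[of _ K]) auto
    also have "\<dots> = 0" using gb0 gc b2 K by (intro sum.neutral) auto
    finally show False using v(2) by simp
  qed
  then obtain j0 where j0: "j0 < K" "w j0 = 0" by blast
  have "inv_into UNIV W 1 = 1 + int j0"
    using W_idx[OF j0(1)] j0(2) \<open>inj W\<close> by (metis add_0 inv_f_f)
  then have norm: "normalized_perm K W" using j0(1) by (simp add: normalized_perm_def)
  \<comment> \<open>Column \<open>i\<close> is the modified column whose leading position is
    congruent to \<open>i\<close>, divided by the power of epsilon that moves the leading term onto
    the diagonal.\<close>
  define b1 where "b1 = mat K K (\<lambda>(l, i). fls_X_intpow (- (w (rinv i) div int K)) * (g *\<^sub>v c (rinv i)) $ l)"
  have b1: "b1 \<in> carrier_mat K K" by (simp add: b1_def)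
  have b1nth: "fls_nth (b1 $$ (l, i)) s = fls_nth ((g *\<^sub>v c (rinv i)) $ l) (s + w (rinv i) div int K)" if "l < K" "i < K" for l i s
  proof -
    have "b1 $$ (l, i) = fls_X_intpow (- (w (rinv i) div int K)) * (g *\<^sub>v c (rinv i)) $ l" using that by (simp add: b1_def)
    then show ?thesis by (simp only: fls_nth_X_intpow_mult) simp
  qed
  have wdec: "w (rinv i) = w (rinv i) div int K * int K + int i" if "i < K" for i
    using rho(2)[of "rinv i"] rinv(2)[OF that] by (metis div_mult_mod_eq)
  have b1z: "fls_nth (b1 $$ (l, i)) s = 0" if "l < K" "i < K" "s * int K + int l < int i" for l i s
    unfolding b1nth[OF that(1,2)]
    by (rule order_filtrationD(2)[OF wc(2)[OF rinv(1)[OF that(2)]] that(1)])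
      (use wdec[OF that(2)] that(3) in \<open>simp add: algebra_simps\<close>)
  have "b1 \<in> iwahori_minus K"
  proof (rule iwahori_minusI[OF b1])
    show "fres.integral_mat b1"
      unfolding fres.integral_mat_def fls_is_integral_def
    proof (intro allI impI)
      fix l i and s :: int assume "l < dim_row b1" "i < dim_col b1" "s < 0"
      then have li: "l < K" "i < K" using b1 by auto
      have "s * int K \<le> (-1) * int K" using \<open>s < 0\<close> by (intro mult_right_mono) auto
      then show "fls_nth (b1 $$ (l, i)) s = 0" using li by (intro b1z) auto
    qed
    show "fls_nth (b1 $$ (i, j)) 0 = 0" if "i < j" "j < K" for i j using that by (intro b1z) auto
    show "fls_nth (b1 $$ (i, i)) 0 \<noteq> 0" if i: "i < K" for i
    proof -
      have "nat (w (rinv i) mod int K) = i" using rinv(2)[OF i] by (simp add: rho_def)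
      then show ?thesis using wc(3)[OF rinv(1)[OF i]] unfolding b1nth[OF i i] order_coeff_def by simp
    qed
  qed
  have len: "length (map (\<lambda>i. ebasis K (W i)) [1..int K]) = K" by simp
  let ?P = "perm_matrix K W"
  have P: "?P \<in> carrier_mat K K" unfolding perm_matrix_def by (rule carrier_matI) (simp_all add: len)
  have "b1 * ?P = g * b2"
  proof (rule mat_col_eqI)
    fix j assume "j < dim_col (g * b2)"
    then have j: "j < K" using b2 by simp
    have "ebasis K x \<in> carrier_vec K" for x by (simp add: ebasis_def)
    moreover have "[1..int K] ! j = 1 + int j" using j by (subst nth_upto) auto
    ultimately have "col ?P j = ebasis K (W (1 + int j))"
      unfolding perm_matrix_def using j len by (subst col_mat_of_cols) simp_all
    also have "\<dots> = fls_X_intpow (w j div int K) \<cdot>\<^sub>v unit_vec K (rho j)"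
      unfolding W_idx[OF j] ebasis_def rho_def by simp
    finally have "col (b1 * ?P) j = fls_X_intpow (w j div int K) \<cdot>\<^sub>v col b1 (rho j)"
      using col_mult2[OF b1 P j] mult_mat_smult_vec[OF b1, of "unit_vec K (rho j)"] mult_mat_vec_unit[OF b1 rho(1)]
      by simp
    also have "\<dots> = g *\<^sub>v c j"
    proof (rule eq_vecI)
      fix l assume "l < dim_vec (g *\<^sub>v c j)"
      then have l: "l < K" using gc by simp
      have "(fls_X_intpow (w j div int K) \<cdot>\<^sub>v col b1 (rho j)) $ l =
        (fls_X_intpow (w j div int K) * fls_X_intpow (- (w j div int K))) * (g *\<^sub>v c j) $ l"
        using l rho(1)[of j] rinv'[OF j] by (simp add: b1_def mult.assoc)
      also have "\<dots> = (g *\<^sub>v c j) $ l" unfolding fls_X_intpow_times_fls_X_intpow by simp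
      finally show "(fls_X_intpow (w j div int K) \<cdot>\<^sub>v col b1 (rho j)) $ l = (g *\<^sub>v c j) $ l" .
    qed (use b1 gc in simp)
    finally show "col (b1 * ?P) j = col (g * b2) j" using gb2[OF j] by simp
  qed (use b1 P gc b2 in auto)
  then have eq: "b1 * ?P * 1\<^sub>m K = g * b2" using right_mult_one_mat[of "g * b2" K K] gc b2 by simp
  have "(1\<^sub>m K :: complex fls mat) \<in> iwahori_minus K"
    by (rule iwahori_minusI) (auto simp: fres.integral_mat_one)
  then have "full_flag K (b1 * ?P * 1\<^sub>m K) \<in> C_flags K"
    unfolding C_flags_def using \<open>b1 \<in> iwahori_minus K\<close> aff pos norm by blast
  then have "full_flag K (g * b2) \<in> C_flags K" unfolding eq .
  moreover have "full_flag K (g * b2) = full_flag K g"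
  proof
    fix i
    show "full_flag K (g * b2) i = full_flag K g i"
    proof (cases "i \<le> K")
      case True
      then show ?thesis using full_flag_eq b2flag by simp
    qed (simp add: full_flag_def)
  qed
  ultimately show ?thesis by simp
qed

section \<open>The operator $\gamma$ on a lattice\<close>

text \<open>Up to powers of epsilon, gamma permutes the basis: in zero-based numbering it sends
  basis vector \<open>c\<close> to epsilon^\<open>gamma_exp\<close> times basis vector
  \<open>gamma_row\<close>. A shift past the last index costs one factor of epsilon.\<close>

definition gamma_row :: "nat \<Rightarrow> nat \<Rightarrow> nat \<Rightarrow> nat" where
  "gamma_row n k c = (if c < (n - k) * k then c + k else if c < K_of n k - 1 then c + 1 - (n - k) * k else 0)"

definition gamma_exp :: "nat \<Rightarrow> nat \<Rightarrow> nat \<Rightarrow> nat \<Rightarrow> nat" where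
  "gamma_exp n k N c = (if c < (n - k) * k then 0 else if c < K_of n k - 1 then 1 else N + 1)"

lemma K_of_eq: "K_of n k = (n - k) * k + k"
  by (simp add: K_of_def algebra_simps)

lemma gamma_row_lt: "1 \<le> k \<Longrightarrow> c < K_of n k \<Longrightarrow> gamma_row n k c < K_of n k"
  unfolding gamma_row_def K_of_eq by auto

lemma gamma_row_inj: "1 \<le> k \<Longrightarrow> inj_on (gamma_row n k) {..<K_of n k}"
proof (rule inj_onI)
  fix x y assume "1 \<le> k" "x \<in> {..<K_of n k}" "y \<in> {..<K_of n k}" "gamma_row n k x = gamma_row n k y"
  moreover define A where "A = (n - k) * k"
  ultimately show "x = y"
    unfolding gamma_row_def K_of_eq A_def[symmetric] by (auto split: if_splits)
qed

lemma gamma_row_surj: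
  assumes "1 \<le> k" "l < K_of n k"
  obtains c where "c < K_of n k" "gamma_row n k c = l"
proof -
  have "gamma_row n k ` {..<K_of n k} = {..<K_of n k}"
    by (rule endo_inj_surj[OF _ _ gamma_row_inj[OF assms(1)]]) (use gamma_row_lt[OF assms(1)] in auto)
  then show thesis using assms(2) that by (metis imageE lessThan_iff)
qed

lemma fls_X_power_intpow: "fls_X ^ d = (fls_X_intpow (int d) :: complex fls)"
  by (simp add: fls_X_power_conv_shift_1)

lemma gamma_carrier: "gamma n k N \<in> carrier_mat (K_of n k) (K_of n k)"
  unfolding gamma_def Let_def by (rule carrier_matI) simp_all

lemma gamma_entry:
  assumes k: "1 \<le> k" and rc: "r < K_of n k" "c < K_of n k"
  shows "gamma n k N $$ (r, c) = (if r = gamma_row n k c then fls_X ^ gamma_exp n k N c else 0)"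
proof -
  let ?K = "K_of n k"
  have e: "ebasis ?K (1 + int x + d * int ?K) = fls_X_intpow d \<cdot>\<^sub>v unit_vec ?K x" if "x < ?K" for x d
  proof -
    have "(1 + int x + d * int ?K - 1) div int ?K = d" "nat ((1 + int x + d * int ?K - 1) mod int ?K) = x" using that by auto
    then show ?thesis unfolding ebasis_def by simp
  qed
  have nth: "[1..int ?K] ! c = 1 + int c" using rc by (subst nth_upto) auto
  have len: "length [1..int ?K] = ?K" by simp
  have "gamma n k N $$ (r, c) = (if 1 + int c \<le> int ((n - k) * k) then ebasis ?K (1 + int c + int k)
               else if 1 + int c < int ?K then ebasis ?K (1 + int c + int k + 1)
               else fls_X ^ (N + 1) \<cdot>\<^sub>v ebasis ?K 1) $ r"
    unfolding gamma_def Let_def using rc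
    by (subst mat_of_cols_index) (simp_all only: length_map len nth_map nth)
  also have "\<dots> = (fls_X ^ gamma_exp n k N c \<cdot>\<^sub>v unit_vec ?K (gamma_row n k c)) $ r"
  proof -
    consider "c < (n - k) * k" | "\<not> c < (n - k) * k" "c < ?K - 1" | "\<not> c < (n - k) * k" "c = ?K - 1" using rc by linarith
    then show ?thesis
    proof cases
      case 1
      then have eq: "1 + int c + int k = 1 + int (c + k) + 0 * int ?K" and lt: "c + k < ?K" by (simp_all add: K_of_eq)
      have "ebasis ?K (1 + int c + int k) = unit_vec ?K (c + k)" unfolding eq e[OF lt] by (intro eq_vecI) auto
      moreover have "1 + int c \<le> int ((n - k) * k)" using 1 by linarith
      ultimately show ?thesis using 1 rc lt by (simp only: if_True) (simp add: gamma_row_def gamma_exp_def)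
    next
      case 2
      then have eq: "1 + int c + int k + 1 = 1 + int (c + 1 - (n - k) * k) + 1 * int ?K" and lt: "c + 1 - (n - k) * k < ?K"
        by (simp_all add: K_of_eq of_nat_diff)
      have "ebasis ?K (1 + int c + int k + 1) = fls_X \<cdot>\<^sub>v unit_vec ?K (c + 1 - (n - k) * k)"
        unfolding eq e[OF lt] using fls_X_power_intpow[of 1] by simp
      moreover have "\<not> 1 + int c \<le> int ((n - k) * k)" "1 + int c < int ?K" using 2 by linarith+
      ultimately show ?thesis using 2 by (simp only: if_True if_False) (simp add: gamma_row_def gamma_exp_def)
    next
      case 3
      have lt: "0 < ?K" using rc by simp
      have "ebasis ?K 1 = unit_vec ?K 0" using ebasis_unit[OF lt] by simp
      moreover have "\<not> 1 + int c \<le> int ((n - k) * k)" "\<not> 1 + int c < int ?K" using 3 rc by linarith+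
      ultimately show ?thesis using 3 by (simp only: if_False) (simp add: gamma_row_def gamma_exp_def)
    qed
  qed
  also have "\<dots> = (if r = gamma_row n k c then fls_X ^ gamma_exp n k N c else 0)"
    using rc gamma_row_lt[OF k rc(2)] by simp
  finally show ?thesis .
qed

lemma gamma_mult_vec:
  assumes k: "1 \<le> k" and v: "v \<in> carrier_vec (K_of n k)" and c: "c < K_of n k"
  shows "(gamma n k N *\<^sub>v v) $ gamma_row n k c = fls_X ^ gamma_exp n k N c * v $ c"
proof -
  have "(gamma n k N *\<^sub>v v) $ gamma_row n k c = (\<Sum>j<K_of n k. gamma n k N $$ (gamma_row n k c, j) * v $ j)"
    by (rule mult_mat_vec_nth[OF gamma_carrier v gamma_row_lt[OF k c]])
  also have "\<dots> = (\<Sum>j<K_of n k. if j = c then fls_X ^ gamma_exp n k N c * v $ c else 0)"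
    using gamma_entry[OF k gamma_row_lt[OF k c]] inj_onD[OF gamma_row_inj[OF k, of n], of c] c
    by (intro sum.cong) auto
  also have "\<dots> = fls_X ^ gamma_exp n k N c * v $ c" using c by simp
  finally show ?thesis .
qed

text \<open>Gamma sends each e_i to some e_j with j > i, so it raises every order. This is the
  source of nilpotency modulo epsilon.\<close>

lemma gamma_order_filtration:
  assumes k: "1 \<le> k" and v: "v \<in> order_filtration (K_of n k) r"
  shows "gamma n k N *\<^sub>v v \<in> order_filtration (K_of n k) (r + 1)"
  unfolding order_filtration_def
proof (intro CollectI conjI allI impI)
  note vc = order_filtrationD(1)[OF v]
  show "gamma n k N *\<^sub>v v \<in> carrier_vec (K_of n k)" by (rule mult_mat_vec_carrier[OF gamma_carrier vc])
  fix l s assume l: "l < K_of n k" and s: "s * int (K_of n k) + int l < r + 1"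
  obtain c where c: "c < K_of n k" "gamma_row n k c = l" using gamma_row_surj[OF k l] .
  let ?d = "gamma_exp n k N c"
  have "c + 1 \<le> l + ?d * K_of n k"
    using k c unfolding gamma_row_def gamma_exp_def by (auto simp: K_of_eq split: if_splits)
  then have "int c + 1 \<le> int l + int ?d * int (K_of n k)" by (metis of_nat_1 of_nat_add of_nat_le_iff of_nat_mult)
  then have lt: "(s - int ?d) * int (K_of n k) + int c < r" using s by (simp add: algebra_simps)
  have "fls_nth ((gamma n k N *\<^sub>v v) $ l) s = fls_nth (v $ c) (s - int ?d)"
    using gamma_mult_vec[OF k vc c(1), of N] unfolding c(2) fls_X_power_intpow by (simp only: fls_nth_X_intpow_mult)
  then show "fls_nth ((gamma n k N *\<^sub>v v) $ l) s = 0" using order_filtrationD(2)[OF v c(1) lt] by simp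
qed

lemma gamma_pow_order_filtration:
  assumes k: "1 \<le> k" and v: "v \<in> order_filtration (K_of n k) r"
  shows "(gamma n k N ^\<^sub>m m) *\<^sub>v v \<in> order_filtration (K_of n k) (r + int m)"
  using v
proof (induction m arbitrary: v r)
  case 0
  then show ?case using gamma_carrier[of n k N] order_filtrationD(1)[OF 0] by simp
next
  case (Suc m)
  have "(gamma n k N ^\<^sub>m Suc m) *\<^sub>v v = (gamma n k N ^\<^sub>m m) *\<^sub>v (gamma n k N *\<^sub>v v)"
    using assoc_mult_mat_vec[OF pow_carrier_mat[OF gamma_carrier] gamma_carrier order_filtrationD(1)[OF Suc.prems]]
    by simp
  moreover have "r + 1 + int m = r + int (Suc m)" by simp
  ultimately show ?case using Suc.IH[OF gamma_order_filtration[OF k Suc.prems, of N]] by (simp only:)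
qed

lemma det_diag:
  "det (mat K K (\<lambda>(r, c). if r = c then f c else 0)) = (\<Prod>c<K. f c :: 'a :: comm_ring_1)"
proof -
  have "det (mat K K (\<lambda>(r, c). if r = c then f c else 0)) =
      prod_list (diag_mat (mat K K (\<lambda>(r, c). if r = c then f c else 0)))"
    by (rule det_lower_triangular[of K]) auto
  also have "\<dots> = (\<Prod>c<K. f c)" by (simp add: prod_list_diag_prod atLeast0LessThan)
  finally show ?thesis .
qed

text \<open>Gamma is a permutation matrix times a diagonal matrix of powers of epsilon. The nonzero
  exponents are \<open>k - 1\<close> ones and a single \<open>N + 1\<close>, with sum
  \<open>N + k\<close>.\<close>

lemma det_gamma:
  assumes k: "1 \<le> k"
  obtains a :: complex where "a \<noteq> 0" "det (gamma n k N) = fls_const a * fls_X ^ (N + k)"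
proof -
  let ?K = "K_of n k"
  let ?P = "mat ?K ?K (\<lambda>(r, c). if r = gamma_row n k c then 1 else 0) :: complex fls mat"
  let ?D = "mat ?K ?K (\<lambda>(r, c). if r = c then fls_X ^ gamma_exp n k N c else 0) :: complex fls mat"
  have P: "?P \<in> carrier_mat ?K ?K" and D: "?D \<in> carrier_mat ?K ?K" by auto
  have "gamma n k N = ?P * ?D"
  proof (rule eq_matI)
    fix r c assume "r < dim_row (?P * ?D)" "c < dim_col (?P * ?D)"
    then have rc: "r < ?K" "c < ?K" by auto
    have "(?P * ?D) $$ (r, c) = (\<Sum>l<?K. ?P $$ (r, l) * ?D $$ (l, c))" by (rule mult_mat_nth[OF P D rc])
    also have "\<dots> = (\<Sum>l<?K. if l = c then gamma n k N $$ (r, c) else 0)"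
      using rc gamma_entry[OF k rc, of N] by (intro sum.cong) auto
    finally show "gamma n k N $$ (r, c) = (?P * ?D) $$ (r, c)" using rc by simp
  qed (use gamma_carrier[of n k N] in auto)
  then have "det (gamma n k N) = det ?P * det ?D" using det_mult[OF P D] by simp
  \<comment> \<open>The permutation matrix is orthogonal, so its determinant is 1 or -1, a nonzero
    constant in either case.\<close>
  moreover have "det ?P * det ?P = 1"
  proof -
    have "transpose_mat ?P * ?P = 1\<^sub>m ?K"
    proof (rule eq_matI)
      fix r c assume "r < dim_row (1\<^sub>m ?K :: complex fls mat)" "c < dim_col (1\<^sub>m ?K :: complex fls mat)"
      then have rc: "r < ?K" "c < ?K" by auto
      have "(transpose_mat ?P * ?P) $$ (r, c) = (\<Sum>l<?K. transpose_mat ?P $$ (r, l) * ?P $$ (l, c))"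
        by (rule mult_mat_nth[OF _ P rc]) simp
      also have "\<dots> = (\<Sum>l<?K. if l = gamma_row n k c then (if r = c then 1 else 0) else 0)"
        using rc inj_onD[OF gamma_row_inj[OF k, of n], of r c] by (intro sum.cong) auto
      also have "\<dots> = 1\<^sub>m ?K $$ (r, c)" using rc gamma_row_lt[OF k rc(2)] by simp
      finally show "(transpose_mat ?P * ?P) $$ (r, c) = 1\<^sub>m ?K $$ (r, c)" .
    qed auto
    then have "det (transpose_mat ?P) * det ?P = 1" using det_mult[of "transpose_mat ?P" ?K ?P] P by simp
    then show ?thesis using det_transpose[OF P] by simp
  qed
  moreover have "det ?D = fls_X ^ (N + k)"
  proof -
    have "(\<Sum>c<?K. gamma_exp n k N c) = N + k"
    proof -
      obtain K' where K': "?K = Suc K'" "K' = (n - k) * k + (k - 1)" using k by (simp add: K_of_eq)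
      have "(\<Sum>c<?K. gamma_exp n k N c) = (\<Sum>c<K'. gamma_exp n k N c) + (N + 1)"
        unfolding K'(1) using K' by (simp add: gamma_exp_def)
      also have "(\<Sum>c<K'. gamma_exp n k N c) = (\<Sum>c\<in>{(n - k) * k..<K'}. 1)"
        using K' by (intro sum.mono_neutral_cong_right) (auto simp: gamma_exp_def)
      also have "\<dots> = k - 1" using K'(2) by simp
      finally show ?thesis using k by simp
    qed
    then show ?thesis unfolding det_diag by (simp flip: power_sum)
  qed
  moreover have "det ?P = fls_const 1 \<or> det ?P = fls_const (- 1)"
    using \<open>det ?P * det ?P = 1\<close> by (simp add: square_eq_1_iff)
  ultimately show thesis using that[of 1] that[of "- 1"] by force
qed

section \<open>Adjugates, kernels and the number of Jordan blocks\<close>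

lemma integral_mat_adj:
  assumes "M \<in> carrier_mat K K" "fres.integral_mat M"
  obtains M' where "M' \<in> carrier_mat K K" "fres.integral_mat M'" "M * M' = det M \<cdot>\<^sub>m 1\<^sub>m K"
proof -
  let ?h = "map_mat fls_regpart M"
  have h: "?h \<in> carrier_mat K K" using assms by simp
  have Mh: "M = map_mat fps_to_fls ?h"
  proof (rule eq_matI)
    fix i j assume "i < dim_row (map_mat fps_to_fls ?h)" "j < dim_col (map_mat fps_to_fls ?h)"
    then have ij: "i < K" "j < K" using assms by auto
    have "fls_is_integral (M $$ (i, j))" by (rule fres.integral_matD[OF assms(2,1) ij])
    then obtain a where "M $$ (i, j) = fps_to_fls a" by (auto simp: fls_is_integral_iff)
    then show "M $$ (i, j) = map_mat fps_to_fls ?h $$ (i, j)" using ij assms by simp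
  qed auto
  have hom: "comm_ring_hom (fps_to_fls :: complex fps \<Rightarrow> complex fls)"
    by unfold_locales (auto simp: fls_times_fps_to_fls)
  interpret comm_ring_hom "fps_to_fls :: complex fps \<Rightarrow> complex fls" by (rule hom)
  note adj = adj_mat[OF h]
  let ?M' = "map_mat fps_to_fls (adj_mat ?h)"
  have "det M = fps_to_fls (det ?h)" by (subst Mh) (rule hom_det)
  moreover have "M * ?M' = map_mat fps_to_fls (?h * adj_mat ?h)"
    using mat_hom_mult[OF h adj(1)] Mh by simp
  moreover have "map_mat fps_to_fls (det ?h \<cdot>\<^sub>m 1\<^sub>m K) = fps_to_fls (det ?h) \<cdot>\<^sub>m (1\<^sub>m K :: complex fls mat)"
    by (intro eq_matI) auto
  ultimately have "M * ?M' = det M \<cdot>\<^sub>m 1\<^sub>m K" unfolding adj(2) by simp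
  moreover have "fres.integral_mat ?M'" by (auto simp: fres.integral_mat_def fls_is_integral_iff)
  ultimately show thesis using that[of ?M'] adj(1) by simp
qed

text \<open>The kernel of \<open>A\<close> is the subspace of a truncation with \<open>q = 1\<close>
  and with an \<open>e\<close> for which the \<open>e\<close>-th power vanishes. Each block then
  contributes one dimension.\<close>

lemma nilpotent_jordan_kernel:
  fixes A :: "complex mat"
  assumes A: "A \<in> carrier_mat d d" and jnf: "jordan_nf A (map (\<lambda>l. (l, 0)) la)"
  obtains E where "injective_mat E" "E \<in> carrier_mat d (length la)" "A * E = 0\<^sub>m d (length la)"
proof -
  obtain P P' where wit: "similar_mat_wit A (nilpotent_jordan_matrix la) P P'"
    using jnf unfolding jordan_nf_def similar_mat_def by blast
  have pos: "1 \<le> l" if "l \<in> set la" for l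
  proof -
    have "0 \<notin> set la" using jnf by (auto simp: jordan_nf_def image_image)
    then have "l \<noteq> 0" using that by metis
    then show ?thesis by simp
  qed
  \<comment> \<open>Larger than every block size, so that \<open>l - e = 0\<close> throughout, and
    at least 1, as the truncation with \<open>q = 1\<close> requires.\<close>
  define e where "e = Suc (sum_list la)"
  have le: "l - e = 0" if "l \<in> set la" for l using member_le_sum_list[OF that] by (simp add: e_def)
  let ?G = "nilpotent_jordan_matrix (map (\<lambda>l. 1 + (l - e)) la) :: complex mat"
  obtain Q where Q: "truncation 1 e (nilpotent_jordan_matrix la) ?G Q"
    by (rule truncation_nilpotent_jordan_matrix[of 1 e la]) (use pos in \<open>simp_all add: e_def\<close>)
  have m: "map (\<lambda>l. 1 + (l - e)) la = replicate (length la) 1"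
    unfolding map_replicate_const[symmetric] by (rule map_cong) (use le in auto)
  have Gc: "?G \<in> carrier_mat (length la) (length la)"
    using nilpotent_jordan_matrix_carrier[of "map (\<lambda>l. 1 + (l - e)) la"] unfolding m by (simp add: sum_list_replicate)
  have "?G ^\<^sub>m 1 = 0\<^sub>m (sum_list (map (\<lambda>l. 1 + (l - e)) la)) (sum_list (map (\<lambda>l. 1 + (l - e)) la))"
    unfolding nilpotent_jordan_matrix_pow_eq_zero_iff using le by auto
  then have G0: "?G = 0\<^sub>m (length la) (length la)"
    using Gc unfolding m by (simp add: sum_list_replicate)
  have "similar_mat_wit ?G ?G (1\<^sub>m (length la)) (1\<^sub>m (length la))" by (rule similar_mat_wit_refl[OF Gc])
  from truncation_similar[OF Q wit this] obtain E where "truncation 1 e A ?G E" by blast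
  then obtain a g R where c: "A \<in> carrier_mat a a" "?G \<in> carrier_mat g g" "E \<in> carrier_mat a g" "R \<in> carrier_mat g a"
    and e: "A * E = E * ?G" "R * E = 1\<^sub>m g" unfolding truncation_def by blast
  have ag: "a = d" "g = length la" using c(1,2) A Gc by auto
  have "injective_mat E" by (rule injective_mat_of_left_inverse[OF c(3,4) e(2)])
  moreover have "A * E = 0\<^sub>m d (length la)" using e(1) c(3) unfolding G0 ag by simp
  ultimately show thesis using that c(3) unfolding ag by blast
qed

lemma smult_one_mult_mat_vec:
  fixes w :: "'a :: comm_ring_1 vec"
  assumes w: "w \<in> carrier_vec m"
  shows "(b \<cdot>\<^sub>m 1\<^sub>m m) *\<^sub>v w = b \<cdot>\<^sub>v w"
proof (rule eq_vecI)
  fix i assume "i < dim_vec (b \<cdot>\<^sub>v w)"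
  then have i: "i < m" using w by simp
  have "((b \<cdot>\<^sub>m 1\<^sub>m m) *\<^sub>v w) $ i = (\<Sum>j<m. (b \<cdot>\<^sub>m 1\<^sub>m m) $$ (i, j) * w $ j)"
    by (rule mult_mat_vec_nth[OF _ w i]) simp
  also have "\<dots> = (\<Sum>j<m. if j = i then b * w $ i else 0)" using i by (intro sum.cong) auto
  finally show "((b \<cdot>\<^sub>m 1\<^sub>m m) *\<^sub>v w) $ i = (b \<cdot>\<^sub>v w) $ i" using i w by simp
qed (use w in simp)

text \<open>The columns of \<open>g0\<close> are a basis of a gamma-stable lattice with the two
  properties of Lambda_0 that characterize membership in C; \<open>v\<close> witnesses the second
  one.\<close>

locale gamma_lattice =
  fixes n k N :: nat and g0 g0' :: "complex fls mat" and v :: "complex fls vec"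
  assumes k: "1 \<le> k" and g0: "g0 \<in> carrier_mat (K_of n k) (K_of n k)"
    and g0': "g0' \<in> carrier_mat (K_of n k) (K_of n k)"
    and inv: "g0 * g0' = 1\<^sub>m (K_of n k)" "g0' * g0 = 1\<^sub>m (K_of n k)"
    and sub: "fres.matrix_flag (K_of n k) g0 0 \<subseteq> fres.std_flag (K_of n k) 0"
    and v: "v \<in> fres.matrix_flag (K_of n k) g0 0" "fls_nth (v $ 0) 0 \<noteq> 0"
    and stable: "\<And>x. x \<in> fres.matrix_flag (K_of n k) g0 0 \<Longrightarrow> gamma n k N *\<^sub>v x \<in> fres.matrix_flag (K_of n k) g0 0"
begin

abbreviation "K \<equiv> K_of n k"

text \<open>The matrix of gamma in the basis \<open>g0\<close>. Stability makes it integral, and its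
  reduction \<open>A\<close> describes gamma on the lattice modulo epsilon.\<close>

definition B :: "complex fls mat" where "B = g0' * gamma n k N * g0"

definition A :: "complex mat" where "A = red_mat B"

lemma K_pos: "0 < K"
  using k by (simp add: K_of_eq)

lemma g0_GL: "g0 \<in> GL K"
  using g0 g0' inv by (intro GL_I)

lemma B: "B \<in> carrier_mat K K"
  unfolding B_def using g0 g0' gamma_carrier by (intro mult_carrier_mat)

lemma A: "A \<in> carrier_mat K K"
  using B by (simp add: A_def)

lemma g0_B: "x \<in> carrier_vec K \<Longrightarrow> g0 *\<^sub>v (B *\<^sub>v x) = gamma n k N *\<^sub>v (g0 *\<^sub>v x)"
proof -
  assume x: "x \<in> carrier_vec K"
  have "g0 * B = gamma n k N * g0"
  proof -
    have "g0 * B = (g0 * g0') * (gamma n k N * g0)"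
      unfolding B_def using g0 g0' gamma_carrier[of n k N] by (simp add: mult_mat_assoc_dims)
    then show ?thesis
      unfolding inv(1) left_mult_one_mat[OF mult_carrier_mat[OF gamma_carrier g0]] .
  qed
  then show ?thesis
    using assoc_mult_mat_vec[OF g0 B x] assoc_mult_mat_vec[OF gamma_carrier g0 x] by simp
qed

lemma unit_vec_std: "j < K \<Longrightarrow> unit_vec K j \<in> fres.std_flag K 0"
  by (auto simp: fres.std_flag_def fres.integral_vec_def fres.integral_0 fres.integral_1 unit_vec_def)

lemma integral_B: "fres.integral_mat B"
  unfolding fres.integral_mat_def
proof (intro allI impI)
  fix i j assume "i < dim_row B" "j < dim_col B"
  then have ij: "i < K" "j < K" using B by auto
  have "gamma n k N *\<^sub>v (g0 *\<^sub>v unit_vec K j) \<in> fres.matrix_flag K g0 0"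
    using unit_vec_std[OF ij(2)] by (intro stable) (auto simp: fres.matrix_flag_def)
  then have "B *\<^sub>v unit_vec K j \<in> fres.std_flag K 0"
    unfolding g0_B[OF unit_vec_carrier, symmetric]
    using fres.matrix_flag_mem_iff[OF g0_GL] mult_mat_vec_carrier[OF B unit_vec_carrier] by blast
  then have "fres.integral_vec (col B j)" unfolding mult_mat_vec_unit[OF B ij(2)] by (simp add: fres.std_flag_def)
  then show "fls_is_integral (B $$ (i, j))" using ij B by (auto simp: fres.integral_vec_def)
qed

text \<open>A high power of gamma takes the lattice, which lies in O^K, into epsilon^(M+1) O^K. As
  the inverse of \<open>g0\<close> has poles of order at most \<open>M\<close>, that power of
  \<open>B\<close> is divisible by epsilon.\<close>

lemma A_nilpotent: "\<exists>r. A ^\<^sub>m r = 0\<^sub>m K K"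
proof -
  obtain M where M: "0 \<le> M" "\<And>i j. i < K \<Longrightarrow> j < K \<Longrightarrow> coeffs_above (- M) (g0' $$ (i, j))"
    using mat_coeffs_above[of g0'] g0' by auto
  define r where "r = nat (M + 1) * K"
  have r: "int r = (M + 1) * int K" using M(1) by (simp add: r_def)
  have "similar_mat_wit B (gamma n k N) g0' g0"
    by (rule similar_mat_witI[OF inv(2,1) B_def B gamma_carrier g0' g0])
  from similar_mat_wit_pow_id[OF this] have Br: "B ^\<^sub>m r = g0' * gamma n k N ^\<^sub>m r * g0" .
  have gr: "gamma n k N ^\<^sub>m r \<in> carrier_mat K K" by (rule pow_carrier_mat[OF gamma_carrier])
  have "fls_nth ((B ^\<^sub>m r) $$ (i, j)) 0 = 0" if ij: "i < K" "j < K" for i j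
  proof -
    let ?u = "g0 *\<^sub>v unit_vec K j"
    have "?u \<in> fres.matrix_flag K g0 0" using unit_vec_std[OF ij(2)] by (auto simp: fres.matrix_flag_def)
    then have "?u \<in> order_filtration K 0" using sub std_flag_order_filtration[of 0 K] K_pos by auto
    from gamma_pow_order_filtration[OF k this, of N r]
    have w: "(gamma n k N ^\<^sub>m r) *\<^sub>v ?u \<in> carrier_vec K"
      "\<And>l. l < K \<Longrightarrow> coeffs_above (M + 1) (((gamma n k N ^\<^sub>m r) *\<^sub>v ?u) $ l)"
      using order_filtration_coeffs_above[OF K_pos, of _ "M + 1"] r by auto
    have "coeffs_above (- M + (M + 1)) ((g0' *\<^sub>v ((gamma n k N ^\<^sub>m r) *\<^sub>v ?u)) $ i)"
      using M w ij by (intro coeffs_above_mult_mat_vec[OF g0']) auto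
    moreover have "g0' *\<^sub>v ((gamma n k N ^\<^sub>m r) *\<^sub>v ?u) = (B ^\<^sub>m r) *\<^sub>v unit_vec K j"
      unfolding Br using g0 g0' gr by (simp add: assoc_mult_mat_vec[of _ K K _ K])
    moreover have "((B ^\<^sub>m r) *\<^sub>v unit_vec K j) $ i = (B ^\<^sub>m r) $$ (i, j)"
      unfolding mult_mat_vec_unit[OF pow_carrier_mat[OF B] ij(2)]
      using carrier_matD[OF pow_carrier_mat[OF B, of r]] ij by (intro index_col) simp_all
    ultimately show ?thesis by (simp add: coeffs_above_def)
  qed
  moreover have "red_mat P = 0\<^sub>m K K" if "P \<in> carrier_mat K K"
    "\<And>i j. i < K \<Longrightarrow> j < K \<Longrightarrow> fls_nth (P $$ (i, j)) 0 = 0" for P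
    using that by (intro eq_matI) auto
  ultimately have "red_mat (B ^\<^sub>m r) = 0\<^sub>m K K" using pow_carrier_mat[OF B, of r] by blast
  then show ?thesis unfolding A_def using fres.integral_mat_pow(2)[OF integral_B B] by metis
qed

text \<open>If \<open>A\<close> had more than \<open>k\<close> blocks, then $\epsilon^N$ times the inverse of \<open>B\<close> would be integral,
  since $\det B$ is a unit times $\epsilon^{N+k}$. But $\epsilon^N v \notin \gamma \mathbb{O}^K$,
  because the first row of $\gamma$ is divisible by $\epsilon^{N+1}$.\<close>

lemma jordan_blocks_le:
  assumes jnf: "jordan_nf A (map (\<lambda>l. (l, 0)) la)"
  shows "length la \<le> k"
proof (rule ccontr)
  let ?b = "length la"
  assume "\<not> ?b \<le> k"
  then have bk: "k + 1 \<le> ?b" by simp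
  obtain E where E: "injective_mat E" "E \<in> carrier_mat K ?b" "A * E = 0\<^sub>m K ?b"
    using nilpotent_jordan_kernel[OF A jnf] .
  \<comment> \<open>The last \<open>?b\<close> columns of \<open>c\<close> lie in the kernel of
    \<open>A\<close>, so the same columns of \<open>B * ?c\<close> are divisible by epsilon.\<close>
  obtain c where c: "c \<in> GL K" "tail_cols ?b c = E" using complete_to_GL[OF E(1,2)] .
  have bK: "?b \<le> K" using injective_mat_cols_le_rows[OF E(1,2)] .
  note cc = GL_carrier[OF c(1)]
  have Ac: "(A * c) $$ (i, j) = 0" if "i < K" "K - ?b \<le> j" "j < K" for i j
  proof -
    have "(A * c) $$ (i, j) = (\<Sum>l<K. A $$ (i, l) * c $$ (l, j))" by (rule mult_mat_nth[OF A cc that(1,3)])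
    also have "\<dots> = (\<Sum>l<K. A $$ (i, l) * E $$ (l, j - (K - ?b)))"
      using that bK cc unfolding c(2)[symmetric] by (intro sum.cong) (auto simp: tail_cols_def)
    also have "\<dots> = (A * E) $$ (i, j - (K - ?b))"
      using that bK by (intro mult_mat_nth[OF A E(2), symmetric]) auto
    finally show ?thesis using E(3) that bK by simp
  qed
  let ?c = "map_mat fls_const c"
  have hom: "comm_ring_hom (fls_const :: complex \<Rightarrow> complex fls)" by (rule comm_ring_hom_fls_const)
  have c': "?c \<in> carrier_mat K K" "fres.integral_mat ?c" "red_mat ?c = c"
    using cc fres.integral_mat_sc[of c] by auto
  have Bc: "B * ?c \<in> carrier_mat K K" "fres.integral_mat (B * ?c)" "red_mat (B * ?c) = A * c"
    using B c' fres.mult_mat_residue[OF integral_B B c'(2,1)] by (auto simp: A_def)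
  \<comment> \<open>\<open>?M\<close> is \<open>B * ?c\<close> with those columns divided by
    epsilon, which lowers the exponent of epsilon in the determinant by \<open>?b\<close>. The
    product of \<open>?D\<close> and \<open>?D'\<close> is the scalar epsilon, so \<open>?D'\<close>
    replaces the inverse of \<open>?D\<close> by an integral matrix.\<close>
  let ?D = "mat K K (\<lambda>(r, l). if r = l then (if K - ?b \<le> l then fls_X else 1) else 0) :: complex fls mat"
  let ?D' = "mat K K (\<lambda>(r, l). if r = l then (if K - ?b \<le> l then 1 else fls_X) else 0) :: complex fls mat"
  let ?M = "mat K K (\<lambda>(i, j). if K - ?b \<le> j then fls_X_intpow (- 1) * (B * ?c) $$ (i, j) else (B * ?c) $$ (i, j))"
  have M: "?M \<in> carrier_mat K K" and D: "?D \<in> carrier_mat K K" and D': "?D' \<in> carrier_mat K K" by auto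
  have X1: "fls_X_intpow 1 = (fls_X :: complex fls)" by (simp add: fls_X_conv_shift_1)
  have XX: "fls_X_intpow (- 1) * x * fls_X = x" for x :: "complex fls"
  proof -
    have "fls_X_intpow (- 1) * x * fls_X = (fls_X_intpow (- 1) * fls_X_intpow 1) * x" unfolding X1 by (simp add: ac_simps)
    then show ?thesis unfolding fls_X_intpow_times_fls_X_intpow by simp
  qed
  have MD: "B * ?c = ?M * ?D"
  proof (rule eq_matI)
    fix i j assume "i < dim_row (?M * ?D)" "j < dim_col (?M * ?D)"
    then have ij: "i < K" "j < K" by auto
    have "(?M * ?D) $$ (i, j) = (\<Sum>l<K. ?M $$ (i, l) * ?D $$ (l, j))" by (rule mult_mat_nth[OF M D ij])
    also have "\<dots> = (\<Sum>l<K. if l = j then (B * ?c) $$ (i, j) else 0)"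
    proof (rule sum.cong[OF refl])
      fix l assume "l \<in> {..<K}"
      then show "?M $$ (i, l) * ?D $$ (l, j) = (if l = j then (B * ?c) $$ (i, j) else 0)"
        using ij XX[of "(B * ?c) $$ (i, j)"] by (cases "l = j"; cases "K - ?b \<le> j") simp_all
    qed
    finally show "(B * ?c) $$ (i, j) = (?M * ?D) $$ (i, j)" using ij by simp
  qed (use Bc in auto)
  have Mi: "fres.integral_mat ?M"
    unfolding fres.integral_mat_def
  proof (intro allI impI)
    fix i j assume "i < dim_row ?M" "j < dim_col ?M"
    then have ij: "i < K" "j < K" by auto
    have int: "fls_is_integral ((B * ?c) $$ (i, j))" by (rule fres.integral_matD[OF Bc(2,1) ij])
    show "fls_is_integral (?M $$ (i, j))"
    proof (cases "K - ?b \<le> j")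
      case True
      have "fls_nth ((B * ?c) $$ (i, j)) 0 = red_mat (B * ?c) $$ (i, j)" using ij Bc(1) by (simp only: index_map_mat carrier_matD)
      also have "\<dots> = 0" unfolding Bc(3) by (rule Ac[OF ij(1) True ij(2)])
      finally have z: "fls_nth ((B * ?c) $$ (i, j)) 0 = 0" .
      have "?M $$ (i, j) = fls_X_intpow (- 1) * (B * ?c) $$ (i, j)" using ij True by simp
      moreover have "fls_is_integral (fls_X_intpow (- 1) * (B * ?c) $$ (i, j))"
        unfolding fls_is_integral_def fls_nth_X_intpow_mult
      proof (intro allI impI)
        fix s :: int assume "s < 0"
        then have "s - - 1 < 0 \<or> s - - 1 = 0" by linarith
        then show "fls_nth ((B * ?c) $$ (i, j)) (s - - 1) = 0" using int z unfolding fls_is_integral_def by auto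
      qed
      ultimately show ?thesis by (simp only:)
    next
      case False
      then have "?M $$ (i, j) = (B * ?c) $$ (i, j)" using ij by simp
      then show ?thesis using int by (simp only:)
    qed
  qed
  obtain M' where M': "M' \<in> carrier_mat K K" "fres.integral_mat M'" "?M * M' = det ?M \<cdot>\<^sub>m 1\<^sub>m K"
    using integral_mat_adj[OF M Mi] .
  obtain a where a: "a \<noteq> 0" "det (gamma n k N) = fls_const a * fls_X ^ (N + k)" using det_gamma[OF k] .
  have dc: "det ?c = fls_const (det c)" using comm_ring_hom.hom_det[OF hom, of c] .
  have dc0: "det c \<noteq> 0" using c(1) GL_iff_det[OF cc] by simp
  have dB: "det B = det (gamma n k N)"
  proof -
    have "det g0' * det g0 = 1" using det_mult[OF g0' g0] inv(2) by simp
    moreover have "det B = det g0' * det (gamma n k N) * det g0"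
      unfolding B_def using det_mult[OF mult_carrier_mat[OF g0' gamma_carrier] g0] det_mult[OF g0' gamma_carrier] by simp
    ultimately show ?thesis by (simp add: ac_simps)
  qed
  have dD: "det ?D = fls_X ^ ?b"
  proof -
    have "det ?D = (\<Prod>l<K. if K - ?b \<le> l then fls_X else 1)" by (rule det_diag)
    also have "\<dots> = (\<Prod>l\<in>{K - ?b..<K}. fls_X)" by (intro prod.mono_neutral_cong_right) auto
    finally show ?thesis using bK by simp
  qed
  let ?t = "a * det c"
  have t0: "?t \<noteq> 0" using a(1) dc0 by simp
  have "det ?M * fls_X ^ ?b = fls_const ?t * fls_X ^ (N + k)"
    using det_mult[OF M D] det_mult[OF B c'(1)] MD dB dc dD a(2) by (simp add: ac_simps flip: fls_const_mult_const)
  then have "(det ?M * fls_X ^ (?b - k)) * fls_X ^ k = (fls_const ?t * fls_X ^ N) * fls_X ^ k"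
    using bk by (simp add: power_add[symmetric] mult.assoc)
  then have detM: "det ?M * fls_X ^ (?b - k) = fls_const ?t * fls_X ^ N" by simp
  obtain u where u: "u \<in> fres.std_flag K 0" "v = g0 *\<^sub>v u" using v(1) by (auto simp: fres.matrix_flag_def)
  have uc: "u \<in> carrier_vec K" "fres.integral_vec u" using u(1) by (auto simp: fres.std_flag_def)
  \<comment> \<open>The scalar that turns \<open>fls_X * det ?M\<close> into
    \<open>fls_X ^ N\<close>. It is integral because there are more than \<open>k\<close> blocks,
    and so \<open>y\<close> and \<open>x\<close> are integral.\<close>
  let ?s = "fls_const (inverse ?t) * fls_X ^ (?b - k - 1)"
  have M'u: "M' *\<^sub>v u \<in> carrier_vec K" "fres.integral_vec (M' *\<^sub>v u)"
    using M' uc fres.mult_mat_vec_residue(1)[OF M'(2,1) uc(2,1)] by auto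
  have D'i: "fres.integral_mat ?D'"
    by (auto simp: fres.integral_mat_def fres.integral_0 fres.integral_1 fls_is_integral_def)
  have D'M'u: "?D' *\<^sub>v (M' *\<^sub>v u) \<in> carrier_vec K" "fres.integral_vec (?D' *\<^sub>v (M' *\<^sub>v u))"
    using mult_mat_vec_carrier[OF D' M'u(1)] fres.mult_mat_vec_residue(1)[OF D'i D' M'u(2,1)] by auto
  define y where "y = ?s \<cdot>\<^sub>v (?D' *\<^sub>v (M' *\<^sub>v u))"
  have y: "y \<in> carrier_vec K" using D'M'u by (simp add: y_def)
  have si: "fls_is_integral ?s"
    unfolding fls_X_power_intpow fls_is_integral_def fls_mult_const_nth
    by (auto simp: one_fls_def)
  have yi: "fres.integral_vec y"
    unfolding fres.integral_vec_def
  proof (intro allI impI)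
    fix i assume "i < dim_vec y"
    then have i: "i < K" using y by simp
    have "y $ i = ?s * (?D' *\<^sub>v (M' *\<^sub>v u)) $ i" using i D'M'u(1) unfolding y_def by (subst index_smult_vec) auto
    then show "fls_is_integral (y $ i)"
      using fres.integral_mult[OF si fres.integral_vecD[OF D'M'u(2,1) i]] by (simp only:)
  qed
  define x where "x = ?c *\<^sub>v y"
  have x: "x \<in> carrier_vec K" "fres.integral_vec x"
    unfolding x_def using mult_mat_vec_carrier[OF c'(1) y] fres.mult_mat_vec_residue(1)[OF c'(2,1) yi y] by auto
  have DD: "?D * ?D' = fls_X \<cdot>\<^sub>m 1\<^sub>m K"
  proof (rule eq_matI)
    fix i j assume "i < dim_row (fls_X \<cdot>\<^sub>m 1\<^sub>m K :: complex fls mat)" "j < dim_col (fls_X \<cdot>\<^sub>m 1\<^sub>m K :: complex fls mat)"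
    then have ij: "i < K" "j < K" by auto
    have "(?D * ?D') $$ (i, j) = (\<Sum>l<K. ?D $$ (i, l) * ?D' $$ (l, j))" by (rule mult_mat_nth[OF D D' ij])
    also have "\<dots> = (\<Sum>l<K. if l = j then (if i = j then fls_X else 0) else 0)"
      using ij by (intro sum.cong) auto
    finally show "(?D * ?D') $$ (i, j) = (fls_X \<cdot>\<^sub>m 1\<^sub>m K) $$ (i, j)" using ij by simp
  qed auto
  have "B *\<^sub>v x = (?M * ?D) *\<^sub>v y"
    unfolding x_def MD[symmetric] by (rule assoc_mult_mat_vec[OF B c'(1) y, symmetric])
  also have "\<dots> = ?s \<cdot>\<^sub>v ((?M * ?D) *\<^sub>v (?D' *\<^sub>v (M' *\<^sub>v u)))"
    unfolding y_def by (rule mult_mat_smult_vec[OF mult_carrier_mat[OF M D] D'M'u(1)])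
  also have "(?M * ?D) *\<^sub>v (?D' *\<^sub>v (M' *\<^sub>v u)) = ?M *\<^sub>v ((?D * ?D') *\<^sub>v (M' *\<^sub>v u))"
    using assoc_mult_mat_vec[OF M D D'M'u(1)] assoc_mult_mat_vec[OF D D' M'u(1)] by simp
  also have "(?D * ?D') *\<^sub>v (M' *\<^sub>v u) = fls_X \<cdot>\<^sub>v (M' *\<^sub>v u)" unfolding DD by (rule smult_one_mult_mat_vec[OF M'u(1)])
  also have "?M *\<^sub>v \<dots> = fls_X \<cdot>\<^sub>v (?M *\<^sub>v (M' *\<^sub>v u))" by (rule mult_mat_smult_vec[OF M M'u(1)])
  also have "?M *\<^sub>v (M' *\<^sub>v u) = (?M * M') *\<^sub>v u" by (rule assoc_mult_mat_vec[OF M M'(1) uc(1), symmetric])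
  also have "\<dots> = det ?M \<cdot>\<^sub>v u" unfolding M'(3) by (rule smult_one_mult_mat_vec[OF uc(1)])
  finally have Bx: "B *\<^sub>v x = ?s \<cdot>\<^sub>v (fls_X \<cdot>\<^sub>v (det ?M \<cdot>\<^sub>v u))" .
  have "?s * (fls_X * det ?M) = fls_X ^ N"
  proof -
    have "?b - k = Suc (?b - k - 1)" using bk by simp
    then have "fls_X ^ (?b - k) = fls_X * (fls_X :: complex fls) ^ (?b - k - 1)" by (metis power_Suc)
    then have "?s * (fls_X * det ?M) = fls_const (inverse ?t) * (det ?M * fls_X ^ (?b - k))" by (simp only: ac_simps)
    also have "\<dots> = (fls_const (inverse ?t) * fls_const ?t) * fls_X ^ N" unfolding detM by (simp only: ac_simps)
    also have "fls_const (inverse ?t) * fls_const ?t = 1" unfolding fls_const_mult_const left_inverse[OF t0] by simp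
    finally show ?thesis by simp
  qed
  then have Bx': "B *\<^sub>v x = fls_X ^ N \<cdot>\<^sub>v u" unfolding Bx smult_smult_assoc by (simp only: mult.assoc)
  let ?w = "g0 *\<^sub>v x"
  have "?w \<in> fres.matrix_flag K g0 0" using x by (auto simp: fres.matrix_flag_def fres.std_flag_def)
  then have w: "?w \<in> carrier_vec K" "fres.integral_vec ?w" using sub by (auto simp: fres.std_flag_def)
  \<comment> \<open>Column \<open>K - 1\<close> is the one that gamma sends to the first coordinate,
    with the factor epsilon^(N+1).\<close>
  have row: "K - 1 < K" "gamma_row n k (K - 1) = 0" "gamma_exp n k N (K - 1) = N + 1"
    using K_pos k by (auto simp: gamma_row_def gamma_exp_def K_of_eq)
  have vc: "v \<in> carrier_vec K" unfolding u(2) by (rule mult_mat_vec_carrier[OF g0 uc(1)])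
  have "gamma n k N *\<^sub>v ?w = fls_X ^ N \<cdot>\<^sub>v v"
    unfolding g0_B[OF x(1), symmetric] Bx' u(2) by (rule mult_mat_smult_vec[OF g0 uc(1)])
  moreover have "(gamma n k N *\<^sub>v ?w) $ 0 = fls_X ^ (N + 1) * ?w $ (K - 1)"
    using gamma_mult_vec[OF k w(1) row(1), of N] unfolding row(2,3) .
  moreover have "(fls_X ^ N \<cdot>\<^sub>v v) $ 0 = fls_X ^ N * v $ 0" using vc K_pos by simp
  ultimately have "fls_X ^ N * v $ 0 = fls_X ^ (N + 1) * ?w $ (K - 1)" by simp
  \<comment> \<open>The coefficient at epsilon^N is the nonzero constant term of
    \<open>v $ 0\<close> on the left and the coefficient at -1 of an integral series on the
    right.\<close>
  then have "fls_nth (fls_X ^ N * v $ 0) (int N) = fls_nth (fls_X ^ (N + 1) * ?w $ (K - 1)) (int N)"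
    by (rule arg_cong)
  then have "fls_nth (v $ 0) 0 = fls_nth (?w $ (K - 1)) (- 1)"
    unfolding fls_X_power_intpow fls_nth_X_intpow_mult by simp
  also have "\<dots> = 0" using fres.integral_vecD[OF w(2,1) row(1)] by (simp add: fls_is_integral_def)
  finally show False using v(2) by simp
qed

end

section \<open>Flags stable under a nilpotent operator\<close>

text \<open>Records a flag through a rectangular matrix that is not completed to an invertible one,
  so that flags move between C^K and C^d by matrix multiplication.\<close>

definition tail_span :: "nat \<Rightarrow> complex mat \<Rightarrow> nat \<Rightarrow> complex vec set" where
  "tail_span m H j = (\<lambda>v. H *\<^sub>v v) ` {v \<in> carrier_vec m. \<forall>l<j. v $ l = 0}"

lemma column_flag_tail_span:
  assumes h: "h \<in> carrier_mat D D" and m: "m \<le> D" and j: "j \<le> m"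
  shows "column_flag D h (D - m + j) = tail_span m (tail_cols m h) j"
proof -
  have cf: "column_flag D h (D - m + j) = (\<lambda>v. h *\<^sub>v v) ` {v \<in> carrier_vec D. \<forall>l<D - m + j. v $ l = 0}"
  proof -
    have "D - m + j \<le> D" using m j by arith
    then show ?thesis by (simp only: column_flag_def restrict_apply atLeastAtMost_iff le0 simp_thms if_True)
  qed
  show ?thesis
    unfolding cf tail_span_def
  proof (intro equalityI subsetI)
    fix x assume "x \<in> (\<lambda>v. h *\<^sub>v v) ` {v \<in> carrier_vec D. \<forall>l<D - m + j. v $ l = 0}"
    then obtain v where v: "v \<in> carrier_vec D" "\<And>l. l < D - m + j \<Longrightarrow> v $ l = 0" "x = h *\<^sub>v v" by auto
    let ?w = "vec m (\<lambda>l. v $ (D - m + l))"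
    have "0\<^sub>v (D - m) @\<^sub>v ?w = v"
      using v(1,2) m by (intro eq_vecI) auto
    then have "x = tail_cols m h *\<^sub>v ?w" using tail_cols_mult_vec[OF h m, of ?w] v(3) by simp
    moreover have "?w \<in> {v \<in> carrier_vec m. \<forall>l<j. v $ l = 0}" using v(2) j by auto
    ultimately show "x \<in> (\<lambda>v. tail_cols m h *\<^sub>v v) ` {v \<in> carrier_vec m. \<forall>l<j. v $ l = 0}" by blast
  next
    fix x assume "x \<in> (\<lambda>v. tail_cols m h *\<^sub>v v) ` {v \<in> carrier_vec m. \<forall>l<j. v $ l = 0}"
    then obtain w where w: "w \<in> carrier_vec m" "\<And>l. l < j \<Longrightarrow> w $ l = 0" "x = tail_cols m h *\<^sub>v w" by auto
    let ?v = "0\<^sub>v (D - m) @\<^sub>v w"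
    have "?v \<in> carrier_vec D" using append_carrier_vec[OF zero_carrier_vec w(1), of "D - m"] m by simp
    moreover have "?v $ l = 0" if "l < D - m + j" for l
      using w(1,2) that j by (cases "l < D - m") auto
    moreover have "x = h *\<^sub>v ?v" using tail_cols_mult_vec[OF h m w(1)] w(3) by simp
    ultimately show "x \<in> (\<lambda>v. h *\<^sub>v v) ` {v \<in> carrier_vec D. \<forall>l<D - m + j. v $ l = 0}" by blast
  qed
qed

lemma tail_span_mult:
  assumes P: "P \<in> carrier_mat r c" and H: "H \<in> carrier_mat c m"
  shows "tail_span m (P * H) j = (\<lambda>w. P *\<^sub>v w) ` tail_span m H j"
  unfolding tail_span_def image_image
  by (intro image_cong) (use assms in \<open>auto simp: assoc_mult_mat_vec[of _ r c _ m]\<close>)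

lemma tail_span_carrier: "H \<in> carrier_mat c m \<Longrightarrow> tail_span m H j \<subseteq> carrier_vec c"
  unfolding tail_span_def by auto

lemma tail_span_0: "tail_span m H 0 = (\<lambda>v. H *\<^sub>v v) ` carrier_vec m"
  by (simp add: tail_span_def)

lemma tail_span_antimono: "i \<le> j \<Longrightarrow> tail_span m H j \<subseteq> tail_span m H i"
  unfolding tail_span_def by (intro image_mono) auto

lemma mat_factor:
  fixes E :: "'a :: comm_ring_1 mat"
  assumes E: "E \<in> carrier_mat r m" and H: "H \<in> carrier_mat r n"
    and range: "\<And>v. v \<in> carrier_vec m \<Longrightarrow> \<exists>w\<in>carrier_vec n. E *\<^sub>v v = H *\<^sub>v w"
  obtains E' where "E' \<in> carrier_mat n m" "E = H * E'"
proof -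
  have "\<forall>j. \<exists>w. w \<in> carrier_vec n \<and> E *\<^sub>v unit_vec m j = H *\<^sub>v w" using range unit_vec_carrier by blast
  then obtain w where w: "\<And>j. w j \<in> carrier_vec n" "\<And>j. E *\<^sub>v unit_vec m j = H *\<^sub>v w j" by metis
  let ?E = "mat_of_cols n (map w [0..<m])"
  have E': "?E \<in> carrier_mat n m" by (rule carrier_matI) simp_all
  have "E = H * ?E"
  proof (rule mat_col_eqI)
    fix j assume "j < dim_col (H * ?E)"
    then have j: "j < m" by simp
    have "col ?E j = w j" using w(1)[of j] j by simp
    then show "col E j = col (H * ?E) j"
      using w(2)[of j] mult_mat_vec_unit[OF E j] col_mult2[OF H E' j] by simp
  qed (use E H in auto)
  then show thesis using that E' by blast
qed

text \<open>The common form of the conditions on the two sides: \<open>A\<close>-stable flags in C^K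
  containing the image of A^(n-k), and \<open>G\<close>-stable flags in C^d containing the image of
  G^(n-|mu|).\<close>

definition good_tail :: "nat \<Rightarrow> nat \<Rightarrow> nat \<Rightarrow> complex mat \<Rightarrow> complex mat \<Rightarrow> bool" where
  "good_tail D n e T H \<longleftrightarrow> (\<forall>j\<le>n. \<forall>w\<in>tail_span n H j. T *\<^sub>v w \<in> tail_span n H j) \<and>
     (\<forall>w\<in>carrier_vec D. (T ^\<^sub>m e) *\<^sub>v w \<in> tail_span n H 0)"

text \<open>In addition to the identities of a truncation, the columns of \<open>E\<close> form a basis of $\mathrm{im}\, A^e$.\<close>

locale truncated_pair =
  fixes q e m D d r :: nat and A G Q R M M' N E X Y :: "complex mat"
  assumes A: "A \<in> carrier_mat D D" and G: "G \<in> carrier_mat d d" and Q: "Q \<in> carrier_mat D d"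
    and R: "R \<in> carrier_mat d D" and M: "M \<in> carrier_mat d D" and M': "M' \<in> carrier_mat D d"
    and N: "N \<in> carrier_mat D D"
    and AQ: "A * Q = Q * G" and RQ: "R * Q = 1\<^sub>m d" and Ae: "A ^\<^sub>m e = Q * G ^\<^sub>m q * M"
    and QGq: "Q * G ^\<^sub>m q = A ^\<^sub>m e * M'" and QRN: "Q * R + N * A ^\<^sub>m q = 1\<^sub>m D" and NAe: "N * A ^\<^sub>m e = 0\<^sub>m D D"
    and E: "E \<in> carrier_mat D m" "injective_mat E" and X: "X \<in> carrier_mat D m" and Y: "Y \<in> carrier_mat m D"
    and EX: "E = A ^\<^sub>m e * X" and EY: "A ^\<^sub>m e = E * Y"
    and nil: "A ^\<^sub>m r = 0\<^sub>m D D"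
begin

lemma Ae_carrier: "A ^\<^sub>m e \<in> carrier_mat D D"
  by (rule pow_carrier_mat[OF A])

lemma A_Ae:
  assumes "x \<in> carrier_vec D"
  shows "A *\<^sub>v ((A ^\<^sub>m e) *\<^sub>v x) = (A ^\<^sub>m e) *\<^sub>v (A *\<^sub>v x)"
proof -
  have "A * A ^\<^sub>m e = A ^\<^sub>m e * A"
    by (induction e) (use A in \<open>simp_all add: assoc_mult_mat[of _ D D _ D _ D, symmetric]\<close>)
  then show ?thesis
    using assoc_mult_mat_vec[OF A Ae_carrier assms] assoc_mult_mat_vec[OF Ae_carrier A assms] by simp
qed

lemma E_range: "(\<lambda>v. E *\<^sub>v v) ` carrier_vec m = (\<lambda>x. (A ^\<^sub>m e) *\<^sub>v x) ` carrier_vec D"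
proof (intro equalityI subsetI)
  fix x assume "x \<in> (\<lambda>v. E *\<^sub>v v) ` carrier_vec m"
  then obtain v where v: "v \<in> carrier_vec m" "x = E *\<^sub>v v" by blast
  then have "x = (A ^\<^sub>m e) *\<^sub>v (X *\<^sub>v v)" using assoc_mult_mat_vec[OF Ae_carrier X v(1)] EX by simp
  then show "x \<in> (\<lambda>x. (A ^\<^sub>m e) *\<^sub>v x) ` carrier_vec D" using mult_mat_vec_carrier[OF X v(1)] by blast
next
  fix x assume "x \<in> (\<lambda>x. (A ^\<^sub>m e) *\<^sub>v x) ` carrier_vec D"
  then obtain v where v: "v \<in> carrier_vec D" "x = (A ^\<^sub>m e) *\<^sub>v v" by blast
  then have "x = E *\<^sub>v (Y *\<^sub>v v)" using assoc_mult_mat_vec[OF E(1) Y v(1)] EY by simp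
  then show "x \<in> (\<lambda>v. E *\<^sub>v v) ` carrier_vec m" using mult_mat_vec_carrier[OF Y v(1)] by blast
qed

text \<open>The columns of \<open>E\<close> lie in the span of \<open>H\<close> because that span
  contains the image of \<open>A ^\<^sub>m e\<close>; their independence then gives
  \<open>m \<le> n\<close>.\<close>

lemma good_tail_factor:
  assumes H: "injective_mat H" "H \<in> carrier_mat D n" and Ae: "\<And>w. w \<in> carrier_vec D \<Longrightarrow> (A ^\<^sub>m e) *\<^sub>v w \<in> tail_span n H 0"
  obtains E' where "E' \<in> carrier_mat n m" "E = H * E'" "injective_mat E'" "m \<le> n"
proof -
  have "\<exists>w\<in>carrier_vec n. E *\<^sub>v v = H *\<^sub>v w" if v: "v \<in> carrier_vec m" for v
  proof -
    have "E *\<^sub>v v \<in> (\<lambda>x. (A ^\<^sub>m e) *\<^sub>v x) ` carrier_vec D" using v E_range by blast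
    then have "E *\<^sub>v v \<in> tail_span n H 0" using Ae by auto
    then show ?thesis unfolding tail_span_0 by blast
  qed
  then obtain E' where E': "E' \<in> carrier_mat n m" "E = H * E'" using mat_factor[OF E(1) H(2)] by blast
  have "injective_mat E'"
    unfolding injective_mat_def
  proof (intro ballI impI)
    fix v assume "v \<in> carrier_vec (dim_col E')" "E' *\<^sub>v v = 0\<^sub>v (dim_row E')"
    then have v: "v \<in> carrier_vec m" "E' *\<^sub>v v = 0\<^sub>v n" using E'(1) by auto
    have "E *\<^sub>v v = H *\<^sub>v (E' *\<^sub>v v)" unfolding E'(2) by (rule assoc_mult_mat_vec[OF H(2) E'(1) v(1)])
    also have "\<dots> = 0\<^sub>v D" unfolding v(2) using H(2) by (intro eq_vecI) auto
    finally show "v = 0\<^sub>v (dim_col E')" using injective_matD[OF E(2,1) v(1)] E'(1) by simp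
  qed
  then show thesis using that E' injective_mat_cols_le_rows by blast
qed

text \<open>The quotient of the span of \<open>H\<close> by the image of
  \<open>A ^\<^sub>m e\<close> has dimension \<open>n - m = q\<close>, so the \<open>q\<close>-th
  power of the nilpotent \<open>A\<close> vanishes on it.\<close>

lemma pow_tail_span:
  assumes H: "injective_mat H" "H \<in> carrier_mat D n" and g: "good_tail D n e A H" and qm: "q + m = n"
    and w: "w \<in> tail_span n H 0"
  obtains x where "x \<in> carrier_vec D" "(A ^\<^sub>m q) *\<^sub>v w = (A ^\<^sub>m e) *\<^sub>v x"
proof -
  have Aew: "\<And>w. w \<in> carrier_vec D \<Longrightarrow> (A ^\<^sub>m e) *\<^sub>v w \<in> tail_span n H 0" using g by (simp add: good_tail_def)
  obtain E' where E': "E' \<in> carrier_mat n m" "E = H * E'" "injective_mat E'" "m \<le> n"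
    using good_tail_factor[OF H Aew] .
  \<comment> \<open>A change of basis of the span of \<open>H\<close> by \<open>z\<close> makes the
    last \<open>m\<close> columns equal to \<open>E\<close>. After completion to \<open>c\<close>,
    both spaces are members of a single column flag, whose quotients have known dimension.\<close>
  obtain z where z: "z \<in> GL n" "tail_cols m z = E'" using complete_to_GL[OF E'(3,1)] .
  note zc = GL_carrier[OF z(1)]
  have Hz: "H * z \<in> carrier_mat D n" using H zc by simp
  have "injective_mat (H * z)" by (rule injective_mat_mult[OF H(1) injective_mat_GL[OF z(1)] H(2) zc])
  then obtain c where c: "c \<in> GL D" "tail_cols n c = H * z" using complete_to_GL[OF _ Hz] by blast
  note cc = GL_carrier[OF c(1)]
  have nD: "n \<le> D" using injective_mat_cols_le_rows[OF H] .
  have W: "cres.matrix_flag D c (D - n) = tail_span n H 0"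
  proof -
    have "cres.matrix_flag D c (D - n) = column_flag D c (D - n + 0)" by (simp add: column_flag_eq)
    also have "\<dots> = (\<lambda>v. (H * z) *\<^sub>v v) ` carrier_vec n"
      unfolding column_flag_tail_span[OF cc nD le0] c(2) tail_span_0 ..
    also have "\<dots> = (\<lambda>v. H *\<^sub>v v) ` (\<lambda>v. z *\<^sub>v v) ` carrier_vec n"
      unfolding image_image using H zc by (intro image_cong) (auto simp: assoc_mult_mat_vec[of _ D n _ n])
    also have "(\<lambda>v. z *\<^sub>v v) ` carrier_vec n = carrier_vec n"
    proof -
      obtain z' where z': "z' \<in> carrier_mat n n" "z * z' = 1\<^sub>m n" using GL_E[OF z(1)] by metis
      have "z *\<^sub>v (z' *\<^sub>v v) = v" if "v \<in> carrier_vec n" for v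
        using assoc_mult_mat_vec[OF zc z'(1) that] z'(2) that by simp
      moreover have "z' *\<^sub>v v \<in> carrier_vec n" if "v \<in> carrier_vec n" for v using z' that by simp
      ultimately have "carrier_vec n \<subseteq> (\<lambda>v. z *\<^sub>v v) ` carrier_vec n" by (metis imageI subsetI)
      then show ?thesis using zc by auto
    qed
    finally show ?thesis by (simp add: tail_span_0)
  qed
  have tc: "tail_cols m c = E"
  proof -
    have "tail_cols m c = tail_cols m (H * z)" unfolding c(2)[symmetric]
      using tail_cols_tail_cols[of m n c] E'(4) nD cc by simp
    also have "\<dots> = H * tail_cols m z"
    proof (rule eq_matI)
      fix i j assume "i < dim_row (H * tail_cols m z)" "j < dim_col (H * tail_cols m z)"
      then have ij: "i < D" "j < m" using H by (auto simp: tail_cols_def)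
      have "tail_cols m (H * z) $$ (i, j) = (H * z) $$ (i, n - m + j)" using ij H zc by (simp add: tail_cols_def)
      also have "\<dots> = (\<Sum>l<n. H $$ (i, l) * z $$ (l, n - m + j))"
        using ij E'(4) by (intro mult_mat_nth[OF H(2) zc]) auto
      also have "\<dots> = (\<Sum>l<n. H $$ (i, l) * tail_cols m z $$ (l, j))"
        using ij zc by (intro sum.cong) (auto simp: tail_cols_def)
      also have "\<dots> = (H * tail_cols m z) $$ (i, j)"
        by (rule mult_mat_nth[OF H(2) tail_cols_carrier[OF zc] ij, symmetric])
      finally show "tail_cols m (H * z) $$ (i, j) = (H * tail_cols m z) $$ (i, j)" .
    qed (auto simp: tail_cols_def)
    finally show ?thesis using z(2) E'(2) by simp
  qed
  have mD: "m \<le> D" using E'(4) nD by simp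
  have Im: "cres.matrix_flag D c (D - m) = (\<lambda>x. (A ^\<^sub>m e) *\<^sub>v x) ` carrier_vec D"
  proof -
    have "cres.matrix_flag D c (D - m) = column_flag D c (D - m + 0)" by (simp add: column_flag_eq)
    also have "\<dots> = (\<lambda>v. E *\<^sub>v v) ` carrier_vec m"
      unfolding column_flag_tail_span[OF cc mD le0] tc tail_span_0 ..
    finally show ?thesis using E_range by simp
  qed
  have "D - n \<le> D - m" "D - m \<le> D" "D - m - (D - n) = q" using E'(4) nD qm by auto
  then have dim: "has_quotient_dim (\<lambda>c. c) D (cres.matrix_flag D c (D - n)) (cres.matrix_flag D c (D - m)) q"
    using cres.matrix_flag_quotient_dim[OF c(1), of "D - n" "D - m"] by simp
  have qo: "quotient_operator (\<lambda>c. c) D A (cres.matrix_flag D c (D - n)) (cres.matrix_flag D c (D - m))"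
  proof
    show "A *\<^sub>v u \<in> cres.matrix_flag D c (D - n)" if "u \<in> cres.matrix_flag D c (D - n)" for u
      using that g unfolding W good_tail_def by blast
    show "A *\<^sub>v u \<in> cres.matrix_flag D c (D - m)" if u: "u \<in> cres.matrix_flag D c (D - m)" for u
    proof -
      obtain x where x: "x \<in> carrier_vec D" "u = (A ^\<^sub>m e) *\<^sub>v x" using u unfolding Im by blast
      then show ?thesis unfolding Im using A_Ae[OF x(1)] mult_mat_vec_carrier[OF A x(1)] by auto
    qed
  qed (use A cc \<open>D - n \<le> D - m\<close> cres.scalar_subspace_matrix_flag cres.matrix_flag_antimono cres.sc_hom in auto)
  have "(A ^\<^sub>m q) *\<^sub>v w \<in> cres.matrix_flag D c (D - m)"
  proof (rule quotient_operator.pow_quotient_dim[OF qo dim, of r])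
    fix u assume "u \<in> cres.matrix_flag D c (D - n)"
    then have "u \<in> carrier_vec D" unfolding W using tail_span_carrier[OF H(2)] by blast
    then have "(A ^\<^sub>m r) *\<^sub>v u = 0\<^sub>v D" unfolding nil by (rule zero_mat_mult_vec)
    then show "(A ^\<^sub>m r) *\<^sub>v u \<in> cres.matrix_flag D c (D - m)"
      using scalar_subspaceD(3)[OF cres.scalar_subspace_matrix_flag[OF cc]] by simp
  qed (use w in \<open>simp add: W\<close>)
  then show thesis using that unfolding Im by blast
qed

text \<open>Apply \<open>Q * R + N * A ^\<^sub>m q = 1\<^sub>m D\<close> to \<open>w\<close>: the
  second summand contributes nothing, because \<open>A ^\<^sub>m q\<close> takes \<open>w\<close>
  into the image of \<open>A ^\<^sub>m e\<close>, which \<open>N\<close> kills.\<close>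

lemma tail_in_range:
  assumes H: "injective_mat H" "H \<in> carrier_mat D n" and g: "good_tail D n e A H" and qm: "q + m = n"
    and w: "w \<in> tail_span n H 0"
  shows "Q *\<^sub>v (R *\<^sub>v w) = w"
proof -
  have wc: "w \<in> carrier_vec D" using w tail_span_carrier[OF H(2)] by blast
  obtain x where x: "x \<in> carrier_vec D" "(A ^\<^sub>m q) *\<^sub>v w = (A ^\<^sub>m e) *\<^sub>v x"
    using pow_tail_span[OF H g qm w] .
  have Aq: "A ^\<^sub>m q \<in> carrier_mat D D" by (rule pow_carrier_mat[OF A])
  have "w = (Q * R + N * A ^\<^sub>m q) *\<^sub>v w" unfolding QRN using wc by simp
  also have "\<dots> = Q * R *\<^sub>v w + N * A ^\<^sub>m q *\<^sub>v w"
    by (rule add_mult_distrib_mat_vec[OF mult_carrier_mat[OF Q R] mult_carrier_mat[OF N Aq] wc])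
  also have "N * A ^\<^sub>m q *\<^sub>v w = N *\<^sub>v ((A ^\<^sub>m e) *\<^sub>v x)"
    unfolding assoc_mult_mat_vec[OF N Aq wc] x(2) ..
  also have "\<dots> = 0\<^sub>v D"
    unfolding assoc_mult_mat_vec[OF N Ae_carrier x(1), symmetric] NAe by (rule zero_mat_mult_vec[OF x(1)])
  also have "Q * R *\<^sub>v w = Q *\<^sub>v (R *\<^sub>v w)" by (rule assoc_mult_mat_vec[OF Q R wc])
  finally have "w = Q *\<^sub>v (R *\<^sub>v w) + 0\<^sub>v D" .
  then show ?thesis using mult_mat_vec_carrier[OF Q mult_mat_vec_carrier[OF R wc]] by simp
qed

lemma R_Q: "y \<in> carrier_vec d \<Longrightarrow> R *\<^sub>v (Q *\<^sub>v y) = y"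
  using assoc_mult_mat_vec[OF R Q, of y] RQ by simp

lemma A_Q: "y \<in> carrier_vec d \<Longrightarrow> A *\<^sub>v (Q *\<^sub>v y) = Q *\<^sub>v (G *\<^sub>v y)"
  using assoc_mult_mat_vec[OF A Q, of y] assoc_mult_mat_vec[OF Q G, of y] AQ by simp

lemma injective_Q: "injective_mat Q"
  by (rule injective_mat_of_left_inverse[OF Q R RQ])

text \<open>On the range of \<open>Q\<close>, which contains the span of \<open>H\<close>, the left
  inverse \<open>R\<close> is an inverse and intertwines \<open>A\<close> with \<open>G\<close>. The
  image of \<open>G ^\<^sub>m q\<close> is covered because \<open>Q * G ^\<^sub>m q\<close> factors
  through \<open>A ^\<^sub>m e\<close>.\<close>

lemma good_tail_restrict:
  assumes H: "injective_mat H" "H \<in> carrier_mat D n" and g: "good_tail D n e A H" and qm: "q + m = n"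
  shows "Q * (R * H) = H" "injective_mat (R * H)" "good_tail d n q G (R * H)"
proof -
  have RH: "R * H \<in> carrier_mat d n" using R H by simp
  note range = tail_in_range[OF H g qm]
  show QRH: "Q * (R * H) = H"
  proof (rule eq_mat_of_mult_vec[OF mult_carrier_mat[OF Q RH] H(2)])
    fix v :: "complex vec" assume v: "v \<in> carrier_vec n"
    have "H *\<^sub>v v \<in> tail_span n H 0" unfolding tail_span_0 using v by blast
    from range[OF this] show "Q * (R * H) *\<^sub>v v = H *\<^sub>v v"
      unfolding assoc_mult_mat_vec[OF Q RH v] assoc_mult_mat_vec[OF R H(2) v] .
  qed
  show "injective_mat (R * H)"
    unfolding injective_mat_def
  proof (intro ballI impI)
    fix v assume "v \<in> carrier_vec (dim_col (R * H))" "R * H *\<^sub>v v = 0\<^sub>v (dim_row (R * H))"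
    then have v: "v \<in> carrier_vec n" "R * H *\<^sub>v v = 0\<^sub>v d" using H R by auto
    have "Q *\<^sub>v (0\<^sub>v d) = 0\<^sub>v D" using Q by (intro eq_vecI) auto
    then have "H *\<^sub>v v = 0\<^sub>v D" using assoc_mult_mat_vec[OF Q RH v(1)] v(2) QRH by simp
    then show "v = 0\<^sub>v (dim_col (R * H))" using injective_matD[OF H v(1)] H(2) by simp
  qed
  have span: "tail_span n (R * H) j = (\<lambda>w. R *\<^sub>v w) ` tail_span n H j" for j by (rule tail_span_mult[OF R H(2)])
  have GR: "G *\<^sub>v (R *\<^sub>v w) = R *\<^sub>v (A *\<^sub>v w)" if "w \<in> tail_span n H 0" for w
  proof -
    have wc: "w \<in> carrier_vec D" using that tail_span_carrier[OF H(2)] by blast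
    have Rw: "R *\<^sub>v w \<in> carrier_vec d" by (rule mult_mat_vec_carrier[OF R wc])
    have "R *\<^sub>v (A *\<^sub>v w) = R *\<^sub>v (A *\<^sub>v (Q *\<^sub>v (R *\<^sub>v w)))" unfolding range[OF that] ..
    also have "\<dots> = G *\<^sub>v (R *\<^sub>v w)" unfolding A_Q[OF Rw] by (rule R_Q[OF mult_mat_vec_carrier[OF G Rw]])
    finally show ?thesis by simp
  qed
  show "good_tail d n q G (R * H)"
    unfolding good_tail_def
  proof (intro conjI allI impI ballI)
    fix j w assume "j \<le> n" "w \<in> tail_span n (R * H) j"
    then obtain x where x: "x \<in> tail_span n H j" "w = R *\<^sub>v x" unfolding span by blast
    have "G *\<^sub>v w = R *\<^sub>v (A *\<^sub>v x)" using GR[of x] x tail_span_antimono[of 0 j n H] by auto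
    moreover have "A *\<^sub>v x \<in> tail_span n H j" using g x \<open>j \<le> n\<close> unfolding good_tail_def by blast
    ultimately show "G *\<^sub>v w \<in> tail_span n (R * H) j" unfolding span by blast
  next
    fix y :: "complex vec" assume y: "y \<in> carrier_vec d"
    have Gq: "G ^\<^sub>m q \<in> carrier_mat d d" by (rule pow_carrier_mat[OF G])
    have "Q *\<^sub>v ((G ^\<^sub>m q) *\<^sub>v y) = (A ^\<^sub>m e) *\<^sub>v (M' *\<^sub>v y)"
      using assoc_mult_mat_vec[OF Q Gq y] assoc_mult_mat_vec[OF Ae_carrier M' y] QGq by simp
    also have "\<dots> \<in> tail_span n H 0" using g mult_mat_vec_carrier[OF M' y] unfolding good_tail_def by blast
    finally have "R *\<^sub>v (Q *\<^sub>v ((G ^\<^sub>m q) *\<^sub>v y)) \<in> tail_span n (R * H) 0" unfolding span by blast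
    then show "(G ^\<^sub>m q) *\<^sub>v y \<in> tail_span n (R * H) 0" using R_Q[OF mult_mat_vec_carrier[OF Gq y]] by simp
  qed
qed

text \<open>\<open>A ^\<^sub>m e = Q * G ^\<^sub>m q * M\<close> puts the image of
  \<open>A ^\<^sub>m e\<close> into the image under \<open>Q\<close> of that of
  \<open>G ^\<^sub>m q\<close>.\<close>

lemma good_tail_extend:
  assumes H: "H \<in> carrier_mat d n" and g: "good_tail d n q G H"
  shows "good_tail D n e A (Q * H)"
proof -
  have span: "tail_span n (Q * H) j = (\<lambda>w. Q *\<^sub>v w) ` tail_span n H j" for j by (rule tail_span_mult[OF Q H])
  show ?thesis
    unfolding good_tail_def
  proof (intro conjI allI impI ballI)
    fix j w assume "j \<le> n" "w \<in> tail_span n (Q * H) j"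
    then obtain x where x: "x \<in> tail_span n H j" "w = Q *\<^sub>v x" unfolding span by blast
    have "x \<in> carrier_vec d" using x(1) tail_span_carrier[OF H] by blast
    then have "A *\<^sub>v w = Q *\<^sub>v (G *\<^sub>v x)" using A_Q x(2) by simp
    moreover have "G *\<^sub>v x \<in> tail_span n H j" using g x \<open>j \<le> n\<close> unfolding good_tail_def by blast
    ultimately show "A *\<^sub>v w \<in> tail_span n (Q * H) j" unfolding span by blast
  next
    fix w :: "complex vec" assume w: "w \<in> carrier_vec D"
    have Gq: "G ^\<^sub>m q \<in> carrier_mat d d" by (rule pow_carrier_mat[OF G])
    have Mw: "M *\<^sub>v w \<in> carrier_vec d" by (rule mult_mat_vec_carrier[OF M w])
    have "(A ^\<^sub>m e) *\<^sub>v w = Q *\<^sub>v ((G ^\<^sub>m q) *\<^sub>v (M *\<^sub>v w))"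
      using assoc_mult_mat_vec[OF mult_carrier_mat[OF Q Gq] M w] assoc_mult_mat_vec[OF Q Gq Mw] Ae by simp
    moreover have "(G ^\<^sub>m q) *\<^sub>v (M *\<^sub>v w) \<in> tail_span n H 0" using g Mw unfolding good_tail_def by blast
    ultimately show "(A ^\<^sub>m e) *\<^sub>v w \<in> tail_span n (Q * H) 0" unfolding span by blast
  qed
qed

end

section \<open>$\Delta$-Springer flags\<close>

lemma subspace_iff_scalar_subspace:
  "subspace class_ring W (module_vec TYPE(complex) d) \<longleftrightarrow> scalar_subspace (\<lambda>c. c) d W"
proof
  assume "subspace class_ring W (module_vec TYPE(complex) d)"
  then have "submodule class_ring W (module_vec TYPE(complex) d)" by (simp add: subspace_def)
  then show "scalar_subspace (\<lambda>c. c) d W"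
    unfolding submodule_def scalar_subspace_def by (auto simp: module_vec_simps class_ring_simps)
next
  assume "scalar_subspace (\<lambda>c. c) d W"
  then have "submodule class_ring W (module_vec TYPE(complex) d)"
    unfolding submodule_def scalar_subspace_def
    using vec_module[of d] by (auto simp: module_vec_simps class_ring_simps)
  then show "subspace class_ring W (module_vec TYPE(complex) d)" using vec_vs by (simp add: subspace_def)
qed

lemma sum_list_nu_part:
  assumes "length mu \<le> s"
  shows "sum_list (nu_part n mu s) = s * (n - sum_list mu) + sum_list mu"
proof -
  have f: "sum_list (filter (\<lambda>l. 0 < l) xs) = sum_list xs" for xs :: "nat list" by (induction xs) auto
  let ?f = "\<lambda>i. if i < length mu then mu ! i else 0"
  have "sum_list (nu_part n mu s) = (\<Sum>i<s. (n - sum_list mu) + ?f i)"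
    unfolding nu_part_def f by (simp add: interv_sum_list_conv_sum_set_nat atLeast0LessThan)
  also have "\<dots> = s * (n - sum_list mu) + (\<Sum>i<s. ?f i)" by (simp add: sum.distrib)
  also have "(\<Sum>i<s. ?f i) = (\<Sum>i<length mu. mu ! i)"
    using assms by (intro sum.mono_neutral_cong_right) auto
  also have "\<dots> = sum_list mu" by (simp add: sum_list_sum_nth atLeast0LessThan)
  finally show ?thesis .
qed

lemma column_flag_tail_cong:
  assumes "h \<in> carrier_mat d d" "h' \<in> carrier_mat d d" "m \<le> d" "tail_cols m h = tail_cols m h'" "d - m \<le> i" "i \<le> d"
  shows "column_flag d h i = column_flag d h' i"
proof -
  have "i = d - m + (i - (d - m))" "i - (d - m) \<le> m" using assms by auto
  then show ?thesis using column_flag_tail_span[OF assms(1,3)] column_flag_tail_span[OF assms(2,3)] assms(4) by metis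
qed

lemma column_flag_0:
  assumes "h \<in> GL d"
  shows "column_flag d h 0 = carrier_vec d"
proof -
  obtain h' where h': "h' \<in> carrier_mat d d" "h * h' = 1\<^sub>m d" using GL_E[OF assms] by metis
  note hc = GL_carrier[OF assms]
  have "v = h *\<^sub>v (h' *\<^sub>v v)" if "v \<in> carrier_vec d" for v
    using assoc_mult_mat_vec[OF hc h'(1) that] h'(2) that by simp
  moreover have "h' *\<^sub>v v \<in> carrier_vec d" if "v \<in> carrier_vec d" for v using h' that by simp
  ultimately have "carrier_vec d \<subseteq> (\<lambda>v. h *\<^sub>v v) ` carrier_vec d" by (metis imageI subsetI)
  then show ?thesis using hc by (auto simp: column_flag_def)
qed

lemma column_flag_last: "h \<in> carrier_mat d d \<Longrightarrow> column_flag d h d = {0\<^sub>v d}"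
proof -
  assume h: "h \<in> carrier_mat d d"
  have "{v :: complex vec. v \<in> carrier_vec d \<and> (\<forall>j<d. v $ j = 0)} = {0\<^sub>v d}" by (auto intro!: eq_vecI)
  moreover have "h *\<^sub>v 0\<^sub>v d = 0\<^sub>v d" using h by (intro eq_vecI) auto
  ultimately show ?thesis by (simp add: column_flag_def)
qed

lemma injective_mat_of_quotient_basis:
  assumes W: "scalar_subspace (\<lambda>c. c) d W" and qb: "quotient_basis (\<lambda>c. c) d W {0\<^sub>v d} vs"
  shows "injective_mat (mat_of_cols d vs)" "mat_of_cols d vs \<in> carrier_mat d (length vs)"
    "W = (\<lambda>v. mat_of_cols d vs *\<^sub>v v) ` carrier_vec (length vs)"
proof -
  let ?V = "mat_of_cols d vs" and ?l = "length vs"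
  show V: "?V \<in> carrier_mat d ?l" by simp
  have id: "map_vec (\<lambda>c. c) c = c" for c :: "complex vec" by (intro eq_vecI) auto
  have ex1: "\<exists>!c. c \<in> carrier_vec ?l \<and> u - ?V *\<^sub>v c = 0\<^sub>v d" if "u \<in> W" for u
    using qb that unfolding quotient_basis_def id by auto
  have V0: "?V *\<^sub>v 0\<^sub>v ?l = 0\<^sub>v d" by (intro eq_vecI) auto
  show "injective_mat ?V"
    unfolding injective_mat_def
  proof (intro ballI impI)
    fix v assume "v \<in> carrier_vec (dim_col ?V)" "?V *\<^sub>v v = 0\<^sub>v (dim_row ?V)"
    then have v: "v \<in> carrier_vec ?l" "0\<^sub>v d - ?V *\<^sub>v v = 0\<^sub>v d" by auto
    have "0\<^sub>v d - ?V *\<^sub>v 0\<^sub>v ?l = 0\<^sub>v d" unfolding V0 by simp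
    then have "v = 0\<^sub>v ?l" using ex1[OF scalar_subspaceD(3)[OF W]] v by (metis zero_carrier_vec)
    then show "v = 0\<^sub>v (dim_col ?V)" by simp
  qed
  show "W = (\<lambda>v. ?V *\<^sub>v v) ` carrier_vec ?l"
  proof (intro equalityI subsetI)
    fix u assume u: "u \<in> W"
    then obtain c where c: "c \<in> carrier_vec ?l" "u - ?V *\<^sub>v c = 0\<^sub>v d" using ex1 by blast
    have uc: "u \<in> carrier_vec d" by (rule scalar_subspaceD(2)[OF W u])
    have "u = ?V *\<^sub>v c"
    proof (rule eq_vecI)
      fix i assume "i < dim_vec (?V *\<^sub>v c)"
      then have i: "i < d" by simp
      have "(u - ?V *\<^sub>v c) $ i = 0" using c(2) i by simp
      then show "u $ i = (?V *\<^sub>v c) $ i" using i uc by simp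
    qed (use uc in simp)
    then show "u \<in> (\<lambda>v. ?V *\<^sub>v v) ` carrier_vec ?l" using c(1) by blast
  next
    fix u assume "u \<in> (\<lambda>v. ?V *\<^sub>v v) ` carrier_vec ?l"
    then obtain c where c: "c \<in> carrier_vec ?l" "u = ?V *\<^sub>v c" by blast
    have "col ?V j \<in> W" if "j < ?l" for j
    proof -
      have "vs ! j \<in> W" using qb that unfolding quotient_basis_def by auto
      then show ?thesis using scalar_subspaceD(2)[OF W] that by simp
    qed
    then have "?V *\<^sub>v map_vec (\<lambda>c. c) c \<in> W" by (rule scalar_subspace_mult_mat_vec[OF W V c(1)])
    then show "u \<in> W" unfolding id c(2) .
  qed
qed

text \<open>The basis grows one flag member at a time, from the smallest up. A basis of the next
  member need not end in the earlier one, so it is corrected by an invertible matrix.\<close>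

lemma flag_adapted_basis:
  assumes sub: "\<And>i. d - n \<le> i \<Longrightarrow> i \<le> d \<Longrightarrow> scalar_subspace (\<lambda>c. c) d (F i)"
    and dim: "\<And>i. d - n \<le> i \<Longrightarrow> i \<le> d \<Longrightarrow> has_quotient_dim (\<lambda>c. c) d (F i) {0\<^sub>v d} (d - i)"
    and mono: "\<And>i j. d - n \<le> i \<Longrightarrow> i \<le> j \<Longrightarrow> j \<le> d \<Longrightarrow> F j \<subseteq> F i"
    and Fd: "F d = {0\<^sub>v d}" and nd: "n \<le> d"
  obtains h where "h \<in> GL d" "\<And>i. d - n \<le> i \<Longrightarrow> i \<le> d \<Longrightarrow> F i = column_flag d h i"
proof -
  have "\<exists>h\<in>GL d. \<forall>i. d - r \<le> i \<and> i \<le> d \<longrightarrow> F i = column_flag d h i" if "r \<le> n" for r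
    using that
  proof (induction r)
    case 0
    have "(1\<^sub>m d :: complex mat) \<in> GL d" by (rule GL_I[of _ _ "1\<^sub>m d"]) auto
    then show ?case using Fd column_flag_last[of "1\<^sub>m d" d] by (intro bexI[of _ "1\<^sub>m d"]) auto
  next
    case (Suc r)
    then obtain h where h: "h \<in> GL d" "\<And>i. d - r \<le> i \<Longrightarrow> i \<le> d \<Longrightarrow> F i = column_flag d h i" by auto
    note hc = GL_carrier[OF h(1)]
    have rd: "Suc r \<le> d" and i0: "d - n \<le> d - Suc r" using Suc.prems nd by auto
    obtain vs where vs: "quotient_basis (\<lambda>c. c) d (F (d - Suc r)) {0\<^sub>v d} vs" "length vs = Suc r"
      using dim[OF i0] rd unfolding has_quotient_dim_def by auto
    let ?V = "mat_of_cols d vs"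
    have V: "injective_mat ?V" "?V \<in> carrier_mat d (Suc r)" "F (d - Suc r) = (\<lambda>v. ?V *\<^sub>v v) ` carrier_vec (Suc r)"
      using injective_mat_of_quotient_basis[OF sub[OF i0] vs(1)] vs(2) by auto
    let ?T = "tail_cols r h"
    have T: "?T \<in> carrier_mat d r" "injective_mat ?T"
      using tail_cols_carrier[OF hc] injective_tail_cols[OF injective_mat_GL[OF h(1)] hc] rd by auto
    have Fr: "F (d - r) = (\<lambda>v. ?T *\<^sub>v v) ` carrier_vec r"
      using h(2)[of "d - r"] column_flag_tail_span[OF hc, of r 0] rd by (simp add: tail_span_0)
    have "\<exists>w\<in>carrier_vec (Suc r). ?T *\<^sub>v v = ?V *\<^sub>v w" if "v \<in> carrier_vec r" for v
    proof -
      have "?T *\<^sub>v v \<in> F (d - r)" unfolding Fr using that by blast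
      then have "?T *\<^sub>v v \<in> F (d - Suc r)" using mono[OF i0, of "d - r"] by (simp add: diff_le_mono2 subset_iff)
      then show ?thesis unfolding V(3) by blast
    qed
    then obtain Z where Z: "Z \<in> carrier_mat (Suc r) r" "?T = ?V * Z" using mat_factor[OF T(1) V(2)] by blast
    have "injective_mat Z"
      unfolding injective_mat_def
    proof (intro ballI impI)
      fix v assume "v \<in> carrier_vec (dim_col Z)" "Z *\<^sub>v v = 0\<^sub>v (dim_row Z)"
      then have v: "v \<in> carrier_vec r" "Z *\<^sub>v v = 0\<^sub>v (Suc r)" using Z(1) by auto
      have "?T *\<^sub>v v = ?V *\<^sub>v (Z *\<^sub>v v)" unfolding Z(2) by (rule assoc_mult_mat_vec[OF V(2) Z(1) v(1)])
      also have "\<dots> = 0\<^sub>v d" unfolding v(2) using V(2) by (intro eq_vecI) auto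
      finally show "v = 0\<^sub>v (dim_col Z)" using injective_matD[OF T(2,1) v(1)] Z(1) by simp
    qed
    \<comment> \<open>\<open>Z\<close> expresses the earlier basis in that of the larger member.
      With \<open>Z\<close> as the tail of \<open>z\<close>, the basis \<open>?V * z\<close> of the
      larger member ends in the earlier one.\<close>
    then obtain z where z: "z \<in> GL (Suc r)" "tail_cols r z = Z" using complete_to_GL[OF _ Z(1)] by blast
    note zc = GL_carrier[OF z(1)]
    have "injective_mat (?V * z)" by (rule injective_mat_mult[OF V(1) injective_mat_GL[OF z(1)] V(2) zc])
    moreover have Vz: "?V * z \<in> carrier_mat d (Suc r)" using V(2) zc by simp
    ultimately obtain h' where h': "h' \<in> GL d" "tail_cols (Suc r) h' = ?V * z" using complete_to_GL by blast
    note h'c = GL_carrier[OF h'(1)]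
    have "tail_cols r h' = tail_cols r (?V * z)"
      using tail_cols_tail_cols[of r "Suc r" h'] rd h'c h'(2) by auto
    also have "\<dots> = ?V * tail_cols r z"
    proof (rule eq_matI)
      fix i j assume "i < dim_row (?V * tail_cols r z)" "j < dim_col (?V * tail_cols r z)"
      then have ij: "i < d" "j < r" by (auto simp: tail_cols_def)
      have "tail_cols r (?V * z) $$ (i, j) = (?V * z) $$ (i, Suc r - r + j)"
        using ij V(2) zc by (simp add: tail_cols_def)
      also have "\<dots> = (\<Sum>l<Suc r. ?V $$ (i, l) * z $$ (l, Suc r - r + j))"
        using ij by (intro mult_mat_nth[OF V(2) zc]) auto
      also have "\<dots> = (\<Sum>l<Suc r. ?V $$ (i, l) * tail_cols r z $$ (l, j))"
        using ij zc by (intro sum.cong) (auto simp: tail_cols_def)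
      also have "\<dots> = (?V * tail_cols r z) $$ (i, j)"
        by (rule mult_mat_nth[OF V(2) tail_cols_carrier[OF zc] ij, symmetric])
      finally show "tail_cols r (?V * z) $$ (i, j) = (?V * tail_cols r z) $$ (i, j)" .
    qed (auto simp: tail_cols_def)
    finally have tails: "tail_cols r h' = tail_cols r h" unfolding z(2) Z(2) .
    have "F i = column_flag d h' i" if i: "d - Suc r \<le> i" "i \<le> d" for i
    proof (cases "i = d - Suc r")
      case True
      have "column_flag d h' (d - Suc r + 0) = (\<lambda>v. (?V * z) *\<^sub>v v) ` carrier_vec (Suc r)"
        unfolding column_flag_tail_span[OF h'c rd le0] h'(2) tail_span_0 ..
      also have "\<dots> = (\<lambda>v. ?V *\<^sub>v v) ` (\<lambda>v. z *\<^sub>v v) ` carrier_vec (Suc r)"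
        unfolding image_image using V zc by (intro image_cong) (auto simp: assoc_mult_mat_vec[of _ d "Suc r" _ "Suc r"])
      also have "(\<lambda>v. z *\<^sub>v v) ` carrier_vec (Suc r) = carrier_vec (Suc r)"
        using column_flag_0[OF z(1)] by (simp add: column_flag_def)
      finally show ?thesis using True V(3) by simp
    next
      case False
      then have "d - r \<le> i" using i rd by auto
      then show ?thesis
        using h(2)[of i] column_flag_tail_cong[OF hc h'c _ tails[symmetric], of i] i rd by auto
    qed
    then show ?case using h'(1) by blast
  qed
  from this[of n] obtain h where "h \<in> GL d" "\<forall>i. d - n \<le> i \<and> i \<le> d \<longrightarrow> F i = column_flag d h i" by auto
  then show thesis using that by blast
qed

text \<open>The index 0, which \<open>good_tail\<close> does not see, is harmless because the zeroth
  member is the whole space.\<close>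

lemma good_tail_column_flag:
  assumes h: "h \<in> GL d" and nd: "n \<le> d" and T: "T \<in> carrier_mat d d"
  shows "good_tail d n e T (tail_cols n h) \<longleftrightarrow>
    (\<forall>i\<in>flag_index d n. \<forall>w\<in>column_flag d h i. T *\<^sub>v w \<in> column_flag d h i) \<and>
    (\<forall>w\<in>carrier_vec d. (T ^\<^sub>m e) *\<^sub>v w \<in> column_flag d h (d - n))"
proof -
  note hc = GL_carrier[OF h]
  note ct = column_flag_tail_span[OF hc nd]
  have 0: "\<forall>w\<in>column_flag d h 0. T *\<^sub>v w \<in> column_flag d h 0"
    unfolding column_flag_0[OF h] using T by auto
  have "(\<forall>i\<in>{d - n..d}. \<forall>w\<in>column_flag d h i. T *\<^sub>v w \<in> column_flag d h i) \<longleftrightarrow>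
    (\<forall>j\<le>n. \<forall>w\<in>tail_span n (tail_cols n h) j. T *\<^sub>v w \<in> tail_span n (tail_cols n h) j)"
  proof (intro iffI ballI allI impI)
    fix j w assume all: "\<forall>i\<in>{d - n..d}. \<forall>w\<in>column_flag d h i. T *\<^sub>v w \<in> column_flag d h i"
      and j: "j \<le> n" and w: "w \<in> tail_span n (tail_cols n h) j"
    have "d - n + j \<in> {d - n..d}" using j nd by auto
    then show "T *\<^sub>v w \<in> tail_span n (tail_cols n h) j" using all w unfolding ct[OF j, symmetric] by blast
  next
    fix i w assume all: "\<forall>j\<le>n. \<forall>w\<in>tail_span n (tail_cols n h) j. T *\<^sub>v w \<in> tail_span n (tail_cols n h) j"
      and i: "i \<in> {d - n..d}" and w: "w \<in> column_flag d h i"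
    have j: "i - (d - n) \<le> n" "i = d - n + (i - (d - n))" using i nd by auto
    then have "column_flag d h i = tail_span n (tail_cols n h) (i - (d - n))" using ct[OF j(1)] by simp
    then show "T *\<^sub>v w \<in> column_flag d h i" using all j(1) w by simp
  qed
  moreover have "column_flag d h (d - n) = tail_span n (tail_cols n h) 0" using ct[of 0] by simp
  ultimately show ?thesis unfolding good_tail_def flag_index_def using 0 by simp
qed

locale delta_fiber =
  fixes n s :: nat and mu :: "nat list" and G :: "complex mat" and d :: nat
  assumes s: "1 \<le> s" and mu: "sum_list mu \<le> n" "length mu \<le> s" and d: "d = sum_list (nu_part n mu s)"
    and G: "G \<in> carrier_mat d d"
begin

lemma d_eq: "d = s * (n - sum_list mu) + sum_list mu"
  unfolding d by (rule sum_list_nu_part[OF mu(2)])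

text \<open>The codimension is the size of the rectangle (n-m)^(s-1), as the criterion for Jordan
  types dominated by a rectangle requires.\<close>

lemma d_minus_n: "d - n = (s - 1) * (n - sum_list mu)" and n_le_d: "n \<le> d"
proof -
  obtain s' where s': "s = Suc s'" using s by (cases s) auto
  have "d = s' * (n - sum_list mu) + n" unfolding d_eq s' using mu(1) by simp
  then show "d - n = (s - 1) * (n - sum_list mu)" "n \<le> d" unfolding s' by simp_all
qed

text \<open>Dimensions and inclusions hold for the flag of any invertible matrix. What remains is
  stability and the Jordan type condition, and the latter says that the image of a power is
  contained in a member.\<close>

lemma delta_springer_flags_iff:
  assumes h: "h \<in> GL d"
  shows "forget_flag d n (column_flag d h) \<in> delta_springer_flags n mu s G \<longleftrightarrow>
    good_tail d n (n - sum_list mu) G (tail_cols n h)"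
proof -
  let ?F = "forget_flag d n (column_flag d h)" and ?e = "n - sum_list mu"
  note hc = GL_carrier[OF h]
  have F: "?F i = cres.matrix_flag d h i" "?F i = column_flag d h i" if "i \<in> flag_index d n" for i
    using that column_flag_eq[of i d h] by (auto simp: forget_flag_def flag_index_def)
  have idx: "0 \<in> flag_index d n" "d \<in> flag_index d n" "d - n \<in> flag_index d n" "i \<in> flag_index d n \<Longrightarrow> i \<le> d" for i
    using n_le_d by (auto simp: flag_index_def)
  have basic: "?F \<in> extensional (flag_index d n)" "?F 0 = carrier_vec d" "?F d = {0\<^sub>v d}"
    using F(2) idx column_flag_0[OF h] column_flag_last[OF hc] by (auto simp: forget_flag_def)
  have sub: "subspace class_ring (?F i) (module_vec TYPE(complex) d)" if "i \<in> flag_index d n" for i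
    unfolding subspace_iff_scalar_subspace F(1)[OF that] by (rule cres.scalar_subspace_matrix_flag[OF hc])
  have zero: "cres.matrix_flag d h d = {0\<^sub>v d}" using F[OF idx(2)] basic(3) by simp
  have dim: "has_quotient_dim (\<lambda>c. c) d (?F i) {0\<^sub>v d} (d - i)" if "i \<in> flag_index d n" for i
    using cres.matrix_flag_quotient_dim[OF h idx(4)[OF that] order_refl] unfolding F(1)[OF that] zero .
  have mono: "?F j \<subseteq> ?F i" if "i \<in> flag_index d n" "j \<in> flag_index d n" "i \<le> j" for i j
    using cres.matrix_flag_antimono[OF that(3)] unfolding F(1)[OF that(1)] F(1)[OF that(2)] .
  have stab: "(\<lambda>v. G *\<^sub>v v) ` ?F i \<subseteq> ?F i \<longleftrightarrow> (\<forall>w\<in>column_flag d h i. G *\<^sub>v w \<in> column_flag d h i)"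
    if "i \<in> flag_index d n" for i unfolding F(2)[OF that] by auto
  have jt: "jordan_type_le (\<lambda>c. c) d (\<lambda>v. G *\<^sub>v v) (?F 0) (?F (d - n)) (replicate (s - 1) ?e) \<longleftrightarrow>
      (\<forall>w\<in>carrier_vec d. (G ^\<^sub>m ?e) *\<^sub>v w \<in> column_flag d h (d - n))"
    if st: "\<forall>i\<in>flag_index d n. \<forall>w\<in>column_flag d h i. G *\<^sub>v w \<in> column_flag d h i"
  proof -
    have "quotient_operator (\<lambda>c. c) d G (?F 0) (?F (d - n))"
    proof
      show "scalar_subspace (\<lambda>c. c) d (?F 0)" "scalar_subspace (\<lambda>c. c) d (?F (d - n))"
        using sub idx unfolding subspace_iff_scalar_subspace by auto
      show "?F (d - n) \<subseteq> ?F 0" by (rule mono) (use idx in auto)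
      show "G *\<^sub>v u \<in> ?F 0" if "u \<in> ?F 0" for u using that G basic(2) by auto
      show "G *\<^sub>v u \<in> ?F (d - n)" if "u \<in> ?F (d - n)" for u
        using that st idx(3) unfolding F(2)[OF idx(3)] by blast
    qed (use G cres.sc_hom in auto)
    moreover have "has_quotient_dim (\<lambda>c. c) d (?F 0) (?F (d - n)) ((s - 1) * ?e)"
      using cres.matrix_flag_quotient_dim[OF h, of 0 "d - n"] d_minus_n
      unfolding F(1)[OF idx(1)] F(1)[OF idx(3)] by simp
    ultimately show ?thesis
      using quotient_operator.jordan_type_le_replicate_iff basic(2) F(2)[OF idx(3)] by metis
  qed
  show ?thesis
    unfolding delta_springer_flags_def Let_def d[symmetric] good_tail_column_flag[OF h n_le_d G]
    using basic sub dim mono stab jt by auto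
qed

lemma delta_springer_flags_adapted:
  assumes "F \<in> delta_springer_flags n mu s G"
  obtains h where "h \<in> GL d" "F = forget_flag d n (column_flag d h)"
proof -
  have F: "F \<in> extensional (flag_index d n)" "F 0 = carrier_vec d" "F d = {0\<^sub>v d}"
    "\<And>i. i \<in> flag_index d n \<Longrightarrow> scalar_subspace (\<lambda>c. c) d (F i)"
    "\<And>i. i \<in> flag_index d n \<Longrightarrow> has_quotient_dim (\<lambda>c. c) d (F i) {0\<^sub>v d} (d - i)"
    "\<And>i j. i \<in> flag_index d n \<Longrightarrow> j \<in> flag_index d n \<Longrightarrow> i \<le> j \<Longrightarrow> F j \<subseteq> F i"
    using assms unfolding delta_springer_flags_def Let_def d[symmetric] subspace_iff_scalar_subspace by auto
  have idx: "i \<in> flag_index d n" if "d - n \<le> i" "i \<le> d" for i using that by (auto simp: flag_index_def)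
  obtain h where h: "h \<in> GL d" "\<And>i. d - n \<le> i \<Longrightarrow> i \<le> d \<Longrightarrow> F i = column_flag d h i"
  proof (rule flag_adapted_basis[of d n F])
    show "F j \<subseteq> F i" if "d - n \<le> i" "i \<le> j" "j \<le> d" for i j
      using that by (intro F(6) idx) auto
  qed (use F idx n_le_d in auto)
  have "F = forget_flag d n (column_flag d h)"
  proof (rule extensionalityI[OF F(1)])
    show "forget_flag d n (column_flag d h) \<in> extensional (flag_index d n)" by (simp add: forget_flag_def)
    fix i assume i: "i \<in> flag_index d n"
    then have "F i = column_flag d h i"
      using h(2)[of i] F(2) column_flag_0[OF h(1)] unfolding flag_index_def by (cases "i = 0") auto
    then show "F i = forget_flag d n (column_flag d h) i" using i by (simp add: forget_flag_def)
  qed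
  then show thesis using that h(1) by blast
qed

end

section \<open>Flags over a fixed lattice\<close>

text \<open>A truncation with 0 in place of \<open>q\<close> describes the image of
  \<open>A ^\<^sub>m e\<close> itself: as \<open>G0 ^\<^sub>m 0\<close> is the identity,
  \<open>E\<close> and \<open>A ^\<^sub>m e\<close> factor through each other.\<close>

lemma truncated_pair_of_truncations:
  assumes A: "A \<in> carrier_mat D D" and nil: "A ^\<^sub>m r = 0\<^sub>m D D"
    and t: "truncation q e A G Q" and G: "G \<in> carrier_mat d d"
    and t0: "truncation 0 e A G0 E" and G0: "G0 \<in> carrier_mat m m"
  shows "\<exists>R M M' N X Y. truncated_pair q e m D d r A G Q R M M' N E X Y"
proof -
  obtain a g R M M' N where
    c: "A \<in> carrier_mat a a" "G \<in> carrier_mat g g" "Q \<in> carrier_mat a g" "R \<in> carrier_mat g a"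
     "M \<in> carrier_mat g a" "M' \<in> carrier_mat a g" "N \<in> carrier_mat a a" and
    e: "A * Q = Q * G" "R * Q = 1\<^sub>m g" "A ^\<^sub>m e = Q * G ^\<^sub>m q * M" "Q * G ^\<^sub>m q = A ^\<^sub>m e * M'"
     "Q * R + N * A ^\<^sub>m q = 1\<^sub>m a" "N * A ^\<^sub>m e = 0\<^sub>m a a"
    using t unfolding truncation_def by blast
  have ag: "a = D" "g = d" using c(1,2) A G by auto
  obtain a' g' R0 Y X where
    c0: "A \<in> carrier_mat a' a'" "G0 \<in> carrier_mat g' g'" "E \<in> carrier_mat a' g'" "R0 \<in> carrier_mat g' a'"
     "Y \<in> carrier_mat g' a'" "X \<in> carrier_mat a' g'" and
    e0: "R0 * E = 1\<^sub>m g'" "A ^\<^sub>m e = E * G0 ^\<^sub>m 0 * Y" "E * G0 ^\<^sub>m 0 = A ^\<^sub>m e * X"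
    using t0 unfolding truncation_def by blast
  have ag': "a' = D" "g' = m" using c0(1,2) A G0 by auto
  have "E * G0 ^\<^sub>m 0 = E" using c0(2,3) by simp
  then have EX: "E = A ^\<^sub>m e * X" and EY: "A ^\<^sub>m e = E * Y" using e0(2,3) by metis+
  have inj: "injective_mat E" by (rule injective_mat_of_left_inverse[OF c0(3,4) e0(1)])
  note cs = c[unfolded ag] e[unfolded ag] c0(3,5,6)[unfolded ag']
  have "truncated_pair q e m D d r A G Q R M M' N E X Y"
    by (intro truncated_pair.intro cs EX EY inj nil)
  then show ?thesis by blast
qed

text \<open>In a decreasing list the zeros come last, so removing them keeps the positions of the
  other entries.\<close>

lemma filter_positive_nth:
  fixes xs :: "nat list"
  assumes "sorted_wrt (\<ge>) xs"
  shows "(if i < length (filter (\<lambda>l. 0 < l) xs) then filter (\<lambda>l. 0 < l) xs ! i else 0) =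
    (if i < length xs then xs ! i else 0)"
  using assms
proof (induction xs arbitrary: i)
  case (Cons x xs)
  show ?case
  proof (cases "0 < x")
    case True
    then show ?thesis using Cons.IH[of "i - 1"] Cons.prems by (cases i) auto
  next
    case False
    then have all: "\<forall>y\<in>set (x # xs). y = 0" using Cons.prems by auto
    then have "filter (\<lambda>l. 0 < l) (x # xs) = []" by (simp add: filter_empty_conv)
    moreover have "(x # xs) ! i = 0" if "i < length (x # xs)" using nth_mem[OF that] all by blast
    ultimately show ?thesis by (simp only: list.size(3) not_less_zero if_False if_cancel split: if_split) simp
  qed
qed simp

text \<open>Blocks of size 0 are empty. This allows the Jordan type to be padded to exactly
  \<open>k\<close> parts and agrees with the dropping of zero parts in nu.\<close>

lemma nilpotent_jordan_matrix_filter: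
  "nilpotent_jordan_matrix (filter (\<lambda>l. 0 < l) ls) = (nilpotent_jordan_matrix ls :: 'a :: field mat)"
proof (induction ls)
  case (Cons l ls)
  show ?case
  proof (cases "0 < l")
    case True
    have f: "sum_list (filter (\<lambda>l. 0 < l) xs) = sum_list xs" for xs :: "nat list" by (induction xs) auto
    have "filter (\<lambda>l. 0 < l) (l # ls) = l # filter (\<lambda>l. 0 < l) ls" using True by simp
    then show ?thesis by (simp only: nilpotent_jordan_matrix_Cons Cons.IH f)
  next
    case False
    have c: "(nilpotent_jordan_matrix ls :: 'a mat) \<in> carrier_mat (sum_list ls) (sum_list ls)" by (rule nilpotent_jordan_matrix_carrier)
    have "nilpotent_jordan_matrix (0 # ls) = (nilpotent_jordan_matrix ls :: 'a mat)"
      unfolding nilpotent_jordan_matrix_Cons using c by (intro eq_matI) auto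
    then show ?thesis using False Cons by simp
  qed
qed simp

lemma sum_list_min_le:
  assumes "l \<in> set ls"
  shows "sum_list (map (\<lambda>x. min x e) ls) \<le> min l e + (length ls - 1) * e"
proof -
  obtain us vs where ls: "ls = us @ l # vs" using split_list[OF assms] by blast
  have "sum_list (map (\<lambda>x. min x e) xs) \<le> length xs * e" for xs :: "nat list"
    using sum_list_le_length_mult[of "map (\<lambda>x. min x e) xs" e] by simp
  from this[of us] this[of vs] show ?thesis unfolding ls by (simp add: add_mult_distrib)
qed

lemma sum_list_min_add_diff:
  fixes ls :: "nat list"
  shows "sum_list (map (\<lambda>x. min x e) ls) + sum_list (map (\<lambda>x. x - e) ls) = sum_list ls"
proof (induction ls)
  case (Cons x ls)
  have "min x e + (x - e) = x" by (simp add: min_def)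
  then show ?case using Cons by simp
qed simp

context gamma_lattice
begin

text \<open>The partition $\mu$ arises from the Jordan type $\lambda$ of \<open>A\<close> by $\mu_i = \max(\lambda_i - (n-k), 0)$. The
  flags only see the subspace $\{x : A^q x \in \mathrm{im}\, A^{n-k}\}$ with $q = n - |\mu|$, on which \<open>A\<close> has
  Jordan type $(q^k) + \mu$.\<close>

lemma exists_delta_partition:
  assumes kn: "k \<le> n" and H: "injective_mat H" "H \<in> carrier_mat K n" and good: "good_tail K n (n - k) A H"
  obtains mu where "is_partition mu" "sum_list mu \<le> n" "length mu \<le> k"
    "\<And>G d. d = sum_list (nu_part n mu k) \<Longrightarrow> G \<in> carrier_mat d d \<Longrightarrow>
       jordan_nf G (map (\<lambda>l. (l, 0)) (nu_part n mu k)) \<Longrightarrow>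
       \<exists>r Q R M M' N E X Y. truncated_pair (n - sum_list mu) (n - k) (sum_list mu) K d r A G Q R M M' N E X Y"
proof -
  define e where "e = n - k"
  have n: "n = e + k" using kn by (simp add: e_def)
  have Ke: "K = e * k + k" by (simp add: K_of_eq e_def)
  obtain r where nil: "A ^\<^sub>m r = 0\<^sub>m K K" using A_nilpotent by blast
  obtain la where la: "is_partition la" "sum_list la = K" "jordan_nf A (map (\<lambda>l. (l, 0)) la)"
    using jordan_nf_nilpotent_exists[OF A nil] by blast
  have lak: "length la \<le> k" by (rule jordan_blocks_le[OF la(3)])
  obtain P P' where wit: "similar_mat_wit A (nilpotent_jordan_matrix la) P P'"
    using la(3) unfolding jordan_nf_def similar_mat_def by blast
  define dl where "dl = map (\<lambda>l. l - e) la"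
  define mu where "mu = filter (\<lambda>l. 0 < l) dl"
  \<comment> \<open>Padded by zeros to length \<open>k\<close>, since nu is formed from exactly
    \<open>k\<close> parts before zeros are dropped.\<close>
  define ls where "ls = la @ replicate (k - length la) 0"
  have sdl: "sorted_wrt (\<ge>) dl"
    using la(1) unfolding dl_def is_partition_def sorted_wrt_map by (auto elim!: sorted_wrt_mono_rel[rotated])
  have f: "sum_list (filter (\<lambda>l. 0 < l) xs) = sum_list xs" for xs :: "nat list" by (induction xs) auto
  have summu: "sum_list mu = sum_list dl" unfolding mu_def by (rule f)
  have pmu: "is_partition mu"
    unfolding is_partition_def mu_def using sdl by (auto intro: sorted_wrt_filter)
  have lmu: "length mu \<le> k"
  proof -
    have "length mu \<le> length dl" unfolding mu_def by (rule length_filter_le)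
    then show ?thesis using lak by (simp add: dl_def)
  qed
  let ?m = "sum_list mu"
  let ?G0 = "nilpotent_jordan_matrix dl :: complex mat"
  have G0: "?G0 \<in> carrier_mat ?m ?m" unfolding summu by (rule nilpotent_jordan_matrix_carrier)
  obtain E0 where "truncation 0 e (nilpotent_jordan_matrix la) ?G0 E0"
    using truncation_nilpotent_jordan_matrix[of 0 e la] unfolding dl_def by auto
  from truncation_similar[OF this wit similar_mat_wit_refl[OF G0]]
  obtain E where tE: "truncation 0 e A ?G0 E" by blast
  obtain R M M' N X Y where tp0: "truncated_pair 0 e ?m K ?m r A ?G0 E R M M' N E X Y"
    using truncated_pair_of_truncations[OF A nil tE G0 tE G0] by blast
  have "(A ^\<^sub>m e) *\<^sub>v w \<in> tail_span n H 0" if "w \<in> carrier_vec K" for w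
    using good that unfolding good_tail_def e_def by blast
  \<comment> \<open>The image of \<open>A ^\<^sub>m e\<close> has dimension \<open>?m\<close> and
    lies in the span of the \<open>n\<close> columns of \<open>H\<close>; here the point of the
    fiber is used.\<close>
  from truncated_pair.good_tail_factor[OF tp0 H this] have mn: "?m \<le> n" by blast
  define q where "q = n - ?m"
  have lenls: "length ls = k" using lak by (simp add: ls_def)
  have sumls: "sum_list ls = K" using la(2) by (simp add: ls_def sum_list_replicate)
  have "sum_list (map (\<lambda>x. x - e) ls) = ?m" unfolding summu dl_def ls_def by (simp add: sum_list_replicate map_replicate_const)
  then have minsum: "sum_list (map (\<lambda>x. min x e) ls) + ?m = K" using sum_list_min_add_diff[of e ls] sumls by simp
  \<comment> \<open>The minima add up to \<open>K - ?m\<close>, and all but the one for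
    \<open>l\<close> are bounded by \<open>e\<close>. Because \<open>K = (k - 1) * e + n\<close>, at
    least \<open>n - ?m\<close> is left for that one.\<close>
  have qmin: "q \<le> min l e" if "l \<in> set ls" for l
  proof -
    obtain k' where k': "k = Suc k'" using k by (cases k) auto
    have "sum_list (map (\<lambda>x. min x e) ls) \<le> min l e + k' * e" using sum_list_min_le[OF that, of e] lenls k' by simp
    then have "K \<le> min l e + k' * e + ?m" using minsum by linarith
    moreover have "K = k' * e + n"
    proof (rule trans[OF Ke])
      show "e * k + k = k' * e + n" unfolding n k' by simp
    qed
    ultimately show ?thesis unfolding q_def by linarith
  qed
  have "ls \<noteq> []" using lenls k by auto
  then have qe: "q \<le> e" using qmin[of "hd ls"] by simp
  let ?ns = "map (\<lambda>l. q + (l - e)) ls"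
  obtain Q1 where Q1: "truncation q e (nilpotent_jordan_matrix ls) (nilpotent_jordan_matrix ?ns :: complex mat) Q1"
    using truncation_nilpotent_jordan_matrix[of q e ls] qe qmin by (metis min.bounded_iff)
  have fil: "filter (\<lambda>l. 0 < l) ls = la"
    using la(1) unfolding ls_def is_partition_def by (auto intro!: filter_True gr0I)
  have Jls: "nilpotent_jordan_matrix ls = (nilpotent_jordan_matrix la :: complex mat)"
    using nilpotent_jordan_matrix_filter[of ls, where ?'a = complex, unfolded fil] by (rule sym)
  have nu: "nu_part n mu k = filter (\<lambda>l. 0 < l) ?ns"
  proof -
    have "map (\<lambda>i. (n - ?m) + (if i < length mu then mu ! i else 0)) [0..<k] = ?ns"
    proof (rule nth_equalityI)
      fix i assume "i < length (map (\<lambda>i. (n - ?m) + (if i < length mu then mu ! i else 0)) [0..<k])"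
      then have i: "i < k" by simp
      have "(if i < length mu then mu ! i else 0) = (if i < length dl then dl ! i else 0)"
        unfolding mu_def by (rule filter_positive_nth[OF sdl])
      also have "\<dots> = ls ! i - e" using i by (simp add: dl_def ls_def nth_append)
      finally have eq: "(if i < length mu then mu ! i else 0) = ls ! i - e" .
      have "map (\<lambda>i. (n - ?m) + (if i < length mu then mu ! i else 0)) [0..<k] ! i =
          (n - ?m) + (if i < length mu then mu ! i else 0)"
        using i by (subst nth_map) simp_all
      also have "\<dots> = q + (ls ! i - e)" unfolding eq q_def ..
      also have "\<dots> = ?ns ! i" using i lenls by simp
      finally show "map (\<lambda>i. (n - ?m) + (if i < length mu then mu ! i else 0)) [0..<k] ! i = ?ns ! i" .
    qed (simp add: lenls)
    then show ?thesis unfolding nu_part_def by simp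
  qed
  show thesis
  proof (rule that[OF pmu mn lmu])
    fix G :: "complex mat" and d assume d: "d = sum_list (nu_part n mu k)" and G: "G \<in> carrier_mat d d"
      and jnf: "jordan_nf G (map (\<lambda>l. (l, 0)) (nu_part n mu k))"
    obtain S S' where witG: "similar_mat_wit G (nilpotent_jordan_matrix (nu_part n mu k)) S S'"
      using jnf unfolding jordan_nf_def similar_mat_def by blast
    have "similar_mat_wit G (nilpotent_jordan_matrix ?ns) S S'"
    proof -
      have "nilpotent_jordan_matrix (nu_part n mu k) = (nilpotent_jordan_matrix ?ns :: complex mat)"
        unfolding nu by (rule nilpotent_jordan_matrix_filter)
      with witG show ?thesis by (simp only:)
    qed
    from truncation_similar[OF Q1[unfolded Jls] wit this]
    obtain Q where tQ: "truncation q e A G Q" by blast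
    show "\<exists>r Q R M M' N E X Y. truncated_pair (n - ?m) (n - k) ?m K d r A G Q R M M' N E X Y"
      using truncated_pair_of_truncations[OF A nil tQ G tE G0] unfolding q_def e_def by blast
  qed
qed

lemma K_minus_n:
  assumes "k \<le> n"
  shows "K - n = (k - 1) * (n - k)" "n \<le> K"
proof -
  obtain k' where k': "k = Suc k'" using k by (cases k) auto
  obtain x where x: "n = k + x" using assms by (auto simp: le_iff_add)
  have "K = k' * (n - k) + n" unfolding K_of_eq x k' by simp
  then show "K - n = (k - 1) * (n - k)" "n \<le> K" using k' by simp_all
qed

text \<open>An integral matrix commutes with reduction, and every residue vector is the reduction of
  a constant vector. Applied to gamma and to its power \<open>n - k\<close>.\<close>

lemma lift_map_iff:
  assumes M: "M \<in> carrier_mat K K" "fres.integral_mat M"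
    and T: "\<And>x. x \<in> carrier_vec K \<Longrightarrow> T *\<^sub>v (g0 *\<^sub>v x) = g0 *\<^sub>v (M *\<^sub>v x)"
    and S: "S \<subseteq> carrier_vec K"
  shows "(\<forall>x\<in>fres.lift K g0 S. T *\<^sub>v x \<in> fres.lift K g0 S') \<longleftrightarrow> (\<forall>w\<in>S. red_mat M *\<^sub>v w \<in> S')"
proof (intro iffI ballI)
  fix w assume all: "\<forall>x\<in>fres.lift K g0 S. T *\<^sub>v x \<in> fres.lift K g0 S'" and w: "w \<in> S"
  let ?w = "map_vec fls_const w"
  have wc: "w \<in> carrier_vec K" using w S by blast
  have w': "?w \<in> carrier_vec K" "fres.integral_vec ?w" "map_vec (\<lambda>x. fls_nth x 0) ?w = w"
    using wc by (auto simp: fres.integral_vec_def fls_is_integral_def intro!: eq_vecI)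
  have "g0 *\<^sub>v ?w \<in> fres.lift K g0 S"
    unfolding fres.lift_def
    by (rule image_eqI[OF refl]) (use w' w in \<open>simp only: mem_Collect_eq simp_thms\<close>)
  then have "g0 *\<^sub>v (M *\<^sub>v ?w) \<in> fres.lift K g0 S'" using all T[OF w'(1)] by metis
  then obtain y where y: "y \<in> carrier_vec K" "map_vec (\<lambda>x. fls_nth x 0) y \<in> S'" "g0 *\<^sub>v (M *\<^sub>v ?w) = g0 *\<^sub>v y"
    unfolding fres.lift_def by blast
  have "M *\<^sub>v ?w = y" by (rule GL_mult_vec_cancel[OF g0_GL mult_mat_vec_carrier[OF M(1) w'(1)] y(1,3)])
  then show "red_mat M *\<^sub>v w \<in> S'" using y(2) fres.mult_mat_vec_residue(2)[OF M(2,1) w'(2,1)] w'(3) by simp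
next
  fix x assume all: "\<forall>w\<in>S. red_mat M *\<^sub>v w \<in> S'" and "x \<in> fres.lift K g0 S"
  then obtain y where y: "y \<in> carrier_vec K" "fres.integral_vec y" "map_vec (\<lambda>x. fls_nth x 0) y \<in> S" "x = g0 *\<^sub>v y"
    unfolding fres.lift_def by blast
  have "T *\<^sub>v x = g0 *\<^sub>v (M *\<^sub>v y)" using T[OF y(1)] y(4) by simp
  moreover have "map_vec (\<lambda>x. fls_nth x 0) (M *\<^sub>v y) \<in> S'"
    using all y(3) fres.mult_mat_vec_residue(2)[OF M(2,1) y(2,1)] by simp
  moreover have "M *\<^sub>v y \<in> carrier_vec K" "fres.integral_vec (M *\<^sub>v y)"
    using mult_mat_vec_carrier[OF M(1) y(1)] fres.mult_mat_vec_residue(1)[OF M(2,1) y(2,1)] by auto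
  ultimately show "T *\<^sub>v x \<in> fres.lift K g0 S'" unfolding fres.lift_def by blast
qed

lemma gamma_pow_g0:
  assumes x: "x \<in> carrier_vec K"
  shows "(gamma n k N ^\<^sub>m m) *\<^sub>v (g0 *\<^sub>v x) = g0 *\<^sub>v ((B ^\<^sub>m m) *\<^sub>v x)"
  using x
proof (induction m arbitrary: x)
  case 0
  then show ?case using B g0 gamma_carrier[of n k N] by simp
next
  case (Suc m)
  have g0x: "g0 *\<^sub>v x \<in> carrier_vec K" by (rule mult_mat_vec_carrier[OF g0 Suc.prems])
  have Bx: "B *\<^sub>v x \<in> carrier_vec K" by (rule mult_mat_vec_carrier[OF B Suc.prems])
  have "(gamma n k N ^\<^sub>m Suc m) *\<^sub>v (g0 *\<^sub>v x) = (gamma n k N ^\<^sub>m m) *\<^sub>v (gamma n k N *\<^sub>v (g0 *\<^sub>v x))"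
    using assoc_mult_mat_vec[OF pow_carrier_mat[OF gamma_carrier] gamma_carrier g0x] by simp
  also have "\<dots> = g0 *\<^sub>v ((B ^\<^sub>m m) *\<^sub>v (B *\<^sub>v x))"
    unfolding g0_B[OF Suc.prems, symmetric] by (rule Suc.IH[OF Bx])
  also have "(B ^\<^sub>m m) *\<^sub>v (B *\<^sub>v x) = (B ^\<^sub>m Suc m) *\<^sub>v x"
    using assoc_mult_mat_vec[OF pow_carrier_mat[OF B] B Suc.prems] by simp
  finally show ?case .
qed

lemma fiber_flag:
  assumes u: "u \<in> carrier_mat K K" "fres.integral_mat u"
    and u': "u' \<in> carrier_mat K K" "fres.integral_mat u'" "u * u' = 1\<^sub>m K" "u' * u = 1\<^sub>m K"
  shows "red_mat u \<in> GL K" "g0 * u \<in> GL K"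
    "i \<le> K \<Longrightarrow> fres.matrix_flag K (g0 * u) i = fres.lift K g0 (column_flag K (red_mat u) i)"
    "fres.matrix_flag K (g0 * u) 0 = fres.matrix_flag K g0 0"
proof -
  have "red_mat u * red_mat u' = 1\<^sub>m K" "red_mat u' * red_mat u = 1\<^sub>m K"
    using fres.mult_mat_residue(2)[OF u(2,1) u'(2,1)] fres.mult_mat_residue(2)[OF u'(2,1) u(2,1)]
      u'(3,4) fres.integral_mat_one(2)[of K] by simp_all
  then show ru: "red_mat u \<in> GL K" using u u' by (intro GL_I[of _ _ "red_mat u'"]) auto
  have "u \<in> GL K" using u u' by (intro GL_I)
  then show "g0 * u \<in> GL K" by (rule GL_mult[OF g0_GL])
  show lift: "fres.matrix_flag K (g0 * u) i = fres.lift K g0 (column_flag K (red_mat u) i)" if "i \<le> K" for i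
    by (rule fres.matrix_flag_mult_eq_lift[OF g0 u u' that])
  have "fres.matrix_flag K (g0 * 1\<^sub>m K) 0 = fres.lift K g0 (column_flag K (red_mat (1\<^sub>m K)) 0)"
    by (rule fres.matrix_flag_mult_eq_lift[OF g0 _ _ one_carrier_mat]) (auto simp: fres.integral_mat_one)
  moreover have "(1\<^sub>m K :: complex mat) \<in> GL K" by (rule GL_I[of _ _ "1\<^sub>m K"]) auto
  ultimately show "fres.matrix_flag K (g0 * u) 0 = fres.matrix_flag K g0 0"
    using lift[of 0] column_flag_0[OF ru] column_flag_0[of "1\<^sub>m K" K] g0 by (simp add: fres.integral_mat_one)
qed

text \<open>Membership in C holds because it depends on Lambda_0 alone, and the conditions on
  lattices and dimensions hold for every invertible matrix. Stability and the Jordan type condition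
  reduce modulo epsilon to conditions on \<open>A\<close>.\<close>

lemma Y_flags_iff:
  assumes kn: "k \<le> n"
    and u: "u \<in> carrier_mat K K" "fres.integral_mat u"
    and u': "u' \<in> carrier_mat K K" "fres.integral_mat u'" "u * u' = 1\<^sub>m K" "u' * u = 1\<^sub>m K"
  shows "forget_flag K n (full_flag K (g0 * u)) \<in> Y_flags n k N \<longleftrightarrow> good_tail K n (n - k) A (tail_cols n (red_mat u))"
proof -
  let ?g = "g0 * u" and ?c = "red_mat u" and ?T = "gamma n k N"
  let ?F = "forget_flag K n (full_flag K ?g)"
  note ff = fiber_flag[OF u u']
  note gc = GL_carrier[OF ff(2)]
  have idx: "0 \<in> flag_index K n" "K \<in> flag_index K n" "K - n \<in> flag_index K n" "i \<in> flag_index K n \<Longrightarrow> i \<le> K" for i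
    using K_minus_n(2)[OF kn] by (auto simp: flag_index_def)
  have F: "?F i = fres.matrix_flag K ?g i" if "i \<in> flag_index K n" for i
    using that idx(4)[OF that] by (simp add: forget_flag_def full_flag_eq)
  have FL: "?F i = fres.lift K g0 (column_flag K ?c i)" if "i \<in> flag_index K n" for i
    using F[OF that] ff(3)[OF idx(4)[OF that]] by simp
  have cfc: "column_flag K ?c i \<subseteq> carrier_vec K" if "i \<in> flag_index K n" for i
    using idx(4)[OF that] GL_carrier[OF ff(1)] by (auto simp: column_flag_def)
  have C: "?F \<in> C'_flags K n"
    unfolding C'_flags_def using C_flagsI[OF K_pos ff(2)] sub v unfolding ff(4) by blast
  have P: "?F \<in> partial_affine_flags K n"
    unfolding partial_affine_flags_def
  proof (intro CollectI conjI ballI impI)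
    show "?F \<in> extensional (flag_index K n)" by (simp add: forget_flag_def)
    show "is_lattice K (?F i)" if "i \<in> flag_index K n" for i
      unfolding F[OF that] by (rule is_lattice_matrix_flag[OF ff(2) idx(4)[OF that]])
    show "?F K = eps_times (?F 0)" unfolding F[OF idx(1)] F[OF idx(2)] by (rule matrix_flag_eps_times[OF gc])
    fix i j assume ij: "i \<in> flag_index K n" "j \<in> flag_index K n" "i \<le> j"
    show "?F j \<subseteq> ?F i" unfolding F[OF ij(1)] F[OF ij(2)] by (rule fres.matrix_flag_antimono[OF ij(3)])
    show "has_quotient_dim fls_const K (?F i) (?F j) (j - i)"
      unfolding F[OF ij(1)] F[OF ij(2)] by (rule fres.matrix_flag_quotient_dim[OF ff(2) ij(3) idx(4)[OF ij(2)]])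
  qed
  have stab: "(\<lambda>v. ?T *\<^sub>v v) ` ?F i \<subseteq> ?F i \<longleftrightarrow> (\<forall>w\<in>column_flag K ?c i. A *\<^sub>v w \<in> column_flag K ?c i)"
    if "i \<in> flag_index K n" for i
    using lift_map_iff[OF B integral_B, of ?T, OF g0_B[symmetric] cfc[OF that], of "column_flag K ?c i"]
    unfolding FL[OF that] A_def by auto
  have jt: "jordan_type_le fls_const K (\<lambda>v. ?T *\<^sub>v v) (?F 0) (?F (K - n)) (replicate (k - 1) (n - k)) \<longleftrightarrow>
      (\<forall>w\<in>carrier_vec K. (A ^\<^sub>m (n - k)) *\<^sub>v w \<in> column_flag K ?c (K - n))"
    if st: "\<forall>i\<in>flag_index K n. (\<lambda>v. ?T *\<^sub>v v) ` ?F i \<subseteq> ?F i"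
  proof -
    have "quotient_operator fls_const K ?T (?F 0) (?F (K - n))"
    proof (rule quotient_operator.intro)
      show "scalar_subspace fls_const K (?F 0)" "scalar_subspace fls_const K (?F (K - n))"
        unfolding F[OF idx(1)] F[OF idx(3)] by (rule fres.scalar_subspace_matrix_flag[OF gc])+
      show "?F (K - n) \<subseteq> ?F 0" unfolding F[OF idx(1)] F[OF idx(3)] by (rule fres.matrix_flag_antimono) simp
      show "?T *\<^sub>v x \<in> ?F 0" if "x \<in> ?F 0" for x using st idx(1) that by blast
      show "?T *\<^sub>v x \<in> ?F (K - n)" if "x \<in> ?F (K - n)" for x using st idx(3) that by blast
    qed (rule comm_ring_hom_fls_const gamma_carrier)+
    moreover have "has_quotient_dim fls_const K (?F 0) (?F (K - n)) ((k - 1) * (n - k))"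
      using fres.matrix_flag_quotient_dim[OF ff(2), of 0 "K - n"] K_minus_n(1)[OF kn]
      unfolding F[OF idx(1)] F[OF idx(3)] by simp
    ultimately have "jordan_type_le fls_const K (\<lambda>v. ?T *\<^sub>v v) (?F 0) (?F (K - n)) (replicate (k - 1) (n - k)) \<longleftrightarrow>
      (\<forall>x\<in>?F 0. (?T ^\<^sub>m (n - k)) *\<^sub>v x \<in> ?F (K - n))"
      by (rule quotient_operator.jordan_type_le_replicate_iff)
    also have "\<dots> \<longleftrightarrow> (\<forall>w\<in>carrier_vec K. red_mat (B ^\<^sub>m (n - k)) *\<^sub>v w \<in> column_flag K ?c (K - n))"
      unfolding FL[OF idx(1)] FL[OF idx(3)] column_flag_0[OF ff(1)]
      by (rule lift_map_iff[OF pow_carrier_mat[OF B] fres.integral_mat_pow(1)[OF integral_B B] gamma_pow_g0]) auto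
    finally show ?thesis unfolding fres.integral_mat_pow(2)[OF integral_B B] A_def .
  qed
  show ?thesis
    unfolding Y_flags_def Let_def good_tail_column_flag[OF ff(1) K_minus_n(2)[OF kn] A]
    using C P stab jt by auto
qed

end

section \<open>Isomorphisms of subspaces of homogeneous spaces\<close>

lemma polynomials_in_sum:
  "(\<And>i. i \<in> I \<Longrightarrow> f i \<in> polynomials_in \<Phi>) \<Longrightarrow> (\<lambda>g. \<Sum>i\<in>I. f i g) \<in> polynomials_in \<Phi>"
proof (induction I rule: infinite_finite_induct)
  case (insert x F)
  then have "(\<lambda>g. f x g + (\<Sum>i\<in>F. f i g)) \<in> polynomials_in \<Phi>" by (intro polynomials_in.add) auto
  then show ?case using insert by simp
qed (simp_all add: polynomials_in.const)

lemma polynomials_in_prod: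
  "(\<And>i. i \<in> I \<Longrightarrow> f i \<in> polynomials_in \<Phi>) \<Longrightarrow> (\<lambda>g. \<Prod>i\<in>I. f i g) \<in> polynomials_in \<Phi>"
proof (induction I rule: infinite_finite_induct)
  case (insert x F)
  then have "(\<lambda>g. f x g * (\<Prod>i\<in>F. f i g)) \<in> polynomials_in \<Phi>" by (intro polynomials_in.mult) auto
  then show ?case using insert by simp
qed (simp_all add: polynomials_in.const)

text \<open>By the Leibniz formula; this makes invertibility of a polynomial family of matrices a
  Zariski open condition.\<close>

lemma polynomials_in_det:
  assumes "\<And>g. M g \<in> carrier_mat d d" "\<And>i j. i < d \<Longrightarrow> j < d \<Longrightarrow> (\<lambda>g. M g $$ (i, j)) \<in> polynomials_in \<Phi>"
  shows "(\<lambda>g. det (M g)) \<in> polynomials_in \<Phi>"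
proof -
  have "(\<lambda>g. \<Sum>p\<in>{p. p permutes {0..<d}}. signof p * (\<Prod>i=0..<d. M g $$ (i, p i))) \<in> polynomials_in \<Phi>"
    by (intro polynomials_in_sum polynomials_in.mult[OF polynomials_in.const] polynomials_in_prod assms(2))
      (auto dest: permutes_in_image)
  moreover have "det (M g) = (\<Sum>p\<in>{p. p permutes {0..<d}}. signof p * (\<Prod>i=0..<d. M g $$ (i, p i)))" for g
    by (rule det_def'[OF assms(1)])
  ultimately show ?thesis by simp
qed

lemma polynomials_in_subst:
  assumes "P \<in> polynomials_in \<Psi>" "\<And>x. x \<in> \<Psi> \<Longrightarrow> \<exists>P\<in>polynomials_in \<Phi>. \<forall>g\<in>S. x (r g) = P g"
  shows "\<exists>P'\<in>polynomials_in \<Phi>. \<forall>g\<in>S. P (r g) = P' g"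
  using assms(1)
proof induction
  case (const c)
  show ?case by (rule bexI[OF _ polynomials_in.const]) auto
next
  case (coord x)
  then show ?case by (rule assms(2))
next
  case (add p q)
  then obtain p' q' where "p' \<in> polynomials_in \<Phi>" "q' \<in> polynomials_in \<Phi>" "\<forall>g\<in>S. p (r g) = p' g" "\<forall>g\<in>S. q (r g) = q' g" by blast
  then show ?case by (intro bexI[of _ "\<lambda>g. p' g + q' g"]) (auto intro: polynomials_in.add)
next
  case (mult p q)
  then obtain p' q' where "p' \<in> polynomials_in \<Phi>" "q' \<in> polynomials_in \<Phi>" "\<forall>g\<in>S. p (r g) = p' g" "\<forall>g\<in>S. q (r g) = q' g" by blast
  then show ?case by (intro bexI[of _ "\<lambda>g. p' g * q' g"]) (auto intro: polynomials_in.mult)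
qed

text \<open>The map \<open>\<theta>\<close> between subsets of two homogeneous spaces lifts, locally in the Zariski topology, to
  a polynomial map \<open>r\<close> between the groups.\<close>

definition locally_polynomial ::
  "('g \<Rightarrow> complex) set \<Rightarrow> 'g set \<Rightarrow> ('g \<Rightarrow> 'p) \<Rightarrow> 'p set \<Rightarrow> ('h \<Rightarrow> complex) set \<Rightarrow> 'h set \<Rightarrow> ('h \<Rightarrow> 'q) \<Rightarrow> ('p \<Rightarrow> 'q) \<Rightarrow> bool"
where
  "locally_polynomial \<Phi> G q X \<Psi> H p \<theta> \<longleftrightarrow> (\<forall>g\<in>G. q g \<in> X \<longrightarrow> (\<exists>f\<in>polynomials_in \<Phi>. \<exists>r. f g \<noteq> 0 \<and>
     (\<forall>g'\<in>{g \<in> G. q g \<in> X}. f g' \<noteq> 0 \<longrightarrow> r g' \<in> H \<and> p (r g') = \<theta> (q g')) \<and>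
     (\<forall>x\<in>\<Psi>. \<exists>P\<in>polynomials_in \<Phi>. \<forall>g'\<in>{g \<in> G. q g \<in> X}. x (r g') = P g')))"

lemma locally_polynomialE:
  assumes "locally_polynomial \<Phi> G q X \<Psi> H p \<theta>" "g \<in> G" "q g \<in> X"
  obtains f r where "f \<in> polynomials_in \<Phi>" "f g \<noteq> 0"
    "\<forall>g'. g' \<in> G \<and> q g' \<in> X \<and> f g' \<noteq> 0 \<longrightarrow> r g' \<in> H \<and> p (r g') = \<theta> (q g')"
    "\<forall>P\<in>polynomials_in \<Psi>. \<exists>P'\<in>polynomials_in \<Phi>. \<forall>g'\<in>{g \<in> G. q g \<in> X}. P (r g') = P' g'"
proof -
  from assms obtain f r where fr: "f \<in> polynomials_in \<Phi>" "f g \<noteq> 0"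
     "\<forall>g'\<in>{g \<in> G. q g \<in> X}. f g' \<noteq> 0 \<longrightarrow> r g' \<in> H \<and> p (r g') = \<theta> (q g')"
     "\<forall>x\<in>\<Psi>. \<exists>P\<in>polynomials_in \<Phi>. \<forall>g'\<in>{g \<in> G. q g \<in> X}. x (r g') = P g'"
    unfolding locally_polynomial_def by blast
  have "\<exists>P'\<in>polynomials_in \<Phi>. \<forall>g'\<in>{g \<in> G. q g \<in> X}. P (r g') = P' g'" if "P \<in> polynomials_in \<Psi>" for P
    by (rule polynomials_in_subst[OF that]) (use fr(4) in blast)
  then show thesis using that fr(1-3) by blast
qed

text \<open>Openness is tested on the groups. The function that cuts out a neighborhood is pulled
  back along the local lift \<open>r\<close> and multiplied by \<open>f\<close>, away from whose
  zeros \<open>r\<close> lifts \<open>\<theta>\<close>.\<close>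

lemma zariski_open_transfer:
  assumes lp: "locally_polynomial \<Phi> G q X \<Psi> H p \<theta>" and \<theta>: "\<And>x. x \<in> X \<Longrightarrow> \<theta> x \<in> Y"
    and op: "zariski_open_in \<Psi> {h \<in> H. p h \<in> Y} {h \<in> H. p h \<in> V}"
  shows "zariski_open_in \<Phi> {g \<in> G. q g \<in> X} {g \<in> G. q g \<in> X \<and> \<theta> (q g) \<in> V}"
  unfolding zariski_open_in_def
proof (intro conjI ballI)
  fix x assume "x \<in> {g \<in> G. q g \<in> X \<and> \<theta> (q g) \<in> V}"
  then have x: "x \<in> G" "q x \<in> X" "\<theta> (q x) \<in> V" by auto
  obtain f r where f: "f \<in> polynomials_in \<Phi>" "f x \<noteq> 0"
    and r: "\<forall>g'. g' \<in> G \<and> q g' \<in> X \<and> f g' \<noteq> 0 \<longrightarrow> r g' \<in> H \<and> p (r g') = \<theta> (q g')"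
    and pb: "\<forall>P\<in>polynomials_in \<Psi>. \<exists>P'\<in>polynomials_in \<Phi>. \<forall>g'\<in>{g \<in> G. q g \<in> X}. P (r g') = P' g'"
    by (rule locally_polynomialE[OF lp x(1,2)])
  have "r x \<in> {h \<in> H. p h \<in> V}" using r x f by auto
  then obtain c where c: "c \<in> polynomials_in \<Psi>" "c (r x) \<noteq> 0" "{y \<in> {h \<in> H. p h \<in> Y}. c y \<noteq> 0} \<subseteq> {h \<in> H. p h \<in> V}"
    using op unfolding zariski_open_in_def by blast
  obtain P where P: "P \<in> polynomials_in \<Phi>" "\<And>g'. g' \<in> G \<Longrightarrow> q g' \<in> X \<Longrightarrow> c (r g') = P g'" using pb c(1) by blast
  show "\<exists>h\<in>polynomials_in \<Phi>. h x \<noteq> 0 \<and> {y \<in> {g \<in> G. q g \<in> X}. h y \<noteq> 0} \<subseteq> {g \<in> G. q g \<in> X \<and> \<theta> (q g) \<in> V}"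
  proof (intro bexI conjI)
    show "(\<lambda>g. f g * P g) \<in> polynomials_in \<Phi>" by (rule polynomials_in.mult[OF f(1) P(1)])
    show "f x * P x \<noteq> 0" using f(2) c(2) P(2)[OF x(1,2)] by simp
    show "{y \<in> {g \<in> G. q g \<in> X}. f y * P y \<noteq> 0} \<subseteq> {g \<in> G. q g \<in> X \<and> \<theta> (q g) \<in> V}"
    proof
      fix y assume "y \<in> {y \<in> {g \<in> G. q g \<in> X}. f y * P y \<noteq> 0}"
      then have y: "y \<in> G" "q y \<in> X" "f y \<noteq> 0" "P y \<noteq> 0" by auto
      have "r y \<in> {y \<in> {h \<in> H. p h \<in> Y}. c y \<noteq> 0}" using r y \<theta>[OF y(2)] P(2)[OF y(1,2)] y(4) by simp
      then have "p (r y) \<in> V" using c(3) by blast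
      then show "y \<in> {g \<in> G. q g \<in> X \<and> \<theta> (q g) \<in> V}" using r y by simp
    qed
  qed
qed auto

lemma regular_transfer:
  assumes lp: "locally_polynomial \<Phi> G q X \<Psi> H p \<theta>"
    and reg: "regular_on \<Psi> {h \<in> H. p h \<in> V} (f \<circ> p)"
  shows "regular_on \<Phi> {g \<in> G. q g \<in> {x \<in> X. \<theta> x \<in> V}} (f \<circ> \<theta> \<circ> q)"
  unfolding regular_on_def
proof
  fix x assume "x \<in> {g \<in> G. q g \<in> {x \<in> X. \<theta> x \<in> V}}"
  then have x: "x \<in> G" "q x \<in> X" "\<theta> (q x) \<in> V" by auto
  obtain c r where f: "c \<in> polynomials_in \<Phi>" "c x \<noteq> 0"
    and r: "\<forall>g'. g' \<in> G \<and> q g' \<in> X \<and> c g' \<noteq> 0 \<longrightarrow> r g' \<in> H \<and> p (r g') = \<theta> (q g')"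
    and pb: "\<forall>P\<in>polynomials_in \<Psi>. \<exists>P'\<in>polynomials_in \<Phi>. \<forall>g'\<in>{g \<in> G. q g \<in> X}. P (r g') = P' g'"
    by (rule locally_polynomialE[OF lp x(1,2)])
  have "r x \<in> {h \<in> H. p h \<in> V}" using r x f by auto
  then obtain a b where ab: "a \<in> polynomials_in \<Psi>" "b \<in> polynomials_in \<Psi>" "b (r x) \<noteq> 0"
    "\<And>y. y \<in> H \<Longrightarrow> p y \<in> V \<Longrightarrow> b y \<noteq> 0 \<Longrightarrow> (f \<circ> p) y = a y / b y"
    using reg unfolding regular_on_def by blast
  obtain A where A: "A \<in> polynomials_in \<Phi>" "\<And>g'. g' \<in> G \<Longrightarrow> q g' \<in> X \<Longrightarrow> a (r g') = A g'" using pb ab(1) by blast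
  obtain B where B: "B \<in> polynomials_in \<Phi>" "\<And>g'. g' \<in> G \<Longrightarrow> q g' \<in> X \<Longrightarrow> b (r g') = B g'" using pb ab(2) by blast
  show "\<exists>a\<in>polynomials_in \<Phi>. \<exists>h\<in>polynomials_in \<Phi>. h x \<noteq> 0 \<and>
      (\<forall>y\<in>{g \<in> G. q g \<in> {x \<in> X. \<theta> x \<in> V}}. h y \<noteq> 0 \<longrightarrow> (f \<circ> \<theta> \<circ> q) y = a y / h y)"
  \<comment> \<open>Multiplying numerator and denominator by \<open>c\<close> leaves the fraction
    unchanged and restricts it to points where \<open>r\<close> lifts
    \<open>\<theta>\<close>.\<close>
  proof (rule bexI[of _ "\<lambda>g. c g * A g"], rule bexI[of _ "\<lambda>g. c g * B g"], intro conjI ballI impI)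
    show "(\<lambda>g. c g * A g) \<in> polynomials_in \<Phi>" "(\<lambda>g. c g * B g) \<in> polynomials_in \<Phi>"
      by (rule polynomials_in.mult[OF f(1) A(1)], rule polynomials_in.mult[OF f(1) B(1)])
    show "c x * B x \<noteq> 0" using f(2) ab(3) B(2)[OF x(1,2)] by simp
    fix y assume "y \<in> {g \<in> G. q g \<in> {x \<in> X. \<theta> x \<in> V}}" "c y * B y \<noteq> 0"
    then have y: "y \<in> G" "q y \<in> X" "\<theta> (q y) \<in> V" "c y \<noteq> 0" "B y \<noteq> 0" by auto
    have ry: "r y \<in> H" "p (r y) = \<theta> (q y)" using r y by auto
    have "f (p (r y)) = a (r y) / b (r y)" using ab(4)[OF ry(1)] ry(2) y B(2)[OF y(1,2)] by simp
    then show "(f \<circ> \<theta> \<circ> q) y = c y * A y / (c y * B y)"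
      using ry(2) y A(2)[OF y(1,2)] B(2)[OF y(1,2)] by simp
  qed
qed

lemma regular_on_cong: "(\<And>x. x \<in> S \<Longrightarrow> f x = g x) \<Longrightarrow> regular_on \<Phi> S f \<Longrightarrow> regular_on \<Phi> S g"
  unfolding regular_on_def by (simp cong: ball_cong)

text \<open>Local lifts in one direction pull back open sets and regular functions; lifts in both
  directions make the correspondence an equivalence.\<close>

lemma isomorphic_homogeneous_subspaces:
  assumes bij: "bij_betw \<psi> Y X"
    and lp1: "locally_polynomial \<Phi> G q X \<Psi> H p (inv_into Y \<psi>)"
    and lp2: "locally_polynomial \<Psi> H p Y \<Phi> G q \<psi>"
  shows "isomorphic_spaces (homogeneous_subspace \<Phi> G q X) (homogeneous_subspace \<Psi> H p Y)"
proof -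
  let ?\<phi> = "inv_into Y \<psi>"
  have \<phi>: "?\<phi> x \<in> Y" "\<psi> (?\<phi> x) = x" if "x \<in> X" for x
    using that bij by (auto simp: bij_betw_def inv_into_into f_inv_into_f)
  have \<psi>: "\<psi> y \<in> X" "?\<phi> (\<psi> y) = y" if "y \<in> Y" for y
    using that bij by (auto simp: bij_betw_def inv_into_f_f)
  have op: "is_open (homogeneous_subspace \<Phi> G q X) U \<longleftrightarrow> is_open (homogeneous_subspace \<Psi> H p Y) (?\<phi> ` U)"
    if U: "U \<subseteq> X" for U
  proof
    assume "is_open (homogeneous_subspace \<Phi> G q X) U"
    then have "zariski_open_in \<Phi> {g \<in> G. q g \<in> X} {g \<in> G. q g \<in> U}" by (simp add: homogeneous_subspace_def)
    from zariski_open_transfer[OF lp2 \<psi>(1) this]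
    have "zariski_open_in \<Psi> {h \<in> H. p h \<in> Y} {h \<in> H. p h \<in> Y \<and> \<psi> (p h) \<in> U}" .
    moreover have "y \<in> Y \<and> \<psi> y \<in> U \<longleftrightarrow> y \<in> ?\<phi> ` U" for y
    proof
      assume "y \<in> Y \<and> \<psi> y \<in> U"
      then show "y \<in> ?\<phi> ` U" using imageI[of "\<psi> y" U ?\<phi>] \<psi>(2)[of y] by simp
    next
      assume "y \<in> ?\<phi> ` U"
      then obtain x where "x \<in> U" "y = ?\<phi> x" by blast
      then show "y \<in> Y \<and> \<psi> y \<in> U" using U \<phi>[of x] by auto
    qed
    ultimately show "is_open (homogeneous_subspace \<Psi> H p Y) (?\<phi> ` U)"
      using U \<phi>(1) by (auto simp: homogeneous_subspace_def)
  next
    assume "is_open (homogeneous_subspace \<Psi> H p Y) (?\<phi> ` U)"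
    then have "zariski_open_in \<Psi> {h \<in> H. p h \<in> Y} {h \<in> H. p h \<in> ?\<phi> ` U}" by (simp add: homogeneous_subspace_def)
    from zariski_open_transfer[OF lp1 \<phi>(1) this]
    have "zariski_open_in \<Phi> {g \<in> G. q g \<in> X} {g \<in> G. q g \<in> X \<and> ?\<phi> (q g) \<in> ?\<phi> ` U}" .
    moreover have "x \<in> X \<and> ?\<phi> x \<in> ?\<phi> ` U \<longleftrightarrow> x \<in> U" for x
    proof
      assume x: "x \<in> X \<and> ?\<phi> x \<in> ?\<phi> ` U"
      then obtain y where "y \<in> U" "?\<phi> x = ?\<phi> y" by blast
      then show "x \<in> U" using x \<phi>(2)[of x] \<phi>(2)[of y] U by auto
    next
      assume "x \<in> U"
      then show "x \<in> X \<and> ?\<phi> x \<in> ?\<phi> ` U" using U by blast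
    qed
    ultimately show "is_open (homogeneous_subspace \<Phi> G q X) U" using U by (simp add: homogeneous_subspace_def)
  qed
  have reg: "is_regular (homogeneous_subspace \<Psi> H p Y) V f \<longleftrightarrow>
      is_regular (homogeneous_subspace \<Phi> G q X) {x \<in> X. ?\<phi> x \<in> V} (f \<circ> ?\<phi>)" if V: "V \<subseteq> Y" for V f
  proof
    assume "is_regular (homogeneous_subspace \<Psi> H p Y) V f"
    then have "regular_on \<Psi> {h \<in> H. p h \<in> V} (f \<circ> p)" by (simp add: homogeneous_subspace_def)
    from regular_transfer[OF lp1 this]
    show "is_regular (homogeneous_subspace \<Phi> G q X) {x \<in> X. ?\<phi> x \<in> V} (f \<circ> ?\<phi>)"
      by (simp add: homogeneous_subspace_def)
  next
    let ?U = "{x \<in> X. ?\<phi> x \<in> V}"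
    assume "is_regular (homogeneous_subspace \<Phi> G q X) ?U (f \<circ> ?\<phi>)"
    then have "regular_on \<Phi> {g \<in> G. q g \<in> ?U} ((f \<circ> ?\<phi>) \<circ> q)" by (simp add: homogeneous_subspace_def)
    from regular_transfer[OF lp2 this]
    have r: "regular_on \<Psi> {h \<in> H. p h \<in> {y \<in> Y. \<psi> y \<in> ?U}} ((f \<circ> ?\<phi>) \<circ> \<psi> \<circ> p)" .
    have "{y \<in> Y. \<psi> y \<in> ?U} = V" using V \<psi> by auto
    then have "regular_on \<Psi> {h \<in> H. p h \<in> V} ((f \<circ> ?\<phi>) \<circ> \<psi> \<circ> p)" using r by simp
    moreover have "((f \<circ> ?\<phi>) \<circ> \<psi> \<circ> p) h = (f \<circ> p) h" if "h \<in> {h \<in> H. p h \<in> V}" for h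
      using that V \<psi>(2) by auto
    ultimately have "regular_on \<Psi> {h \<in> H. p h \<in> V} (f \<circ> p)" using regular_on_cong by blast
    then show "is_regular (homogeneous_subspace \<Psi> H p Y) V f" by (simp add: homogeneous_subspace_def)
  qed
  have "bij_betw ?\<phi> X Y" by (rule bij_betw_inv_into[OF bij])
  moreover have "points (homogeneous_subspace \<Phi> G q X) = X" "points (homogeneous_subspace \<Psi> H p Y) = Y"
    "is_open (homogeneous_subspace \<Psi> H p Y) V \<Longrightarrow> V \<subseteq> Y" for V
    by (auto simp: homogeneous_subspace_def)
  ultimately show ?thesis
    unfolding isomorphic_spaces_def using op reg by (intro exI[of _ ?\<phi>]) auto
qed

section \<open>The isomorphism of fibers\<close>

text \<open>Every residue vector has a constant lift, so \<open>S\<close> can be recovered from its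
  lift.\<close>

lemma (in residue_map) lift_subset_iff:
  assumes g: "g \<in> GL D" and S: "S \<subseteq> carrier_vec D"
  shows "lift D g S \<subseteq> lift D g S' \<longleftrightarrow> S \<subseteq> S'"
proof
  assume sub: "lift D g S \<subseteq> lift D g S'"
  show "S \<subseteq> S'"
  proof
    fix x assume x: "x \<in> S"
    let ?x = "map_vec sc x"
    have xc: "x \<in> carrier_vec D" using x S by blast
    have ct: "map_vec ct ?x = x" by (intro eq_vecI) (auto simp: ct_sc)
    have "?x \<in> carrier_vec D" "integral_vec ?x" using xc by (auto simp: integral_vec_def integral_sc)
    then have "g *\<^sub>v ?x \<in> lift D g S" unfolding lift_def using ct x by auto
    then obtain w where w: "w \<in> carrier_vec D" "map_vec ct w \<in> S'" "g *\<^sub>v ?x = g *\<^sub>v w"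
      using sub unfolding lift_def by blast
    then have "?x = w" using GL_mult_vec_cancel[OF g _ w(1)] xc by simp
    then show "x \<in> S'" using w(2) ct by simp
  qed
qed (auto simp: lift_def)

lemma (in residue_map) lift_eq_iff:
  assumes "g \<in> GL D" "S \<subseteq> carrier_vec D" "S' \<subseteq> carrier_vec D"
  shows "lift D g S = lift D g S' \<longleftrightarrow> S = S'"
  using lift_subset_iff[OF assms(1,2)] lift_subset_iff[OF assms(1,3)] by blast

text \<open>The range of \<open>t\<close> is fixed by the pole bounds alone, which makes the
  constant term of a product a polynomial in the coefficients.\<close>

lemma red_mat_mult_nth:
  fixes g g' :: "complex fls mat"
  assumes g: "g \<in> carrier_mat K K" and g': "g' \<in> carrier_mat K K" and ij: "i < K" "j < K"
    and a: "\<And>l. l < K \<Longrightarrow> coeffs_above (- a) (g $$ (i, l))" and b: "\<And>l. l < K \<Longrightarrow> coeffs_above (- b) (g' $$ (l, j))"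
  shows "red_mat (g * g') $$ (i, j) = (\<Sum>l<K. \<Sum>t=-a..b. fls_nth (g $$ (i, l)) t * fls_nth (g' $$ (l, j)) (- t))"
proof -
  have "red_mat (g * g') $$ (i, j) = fls_nth ((g * g') $$ (i, j)) 0" using g g' ij by (intro index_map_mat) auto
  also have "\<dots> = (\<Sum>l<K. fls_nth (g $$ (i, l) * g' $$ (l, j)) 0)"
    unfolding mult_mat_nth[OF g g' ij] fls_nth_sum ..
  also have "\<dots> = (\<Sum>l<K. \<Sum>t=-a..b. fls_nth (g $$ (i, l)) t * fls_nth (g' $$ (l, j)) (- t))"
  proof (intro sum.cong refl)
    fix l assume "l \<in> {..<K}"
    then have l: "l < K" by simp
    show "fls_nth (g $$ (i, l) * g' $$ (l, j)) 0 = (\<Sum>t=-a..b. fls_nth (g $$ (i, l)) t * fls_nth (g' $$ (l, j)) (- t))"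
      using fls_nth_mult_bounded_below[of "- a" "g $$ (i, l)" "- b" "g' $$ (l, j)" 0] a[OF l] b[OF l]
      by (auto simp: coeffs_above_def)
  qed
  finally show ?thesis .
qed

text \<open>The first \<open>d - n\<close> columns are frozen at those of \<open>h\<close> while the
  tail varies. When the tail is that of \<open>h\<close>, the matrix is \<open>h\<close>; for
  invertible \<open>h\<close> it stays invertible on a Zariski neighborhood, which yields the local
  lifts below.\<close>

definition append_tail :: "nat \<Rightarrow> nat \<Rightarrow> complex mat \<Rightarrow> (nat \<Rightarrow> nat \<Rightarrow> complex) \<Rightarrow> complex mat" where
  "append_tail d n h f = mat d d (\<lambda>(i, j). if j < d - n then h $$ (i, j) else f i (j - (d - n)))"

lemma append_tail_carrier: "append_tail d n h f \<in> carrier_mat d d"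
  by (simp add: append_tail_def)

lemma tail_append_tail:
  assumes "n \<le> d" "H \<in> carrier_mat d n" "\<And>i j. i < d \<Longrightarrow> j < n \<Longrightarrow> f i j = H $$ (i, j)"
  shows "tail_cols n (append_tail d n h f) = H"
proof (rule eq_matI)
  fix i j assume "i < dim_row H" "j < dim_col H"
  then have "i < d" "j < n" using assms(2) by auto
  then show "tail_cols n (append_tail d n h f) $$ (i, j) = H $$ (i, j)"
    using assms(1,3) by (auto simp: tail_cols_def append_tail_def)
qed (use assms(2) in \<open>auto simp: tail_cols_def append_tail_def\<close>)

lemma append_tail_self:
  assumes h: "h \<in> carrier_mat d d" and "n \<le> d" "\<And>i j. i < d \<Longrightarrow> j < n \<Longrightarrow> f i j = tail_cols n h $$ (i, j)"
  shows "append_tail d n h f = h"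
proof (rule eq_matI)
  fix i j assume "i < dim_row h" "j < dim_col h"
  then have "i < d" "j < d" using h by auto
  then show "append_tail d n h f $$ (i, j) = h $$ (i, j)"
    using assms by (auto simp: tail_cols_def append_tail_def)
qed (use h in \<open>auto simp: append_tail_def\<close>)

lemma polynomials_in_append_tail:
  assumes "\<And>i j. i < d \<Longrightarrow> j < n \<Longrightarrow> (\<lambda>g. f g i j) \<in> polynomials_in \<Phi>" "i < d" "j < d" "n \<le> d"
  shows "(\<lambda>g. append_tail d n h (f g) $$ (i, j)) \<in> polynomials_in \<Phi>"
proof (cases "j < d - n")
  case True
  then have "append_tail d n h (f g) $$ (i, j) = h $$ (i, j)" for g using assms(2,3) by (simp add: append_tail_def)
  then show ?thesis using polynomials_in.const[of "h $$ (i, j)" \<Phi>] by simp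
next
  case False
  then have "append_tail d n h (f g) $$ (i, j) = f g i (j - (d - n))" for g using assms(2,3) by (simp add: append_tail_def)
  moreover have "j - (d - n) < n" using False assms(3,4) by auto
  ultimately show ?thesis using assms(1,2) by simp
qed

lemma entry_coordinatesI: "i < d \<Longrightarrow> j < d \<Longrightarrow> (\<lambda>g. g $$ (i, j)) \<in> entry_coordinates d"
  by (auto simp: entry_coordinates_def)

lemma tail_cols_nth: "h \<in> carrier_mat r c \<Longrightarrow> i < r \<Longrightarrow> j < m \<Longrightarrow> tail_cols m h $$ (i, j) = h $$ (i, c - m + j)"
  by (simp add: tail_cols_def)

text \<open>Of the truncation, only the transfer of flags in both directions by \<open>Q\<close> and
  \<open>R\<close> is retained.\<close>

locale fiber_isomorphism = gamma_lattice +
  fixes mu :: "nat list" and G Q R :: "complex mat" and d :: nat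
  assumes kn: "k \<le> n"
    and delta: "delta_fiber n k mu G d"
    and Q: "Q \<in> carrier_mat K d" "injective_mat Q" and R: "R \<in> carrier_mat d K"
    and restrict_tail: "\<And>H. injective_mat H \<Longrightarrow> H \<in> carrier_mat K n \<Longrightarrow> good_tail K n (n - k) A H \<Longrightarrow>
       Q * (R * H) = H \<and> injective_mat (R * H) \<and> good_tail d n (n - sum_list mu) G (R * H)"
    and extend_tail: "\<And>H. H \<in> carrier_mat d n \<Longrightarrow> good_tail d n (n - sum_list mu) G H \<Longrightarrow>
       good_tail K n (n - k) A (Q * H)"
begin

abbreviation "L \<equiv> fres.matrix_flag K g0 0"
abbreviation "affine_flag g \<equiv> forget_flag K n (full_flag K g)"
abbreviation "finite_flag h \<equiv> forget_flag d n (column_flag d h)"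
abbreviation "fiber \<equiv> {F \<in> Y_flags n k N. Y_proj F = L}"
abbreviation "delta_flags \<equiv> delta_springer_flags n mu k G"

lemma n_le_d: "n \<le> d" by (rule delta_fiber.n_le_d[OF delta])

lemma d_le_K: "d \<le> K" by (rule injective_mat_cols_le_rows[OF Q(2,1)])

lemma n_le_K: "n \<le> K" using n_le_d d_le_K by simp

text \<open>Indices are matched from the end, \<open>K - n + j\<close> with
  \<open>d - n + j\<close>. Index 0 is treated apart, because \<open>Q\<close> embeds C^d as a
  subspace that may be smaller than C^K.\<close>

definition psi :: "(nat \<Rightarrow> complex vec set) \<Rightarrow> nat \<Rightarrow> complex fls vec set" where
  "psi S = restrict (\<lambda>i. if i = 0 then L else fres.lift K g0 ((\<lambda>w. Q *\<^sub>v w) ` S (d - n + (i - (K - n))))) (flag_index K n)"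

lemma affine_flag_0: "affine_flag g 0 = fres.matrix_flag K g 0"
  by (simp add: forget_flag_def flag_index_def full_flag_eq)

text \<open>Reduces statements about \<open>psi\<close> to the matrix equation
  \<open>tail_cols n (red_mat u) = Q * tail_cols n h\<close>.\<close>

lemma psi_finite_flag:
  assumes h: "h \<in> GL d"
    and u: "u \<in> carrier_mat K K" "fres.integral_mat u"
    and u': "u' \<in> carrier_mat K K" "fres.integral_mat u'" "u * u' = 1\<^sub>m K" "u' * u = 1\<^sub>m K"
    and tails: "tail_cols n (red_mat u) = Q * tail_cols n h"
  shows "psi (finite_flag h) = affine_flag (g0 * u)"
proof
  fix i
  note hc = GL_carrier[OF h]
  note ff = fiber_flag[OF u u']
  show "psi (finite_flag h) i = affine_flag (g0 * u) i"
  proof (cases "i \<in> flag_index K n \<and> i \<noteq> 0")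
    case True
    define j where "j = i - (K - n)"
    have j: "i = K - n + j" "j \<le> n" "i \<le> K" using True n_le_K by (auto simp: j_def flag_index_def)
    have "affine_flag (g0 * u) i = fres.lift K g0 (column_flag K (red_mat u) i)"
      using True ff(3)[OF j(3)] full_flag_eq[OF j(3)] by (simp add: forget_flag_def)
    also have "column_flag K (red_mat u) i = tail_span n (Q * tail_cols n h) j"
      unfolding j(1) tails[symmetric] by (rule column_flag_tail_span[OF GL_carrier[OF ff(1)] n_le_K j(2)])
    also have "\<dots> = (\<lambda>w. Q *\<^sub>v w) ` column_flag d h (d - n + j)"
      unfolding tail_span_mult[OF Q(1) tail_cols_carrier[OF hc]] column_flag_tail_span[OF hc n_le_d j(2)] ..
    also have "column_flag d h (d - n + j) = finite_flag h (d - n + j)"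
      using j n_le_d by (auto simp: forget_flag_def flag_index_def)
    finally show ?thesis using True by (simp add: psi_def j_def)
  next
    case False
    then show ?thesis
    proof (cases "i = 0")
      case True
      then show ?thesis using ff(4) affine_flag_0 by (simp add: psi_def flag_index_def)
    qed (auto simp: psi_def forget_flag_def)
  qed
qed

text \<open>A matrix that represents a point of the fiber spans the same lattice as
  \<open>g0\<close>, so it is \<open>g0\<close> times an element of GL_K(O).\<close>

lemma fiber_base_change:
  assumes g: "g \<in> carrier_mat K K" and F: "affine_flag g \<in> fiber"
  obtains u u' where "u = g0' * g" "g = g0 * u" "u \<in> carrier_mat K K" "fres.integral_mat u"
    "u' \<in> carrier_mat K K" "fres.integral_mat u'" "u * u' = 1\<^sub>m K" "u' * u = 1\<^sub>m K"
    "tail_cols n (red_mat u) \<in> carrier_mat K n" "injective_mat (tail_cols n (red_mat u))"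
    "good_tail K n (n - k) A (tail_cols n (red_mat u))"
proof -
  have "fres.matrix_flag K g 0 = L" using F affine_flag_0 by (simp add: Y_proj_def)
  from matrix_flag_eq_base_change[OF g g0_GL g0' inv(2,1) this]
  obtain u' where u: "g0' * g \<in> carrier_mat K K" "fres.integral_mat (g0' * g)" and u': "u' \<in> carrier_mat K K"
    "fres.integral_mat u'" "g0' * g * u' = 1\<^sub>m K" "u' * (g0' * g) = 1\<^sub>m K" and geq: "g = g0 * (g0' * g)" by metis
  have "affine_flag (g0 * (g0' * g)) \<in> Y_flags n k N" using F geq by simp
  then have good: "good_tail K n (n - k) A (tail_cols n (red_mat (g0' * g)))"
    unfolding Y_flags_iff[OF kn u u'] .
  note ru = fiber_flag(1)[OF u u']
  show thesis
    by (rule that[OF refl geq u u' tail_cols_carrier[OF GL_carrier[OF ru]]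
      injective_tail_cols[OF injective_mat_GL[OF ru] GL_carrier[OF ru] n_le_K] good])
qed

lemma finite_flag_delta_iff:
  "h \<in> GL d \<Longrightarrow> finite_flag h \<in> delta_flags \<longleftrightarrow> good_tail d n (n - sum_list mu) G (tail_cols n h)"
  by (rule delta_fiber.delta_springer_flags_iff[OF delta])

lemma tail_restrict:
  assumes "injective_mat H" "H \<in> carrier_mat K n" "good_tail K n (n - k) A H"
  shows "Q * (R * H) = H" "injective_mat (R * H)" "good_tail d n (n - sum_list mu) G (R * H)" "R * H \<in> carrier_mat d n"
  using restrict_tail[OF assms] R assms(2) by auto

lemma constant_lift:
  assumes c: "c \<in> GL K"
  obtains u u' where "u = map_mat fls_const c" "u \<in> carrier_mat K K" "fres.integral_mat u"
    "u' \<in> carrier_mat K K" "fres.integral_mat u'" "u * u' = 1\<^sub>m K" "u' * u = 1\<^sub>m K" "red_mat u = c"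
proof -
  obtain c' where c': "c' \<in> carrier_mat K K" "c * c' = 1\<^sub>m K" "c' * c = 1\<^sub>m K" using GL_E[OF c] by metis
  note cc = GL_carrier[OF c]
  interpret sc: comm_ring_hom "fls_const :: complex \<Rightarrow> complex fls" by (rule comm_ring_hom_fls_const)
  show thesis
  proof (rule that[OF refl])
    show "map_mat fls_const c * map_mat fls_const c' = 1\<^sub>m K"
      unfolding sc.mat_hom_mult[OF cc c'(1), symmetric] c'(2) by (rule sc.mat_hom_one)
    show "map_mat fls_const c' * map_mat fls_const c = 1\<^sub>m K"
      unfolding sc.mat_hom_mult[OF c'(1) cc, symmetric] c'(3) by (rule sc.mat_hom_one)
  qed (use cc c'(1) fres.integral_mat_sc in auto)
qed

lemma psi_finite_flag_mem:
  assumes h: "h \<in> GL d" "finite_flag h \<in> delta_flags"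
    and u: "u \<in> carrier_mat K K" "fres.integral_mat u"
    and u': "u' \<in> carrier_mat K K" "fres.integral_mat u'" "u * u' = 1\<^sub>m K" "u' * u = 1\<^sub>m K"
    and tails: "tail_cols n (red_mat u) = Q * tail_cols n h"
  shows "affine_flag (g0 * u) \<in> fiber"
proof -
  have "good_tail K n (n - k) A (tail_cols n (red_mat u))"
    unfolding tails
    by (rule extend_tail[OF tail_cols_carrier[OF GL_carrier[OF h(1)]] h(2)[unfolded finite_flag_delta_iff[OF h(1)]]])
  then have "affine_flag (g0 * u) \<in> Y_flags n k N" unfolding Y_flags_iff[OF kn u u'] .
  then show ?thesis using affine_flag_0 fiber_flag(4)[OF u u'] by (simp add: Y_proj_def)
qed

lemma tail_lift_exists:
  assumes h: "h \<in> GL d"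
  obtains c where "c \<in> GL K" "tail_cols n c = Q * tail_cols n h"
proof -
  note hc = GL_carrier[OF h]
  note t = tail_cols_carrier[OF hc, of n]
  have "injective_mat (Q * tail_cols n h)"
    by (rule injective_mat_mult[OF Q(2) injective_tail_cols[OF injective_mat_GL[OF h] hc n_le_d] Q(1) t])
  moreover have "Q * tail_cols n h \<in> carrier_mat K n" by (rule mult_carrier_mat[OF Q(1) t])
  ultimately show thesis using complete_to_GL that by blast
qed

text \<open>For a point of the fiber with tail \<open>H\<close>, completing \<open>R * H\<close>
  gives a preimage, since \<open>Q * (R * H) = H\<close>. Injectivity holds because \<open>Q\<close>
  is injective and a set of residues is determined by its lift.\<close>

lemma bij_betw_psi: "bij_betw psi delta_flags fiber"
  unfolding bij_betw_def
proof (intro conjI inj_onI equalityI subsetI)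
  fix F assume "F \<in> psi ` delta_flags"
  then obtain S where S: "S \<in> delta_flags" "F = psi S" by blast
  obtain h where h: "h \<in> GL d" "S = finite_flag h" using delta_fiber.delta_springer_flags_adapted[OF delta S(1)] by metis
  obtain c where c: "c \<in> GL K" "tail_cols n c = Q * tail_cols n h" using tail_lift_exists[OF h(1)] .
  obtain u u' where u: "u \<in> carrier_mat K K" "fres.integral_mat u"
    and u': "u' \<in> carrier_mat K K" "fres.integral_mat u'" "u * u' = 1\<^sub>m K" "u' * u = 1\<^sub>m K" and r: "red_mat u = c"
    using constant_lift[OF c(1)] by metis
  have t: "tail_cols n (red_mat u) = Q * tail_cols n h" unfolding r by (rule c(2))
  show "F \<in> fiber"
    unfolding S(2) h(2) psi_finite_flag[OF h(1) u u' t]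
    by (rule psi_finite_flag_mem[OF h(1) S(1)[unfolded h(2)] u u' t])
next
  fix F assume F: "F \<in> fiber"
  then have "F \<in> C'_flags K n" unfolding Y_flags_def Let_def by blast
  then obtain F0 where F0: "F0 \<in> C_flags K" "F = forget_flag K n F0" unfolding C'_flags_def by blast
  obtain g where g: "g \<in> carrier_mat K K" "F0 = full_flag K g" using C_flagsE[OF F0(1) K_pos] by metis
  have Fg: "F = affine_flag g" using F0(2) g(2) by simp
  obtain u u' where geq: "g = g0 * u" and u: "u \<in> carrier_mat K K" "fres.integral_mat u"
    and u': "u' \<in> carrier_mat K K" "fres.integral_mat u'" "u * u' = 1\<^sub>m K" "u' * u = 1\<^sub>m K"
    and H: "tail_cols n (red_mat u) \<in> carrier_mat K n" "injective_mat (tail_cols n (red_mat u))"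
    "good_tail K n (n - k) A (tail_cols n (red_mat u))"
    using fiber_base_change[OF g(1) F[unfolded Fg]] by metis
  note r = tail_restrict[OF H(2,1,3)]
  obtain h where h: "h \<in> GL d" "tail_cols n h = R * tail_cols n (red_mat u)" using complete_to_GL[OF r(2,4)] .
  have "psi (finite_flag h) = F"
    unfolding Fg geq by (rule psi_finite_flag[OF h(1) u u']) (simp only: h(2) r(1))
  moreover have "finite_flag h \<in> delta_flags" unfolding finite_flag_delta_iff[OF h(1)] h(2) by (rule r(3))
  ultimately show "F \<in> psi ` delta_flags" by blast
next
  fix S S' assume S: "S \<in> delta_flags" "S' \<in> delta_flags" "psi S = psi S'"
  obtain h where h: "h \<in> GL d" "S = finite_flag h" using delta_fiber.delta_springer_flags_adapted[OF delta S(1)] by metis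
  obtain h' where h': "h' \<in> GL d" "S' = finite_flag h'" using delta_fiber.delta_springer_flags_adapted[OF delta S(2)] by metis
  note hc = GL_carrier[OF h(1)] GL_carrier[OF h'(1)]
  have sub: "column_flag d h i \<subseteq> carrier_vec d" "column_flag d h' i \<subseteq> carrier_vec d" if "i \<le> d" for i
    using hc that by (auto simp: column_flag_def restrict_def)
  show "S = S'"
  proof
    fix i
    consider "i \<notin> flag_index d n" | "i = 0" | "i \<in> flag_index d n" "i \<noteq> 0" by blast
    then show "S i = S' i"
    proof cases
      case 1
      then show ?thesis using h(2) h'(2) by (simp add: forget_flag_def)
    next
      case 2
      then show ?thesis using h(2) h'(2) column_flag_0[OF h(1)] column_flag_0[OF h'(1)]
        by (simp add: forget_flag_def flag_index_def)
    next
      case 3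
      define j where "j = i - (d - n)"
      have j: "i = d - n + j" "j \<le> n" "i \<le> d" using 3 n_le_d by (auto simp: j_def flag_index_def)
      let ?i = "K - n + j"
      have Si: "S i = column_flag d h i" "S' i = column_flag d h' i" using 3 h(2) h'(2) by (auto simp: forget_flag_def)
      have "?i \<in> flag_index K n" using j n_le_K by (auto simp: flag_index_def)
      \<comment> \<open>If \<open>?i\<close> were 0, then \<open>K - n\<close> and \<open>j\<close>
        would be 0, hence \<open>d - n = 0\<close> because \<open>d \<le> K\<close>, and so
        \<open>i = 0\<close>, which is excluded.\<close>
      moreover have "?i \<noteq> 0"
      proof
        assume "?i = 0"
        then have "d - n = 0" "j = 0" using d_le_K by auto
        then show False using 3 j by simp
      qed
      ultimately have psi_at: "psi T ?i = fres.lift K g0 ((\<lambda>w. Q *\<^sub>v w) ` T i)" for T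
        by (auto simp: psi_def j(1))
      have "fres.lift K g0 ((\<lambda>w. Q *\<^sub>v w) ` S i) = fres.lift K g0 ((\<lambda>w. Q *\<^sub>v w) ` S' i)"
        unfolding psi_at[symmetric] S(3) ..
      moreover have "(\<lambda>w. Q *\<^sub>v w) ` S i \<subseteq> carrier_vec K" "(\<lambda>w. Q *\<^sub>v w) ` S' i \<subseteq> carrier_vec K"
        using sub[OF j(3)] mult_mat_vec_carrier[OF Q(1)] unfolding Si by blast+
      ultimately have img: "(\<lambda>w. Q *\<^sub>v w) ` S i = (\<lambda>w. Q *\<^sub>v w) ` S' i" using fres.lift_eq_iff[OF g0_GL] by blast
      have "inj_on (\<lambda>w. Q *\<^sub>v w) (carrier_vec d)"
        by (intro inj_onI) (rule injective_mat_cancel[OF Q(2,1)])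
      then show ?thesis using img sub[OF j(3)] unfolding Si by (simp add: inj_on_image_eq_iff)
    qed
  qed
qed

text \<open>The local lift multiplies \<open>g0\<close> by a constant matrix with tail
  \<open>Q * tail_cols n h'\<close> and with frozen remaining columns, so its Laurent coefficients
  are polynomial in the entries of \<open>h'\<close>.\<close>

lemma locally_polynomial_psi:
  "locally_polynomial (entry_coordinates d) (GL d) finite_flag delta_flags
     (laurent_coordinates K) (GL K) affine_flag psi"
  unfolding locally_polynomial_def
proof (intro ballI impI)
  fix h assume h: "h \<in> GL d" "finite_flag h \<in> delta_flags"
  obtain c where c: "c \<in> GL K" "tail_cols n c = Q * tail_cols n h" using tail_lift_exists[OF h(1)] .
  define T where "T h' i j = (\<Sum>l<d. Q $$ (i, l) * h' $$ (l, d - n + j))" for h' i j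
  define C where "C h' = append_tail K n c (T h')" for h'
  define r where "r h' = g0 * map_mat fls_const (C h')" for h'
  have T: "T h' i j = (Q * tail_cols n h') $$ (i, j)" if "h' \<in> GL d" "i < K" "j < n" for h' i j
    unfolding T_def mult_mat_nth[OF Q(1) tail_cols_carrier[OF GL_carrier[OF that(1)]] that(2,3)]
    using that by (intro sum.cong refl) (simp add: tail_cols_nth[OF GL_carrier[OF that(1)]])
  have Cc: "C h' \<in> carrier_mat K K" for h' unfolding C_def by (rule append_tail_carrier)
  have Tp: "(\<lambda>g. T g i j) \<in> polynomials_in (entry_coordinates d)" if "i < K" "j < n" for i j
    unfolding T_def
    using that n_le_d
    by (intro polynomials_in_sum polynomials_in.mult[OF polynomials_in.const] polynomials_in.coord
      entry_coordinatesI) auto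
  have Cp: "(\<lambda>g. C g $$ (i, j)) \<in> polynomials_in (entry_coordinates d)" if "i < K" "j < K" for i j
    unfolding C_def by (rule polynomials_in_append_tail[OF Tp that n_le_K])
  have tC: "tail_cols n (C h') = Q * tail_cols n h'" if "h' \<in> GL d" for h'
    unfolding C_def
    by (rule tail_append_tail[OF n_le_K mult_carrier_mat[OF Q(1) tail_cols_carrier[OF GL_carrier[OF that]]] T[OF that]])
  have "C h = c"
    unfolding C_def by (rule append_tail_self[OF GL_carrier[OF c(1)] n_le_K]) (simp add: c(2) T[OF h(1)])
  then have d0: "det (C h) \<noteq> 0" using c(1) GL_iff_det[OF GL_carrier[OF c(1)]] by simp
  have dp: "(\<lambda>h'. det (C h')) \<in> polynomials_in (entry_coordinates d)" by (rule polynomials_in_det[OF Cc Cp])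
  have rh: "r h' \<in> GL K \<and> affine_flag (r h') = psi (finite_flag h')"
    if h': "h' \<in> GL d" "finite_flag h' \<in> delta_flags" "det (C h') \<noteq> 0" for h'
  proof -
    have "C h' \<in> GL K" using h'(3) GL_iff_det[OF Cc] by blast
    then obtain u u' where ueq: "u = map_mat fls_const (C h')" and u: "u \<in> carrier_mat K K" "fres.integral_mat u"
      and u': "u' \<in> carrier_mat K K" "fres.integral_mat u'" "u * u' = 1\<^sub>m K" "u' * u = 1\<^sub>m K" and ru: "red_mat u = C h'"
      using constant_lift by metis
    have "tail_cols n (red_mat u) = Q * tail_cols n h'" unfolding ru by (rule tC[OF h'(1)])
    from psi_finite_flag[OF h'(1) u u' this] fiber_flag(2)[OF u u'] show ?thesis
      unfolding r_def ueq[symmetric] by simp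
  qed
  have xp: "\<exists>P\<in>polynomials_in (entry_coordinates d). \<forall>h'\<in>{h \<in> GL d. finite_flag h \<in> delta_flags}. x (r h') = P h'"
    if x: "x \<in> laurent_coordinates K" for x
  proof -
    obtain i j s where ij: "i < K" "j < K" and xeq: "x = (\<lambda>g. fls_nth (g $$ (i, j)) s)"
      using x unfolding laurent_coordinates_def by blast
    have xr: "x (r h') = (\<Sum>l<K. fls_nth (g0 $$ (i, l)) s * C h' $$ (l, j))" for h'
    proof -
      have Cc': "map_mat fls_const (C h') \<in> carrier_mat K K" using Cc by simp
      have "x (r h') = (\<Sum>l<K. fls_nth (g0 $$ (i, l) * map_mat fls_const (C h') $$ (l, j)) s)"
        unfolding xeq r_def mult_mat_nth[OF g0 Cc' ij] fls_nth_sum ..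
      also have "\<dots> = (\<Sum>l<K. fls_nth (g0 $$ (i, l)) s * C h' $$ (l, j))"
        using ij(2) carrier_matD[OF Cc[of h']] by (intro sum.cong refl) (simp add: mult.commute)
      finally show ?thesis .
    qed
    have "(\<lambda>h'. \<Sum>l<K. fls_nth (g0 $$ (i, l)) s * C h' $$ (l, j)) \<in> polynomials_in (entry_coordinates d)"
      using ij(2) by (intro polynomials_in_sum polynomials_in.mult[OF polynomials_in.const] Cp) auto
    then show ?thesis by (rule bexI[rotated]) (intro ballI xr)
  qed
  show "\<exists>f\<in>polynomials_in (entry_coordinates d). \<exists>r. f h \<noteq> 0 \<and>
     (\<forall>g'\<in>{g \<in> GL d. finite_flag g \<in> delta_flags}. f g' \<noteq> 0 \<longrightarrow> r g' \<in> GL K \<and> affine_flag (r g') = psi (finite_flag g')) \<and>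
     (\<forall>x\<in>laurent_coordinates K. \<exists>P\<in>polynomials_in (entry_coordinates d).
        \<forall>g'\<in>{g \<in> GL d. finite_flag g \<in> delta_flags}. x (r g') = P g')"
    by (rule bexI[OF exI[of _ r] dp]) (use d0 rh xp in blast)
qed

text \<open>The local lift completes \<open>R\<close> times the tail of the reduction of
  \<open>g0' * g'\<close>. On the fiber, \<open>g' = g0 * u\<close> with \<open>u\<close> integral,
  so the poles of \<open>g'\<close> are no worse than those of \<open>g0\<close>, and the reduction
  is polynomial in finitely many Laurent coefficients.\<close>

lemma locally_polynomial_inv_psi:
  "locally_polynomial (laurent_coordinates K) (GL K) affine_flag fiber
     (entry_coordinates d) (GL d) finite_flag (inv_into delta_flags psi)"
  unfolding locally_polynomial_def
proof (intro ballI impI)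
  fix g assume g: "g \<in> GL K" "affine_flag g \<in> fiber"
  obtain a where a: "\<And>i j. i < K \<Longrightarrow> j < K \<Longrightarrow> coeffs_above (- a) (g0' $$ (i, j))"
    using mat_coeffs_above[of g0'] g0' by (metis carrier_matD)
  obtain b where b: "\<And>i j. i < K \<Longrightarrow> j < K \<Longrightarrow> coeffs_above (- b) (g0 $$ (i, j))"
    using mat_coeffs_above[of g0] g0 by (metis carrier_matD)
  \<comment> \<open>On the fiber this is the constant term of an entry of \<open>g0' * g'\<close>;
    the range of \<open>t\<close> comes from the pole bounds \<open>a\<close> for \<open>g0'\<close>
    and \<open>b\<close> for \<open>g0\<close>.\<close>
  define U where "U g' i j = (\<Sum>l<K. \<Sum>t=-a..b. fls_nth (g0' $$ (i, l)) t * fls_nth (g' $$ (l, j)) (- t))" for g' i j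
  define T where "T g' i j = (\<Sum>l<K. R $$ (i, l) * U g' l (K - n + j))" for g' i j
  have U: "U g' i j = red_mat (g0' * g') $$ (i, j)" if g': "g' \<in> GL K" "affine_flag g' \<in> fiber" and ij: "i < K" "j < K" for g' i j
  proof -
    note g'c = GL_carrier[OF g'(1)]
    obtain u where u: "g' = g0 * u" "u \<in> carrier_mat K K" "fres.integral_mat u" using fiber_base_change[OF g'c g'(2)] by metis
    have "coeffs_above (- b) (g' $$ (l, j))" if l: "l < K" for l
    proof -
      have "coeffs_above (- b + 0) ((g0 *\<^sub>v col u j) $ l)"
      proof (rule coeffs_above_mult_mat_vec[OF g0 _ b _ l])
        show "col u j \<in> carrier_vec K" by (rule col_carrier_vec[OF ij(2) u(2)])
        fix i assume "i < K"
        then show "coeffs_above 0 (col u j $ i)"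
          using fres.integral_matD[OF u(3,2) _ ij(2)] u(2) ij(2) by (simp add: coeffs_above_def fls_is_integral_def)
      qed
      also have "(g0 *\<^sub>v col u j) $ l = g' $$ (l, j)"
        unfolding u(1) using g0 u(2) l ij(2) by simp
      finally show ?thesis by simp
    qed
    from red_mat_mult_nth[OF g0' g'c ij a[OF ij(1)] this] show ?thesis unfolding U_def by simp
  qed
  have T: "T g' i j = (R * tail_cols n (red_mat (g0' * g'))) $$ (i, j)"
    if g': "g' \<in> GL K" "affine_flag g' \<in> fiber" and ij: "i < d" "j < n" for g' i j
  proof -
    have c: "red_mat (g0' * g') \<in> carrier_mat K K" using g0' GL_carrier[OF g'(1)] by simp
    show ?thesis
      unfolding T_def mult_mat_nth[OF R tail_cols_carrier[OF c] ij]
      using ij n_le_K by (intro sum.cong refl) (simp add: U[OF g'] tail_cols_nth[OF c])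
  qed
  have Up: "(\<lambda>g'. U g' i j) \<in> polynomials_in (laurent_coordinates K)" if "i < K" "j < K" for i j
    unfolding U_def using that
    by (intro polynomials_in_sum polynomials_in.mult[OF polynomials_in.const] polynomials_in.coord)
      (auto simp: laurent_coordinates_def)
  have Tp: "(\<lambda>g'. T g' i j) \<in> polynomials_in (laurent_coordinates K)" if "i < d" "j < n" for i j
    unfolding T_def using that n_le_K
    by (intro polynomials_in_sum polynomials_in.mult[OF polynomials_in.const] Up) auto
  obtain u u' where geq: "u = g0' * g" and u: "u \<in> carrier_mat K K" "fres.integral_mat u"
    and u': "u' \<in> carrier_mat K K" "fres.integral_mat u'" "u * u' = 1\<^sub>m K" "u' * u = 1\<^sub>m K"
    and H: "tail_cols n (red_mat u) \<in> carrier_mat K n" "injective_mat (tail_cols n (red_mat u))"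
    "good_tail K n (n - k) A (tail_cols n (red_mat u))"
    using fiber_base_change[OF GL_carrier[OF g(1)] g(2)] by metis
  note rt = tail_restrict[OF H(2,1,3)]
  obtain h where h: "h \<in> GL d" "tail_cols n h = R * tail_cols n (red_mat u)" using complete_to_GL[OF rt(2,4)] .
  define r where "r g' = append_tail d n h (T g')" for g'
  have rc: "r g' \<in> carrier_mat d d" for g' unfolding r_def by (rule append_tail_carrier)
  have rp: "(\<lambda>g. r g $$ (i, j)) \<in> polynomials_in (laurent_coordinates K)" if "i < d" "j < d" for i j
    unfolding r_def by (rule polynomials_in_append_tail[OF Tp that n_le_d])
  have "r g = h"
    unfolding r_def by (rule append_tail_self[OF GL_carrier[OF h(1)] n_le_d]) (simp add: h(2) geq T[OF g])
  then have d0: "det (r g) \<noteq> 0" using h(1) GL_iff_det[OF GL_carrier[OF h(1)]] by simp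
  have dp: "(\<lambda>g'. det (r g')) \<in> polynomials_in (laurent_coordinates K)" by (rule polynomials_in_det[OF rc rp])
  have rg: "r g' \<in> GL d \<and> finite_flag (r g') = inv_into delta_flags psi (affine_flag g')"
    if g': "g' \<in> GL K" "affine_flag g' \<in> fiber" "det (r g') \<noteq> 0" for g'
  proof -
    have rg: "r g' \<in> GL d" using g'(3) GL_iff_det[OF rc] by blast
    obtain u u' where geq: "u = g0' * g'" "g' = g0 * u" and u: "u \<in> carrier_mat K K" "fres.integral_mat u"
      and u': "u' \<in> carrier_mat K K" "fres.integral_mat u'" "u * u' = 1\<^sub>m K" "u' * u = 1\<^sub>m K"
      and H: "tail_cols n (red_mat u) \<in> carrier_mat K n" "injective_mat (tail_cols n (red_mat u))"
      "good_tail K n (n - k) A (tail_cols n (red_mat u))"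
      using fiber_base_change[OF GL_carrier[OF g'(1)] g'(2)] by metis
    note rt = tail_restrict[OF H(2,1,3)]
    have tr: "tail_cols n (r g') = R * tail_cols n (red_mat u)"
      unfolding r_def by (rule tail_append_tail[OF n_le_d rt(4)]) (simp add: geq(1) T[OF g'(1,2)])
    have "psi (finite_flag (r g')) = affine_flag (g0 * u)"
      by (rule psi_finite_flag[OF rg u u']) (simp only: tr rt(1))
    then have psi: "psi (finite_flag (r g')) = affine_flag g'" unfolding geq(2) .
    have "finite_flag (r g') \<in> delta_flags" unfolding finite_flag_delta_iff[OF rg] tr by (rule rt(3))
    from inv_into_f_f[OF bij_betw_imp_inj_on[OF bij_betw_psi] this]
    have "inv_into delta_flags psi (affine_flag g') = finite_flag (r g')" unfolding psi .
    then show ?thesis using rg by simp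
  qed
  have xp: "\<exists>P\<in>polynomials_in (laurent_coordinates K). \<forall>g'\<in>{g \<in> GL K. affine_flag g \<in> fiber}. x (r g') = P g'"
    if x: "x \<in> entry_coordinates d" for x
  proof -
    obtain i j where ij: "i < d" "j < d" and xeq: "x = (\<lambda>g. g $$ (i, j))"
      using x unfolding entry_coordinates_def by blast
    show ?thesis unfolding xeq by (rule bexI[OF _ rp[OF ij]]) simp
  qed
  show "\<exists>f\<in>polynomials_in (laurent_coordinates K). \<exists>r. f g \<noteq> 0 \<and>
     (\<forall>g'\<in>{g \<in> GL K. affine_flag g \<in> fiber}. f g' \<noteq> 0 \<longrightarrow>
        r g' \<in> GL d \<and> finite_flag (r g') = inv_into delta_flags psi (affine_flag g')) \<and>
     (\<forall>x\<in>entry_coordinates d. \<exists>P\<in>polynomials_in (laurent_coordinates K).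
        \<forall>g'\<in>{g \<in> GL K. affine_flag g \<in> fiber}. x (r g') = P g')"
    by (rule bexI[OF exI[of _ r] dp]) (use d0 rg xp in blast)
qed

lemma isomorphic_fiber: "isomorphic_spaces (Y_fiber n k N L) (delta_springer_fiber n mu k G)"
  unfolding Y_fiber_def delta_springer_fiber_def Let_def delta_fiber.d[OF delta, symmetric]
  by (rule isomorphic_homogeneous_subspaces[OF bij_betw_psi locally_polynomial_inv_psi locally_polynomial_psi])

end

theorem theorem1p10:
  fixes n k N :: nat and L :: "complex fls vec set"
  assumes "1 \<le> k" and "k \<le> n"
    and "is_lattice (K_of n k) L"
  shows "{F \<in> Y_flags n k N. Y_proj F = L} = {} \<or>
    (\<exists>mu. is_partition mu \<and> sum_list mu \<le> n \<and> length mu \<le> k \<and>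
       (\<forall>G \<in> carrier_mat (sum_list (nu_part n mu k)) (sum_list (nu_part n mu k)).
          jordan_nf G (map (\<lambda>l. (l, 0)) (nu_part n mu k)) \<longrightarrow>
          isomorphic_spaces (Y_fiber n k N L) (delta_springer_fiber n mu k G)))"
proof (cases "{F \<in> Y_flags n k N. Y_proj F = L} = {}")
  case False
  let ?K = "K_of n k"
  have K: "0 < ?K" using assms(1) by (simp add: K_of_def)
  obtain F where F: "F \<in> Y_flags n k N" "F 0 = L" using False by (auto simp: Y_proj_def)
  then have "F \<in> C'_flags ?K n" unfolding Y_flags_def Let_def by blast
  then obtain F0 where F0: "F0 \<in> C_flags ?K" "F = forget_flag ?K n F0" unfolding C'_flags_def by blast
  obtain g v where g: "g \<in> carrier_mat ?K ?K" "F0 = full_flag ?K g" "fres.matrix_flag ?K g 0 \<subseteq> fres.std_flag ?K 0"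
    "v \<in> fres.matrix_flag ?K g 0" "fls_nth (v $ 0) 0 \<noteq> 0" by (rule C_flagsE[OF F0(1) K])
  obtain g0 where gl: "g0 \<in> GL ?K" "L = fres.matrix_flag ?K g0 0" using assms(3) unfolding is_lattice_iff by blast
  obtain g0' where gi: "g0' \<in> carrier_mat ?K ?K" "g0 * g0' = 1\<^sub>m ?K" "g0' * g0 = 1\<^sub>m ?K" using GL_E[OF gl(1)] .
  have eq: "fres.matrix_flag ?K g 0 = fres.matrix_flag ?K g0 0"
    using F(2) F0(2) g(2) gl(2) by (simp add: forget_flag_def flag_index_def full_flag_eq)
  interpret gamma_lattice n k N g0 g0' v
  proof
    show "gamma n k N *\<^sub>v x \<in> fres.matrix_flag ?K g0 0" if "x \<in> fres.matrix_flag ?K g0 0" for x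
    proof -
      have "\<forall>i\<in>flag_index ?K n. (\<lambda>v. gamma n k N *\<^sub>v v) ` F i \<subseteq> F i"
        using F(1) unfolding Y_flags_def Let_def by blast
      then have "(\<lambda>v. gamma n k N *\<^sub>v v) ` F 0 \<subseteq> F 0" by (simp add: flag_index_def)
      then show ?thesis using that F(2) gl(2) by blast
    qed
  qed (use assms(1) GL_carrier[OF gl(1)] gi g eq in auto)
  \<comment> \<open>The given point of the fiber, written in the basis \<open>g0\<close>, supplies
    the tail that bounds the size of the partition.\<close>
  obtain u' where u: "g0' * g \<in> carrier_mat ?K ?K" "fres.integral_mat (g0' * g)" and u': "u' \<in> carrier_mat ?K ?K"
    "fres.integral_mat u'" "g0' * g * u' = 1\<^sub>m ?K" "u' * (g0' * g) = 1\<^sub>m ?K" and geq: "g = g0 * (g0' * g)"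
    using matrix_flag_eq_base_change[OF g(1) gl(1) gi(1,3,2) eq] by metis
  let ?H = "tail_cols n (red_mat (g0' * g))"
  have "forget_flag ?K n (full_flag ?K (g0 * (g0' * g))) \<in> Y_flags n k N" using F(1) F0(2) g(2) geq by simp
  then have good: "good_tail ?K n (n - k) A ?H" unfolding Y_flags_iff[OF assms(2) u u'] .
  note ru = fiber_flag(1)[OF u u']
  note H = injective_tail_cols[OF injective_mat_GL[OF ru] GL_carrier[OF ru] K_minus_n(2)[OF assms(2)]]
    tail_cols_carrier[OF GL_carrier[OF ru]]
  show ?thesis
  \<comment> \<open>\<open>mu\<close> is fixed by the lattice; \<open>G\<close> is afterwards an
    arbitrary operator of Jordan type nu.\<close>
  proof (rule exists_delta_partition[OF assms(2) H good])
    fix mu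
    assume mu: "is_partition mu" "sum_list mu \<le> n" "length mu \<le> k"
      and pair: "\<And>G d. d = sum_list (nu_part n mu k) \<Longrightarrow> G \<in> carrier_mat d d \<Longrightarrow>
       jordan_nf G (map (\<lambda>l. (l, 0)) (nu_part n mu k)) \<Longrightarrow>
       \<exists>r Q R M M' N E X Y. truncated_pair (n - sum_list mu) (n - k) (sum_list mu) K d r A G Q R M M' N E X Y"
  have "isomorphic_spaces (Y_fiber n k N L) (delta_springer_fiber n mu k G)"
    if G: "G \<in> carrier_mat (sum_list (nu_part n mu k)) (sum_list (nu_part n mu k))"
      and jnf: "jordan_nf G (map (\<lambda>l. (l, 0)) (nu_part n mu k))" for G
  proof -
    let ?d = "sum_list (nu_part n mu k)"
    obtain r Q R M M' N' E X Y where
      "truncated_pair (n - sum_list mu) (n - k) (sum_list mu) K ?d r A G Q R M M' N' E X Y"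
      using pair[OF refl G jnf] by blast
    then interpret tp: truncated_pair "n - sum_list mu" "n - k" "sum_list mu" K ?d r A G Q R M M' N' E X Y .
    have "n - sum_list mu + sum_list mu = n" using mu(2) by simp
    note restrict = tp.good_tail_restrict[OF _ _ _ this]
    have delta: "delta_fiber n k mu G ?d" by (rule delta_fiber.intro[OF assms(1) mu(2,3) refl G])
    interpret fiber_isomorphism n k N g0 g0' v mu G Q R ?d
    proof (rule fiber_isomorphism.intro[OF gamma_lattice_axioms],
        rule fiber_isomorphism_axioms.intro[OF assms(2) delta tp.Q tp.injective_Q tp.R])
      fix H
      show "Q * (R * H) = H \<and> injective_mat (R * H) \<and> good_tail ?d n (n - sum_list mu) G (R * H)"
        if "injective_mat H" "H \<in> carrier_mat K n" "good_tail K n (n - k) A H"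
        using restrict[OF that] by blast
      show "good_tail K n (n - k) A (Q * H)" if "H \<in> carrier_mat ?d n" "good_tail ?d n (n - sum_list mu) G H"
        by (rule tp.good_tail_extend[OF that])
    qed
    show ?thesis unfolding gl(2) by (rule isomorphic_fiber)
  qed
    then show ?thesis using mu by blast
  qed
qed simp

end
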